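(* Let $R$ be a unital commutative ring. Let $\vec{X}\in\mathbf{Fun}(\overline{\mathbb{N}}_0,\mathbf{Top})$ be a functor such that the direct image functor $(X_i^j)_*$ is exact for all $i\leq j\in\overline{\mathbb{N}}_0$, and let $\mathcal{F}\in\mathbf{Shv}(X_{\infty},\mathbf{Mod}_R)$. Then, for all $k\in\mathbb{N}_0$, there is an isomorphism in $\mathbf{Fun}(\mathbb{N}_0^{\mathrm{op}},\mathbf{Mod}_R)$ $$H^k(X_{\infty},-)\circ \overleftarrow{\mathcal{G}}(\vec{X},\mathcal{F})\cong \overleftarrow{D}^k(\vec{X},\mathcal{F}).$$
   Context: $\overline{\mathbb{N}}_0=\mathbb{N}_0\cup\{\infty\}$, regarded as the category of the poset with $\infty$ as greatest element. For $\vec{X}\in\mathbf{Fun}(\overline{\mathbb{N}}_0,\mathbf{Top})$ write $X_i=\vec{X}(i)$ and $X_i^j=\vec{X}(i\to j)\colon X_i\to X_j$ for $i\le j$. $\mathbf{Shv}(X,\mathbf{Mod}_R)$ is the category of sheaves of $R$-modules on $X$; $H^k(X,-)$ is sheaf cohomology (the $k$-th right derived functor of global sections). For continuous $f\colon X\to Y$, $f_*$ and $f^*$ denote the direct image and inverse image (sheafified pullback) functors on sheaves; $f^*$ is left adjoint to $f_*$. The canonical identifications $(g\circ f)^*= f^*g^*$ and $(g\circ f)_*=g_*f_*$ are used throughout. Induced morphisms: for continuous $f\colon X\to Y$ and a sheaf $\mathcal{H}$ on $Y$, the morphism $H^k(f)\colon H^k(Y,\mathcal{H})\to H^k(X,f^*\mathcal{H})$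 is defined as follows. Choose injective resolutions $\mathcal{H}\to\mathcal{I}^\bullet$ and $f^*\mathcal{H}\to\mathcal{J}^\bullet$. Let $\eta_{\mathcal{I}^n}\colon\mathcal{I}^n\to f_*f^*\mathcal{I}^n$ be the units of the adjunction $f^*\dashv f_*$, forming $\eta^\bullet\colon\mathcal{I}^\bullet\to f_*f^*\mathcal{I}^\bullet$, and let $g^\bullet\colon f^*\mathcal{I}^\bullet\to\mathcal{J}^\bullet$ be a cochain map lifting $\mathrm{id}_{f^*\mathcal{H}}$. Using $\Gamma(Y,f_*f^*\mathcal{I}^n)=\Gamma(X,f^*\mathcal{I}^n)$, put $H^k(f)=H^k(\Gamma(X,g^\bullet))\circ H^k(\Gamma(Y,\eta^\bullet))$. For $i\in\mathbb{N}_0$ let $\mathcal{F}^i=(X_i^\infty)^*\mathcal{F}$, so that $\mathcal{F}^i=(X_i^{i+1})^*\mathcal{F}^{i+1}$. The copersistence module $\overleftarrow{D}^k(\vec{X},\mathcal{F})\colon\mathbb{N}_0^{\mathrm{op}}\to\mathbf{Mod}_R$ is given by $i\mapsto H^k(X_i,\mathcal{F}^i)$ with structure maps $H^k(X_i^{i+1})\colon H^k(X_{i+1},\mathcal{F}^{i+1})\to H^k(X_i,\mathcal{F}^i)$. The functor $\overleftarrow{\mathcal{G}}(\vec{X},\mathcal{F})\colon\mathbb{N}_0^{\mathrm{op}}\to\mathbf{Shv}(X_\infty,\mathbf{Mod}_R)$ is given by $i\mapsto\mathcal{G}_i=(X_i^\infty)_*(X_i^\infty)^*\mathcal{F}$,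 with structure maps $\mathcal{G}_i^{i-1}=(X_i^\infty)_*\eta_i\colon\mathcal{G}_i\to\mathcal{G}_{i-1}$ for $i\ge1$, where $\eta_i\colon\mathcal{F}^i\to(X_{i-1}^i)_*(X_{i-1}^i)^*\mathcal{F}^i$ is the unit of the adjunction $(X_{i-1}^i)^*\dashv(X_{i-1}^i)_*$ at $\mathcal{F}^i$. *)

theory Defs
  imports
    "HOL-Algebra.Module"
    "HOL-Algebra.AbelCoset"
    "HOL-Analysis.Abstract_Topology"
    "HOL-Library.Extended_Nat"
begin

section \<open>Modules\<close>

definition mod_hom ::
  "'r ring \<Rightarrow> ('r, 'm) module \<Rightarrow> ('r, 'n) module \<Rightarrow> ('m \<Rightarrow> 'n) set" where
  "mod_hom R M N = {h \<in> hom (add_monoid M) (add_monoid N).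
     \<forall>a\<in>carrier R. \<forall>x\<in>carrier M. h (a \<odot>\<^bsub>M\<^esub> x) = a \<odot>\<^bsub>N\<^esub> h x}"

text \<open>The library record for modules extends the one for rings; the fields \<open>mult\<close> and
  \<open>one\<close> play no role for modules and are left undefined in the constructions below.\<close>

definition image_module :: "('m \<Rightarrow> 'n) \<Rightarrow> ('r, 'm) module \<Rightarrow> ('r, 'n) module" where
  "image_module e M = (let d = inv_into (carrier M) e in
     \<lparr>carrier = e ` carrier M, mult = undefined, one = undefined,
      zero = e \<zero>\<^bsub>M\<^esub>, add = (\<lambda>a b. e (d a \<oplus>\<^bsub>M\<^esub> d b)),
      smult = (\<lambda>r a. e (r \<odot>\<^bsub>M\<^esub> d a))\<rparr>)"


subsection \<open>Cohomology of a cochain complex of modules\<close>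

definition cocycles ::
  "(nat \<Rightarrow> ('r, 'm) module) \<Rightarrow> (nat \<Rightarrow> 'm \<Rightarrow> 'm) \<Rightarrow> nat \<Rightarrow> 'm set" where
  "cocycles C d k = {z \<in> carrier (C k). d k z = \<zero>\<^bsub>C (Suc k)\<^esub>}"

definition coboundaries ::
  "(nat \<Rightarrow> ('r, 'm) module) \<Rightarrow> (nat \<Rightarrow> 'm \<Rightarrow> 'm) \<Rightarrow> nat \<Rightarrow> 'm set" where
  "coboundaries C d k =
     (case k of 0 \<Rightarrow> {\<zero>\<^bsub>C 0\<^esub>} | Suc n \<Rightarrow> d n ` carrier (C n))"

definition cohom_module ::
  "(nat \<Rightarrow> ('r, 'm) module) \<Rightarrow> (nat \<Rightarrow> 'm \<Rightarrow> 'm) \<Rightarrow> nat \<Rightarrow> ('r, 'm set) module" where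
  "cohom_module C d k = (let B = coboundaries C d k in
     \<lparr>carrier = (\<lambda>z. B +>\<^bsub>C k\<^esub> z) ` cocycles C d k,
      mult = undefined, one = undefined,
      zero = B, add = set_add (C k),
      smult = (\<lambda>r A. \<Union>z\<in>A. B +>\<^bsub>C k\<^esub> (r \<odot>\<^bsub>C k\<^esub> z))\<rparr>)"

text \<open>The map on cohomology classes induced by a map \<open>h\<close> into degree \<open>k\<close> of the complex
  \<open>(C, d)\<close>: the cosets united here all coincide when \<open>h\<close> is part of a cochain map and
  \<open>A\<close> is a cohomology class.\<close>

definition cohom_map ::
  "(nat \<Rightarrow> ('r, 'n) module) \<Rightarrow> (nat \<Rightarrow> 'n \<Rightarrow> 'n) \<Rightarrow> nat \<Rightarrow> ('m \<Rightarrow> 'n) \<Rightarrow> 'm set \<Rightarrow> 'n set" where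
  "cohom_map C d k h A = (\<Union>z\<in>A. coboundaries C d k +>\<^bsub>C k\<^esub> h z)"


section \<open>Presheaves and sheaves of modules\<close>

record ('x, 'r, 'm) presheaf =
  sections :: "'x set \<Rightarrow> ('r, 'm) module"
  restr :: "'x set \<Rightarrow> 'x set \<Rightarrow> 'm \<Rightarrow> 'm"

text \<open>\<^term>\<open>restr P U V\<close> is the restriction from \<open>U\<close> to \<open>V \<subseteq> U\<close>. Values at sets that are not
  open are irrelevant throughout.\<close>

locale presheaf = cring R
  for R :: "'r ring" (structure)
    and X :: "'x topology" and P :: "('x, 'r, 'm) presheaf" +
  assumes sections_module: "openin X U \<Longrightarrow> Module.module R (sections P U)"
    and restr_hom: "\<lbrakk>openin X U; openin X V; V \<subseteq> U\<rbrakk>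
      \<Longrightarrow> restr P U V \<in> mod_hom R (sections P U) (sections P V)"
    and restr_id: "\<lbrakk>openin X U; s \<in> carrier (sections P U)\<rbrakk> \<Longrightarrow> restr P U U s = s"
    and restr_restr: "\<lbrakk>openin X U; openin X V; openin X W; W \<subseteq> V; V \<subseteq> U;
        s \<in> carrier (sections P U)\<rbrakk>
      \<Longrightarrow> restr P V W (restr P U V s) = restr P U W s"

locale sheaf = presheaf +
  assumes locality: "\<lbrakk>\<And>V. V \<in> \<U> \<Longrightarrow> openin X V;
        s \<in> carrier (sections P (\<Union>\<U>)); t \<in> carrier (sections P (\<Union>\<U>));
        \<And>V. V \<in> \<U> \<Longrightarrow> restr P (\<Union>\<U>) V s = restr P (\<Union>\<U>) V t\<rbrakk>
      \<Longrightarrow> s = t"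
    and gluing: "\<lbrakk>\<And>V. V \<in> \<U> \<Longrightarrow> openin X V;
        \<And>V. V \<in> \<U> \<Longrightarrow> \<sigma> V \<in> carrier (sections P V);
        \<And>V W. \<lbrakk>V \<in> \<U>; W \<in> \<U>\<rbrakk>
          \<Longrightarrow> restr P V (V \<inter> W) (\<sigma> V) = restr P W (V \<inter> W) (\<sigma> W)\<rbrakk>
      \<Longrightarrow> \<exists>s\<in>carrier (sections P (\<Union>\<U>)). \<forall>V\<in>\<U>. restr P (\<Union>\<U>) V s = \<sigma> V"

definition mor ::
  "'r ring \<Rightarrow> 'x topology \<Rightarrow> ('x, 'r, 'm) presheaf \<Rightarrow> ('x, 'r, 'n) presheaf
    \<Rightarrow> ('x set \<Rightarrow> 'm \<Rightarrow> 'n) set" where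
  "mor R X P Q = {\<alpha>.
     (\<forall>U. openin X U \<longrightarrow> \<alpha> U \<in> mod_hom R (sections P U) (sections Q U)) \<and>
     (\<forall>U V. openin X U \<and> openin X V \<and> V \<subseteq> U \<longrightarrow>
        (\<forall>s\<in>carrier (sections P U). restr Q U V (\<alpha> U s) = \<alpha> V (restr P U V s)))}"

text \<open>Morphisms are HOL functions, so equality of morphisms means agreement on sections over
  open sets.\<close>

definition mor_eq ::
  "'x topology \<Rightarrow> ('x, 'r, 'm) presheaf \<Rightarrow> ('x set \<Rightarrow> 'm \<Rightarrow> 'n) \<Rightarrow> ('x set \<Rightarrow> 'm \<Rightarrow> 'n) \<Rightarrow> bool" where
  "mor_eq X P \<alpha> \<beta> \<longleftrightarrow> (\<forall>U. openin X U \<longrightarrow> (\<forall>s\<in>carrier (sections P U). \<alpha> U s = \<beta> U s))"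

definition mor_comp ::
  "('x set \<Rightarrow> 'n \<Rightarrow> 'p) \<Rightarrow> ('x set \<Rightarrow> 'm \<Rightarrow> 'n) \<Rightarrow> 'x set \<Rightarrow> 'm \<Rightarrow> 'p" where
  "mor_comp \<beta> \<alpha> = (\<lambda>U. \<beta> U \<circ> \<alpha> U)"

definition mor_id :: "'x set \<Rightarrow> 'm \<Rightarrow> 'm" where
  "mor_id = (\<lambda>U s. s)"


subsection \<open>Exactness and injective sheaves\<close>

definition kernel_sections ::
  "('x, 'r, 'm) presheaf \<Rightarrow> ('x, 'r, 'n) presheaf \<Rightarrow> ('x set \<Rightarrow> 'm \<Rightarrow> 'n) \<Rightarrow> 'x set \<Rightarrow> 'm set" where
  "kernel_sections P Q \<alpha> U = {s \<in> carrier (sections P U). \<alpha> U s = \<zero>\<^bsub>sections Q U\<^esub>}"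

text \<open>Sections of the image sheaf, i.e. of the sheafified presheaf image, as a subsheaf of the
  target: the sections that locally lie in the image.\<close>

definition image_sections ::
  "'x topology \<Rightarrow> ('x, 'r, 'm) presheaf \<Rightarrow> ('x, 'r, 'n) presheaf \<Rightarrow> ('x set \<Rightarrow> 'm \<Rightarrow> 'n)
    \<Rightarrow> 'x set \<Rightarrow> 'n set" where
  "image_sections X P Q \<alpha> U = {s \<in> carrier (sections Q U).
     \<forall>x\<in>U. \<exists>V. openin X V \<and> x \<in> V \<and> V \<subseteq> U \<and> restr Q U V s \<in> \<alpha> V ` carrier (sections P V)}"

definition mono_sheaf ::
  "'x topology \<Rightarrow> ('x, 'r, 'm) presheaf \<Rightarrow> ('x set \<Rightarrow> 'm \<Rightarrow> 'n) \<Rightarrow> bool" where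
  "mono_sheaf X P \<alpha> \<longleftrightarrow> (\<forall>U. openin X U \<longrightarrow> inj_on (\<alpha> U) (carrier (sections P U)))"

definition epi_sheaf ::
  "'x topology \<Rightarrow> ('x, 'r, 'm) presheaf \<Rightarrow> ('x, 'r, 'n) presheaf \<Rightarrow> ('x set \<Rightarrow> 'm \<Rightarrow> 'n) \<Rightarrow> bool" where
  "epi_sheaf X P Q \<alpha> \<longleftrightarrow>
     (\<forall>U. openin X U \<longrightarrow> image_sections X P Q \<alpha> U = carrier (sections Q U))"

definition exact_sheaf ::
  "'x topology \<Rightarrow> ('x, 'r, 'm) presheaf \<Rightarrow> ('x, 'r, 'n) presheaf \<Rightarrow> ('x, 'r, 'p) presheaf
    \<Rightarrow> ('x set \<Rightarrow> 'm \<Rightarrow> 'n) \<Rightarrow> ('x set \<Rightarrow> 'n \<Rightarrow> 'p) \<Rightarrow> bool" where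
  "exact_sheaf X P Q S \<alpha> \<beta> \<longleftrightarrow>
     (\<forall>U. openin X U \<longrightarrow> image_sections X P Q \<alpha> U = kernel_sections Q S \<beta> U)"

definition short_exact ::
  "'r ring \<Rightarrow> 'x topology
    \<Rightarrow> ('x, 'r, 'm) presheaf \<Rightarrow> ('x, 'r, 'n) presheaf \<Rightarrow> ('x, 'r, 'p) presheaf
    \<Rightarrow> ('x set \<Rightarrow> 'm \<Rightarrow> 'n) \<Rightarrow> ('x set \<Rightarrow> 'n \<Rightarrow> 'p) \<Rightarrow> bool" where
  "short_exact R X A B C \<alpha> \<beta> \<longleftrightarrow>
     sheaf R X A \<and> sheaf R X B \<and> sheaf R X C \<and> \<alpha> \<in> mor R X A B \<and> \<beta> \<in> mor R X B C \<and>
     mono_sheaf X A \<alpha> \<and> exact_sheaf X A B C \<alpha> \<beta> \<and> epi_sheaf X B C \<beta>"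

definition injective_sheaf :: "'r ring \<Rightarrow> 'x topology \<Rightarrow> ('x, 'r, 'u) presheaf \<Rightarrow> bool" where
  "injective_sheaf R X I \<longleftrightarrow> sheaf R X I \<and>
     (\<forall>(A :: ('x, 'r, 'u) presheaf) (B :: ('x, 'r, 'u) presheaf) \<iota> g.
        sheaf R X A \<and> sheaf R X B \<and> \<iota> \<in> mor R X A B \<and> mono_sheaf X A \<iota> \<and> g \<in> mor R X A I
        \<longrightarrow> (\<exists>h\<in>mor R X B I. mor_eq X A (mor_comp h \<iota>) g))"


section \<open>Direct images\<close>

definition preim :: "'x topology \<Rightarrow> ('x \<Rightarrow> 'y) \<Rightarrow> 'y set \<Rightarrow> 'x set" where
  "preim X f V = {x \<in> topspace X. f x \<in> V}"

definition direct_image ::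
  "'x topology \<Rightarrow> ('x \<Rightarrow> 'y) \<Rightarrow> ('x, 'r, 'm) presheaf \<Rightarrow> ('y, 'r, 'm) presheaf" where
  "direct_image X f P = \<lparr>sections = (\<lambda>V. sections P (preim X f V)),
     restr = (\<lambda>V W. restr P (preim X f V) (preim X f W))\<rparr>"

definition direct_image_mor ::
  "'x topology \<Rightarrow> ('x \<Rightarrow> 'y) \<Rightarrow> ('x set \<Rightarrow> 'm \<Rightarrow> 'n) \<Rightarrow> 'y set \<Rightarrow> 'm \<Rightarrow> 'n" where
  "direct_image_mor X f \<alpha> = (\<lambda>V. \<alpha> (preim X f V))"

text \<open>Exactness of the functor \<open>f\<^sub>*\<close>, on sheaves with sections in the type \<open>'u\<close>.\<close>

definition direct_image_exact ::
  "'u itself \<Rightarrow> 'r ring \<Rightarrow> 'x topology \<Rightarrow> 'y topology \<Rightarrow> ('x \<Rightarrow> 'y) \<Rightarrow> bool" where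
  "direct_image_exact _ R X Y f \<longleftrightarrow>
     (\<forall>(A :: ('x, 'r, 'u) presheaf) (B :: ('x, 'r, 'u) presheaf) (C :: ('x, 'r, 'u) presheaf) \<alpha> \<beta>.
        short_exact R X A B C \<alpha> \<beta> \<longrightarrow>
        short_exact R Y (direct_image X f A) (direct_image X f B) (direct_image X f C)
          (direct_image_mor X f \<alpha>) (direct_image_mor X f \<beta>))"


section \<open>Inverse images\<close>

subsection \<open>Colimits over open neighbourhoods\<close>

text \<open>\<open>germ_module Y P S\<close> is the colimit of \<open>P(V)\<close> over the open sets \<open>V \<supseteq> S\<close>; its elements are
  equivalence classes of pairs \<open>(V, s)\<close> with \<open>s \<in> P(V)\<close>, and \<open>germ Y P S V s\<close> is the class of
  \<open>(V, s)\<close>. The stalk at \<open>x\<close> is the case \<open>S = {x}\<close>. The unions express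
  constructions on representatives: all members of the union coincide.\<close>

definition germ ::
  "'y topology \<Rightarrow> ('y, 'r, 'm) presheaf \<Rightarrow> 'y set \<Rightarrow> 'y set \<Rightarrow> 'm \<Rightarrow> ('y set \<times> 'm) set" where
  "germ Y P S V s = {(V', s'). openin Y V' \<and> S \<subseteq> V' \<and> s' \<in> carrier (sections P V') \<and>
     (\<exists>W. openin Y W \<and> S \<subseteq> W \<and> W \<subseteq> V \<inter> V' \<and> restr P V W s = restr P V' W s')}"

definition germ_module ::
  "'y topology \<Rightarrow> ('y, 'r, 'm) presheaf \<Rightarrow> 'y set \<Rightarrow> ('r, ('y set \<times> 'm) set) module" where
  "germ_module Y P S =
     \<lparr>carrier = {germ Y P S V s | V s. openin Y V \<and> S \<subseteq> V \<and> s \<in> carrier (sections P V)},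
      mult = undefined, one = undefined,
      zero = germ Y P S (topspace Y) \<zero>\<^bsub>sections P (topspace Y)\<^esub>,
      add = (\<lambda>A B. \<Union>(V, s)\<in>A. \<Union>(W, t)\<in>B. germ Y P S (V \<inter> W)
        (restr P V (V \<inter> W) s \<oplus>\<^bsub>sections P (V \<inter> W)\<^esub> restr P W (V \<inter> W) t)),
      smult = (\<lambda>r A. \<Union>(V, s)\<in>A. germ Y P S V (r \<odot>\<^bsub>sections P V\<^esub> s))\<rparr>"


subsection \<open>Presheaf pullback\<close>

definition pre_inverse_image ::
  "'y topology \<Rightarrow> ('x \<Rightarrow> 'y) \<Rightarrow> ('y, 'r, 'm) presheaf \<Rightarrow> ('x, 'r, ('y set \<times> 'm) set) presheaf" where
  "pre_inverse_image Y f P = \<lparr>sections = (\<lambda>U. germ_module Y P (f ` U)),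
     restr = (\<lambda>U V A. \<Union>(W, s)\<in>A. germ Y P (f ` V) W s)\<rparr>"

definition pre_inverse_image_mor ::
  "'y topology \<Rightarrow> ('x \<Rightarrow> 'y) \<Rightarrow> ('y, 'r, 'n) presheaf \<Rightarrow> ('y set \<Rightarrow> 'm \<Rightarrow> 'n)
    \<Rightarrow> 'x set \<Rightarrow> ('y set \<times> 'm) set \<Rightarrow> ('y set \<times> 'n) set" where
  "pre_inverse_image_mor Y f Q \<alpha> = (\<lambda>U A. \<Union>(W, s)\<in>A. germ Y Q (f ` U) W (\<alpha> W s))"


subsection \<open>Sheafification\<close>

definition sheafify ::
  "'x topology \<Rightarrow> ('x, 'r, 'm) presheaf \<Rightarrow> ('x, 'r, 'x \<Rightarrow> ('x set \<times> 'm) set) presheaf" where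
  "sheafify X P =
     \<lparr>sections = (\<lambda>U.
        \<lparr>carrier = {\<sigma> \<in> Pi\<^sub>E U (\<lambda>x. carrier (germ_module X P {x})).
           \<forall>x\<in>U. \<exists>V t. openin X V \<and> x \<in> V \<and> V \<subseteq> U \<and> t \<in> carrier (sections P V) \<and>
             (\<forall>y\<in>V. \<sigma> y = germ X P {y} V t)},
         mult = undefined, one = undefined,
         zero = (\<lambda>x\<in>U. \<zero>\<^bsub>germ_module X P {x}\<^esub>),
         add = (\<lambda>\<sigma> \<tau>. \<lambda>x\<in>U. \<sigma> x \<oplus>\<^bsub>germ_module X P {x}\<^esub> \<tau> x),
         smult = (\<lambda>r \<sigma>. \<lambda>x\<in>U. r \<odot>\<^bsub>germ_module X P {x}\<^esub> \<sigma> x)\<rparr>),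
      restr = (\<lambda>U V \<sigma>. restrict \<sigma> V)\<rparr>"

definition sheafify_mor ::
  "'x topology \<Rightarrow> ('x, 'r, 'n) presheaf \<Rightarrow> ('x set \<Rightarrow> 'm \<Rightarrow> 'n)
    \<Rightarrow> 'x set \<Rightarrow> ('x \<Rightarrow> ('x set \<times> 'm) set) \<Rightarrow> ('x \<Rightarrow> ('x set \<times> 'n) set)" where
  "sheafify_mor X Q \<alpha> = (\<lambda>U \<sigma>. \<lambda>x\<in>U. \<Union>(V, t)\<in>\<sigma> x. germ X Q {x} V (\<alpha> V t))"

definition sheafify_unit ::
  "'x topology \<Rightarrow> ('x, 'r, 'm) presheaf \<Rightarrow> 'x set \<Rightarrow> 'm \<Rightarrow> ('x \<Rightarrow> ('x set \<times> 'm) set)" where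
  "sheafify_unit X P = (\<lambda>U t. \<lambda>x\<in>U. germ X P {x} U t)"


subsection \<open>Universes\<close>

text \<open>In HOL a category of sheaves has to be formed with all sections in one fixed type. That type
  must be closed under inverse images and contain enough injectives. For spaces with points in
  \<open>'x\<close>, scalars in \<open>'r\<close> and a given sheaf with sections in \<open>'m\<close>, the type below serves: with
  \<open>\<kappa>\<close> the (infinite) cardinality of \<open>('x + 'r + 'm) list\<close> it has \<open>2 ^ \<kappa>\<close> elements, hence
  it absorbs \<open>\<kappa>\<close>-indexed products. This covers stalks, sheafifications, products of stalks over all
  points, and injective modules of the form \<open>Hom(R, D)\<close> with \<open>D\<close> divisible. In particular every
  sheaf in it embeds into an injective one, and injectivity with respect to sheaves in it is
  injectivity with respect to all sheaves, by Baer's criterion.\<close>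

type_synonym ('x, 'r, 'm) univ = "('x + 'r + 'm) list set"

text \<open>An isomorphic copy of a presheaf with sections in the type \<open>'u\<close>; meaningful when the modules
  of sections have at most as many elements as \<open>'u\<close>.\<close>

definition copy_code :: "'x topology \<Rightarrow> ('x, 'r, 'm) presheaf \<Rightarrow> 'x set \<Rightarrow> 'm \<Rightarrow> 'u" where
  "copy_code X P = (SOME e. \<forall>U. openin X U \<longrightarrow> inj_on (e U) (carrier (sections P U)))"

definition copy_decode :: "'x topology \<Rightarrow> ('x, 'r, 'm) presheaf \<Rightarrow> 'x set \<Rightarrow> 'u \<Rightarrow> 'm" where
  "copy_decode X P U = inv_into (carrier (sections P U)) (copy_code X P U)"

definition copy :: "'x topology \<Rightarrow> ('x, 'r, 'm) presheaf \<Rightarrow> ('x, 'r, 'u) presheaf" where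
  "copy X P = \<lparr>sections = (\<lambda>U. image_module (copy_code X P U) (sections P U)),
     restr = (\<lambda>U V a. copy_code X P V (restr P U V (copy_decode X P U a)))\<rparr>"


subsection \<open>The inverse image functor\<close>

abbreviation big_inverse_image ::
  "'x topology \<Rightarrow> 'y topology \<Rightarrow> ('x \<Rightarrow> 'y) \<Rightarrow> ('y, 'r, 'm) presheaf
    \<Rightarrow> ('x, 'r, 'x \<Rightarrow> ('x set \<times> ('y set \<times> 'm) set) set) presheaf" where
  "big_inverse_image X Y f P \<equiv> sheafify X (pre_inverse_image Y f P)"

definition inverse_image ::
  "'x topology \<Rightarrow> 'y topology \<Rightarrow> ('x \<Rightarrow> 'y) \<Rightarrow> ('y, 'r, 'm) presheaf \<Rightarrow> ('x, 'r, 'u) presheaf" where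
  "inverse_image X Y f P = copy X (big_inverse_image X Y f P)"

definition inverse_image_mor ::
  "'x topology \<Rightarrow> 'y topology \<Rightarrow> ('x \<Rightarrow> 'y) \<Rightarrow> ('y, 'r, 'm) presheaf \<Rightarrow> ('y, 'r, 'n) presheaf
    \<Rightarrow> ('y set \<Rightarrow> 'm \<Rightarrow> 'n) \<Rightarrow> 'x set \<Rightarrow> 'u \<Rightarrow> 'v" where
  "inverse_image_mor X Y f P Q \<alpha> = (\<lambda>U a.
     copy_code X (big_inverse_image X Y f Q) U
       (sheafify_mor X (pre_inverse_image Y f Q) (pre_inverse_image_mor Y f Q \<alpha>) U
         (copy_decode X (big_inverse_image X Y f P) U a)))"

text \<open>The unit \<open>P \<rightarrow> f\<^sub>* f\<^sup>* P\<close>.\<close>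

definition inverse_image_unit ::
  "'x topology \<Rightarrow> 'y topology \<Rightarrow> ('x \<Rightarrow> 'y) \<Rightarrow> ('y, 'r, 'm) presheaf \<Rightarrow> 'y set \<Rightarrow> 'm \<Rightarrow> 'u" where
  "inverse_image_unit X Y f P = (\<lambda>V s.
     copy_code X (big_inverse_image X Y f P) (preim X f V)
       (sheafify_unit X (pre_inverse_image Y f P) (preim X f V)
         (germ Y P (f ` preim X f V) V s)))"

text \<open>The canonical isomorphism \<open>f\<^sup>* g\<^sup>* P \<rightarrow> h\<^sup>* P\<close> for \<open>f : X \<rightarrow> Y\<close>, \<open>g : Y \<rightarrow> Z\<close> and
  \<open>h = g \<circ> f\<close> on \<open>X\<close>: the unique morphism compatible with the units. It makes the
  identification \<open>h\<^sup>* = f\<^sup>* g\<^sup>*\<close> explicit; by contrast \<open>h\<^sub>* = g\<^sub>* f\<^sub>*\<close> holds literally for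
  \<^const>\<open>direct_image\<close>.\<close>

definition inverse_image_comp ::
  "'r ring \<Rightarrow> 'x topology \<Rightarrow> 'y topology \<Rightarrow> 'z topology \<Rightarrow> ('x \<Rightarrow> 'y) \<Rightarrow> ('y \<Rightarrow> 'z) \<Rightarrow> ('x \<Rightarrow> 'z)
    \<Rightarrow> ('z, 'r, 'm) presheaf \<Rightarrow> ('y, 'r, 'v) presheaf \<Rightarrow> 'x set \<Rightarrow> 'u \<Rightarrow> 'w" where
  "inverse_image_comp R X Y Z f g h P Q = (SOME c.
     c \<in> mor R X (inverse_image X Y f Q) (inverse_image X Z h P) \<and>
     (\<forall>W. openin Z W \<longrightarrow> (\<forall>s\<in>carrier (sections P W).
        c (preim X h W)
          (inverse_image_unit X Y f Q (preim Y g W) (inverse_image_unit Y Z g P W s))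
        = inverse_image_unit X Z h P W s)))"


section \<open>Sheaf cohomology\<close>

record ('x, 'r, 'u) resolution =
  obj :: "nat \<Rightarrow> ('x, 'r, 'u) presheaf"
  diff :: "nat \<Rightarrow> 'x set \<Rightarrow> 'u \<Rightarrow> 'u"
  aug :: "'x set \<Rightarrow> 'u \<Rightarrow> 'u"

definition injective_resolution ::
  "'r ring \<Rightarrow> 'x topology \<Rightarrow> ('x, 'r, 'u) presheaf \<Rightarrow> ('x, 'r, 'u) resolution \<Rightarrow> bool" where
  "injective_resolution R X F I \<longleftrightarrow>
     (\<forall>n. injective_sheaf R X (obj I n)) \<and>
     (\<forall>n. diff I n \<in> mor R X (obj I n) (obj I (Suc n))) \<and>
     aug I \<in> mor R X F (obj I 0) \<and>
     mono_sheaf X F (aug I) \<and>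
     exact_sheaf X F (obj I 0) (obj I 1) (aug I) (diff I 0) \<and>
     (\<forall>n. exact_sheaf X (obj I n) (obj I (Suc n)) (obj I (Suc (Suc n))) (diff I n) (diff I (Suc n)))"

definition inj_res ::
  "'r ring \<Rightarrow> 'x topology \<Rightarrow> ('x, 'r, 'u) presheaf \<Rightarrow> ('x, 'r, 'u) resolution" where
  "inj_res R X F = (SOME I. injective_resolution R X F I)"

text \<open>Cochain maps between augmented complexes \<open>I\<close> and \<open>J\<close> of \<open>F\<close> and \<open>G\<close> that lift
  \<open>\<phi> : F \<rightarrow> G\<close>.\<close>

definition lifts ::
  "'r ring \<Rightarrow> 'x topology \<Rightarrow> ('x, 'r, 'u) presheaf \<Rightarrow> ('x, 'r, 'u) resolution
    \<Rightarrow> ('x, 'r, 'u) resolution \<Rightarrow> ('x set \<Rightarrow> 'u \<Rightarrow> 'u) \<Rightarrow> (nat \<Rightarrow> 'x set \<Rightarrow> 'u \<Rightarrow> 'u) set" where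
  "lifts R X F I J \<phi> = {g.
     (\<forall>n. g n \<in> mor R X (obj I n) (obj J n)) \<and>
     (\<forall>n. mor_eq X (obj I n) (mor_comp (diff J n) (g n)) (mor_comp (g (Suc n)) (diff I n))) \<and>
     mor_eq X F (mor_comp (g 0) (aug I)) (mor_comp (aug J) \<phi>)}"

definition global_obj ::
  "'x topology \<Rightarrow> ('x, 'r, 'u) resolution \<Rightarrow> nat \<Rightarrow> ('r, 'u) module" where
  "global_obj X I n = sections (obj I n) (topspace X)"

definition global_diff ::
  "'x topology \<Rightarrow> ('x, 'r, 'u) resolution \<Rightarrow> nat \<Rightarrow> 'u \<Rightarrow> 'u" where
  "global_diff X I n = diff I n (topspace X)"

text \<open>The functor \<open>H\<^sup>k(X, -)\<close> on objects and on morphisms \<open>\<phi> : F \<rightarrow> G\<close>.\<close>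

definition sheaf_cohom ::
  "'r ring \<Rightarrow> 'x topology \<Rightarrow> nat \<Rightarrow> ('x, 'r, 'u) presheaf \<Rightarrow> ('r, 'u set) module" where
  "sheaf_cohom R X k F = (let I = inj_res R X F in
     cohom_module (global_obj X I) (global_diff X I) k)"

definition sheaf_cohom_mor ::
  "'r ring \<Rightarrow> 'x topology \<Rightarrow> nat \<Rightarrow> ('x, 'r, 'u) presheaf \<Rightarrow> ('x, 'r, 'u) presheaf
    \<Rightarrow> ('x set \<Rightarrow> 'u \<Rightarrow> 'u) \<Rightarrow> 'u set \<Rightarrow> 'u set" where
  "sheaf_cohom_mor R X k F G \<phi> =
     (let I = inj_res R X F; J = inj_res R X G; g = (SOME g. g \<in> lifts R X F I J \<phi>)
      in cohom_map (global_obj X J) (global_diff X J) k (g k (topspace X)))"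

text \<open>The morphism \<open>H\<^sup>k(f) : H\<^sup>k(Y, H) \<rightarrow> H\<^sup>k(X, f\<^sup>* H)\<close> induced by \<open>f : X \<rightarrow> Y\<close>.\<close>

definition inverse_image_resolution ::
  "'x topology \<Rightarrow> 'y topology \<Rightarrow> ('x \<Rightarrow> 'y) \<Rightarrow> ('y, 'r, 'u) presheaf \<Rightarrow> ('y, 'r, 'u) resolution
    \<Rightarrow> ('x, 'r, 'u) resolution" where
  "inverse_image_resolution X Y f H I =
     \<lparr>obj = (\<lambda>n. inverse_image X Y f (obj I n)),
      diff = (\<lambda>n. inverse_image_mor X Y f (obj I n) (obj I (Suc n)) (diff I n)),
      aug = inverse_image_mor X Y f H (obj I 0) (aug I)\<rparr>"

definition induced_cohom_map ::
  "'r ring \<Rightarrow> 'x topology \<Rightarrow> 'y topology \<Rightarrow> ('x \<Rightarrow> 'y) \<Rightarrow> nat \<Rightarrow> ('y, 'r, 'u) presheaf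
    \<Rightarrow> 'u set \<Rightarrow> 'u set" where
  "induced_cohom_map R X Y f k H =
     (let I = inj_res R Y H;
          J = inj_res R X (inverse_image X Y f H);
          g = (SOME g. g \<in> lifts R X (inverse_image X Y f H)
                             (inverse_image_resolution X Y f H I) J mor_id)
      in cohom_map (global_obj X J) (global_diff X J) k
           (\<lambda>z. g k (topspace X) (inverse_image_unit X Y f (obj I k) (topspace Y) z)))"


section \<open>Copersistence modules\<close>

text \<open>A functor on \<open>\<nat>\<^sup>o\<^sup>p\<close> to modules: \<open>m i j : M i \<rightarrow> M j\<close> is the structure map for \<open>j \<le> i\<close>.\<close>

definition copersistence_module ::
  "'r ring \<Rightarrow> (nat \<Rightarrow> ('r, 'm) module) \<Rightarrow> (nat \<Rightarrow> nat \<Rightarrow> 'm \<Rightarrow> 'm) \<Rightarrow> bool" where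
  "copersistence_module R M m \<longleftrightarrow>
     (\<forall>i. Module.module R (M i)) \<and>
     (\<forall>i j. j \<le> i \<longrightarrow> m i j \<in> mod_hom R (M i) (M j)) \<and>
     (\<forall>i. \<forall>z\<in>carrier (M i). m i i z = z) \<and>
     (\<forall>i j l. l \<le> j \<and> j \<le> i \<longrightarrow> (\<forall>z\<in>carrier (M i). m j l (m i j z) = m i l z))"

definition copersistence_isomorphic ::
  "'r ring \<Rightarrow> (nat \<Rightarrow> ('r, 'm) module) \<Rightarrow> (nat \<Rightarrow> nat \<Rightarrow> 'm \<Rightarrow> 'm)
    \<Rightarrow> (nat \<Rightarrow> ('r, 'n) module) \<Rightarrow> (nat \<Rightarrow> nat \<Rightarrow> 'n \<Rightarrow> 'n) \<Rightarrow> bool" where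
  "copersistence_isomorphic R M m N n \<longleftrightarrow>
     copersistence_module R M m \<and> copersistence_module R N n \<and>
     (\<exists>\<theta>. (\<forall>i. \<theta> i \<in> mod_hom R (M i) (N i) \<and> bij_betw (\<theta> i) (carrier (M i)) (carrier (N i))) \<and>
        (\<forall>i j. j \<le> i \<longrightarrow> (\<forall>z\<in>carrier (M i). \<theta> j (m i j z) = n i j (\<theta> i z))))"

text \<open>For steps \<open>s i : M (i+1) \<rightarrow> M i\<close> and \<open>j \<le> i\<close>, the composite
  \<open>s j \<circ> \<dots> \<circ> s (i-1) : M i \<rightarrow> M j\<close>.\<close>

primrec descend :: "(nat \<Rightarrow> 'm \<Rightarrow> 'm) \<Rightarrow> nat \<Rightarrow> nat \<Rightarrow> 'm \<Rightarrow> 'm" where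
  "descend s 0 j = id"
| "descend s (Suc i) j = (if j \<le> i then descend s i j \<circ> s i else id)"


section \<open>Diagrams of spaces\<close>

text \<open>Functors from the poset of extended natural numbers to topological spaces. A countable family
  of spaces can always be realised on subsets of a single type.\<close>

definition top_functor :: "(enat \<Rightarrow> 'x topology) \<Rightarrow> (enat \<Rightarrow> enat \<Rightarrow> 'x \<Rightarrow> 'x) \<Rightarrow> bool" where
  "top_functor X \<phi> \<longleftrightarrow>
     (\<forall>i j. i \<le> j \<longrightarrow> continuous_map (X i) (X j) (\<phi> i j)) \<and>
     (\<forall>i. \<forall>x\<in>topspace (X i). \<phi> i i x = x) \<and>
     (\<forall>i j l. i \<le> j \<and> j \<le> l \<longrightarrow> (\<forall>x\<in>topspace (X i). \<phi> j l (\<phi> i j x) = \<phi> i l x))"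

context
  fixes R :: "'r ring" and X :: "enat \<Rightarrow> 'x topology" and \<phi> :: "enat \<Rightarrow> enat \<Rightarrow> 'x \<Rightarrow> 'x"
    and F :: "('x, 'r, 'm) presheaf"
begin

definition pulled :: "nat \<Rightarrow> ('x, 'r, ('x, 'r, 'm) univ) presheaf" where
  "pulled i = inverse_image (X i) (X \<infinity>) (\<phi> i \<infinity>) F"

text \<open>The identification of \<open>(X\<^sub>i\<^sup>i\<^sup>+\<^sup>1)\<^sup>* F\<^sup>i\<^sup>+\<^sup>1\<close> with \<open>F\<^sup>i\<close>.\<close>

definition pulled_iso ::
  "nat \<Rightarrow> 'x set \<Rightarrow> ('x, 'r, 'm) univ \<Rightarrow> ('x, 'r, 'm) univ" where
  "pulled_iso i = inverse_image_comp R (X i) (X (Suc i)) (X \<infinity>)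
     (\<phi> i (Suc i)) (\<phi> (Suc i) \<infinity>) (\<phi> i \<infinity>) F (pulled (Suc i))"

definition D_obj :: "nat \<Rightarrow> nat \<Rightarrow> ('r, ('x, 'r, 'm) univ set) module" where
  "D_obj k i = sheaf_cohom R (X i) k (pulled i)"

definition D_step ::
  "nat \<Rightarrow> nat \<Rightarrow> ('x, 'r, 'm) univ set \<Rightarrow> ('x, 'r, 'm) univ set" where
  "D_step k i =
     sheaf_cohom_mor R (X i) k
       (inverse_image (X i) (X (Suc i)) (\<phi> i (Suc i)) (pulled (Suc i))) (pulled i) (pulled_iso i)
     \<circ> induced_cohom_map R (X i) (X (Suc i)) (\<phi> i (Suc i)) k (pulled (Suc i))"

definition D_map ::
  "nat \<Rightarrow> nat \<Rightarrow> nat \<Rightarrow> ('x, 'r, 'm) univ set \<Rightarrow> ('x, 'r, 'm) univ set" where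
  "D_map k = descend (D_step k)"

definition G_obj :: "nat \<Rightarrow> ('x, 'r, ('x, 'r, 'm) univ) presheaf" where
  "G_obj i = direct_image (X i) (\<phi> i \<infinity>) (pulled i)"

text \<open>\<open>G_step i : G (i+1) \<rightarrow> G i\<close> is the direct image of the unit at \<open>F\<^sup>i\<^sup>+\<^sup>1\<close>, followed by
  the direct image of the identification \<^const>\<open>pulled_iso\<close>.\<close>

definition G_step ::
  "nat \<Rightarrow> 'x set \<Rightarrow> ('x, 'r, 'm) univ \<Rightarrow> ('x, 'r, 'm) univ" where
  "G_step i = mor_comp
     (direct_image_mor (X i) (\<phi> i \<infinity>) (pulled_iso i))
     (direct_image_mor (X (Suc i)) (\<phi> (Suc i) \<infinity>)
       (inverse_image_unit (X i) (X (Suc i)) (\<phi> i (Suc i)) (pulled (Suc i))))"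

definition G_map ::
  "nat \<Rightarrow> nat \<Rightarrow> 'x set \<Rightarrow> ('x, 'r, 'm) univ \<Rightarrow> ('x, 'r, 'm) univ" where
  "G_map i j = (\<lambda>V. descend (\<lambda>n. G_step n V) i j)"

end

end

theory Submission
  imports Defs "HOL-Algebra.Free_Abelian_Groups"
begin

text \<open>Write \<open>f\<^sub>i\<close> for \<open>X\<^sub>i \<rightarrow> X\<^sub>\<infinity>\<close> and let \<open>J\<^sub>i\<close> be the injective resolution of \<open>F\<^sub>i\<close>. Every injective sheaf
  is a retract of a Godement sheaf built from the modules \<open>Hom(R, D)\<close> with \<open>D\<close> divisible, and direct
  images of such sheaves are injective by a direct argument; so an exact \<open>f\<^sub>i\<^sub>*\<close> turns \<open>J\<^sub>i\<close> into an
  injective resolution of \<open>G\<^sub>i\<close> with the same global sections. A lift of \<open>id\<close> from the chosen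
  resolution of \<open>G\<^sub>i\<close> to \<open>f\<^sub>i\<^sub>* J\<^sub>i\<close> gives the isomorphism. By adjunction the map induced on cohomology
  by \<open>t : X\<^sub>i \<rightarrow> X\<^sub>i\<^sub>+\<^sub>1\<close> is computed by any lift of the unit \<open>F\<^sub>i\<^sub>+\<^sub>1 \<rightarrow> t\<^sub>* t\<^sup>* F\<^sub>i\<^sub>+\<^sub>1\<close> to a cochain map
  \<open>J\<^sub>i\<^sub>+\<^sub>1 \<rightarrow> t\<^sub>* J\<^sub>i\<close>, so naturality is the uniqueness of lifts up to homotopy.\<close>


section \<open>Modules over R: homomorphisms, transport of structure, products and coinduced
  modules\<close>

section \<open>Modules\<close>

text \<open>That direct images preserve injectives is usually read off from exactness of the left
  adjoint, which would call for exactness of sheafified pullbacks. Godement sheaves of coinduced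
  modules avoid this: a morphism into one is a family of additive maps on stalks with values in
  divisible groups, so it extends along a monomorphism by Zorn's lemma, one index at a time.
  Sections live in one fixed type and \<open>injective_sheaf\<close> tests only against sheaves with
  sections in that type. Divisible hulls, products over points and pullbacks must therefore be shown
  to fit into it, and auxiliary sheaves of larger type are copied back. The resolutions, the lifts,
  the encodings and the identification \<open>pulled_iso\<close> are all picked by
  \<open>SOME\<close>. Nothing can be said about them before existence is proved, and afterwards a
  lift is known only up to homotopy. Exactness enters twice: for
  \<open>X i \<rightarrow> X \<infinity>\<close> it makes the pushed resolution a resolution on the
  common space, and for \<open>X i \<rightarrow> X (i+1)\<close> it does the same for the target of
  the transposed cochain map. Since global sections do not change under direct image, the cohomology
  of \<open>X i\<close> is literally that of a complex on \<open>X \<infinity>\<close>, and the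
  whole comparison happens there.\<close>

lemma module_abelian_group: "Module.module R M \<Longrightarrow> abelian_group M"
  by (rule Module.module.axioms(2))

lemma mod_homI:
  assumes "\<And>x. x \<in> carrier M \<Longrightarrow> h x \<in> carrier N"
    and "\<And>x y. \<lbrakk>x \<in> carrier M; y \<in> carrier M\<rbrakk> \<Longrightarrow> h (x \<oplus>\<^bsub>M\<^esub> y) = h x \<oplus>\<^bsub>N\<^esub> h y"
    and "\<And>a x. \<lbrakk>a \<in> carrier R; x \<in> carrier M\<rbrakk> \<Longrightarrow> h (a \<odot>\<^bsub>M\<^esub> x) = a \<odot>\<^bsub>N\<^esub> h x"
  shows "h \<in> mod_hom R M N"
  using assms by (auto simp: mod_hom_def hom_def)

lemma mod_hom_closed: "h \<in> mod_hom R M N \<Longrightarrow> x \<in> carrier M \<Longrightarrow> h x \<in> carrier N"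
  by (auto simp: mod_hom_def hom_def)

lemma mod_hom_add:
  "h \<in> mod_hom R M N \<Longrightarrow> x \<in> carrier M \<Longrightarrow> y \<in> carrier M \<Longrightarrow> h (x \<oplus>\<^bsub>M\<^esub> y) = h x \<oplus>\<^bsub>N\<^esub> h y"
  by (auto simp: mod_hom_def hom_def)

lemma mod_hom_smult:
  "h \<in> mod_hom R M N \<Longrightarrow> a \<in> carrier R \<Longrightarrow> x \<in> carrier M \<Longrightarrow> h (a \<odot>\<^bsub>M\<^esub> x) = a \<odot>\<^bsub>N\<^esub> h x"
  by (auto simp: mod_hom_def)

lemma mod_hom_cong:
  "h \<in> mod_hom R M N \<Longrightarrow> Module.module R M \<Longrightarrow> (\<And>x. x \<in> carrier M \<Longrightarrow> h' x = h x) \<Longrightarrow> h' \<in> mod_hom R M N"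
proof (rule mod_homI)
  assume h: "h \<in> mod_hom R M N" and M: "Module.module R M"
    and e: "\<And>x. x \<in> carrier M \<Longrightarrow> h' x = h x"
  interpret M: Module.module R M by fact
  show "h' x \<in> carrier N" if "x \<in> carrier M" for x
    using h e that by (simp add: mod_hom_closed)
  show "h' (x \<oplus>\<^bsub>M\<^esub> y) = h' x \<oplus>\<^bsub>N\<^esub> h' y" if "x \<in> carrier M" "y \<in> carrier M" for x y
    using h e that by (simp add: mod_hom_add)
  show "h' (a \<odot>\<^bsub>M\<^esub> x) = a \<odot>\<^bsub>N\<^esub> h' x" if "x \<in> carrier M" "a \<in> carrier R" for x a
    using h e that by (simp add: mod_hom_smult)
qed

lemma mod_hom_zero:
  assumes "h \<in> mod_hom R M N" "Module.module R M" "Module.module R N"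
  shows "h \<zero>\<^bsub>M\<^esub> = \<zero>\<^bsub>N\<^esub>"
proof -
  interpret M: Module.module R M by fact
  interpret N: Module.module R N by fact
  have "h \<zero>\<^bsub>M\<^esub> \<oplus>\<^bsub>N\<^esub> h \<zero>\<^bsub>M\<^esub> = h \<zero>\<^bsub>M\<^esub>"
    using mod_hom_add[OF assms(1), of "\<zero>\<^bsub>M\<^esub>" "\<zero>\<^bsub>M\<^esub>"] by simp
  then show ?thesis
    using mod_hom_closed[OF assms(1), of "\<zero>\<^bsub>M\<^esub>"] by (metis M.zero_closed N.add.l_cancel_one')
qed

lemma mod_hom_neg:
  assumes "h \<in> mod_hom R M N" "Module.module R M" "Module.module R N" "x \<in> carrier M"
  shows "h (\<ominus>\<^bsub>M\<^esub> x) = \<ominus>\<^bsub>N\<^esub> h x"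
proof -
  interpret M: Module.module R M by fact
  interpret N: Module.module R N by fact
  have "h (\<ominus>\<^bsub>M\<^esub> x) \<oplus>\<^bsub>N\<^esub> h x = \<zero>\<^bsub>N\<^esub>"
    using mod_hom_add[OF assms(1), of "\<ominus>\<^bsub>M\<^esub> x" x] assms(4) mod_hom_zero[OF assms(1-3)]
    by (simp add: M.l_neg)
  then show ?thesis
    using mod_hom_closed[OF assms(1)] assms(4) by (simp add: N.minus_equality)
qed

lemma mod_hom_minus:
  assumes "h \<in> mod_hom R M N" "Module.module R M" "Module.module R N" "x \<in> carrier M" "y \<in> carrier M"
  shows "h (x \<ominus>\<^bsub>M\<^esub> y) = h x \<ominus>\<^bsub>N\<^esub> h y"
proof -
  interpret M: Module.module R M by fact
  show ?thesis
    using assms by (simp add: a_minus_def mod_hom_add mod_hom_neg)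
qed

lemma mod_hom_id: "(\<lambda>x. x) \<in> mod_hom R M M" "id \<in> mod_hom R M M"
  by (auto intro: mod_homI)

lemma mod_hom_comp:
  "h \<in> mod_hom R M N \<Longrightarrow> g \<in> mod_hom R N P \<Longrightarrow> (\<lambda>x. g (h x)) \<in> mod_hom R M P"
  "h \<in> mod_hom R M N \<Longrightarrow> g \<in> mod_hom R N P \<Longrightarrow> g \<circ> h \<in> mod_hom R M P"
  by (auto intro!: mod_homI simp: mod_hom_closed mod_hom_add mod_hom_smult)

lemma mod_hom_diff:
  assumes "h \<in> mod_hom R M N" "g \<in> mod_hom R M N" "Module.module R M" "Module.module R N"
  shows "(\<lambda>x. h x \<ominus>\<^bsub>N\<^esub> g x) \<in> mod_hom R M N"
proof -
  interpret M: Module.module R M by fact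
  interpret N: Module.module R N by fact
  show ?thesis
  proof (rule mod_homI)
    fix x y assume xy: "x \<in> carrier M" "y \<in> carrier M"
    then show "h (x \<oplus>\<^bsub>M\<^esub> y) \<ominus>\<^bsub>N\<^esub> g (x \<oplus>\<^bsub>M\<^esub> y) = h x \<ominus>\<^bsub>N\<^esub> g x \<oplus>\<^bsub>N\<^esub> (h y \<ominus>\<^bsub>N\<^esub> g y)"
      using assms(1,2)
      by (simp add: mod_hom_add mod_hom_closed a_minus_def N.minus_add N.a_ac)
  qed (use assms in \<open>auto simp: mod_hom_smult mod_hom_closed a_minus_def N.smult_r_distr N.smult_r_minus\<close>)
qed

text \<open>The module axioms are equations together with the existence of negatives, so they
  descend along any surjection that respects the operations. This covers copies along an injection
  as well as cohomology, seen as an image of the cocycles.\<close>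

lemma module_surj:
  assumes M: "Module.module R M"
    and surj: "p ` carrier M = carrier N"
    and add: "\<And>x y. \<lbrakk>x \<in> carrier M; y \<in> carrier M\<rbrakk> \<Longrightarrow> p (x \<oplus>\<^bsub>M\<^esub> y) = p x \<oplus>\<^bsub>N\<^esub> p y"
    and smult: "\<And>a x. \<lbrakk>a \<in> carrier R; x \<in> carrier M\<rbrakk> \<Longrightarrow> p (a \<odot>\<^bsub>M\<^esub> x) = a \<odot>\<^bsub>N\<^esub> p x"
    and zero: "p \<zero>\<^bsub>M\<^esub> = \<zero>\<^bsub>N\<^esub>"
  shows "Module.module R N"
proof -
  interpret M: Module.module R M by fact
  have cl: "p x \<in> carrier N" if "x \<in> carrier M" for x using surj that by auto
  have ex: "\<exists>x\<in>carrier M. y = p x" if "y \<in> carrier N" for y using surj that by auto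
  have "abelian_group N"
  proof (rule abelian_groupI)
    fix x y assume "x \<in> carrier N" "y \<in> carrier N"
    then show "x \<oplus>\<^bsub>N\<^esub> y \<in> carrier N"
      using ex[of x] ex[of y] by (auto simp: add[symmetric] cl)
  next
    show "\<zero>\<^bsub>N\<^esub> \<in> carrier N" by (simp add: zero[symmetric] cl)
  next
    fix x y z assume "x \<in> carrier N" "y \<in> carrier N" "z \<in> carrier N"
    then show "x \<oplus>\<^bsub>N\<^esub> y \<oplus>\<^bsub>N\<^esub> z = x \<oplus>\<^bsub>N\<^esub> (y \<oplus>\<^bsub>N\<^esub> z)"
      using ex[of x] ex[of y] ex[of z] by (auto simp: add[symmetric] M.a_assoc)
  next
    fix x y assume "x \<in> carrier N" "y \<in> carrier N"
    then show "x \<oplus>\<^bsub>N\<^esub> y = y \<oplus>\<^bsub>N\<^esub> x"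
      using ex[of x] ex[of y] by (auto simp: add[symmetric] M.a_comm)
  next
    fix x assume "x \<in> carrier N"
    then show "\<zero>\<^bsub>N\<^esub> \<oplus>\<^bsub>N\<^esub> x = x"
      using ex[of x] by (auto simp: add[symmetric] zero[symmetric])
  next
    fix x assume "x \<in> carrier N"
    then obtain u where u: "u \<in> carrier M" "x = p u" using ex by blast
    then have "p (\<ominus>\<^bsub>M\<^esub> u) \<oplus>\<^bsub>N\<^esub> x = \<zero>\<^bsub>N\<^esub>"
      by (simp add: add[symmetric] zero[symmetric] M.l_neg)
    then show "\<exists>y\<in>carrier N. y \<oplus>\<^bsub>N\<^esub> x = \<zero>\<^bsub>N\<^esub>" using cl[of "\<ominus>\<^bsub>M\<^esub> u"] u by auto
  qed
  then show ?thesis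
  proof (rule moduleI[OF M.R.is_cring])
    fix a x assume "a \<in> carrier R" "x \<in> carrier N"
    then show "a \<odot>\<^bsub>N\<^esub> x \<in> carrier N" using ex[of x] by (auto simp: smult[symmetric] cl)
  next
    fix a b x assume "a \<in> carrier R" "b \<in> carrier R" "x \<in> carrier N"
    then show "(a \<oplus>\<^bsub>R\<^esub> b) \<odot>\<^bsub>N\<^esub> x = a \<odot>\<^bsub>N\<^esub> x \<oplus>\<^bsub>N\<^esub> b \<odot>\<^bsub>N\<^esub> x"
      using ex[of x] by (auto simp: smult[symmetric] add[symmetric] M.smult_l_distr)
  next
    fix a x y assume "a \<in> carrier R" "x \<in> carrier N" "y \<in> carrier N"
    then show "a \<odot>\<^bsub>N\<^esub> (x \<oplus>\<^bsub>N\<^esub> y) = a \<odot>\<^bsub>N\<^esub> x \<oplus>\<^bsub>N\<^esub> a \<odot>\<^bsub>N\<^esub> y"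
      using ex[of x] ex[of y] by (auto simp: smult[symmetric] add[symmetric] M.smult_r_distr)
  next
    fix a b x assume "a \<in> carrier R" "b \<in> carrier R" "x \<in> carrier N"
    then show "(a \<otimes>\<^bsub>R\<^esub> b) \<odot>\<^bsub>N\<^esub> x = a \<odot>\<^bsub>N\<^esub> (b \<odot>\<^bsub>N\<^esub> x)"
      using ex[of x] by (auto simp: smult[symmetric] M.smult_assoc1)
  next
    fix x assume "x \<in> carrier N"
    then show "\<one>\<^bsub>R\<^esub> \<odot>\<^bsub>N\<^esub> x = x" using ex[of x] by (auto simp: smult[symmetric])
  qed
qed

lemma image_module_simps:
  "carrier (image_module e M) = e ` carrier M"
  "\<zero>\<^bsub>image_module e M\<^esub> = e \<zero>\<^bsub>M\<^esub>"
  by (simp_all add: image_module_def Let_def)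

lemma image_module_hom:
  assumes "inj_on e (carrier M)"
  shows "e \<in> mod_hom R M (image_module e M)"
  by (rule mod_homI) (use assms in \<open>auto simp: image_module_def Let_def\<close>)

lemma image_module_module:
  fixes R :: "'r ring"
  assumes M: "Module.module R M" and e: "inj_on e (carrier M)"
  shows "Module.module R (image_module e M)"
  using image_module_hom[OF e, of R]
  by (intro module_surj[OF M, of e]) (auto simp: image_module_simps mod_hom_add mod_hom_smult)

lemma image_module_inv_hom:
  assumes M: "Module.module R M" and e: "inj_on e (carrier M)"
  shows "inv_into (carrier M) e \<in> mod_hom R (image_module e M) M"
proof -
  interpret M: Module.module R M by fact
  show ?thesis
    by (rule mod_homI) (use e in \<open>auto simp: image_module_def Let_def\<close>)
qed

text \<open>Tuples are extensional off \<open>J\<close>, so equality in the carrier is equality at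
  the indices in \<open>J\<close>. The same construction carries the stalk families of a
  sheafification and the sections of Godement sheaves.\<close>

definition prod_module :: "'i set \<Rightarrow> ('i \<Rightarrow> ('r, 'm) module) \<Rightarrow> ('r, 'i \<Rightarrow> 'm) module" where
  "prod_module J N = \<lparr>carrier = (\<Pi>\<^sub>E j\<in>J. carrier (N j)), monoid.mult = undefined, one = undefined,
     ring.zero = (\<lambda>j\<in>J. \<zero>\<^bsub>N j\<^esub>), add = (\<lambda>s t. \<lambda>j\<in>J. s j \<oplus>\<^bsub>N j\<^esub> t j),
     smult = (\<lambda>r s. \<lambda>j\<in>J. r \<odot>\<^bsub>N j\<^esub> s j)\<rparr>"

lemma prod_module_simps [simp]:
  "carrier (prod_module J N) = (\<Pi>\<^sub>E j\<in>J. carrier (N j))"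
  "\<zero>\<^bsub>prod_module J N\<^esub> = (\<lambda>j\<in>J. \<zero>\<^bsub>N j\<^esub>)"
  "s \<oplus>\<^bsub>prod_module J N\<^esub> t = (\<lambda>j\<in>J. s j \<oplus>\<^bsub>N j\<^esub> t j)"
  "r \<odot>\<^bsub>prod_module J N\<^esub> s = (\<lambda>j\<in>J. r \<odot>\<^bsub>N j\<^esub> s j)"
  by (simp_all add: prod_module_def)

lemma prod_module_module:
  assumes "cring R" and N: "\<And>j. j \<in> J \<Longrightarrow> Module.module R (N j)"
  shows "Module.module R (prod_module J N)"
proof (rule moduleI)
  have ag: "abelian_group (N j)" if "j \<in> J" for j by (rule module_abelian_group[OF N[OF that]])
  have am: "abelian_monoid (N j)" if "j \<in> J" for j using ag[OF that] by (simp add: abelian_group_def)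
  note [simp] = abelian_monoid.a_closed[OF am] abelian_monoid.zero_closed[OF am]
    abelian_monoid.a_assoc[OF am] abelian_monoid.l_zero[OF am]
    Module.module.smult_closed[OF N] abelian_group.a_inv_closed[OF ag] abelian_group.l_neg[OF ag]
  show "abelian_group (prod_module J N)"
  proof (rule abelian_groupI)
    fix x y assume "x \<in> carrier (prod_module J N)" "y \<in> carrier (prod_module J N)"
    then show "x \<oplus>\<^bsub>prod_module J N\<^esub> y = y \<oplus>\<^bsub>prod_module J N\<^esub> x"
      by (auto simp: PiE_iff abelian_monoid.a_comm[OF am] intro!: restrict_ext)
  next
    fix x assume x: "x \<in> carrier (prod_module J N)"
    show "\<exists>y\<in>carrier (prod_module J N). y \<oplus>\<^bsub>prod_module J N\<^esub> x = \<zero>\<^bsub>prod_module J N\<^esub>"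
      by (rule bexI[of _ "\<lambda>j\<in>J. \<ominus>\<^bsub>N j\<^esub> x j"]) (use x in \<open>auto simp: PiE_iff intro!: restrict_ext\<close>)
  next
    fix x assume "x \<in> carrier (prod_module J N)"
    then show "\<zero>\<^bsub>prod_module J N\<^esub> \<oplus>\<^bsub>prod_module J N\<^esub> x = x"
      by (auto simp: PiE_iff intro!: extensionalityI[of _ J])
  qed (auto simp: PiE_iff intro!: restrict_ext)
next
  fix x assume "x \<in> carrier (prod_module J N)"
  then show "\<one>\<^bsub>R\<^esub> \<odot>\<^bsub>prod_module J N\<^esub> x = x"
    by (auto simp: PiE_iff Module.module.smult_one[OF N] intro!: extensionalityI[of _ J])
qed (use assms(1) in \<open>auto simp: PiE_iff Module.module.smult_closed[OF N] Module.module.smult_l_distr[OF N]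
     Module.module.smult_r_distr[OF N] Module.module.smult_assoc1[OF N] intro!: restrict_ext\<close>)

text \<open>The coinduced module \<open>Hom(R, D)\<close> of additive maps, with scalars acting by
  \<open>(r u)(a) = u(a r)\<close>. It is right adjoint to forgetting scalars: an R-linear map into
  it amounts to an additive map into \<open>D\<close>, recovered by evaluation at one.\<close>

definition coind_module :: "'r ring \<Rightarrow> 'd monoid \<Rightarrow> ('r, 'r \<Rightarrow> 'd) module" where
  "coind_module R D = \<lparr>carrier = {u \<in> extensional (carrier R). u \<in> hom (add_monoid R) D},
     monoid.mult = undefined, one = undefined, ring.zero = (\<lambda>a\<in>carrier R. \<one>\<^bsub>D\<^esub>),
     add = (\<lambda>u v. \<lambda>a\<in>carrier R. u a \<otimes>\<^bsub>D\<^esub> v a), smult = (\<lambda>r u. \<lambda>a\<in>carrier R. u (a \<otimes>\<^bsub>R\<^esub> r))\<rparr>"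

lemma coind_module_simps [simp]:
  "carrier (coind_module R D) = {u \<in> extensional (carrier R). u \<in> hom (add_monoid R) D}"
  "\<zero>\<^bsub>coind_module R D\<^esub> = (\<lambda>a\<in>carrier R. \<one>\<^bsub>D\<^esub>)"
  "u \<oplus>\<^bsub>coind_module R D\<^esub> v = (\<lambda>a\<in>carrier R. u a \<otimes>\<^bsub>D\<^esub> v a)"
  "r \<odot>\<^bsub>coind_module R D\<^esub> u = (\<lambda>a\<in>carrier R. u (a \<otimes>\<^bsub>R\<^esub> r))"
  by (simp_all add: coind_module_def)

lemma coind_module_module:
  assumes R: "cring R" and D: "comm_group D"
  shows "Module.module R (coind_module R D)"
proof (rule moduleI)
  interpret R: cring R by fact
  interpret D: comm_group D by fact
  show "cring R" by fact
  show "abelian_group (coind_module R D)"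
  proof (rule abelian_groupI)
    fix x assume x: "x \<in> carrier (coind_module R D)"
    show "\<exists>y\<in>carrier (coind_module R D). y \<oplus>\<^bsub>coind_module R D\<^esub> x = \<zero>\<^bsub>coind_module R D\<^esub>"
      by (rule bexI[of _ "\<lambda>a\<in>carrier R. inv\<^bsub>D\<^esub> (x a)"])
        (use x in \<open>auto simp: hom_def Pi_def D.inv_mult intro!: restrict_ext\<close>)
  next
    fix x assume "x \<in> carrier (coind_module R D)"
    then show "\<zero>\<^bsub>coind_module R D\<^esub> \<oplus>\<^bsub>coind_module R D\<^esub> x = x"
      by (auto simp: hom_def Pi_def intro!: extensionalityI[of _ "carrier R"])
  qed (auto simp: hom_def Pi_def D.m_ac intro!: restrict_ext)
  show "\<And>x. x \<in> carrier (coind_module R D) \<Longrightarrow> \<one>\<^bsub>R\<^esub> \<odot>\<^bsub>coind_module R D\<^esub> x = x"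
    by (auto intro!: extensionalityI[of _ "carrier R"])
qed (use assms in \<open>auto simp: hom_def Pi_def cring.cring_simprules
       intro!: restrict_ext\<close>)


section \<open>Cohomology of complexes of modules and the maps induced on it\<close>

section \<open>Cohomology of cochain complexes\<close>

definition cohom_class ::
  "(nat \<Rightarrow> ('r, 'm) module) \<Rightarrow> (nat \<Rightarrow> 'm \<Rightarrow> 'm) \<Rightarrow> nat \<Rightarrow> 'm \<Rightarrow> 'm set" where
  "cohom_class C d k z = coboundaries C d k +>\<^bsub>C k\<^esub> z"

locale cochain_complex =
  fixes R :: "'r ring" and C :: "nat \<Rightarrow> ('r, 'm) module" and d :: "nat \<Rightarrow> 'm \<Rightarrow> 'm"
  assumes C_module: "\<And>n. Module.module R (C n)"
    and d_hom: "\<And>n. d n \<in> mod_hom R (C n) (C (Suc n))"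
    and d_d: "\<And>n x. x \<in> carrier (C n) \<Longrightarrow> d (Suc n) (d n x) = \<zero>\<^bsub>C (Suc (Suc n))\<^esub>"
begin

lemma cocycles_submodule: "submodule (cocycles C d k) R (C k)"
proof -
  interpret M: Module.module R "C k" by (rule C_module)
  interpret N: Module.module R "C (Suc k)" by (rule C_module)
  show ?thesis
    by (rule M.submoduleI)
      (auto simp: cocycles_def mod_hom_zero[OF d_hom C_module C_module]
         mod_hom_neg[OF d_hom C_module C_module] mod_hom_add[OF d_hom] mod_hom_smult[OF d_hom])
qed

lemma coboundaries_submodule: "submodule (coboundaries C d k) R (C k)"
proof -
  interpret M: Module.module R "C k" by (rule C_module)
  show ?thesis
  proof (cases k)
    case 0
    interpret N: Module.module R "C 0" by (rule C_module)
    show ?thesis by (rule M.submoduleI) (auto simp: coboundaries_def 0)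
  next
    case (Suc n)
    interpret N: Module.module R "C n" by (rule C_module)
    have S: "coboundaries C d k = d n ` carrier (C n)" by (simp add: coboundaries_def Suc)
    note h = d_hom[of n, folded Suc]
    show ?thesis unfolding S
    proof (rule M.submoduleI)
      show "d n ` carrier (C n) \<subseteq> carrier (C k)" using mod_hom_closed[OF h] by auto
      show "\<zero>\<^bsub>C k\<^esub> \<in> d n ` carrier (C n)"
        using mod_hom_zero[OF h C_module C_module] by (metis N.zero_closed imageI)
      show "\<ominus>\<^bsub>C k\<^esub> a \<in> d n ` carrier (C n)" if "a \<in> d n ` carrier (C n)" for a
        using that by (auto simp: mod_hom_neg[OF h C_module C_module, symmetric])
      show "a \<oplus>\<^bsub>C k\<^esub> b \<in> d n ` carrier (C n)"
        if "a \<in> d n ` carrier (C n)" "b \<in> d n ` carrier (C n)" for a b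
        using that by (auto simp: mod_hom_add[OF h, symmetric])
      show "a \<odot>\<^bsub>C k\<^esub> x \<in> d n ` carrier (C n)"
        if "a \<in> carrier R" "x \<in> d n ` carrier (C n)" for a x
        using that by (auto simp: mod_hom_smult[OF h, symmetric])
    qed
  qed
qed

lemma coboundaries_abelian_subgroup: "abelian_subgroup (coboundaries C d k) (C k)"
  using coboundaries_submodule module_abelian_group[OF C_module[of k]]
  by (intro abelian_subgroupI3 additive_subgroup.intro) (auto simp: submodule_def)

lemma cocycles_carrier: "x \<in> cocycles C d k \<Longrightarrow> x \<in> carrier (C k)"
  by (simp add: cocycles_def)

lemma cohom_class_eq_iff:
  assumes "x \<in> carrier (C k)" "y \<in> carrier (C k)"
  shows "cohom_class C d k x = cohom_class C d k y \<longleftrightarrow> x \<ominus>\<^bsub>C k\<^esub> y \<in> coboundaries C d k"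
proof -
  interpret B: abelian_subgroup "coboundaries C d k" "C k" by (rule coboundaries_abelian_subgroup)
  show ?thesis
    unfolding cohom_class_def using B.a_rcos_module[of y x] assms unfolding a_minus_def
    by (metis B.a_rcos_self B.a_repr_independence')
qed

lemma cohom_class_mem:
  assumes "x \<in> carrier (C k)" "z \<in> cohom_class C d k x"
  shows "z \<in> carrier (C k)" "cohom_class C d k z = cohom_class C d k x"
proof -
  interpret B: abelian_subgroup "coboundaries C d k" "C k" by (rule coboundaries_abelian_subgroup)
  show "z \<in> carrier (C k)"
    using assms B.a_elemrcos_carrier unfolding cohom_class_def by blast
  show "cohom_class C d k z = cohom_class C d k x"
    using assms B.a_repr_independence' unfolding cohom_class_def by blast
qed

lemma cohom_class_self: "x \<in> carrier (C k) \<Longrightarrow> x \<in> cohom_class C d k x"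
  unfolding cohom_class_def
  by (rule abelian_subgroup.a_rcos_self[OF coboundaries_abelian_subgroup])

text \<open>The definitions of scalar multiplication and of \<open>cohom_map\<close> take unions
  over all representatives; such a union collapses as soon as its terms depend only on the
  class.\<close>

lemma cohom_class_const:
  assumes "x \<in> carrier (C k)" and "\<And>z. z \<in> cohom_class C d k x \<Longrightarrow> f z = f x"
  shows "(\<Union>z\<in>cohom_class C d k x. f z) = f x"
  using assms cohom_class_self[OF assms(1)] by blast

lemma cohom_module_ops:
  assumes "x \<in> carrier (C k)"
  shows "y \<in> carrier (C k) \<Longrightarrow>
      cohom_class C d k x \<oplus>\<^bsub>cohom_module C d k\<^esub> cohom_class C d k y = cohom_class C d k (x \<oplus>\<^bsub>C k\<^esub> y)"
    and "a \<in> carrier R \<Longrightarrow>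
      a \<odot>\<^bsub>cohom_module C d k\<^esub> cohom_class C d k x = cohom_class C d k (a \<odot>\<^bsub>C k\<^esub> x)"
proof -
  interpret B: abelian_subgroup "coboundaries C d k" "C k" by (rule coboundaries_abelian_subgroup)
  interpret M: Module.module R "C k" by (rule C_module)
  show "cohom_class C d k x \<oplus>\<^bsub>cohom_module C d k\<^esub> cohom_class C d k y = cohom_class C d k (x \<oplus>\<^bsub>C k\<^esub> y)"
    if "y \<in> carrier (C k)"
    using assms that by (simp add: cohom_module_def cohom_class_def Let_def B.a_rcos_sum)
  assume a: "a \<in> carrier R"
  have "cohom_class C d k (a \<odot>\<^bsub>C k\<^esub> z) = cohom_class C d k (a \<odot>\<^bsub>C k\<^esub> x)" if "z \<in> cohom_class C d k x" for z
  proof -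
    note z = cohom_class_mem[OF assms that]
    have "z \<ominus>\<^bsub>C k\<^esub> x \<in> coboundaries C d k"
      using cohom_class_eq_iff[OF z(1) assms] z(2) by simp
    then have "a \<odot>\<^bsub>C k\<^esub> (z \<ominus>\<^bsub>C k\<^esub> x) \<in> coboundaries C d k"
      using M.submoduleE(4)[OF coboundaries_submodule a] by simp
    then show ?thesis
      using a z(1) assms
      by (subst cohom_class_eq_iff) (auto simp: a_minus_def M.smult_r_distr M.smult_r_minus)
  qed
  then show "a \<odot>\<^bsub>cohom_module C d k\<^esub> cohom_class C d k x = cohom_class C d k (a \<odot>\<^bsub>C k\<^esub> x)"
    using cohom_class_const[OF assms, of "\<lambda>z. cohom_class C d k (a \<odot>\<^bsub>C k\<^esub> z)"]
    by (simp add: cohom_module_def Let_def flip: cohom_class_def)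
qed

lemma cohom_module_zero: "\<zero>\<^bsub>cohom_module C d k\<^esub> = cohom_class C d k \<zero>\<^bsub>C k\<^esub>"
proof -
  interpret B: abelian_subgroup "coboundaries C d k" "C k" by (rule coboundaries_abelian_subgroup)
  show ?thesis by (simp add: cohom_module_def cohom_class_def Let_def B.a_subset)
qed

lemma carrier_cohom_module: "carrier (cohom_module C d k) = cohom_class C d k ` cocycles C d k"
  by (simp add: cohom_module_def cohom_class_def Let_def)

text \<open>The cocycles form a submodule and taking classes is surjective and compatible with the
  operations, so \<open>module_surj\<close> applies.\<close>

lemma cohom_module_module: "Module.module R (cohom_module C d k)"
proof (rule module_surj[where p = "cohom_class C d k"])
  show "Module.module R ((C k)\<lparr>carrier := cocycles C d k\<rparr>)"
    by (rule submodule.submodule_is_module[OF cocycles_submodule C_module])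
qed (auto simp: carrier_cohom_module cohom_module_ops cohom_module_zero cocycles_carrier)

end

text \<open>What a map in the single degree \<open>k\<close> has to satisfy in order to act on
  cohomology in that degree. One degree suffices because \<open>cohom_map\<close> receives only that
  component of a cochain map.\<close>

definition cochain_at where
  "cochain_at R C d C' d' k h \<longleftrightarrow> h \<in> mod_hom R (C k) (C' k) \<and>
     h ` cocycles C d k \<subseteq> cocycles C' d' k \<and> h ` coboundaries C d k \<subseteq> coboundaries C' d' k"

text \<open>Two representatives differ by a coboundary and \<open>h\<close> sends the difference to
  a coboundary, so the union in \<open>cohom_map\<close> runs over equal cosets.\<close>

lemma cohom_map_class:
  assumes "cochain_complex R C d" "cochain_complex R C' d'"
    and h: "cochain_at R C d C' d' k h" and z: "z \<in> cocycles C d k"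
  shows "cohom_map C' d' k h (cohom_class C d k z) = cohom_class C' d' k (h z)"
proof -
  interpret C: cochain_complex R C d by fact
  interpret C': cochain_complex R C' d' by fact
  have hh: "h \<in> mod_hom R (C k) (C' k)" using h by (simp add: cochain_at_def)
  have zc: "z \<in> carrier (C k)" using z by (rule C.cocycles_carrier)
  have "cohom_class C' d' k (h y) = cohom_class C' d' k (h z)" if "y \<in> cohom_class C d k z" for y
  proof -
    note y = C.cohom_class_mem[OF zc that]
    have "y \<ominus>\<^bsub>C k\<^esub> z \<in> coboundaries C d k"
      using C.cohom_class_eq_iff[OF y(1) zc] y(2) by simp
    then have "h (y \<ominus>\<^bsub>C k\<^esub> z) \<in> coboundaries C' d' k"
      using h by (auto simp: cochain_at_def)
    then show ?thesis
      using mod_hom_minus[OF hh C.C_module C'.C_module y(1) zc]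
      by (subst C'.cohom_class_eq_iff) (auto simp: mod_hom_closed[OF hh] y(1) zc)
  qed
  then show ?thesis
    using C.cohom_class_const[OF zc, of "\<lambda>y. cohom_class C' d' k (h y)"]
    by (simp add: cohom_map_def flip: cohom_class_def)
qed

lemma cohom_map_hom:
  assumes C: "cochain_complex R C d" and C': "cochain_complex R C' d'"
    and h: "cochain_at R C d C' d' k h"
  shows "cohom_map C' d' k h \<in> mod_hom R (cohom_module C d k) (cohom_module C' d' k)"
proof -
  interpret C: cochain_complex R C d by fact
  interpret C': cochain_complex R C' d' by fact
  interpret M: Module.module R "C k" by (rule C.C_module)
  have hh: "h \<in> mod_hom R (C k) (C' k)" and hz: "\<And>z. z \<in> cocycles C d k \<Longrightarrow> h z \<in> cocycles C' d' k"
    using h by (auto simp: cochain_at_def)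
  note cl = cohom_map_class[OF C C' h] C.cocycles_carrier mod_hom_closed[OF hh]
  note sub = M.submoduleE[OF C.cocycles_submodule]
  show ?thesis
  proof (rule mod_homI)
    fix x assume "x \<in> carrier (cohom_module C d k)"
    then show "cohom_map C' d' k h x \<in> carrier (cohom_module C' d' k)"
      by (auto simp: C.carrier_cohom_module C'.carrier_cohom_module cl hz)
  next
    fix x y assume "x \<in> carrier (cohom_module C d k)" "y \<in> carrier (cohom_module C d k)"
    then show "cohom_map C' d' k h (x \<oplus>\<^bsub>cohom_module C d k\<^esub> y) =
        cohom_map C' d' k h x \<oplus>\<^bsub>cohom_module C' d' k\<^esub> cohom_map C' d' k h y"
      by (auto simp: C.carrier_cohom_module C.cohom_module_ops C'.cohom_module_ops cl
          mod_hom_add[OF hh] sub(5))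
  next
    fix a x assume "a \<in> carrier R" "x \<in> carrier (cohom_module C d k)"
    then show "cohom_map C' d' k h (a \<odot>\<^bsub>cohom_module C d k\<^esub> x) =
        a \<odot>\<^bsub>cohom_module C' d' k\<^esub> cohom_map C' d' k h x"
      by (auto simp: C.carrier_cohom_module C.cohom_module_ops C'.cohom_module_ops cl
          mod_hom_smult[OF hh] sub(4))
  qed
qed

lemma cochain_atI:
  assumes C: "cochain_complex R C d" and C': "cochain_complex R C' d'"
    and h: "\<And>n. h n \<in> mod_hom R (C n) (C' n)"
    and comm: "\<And>n x. x \<in> carrier (C n) \<Longrightarrow> d' n (h n x) = h (Suc n) (d n x)"
  shows "cochain_at R C d C' d' k (h k)"
proof -
  interpret C: cochain_complex R C d by fact
  interpret C': cochain_complex R C' d' by fact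
  have z: "h n \<zero>\<^bsub>C n\<^esub> = \<zero>\<^bsub>C' n\<^esub>" for n by (rule mod_hom_zero[OF h C.C_module C'.C_module])
  have "h k ` cocycles C d k \<subseteq> cocycles C' d' k"
    using mod_hom_closed[OF h] by (auto simp: cocycles_def comm z)
  moreover have "h k ` coboundaries C d k \<subseteq> coboundaries C' d' k"
    using mod_hom_closed[OF h] by (cases k) (auto simp: coboundaries_def z comm[symmetric])
  ultimately show ?thesis using h by (simp add: cochain_at_def)
qed


section \<open>Extension of additive maps into divisible groups\<close>

section \<open>Divisible groups\<close>

definition divisible_group :: "('d, 'e) monoid_scheme \<Rightarrow> bool" where
  "divisible_group D \<longleftrightarrow> (\<forall>d\<in>carrier D. \<forall>n::nat. 0 < n \<longrightarrow> (\<exists>e\<in>carrier D. e [^]\<^bsub>D\<^esub> n = d))"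

text \<open>A homomorphism from a subgroup of \<open>B\<close> to \<open>D\<close>, encoded by its
  graph. As the graph is a subgroup of the product, being single-valued only has to be required over
  the unit. With graphs, extension is inclusion and the union of a chain is again a candidate,
  without any domain to carry along.\<close>

definition partial_hom :: "('b, 'e) monoid_scheme \<Rightarrow> ('d, 'f) monoid_scheme \<Rightarrow> ('b \<times> 'd) set \<Rightarrow> bool" where
  "partial_hom B D \<Gamma> \<longleftrightarrow> subgroup \<Gamma> (B \<times>\<times> D) \<and> (\<forall>d. (\<one>\<^bsub>B\<^esub>, d) \<in> \<Gamma> \<longrightarrow> d = \<one>\<^bsub>D\<^esub>)"

lemma partial_hom_functional:
  assumes B: "group B" and D: "group D" and \<Gamma>: "partial_hom B D \<Gamma>"
    and de: "(b, d) \<in> \<Gamma>" "(b, e) \<in> \<Gamma>"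
  shows "d = e"
proof -
  interpret B: group B by fact
  interpret D: group D by fact
  have sub: "subgroup \<Gamma> (B \<times>\<times> D)" using \<Gamma> by (simp add: partial_hom_def)
  have c: "b \<in> carrier B" "d \<in> carrier D" "e \<in> carrier D"
    using subgroup.subset[OF sub] de by auto
  have "(b, d) \<otimes>\<^bsub>B \<times>\<times> D\<^esub> inv\<^bsub>B \<times>\<times> D\<^esub> (b, e) \<in> \<Gamma>"
    using sub de by (intro subgroup.m_closed subgroup.m_inv_closed)
  then have "(\<one>\<^bsub>B\<^esub>, d \<otimes>\<^bsub>D\<^esub> inv\<^bsub>D\<^esub> e) \<in> \<Gamma>" using c B D by simp
  then have "d \<otimes>\<^bsub>D\<^esub> inv\<^bsub>D\<^esub> e = \<one>\<^bsub>D\<^esub>" using \<Gamma> by (auto simp: partial_hom_def)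
  then show ?thesis using c by (metis D.inv_closed D.inv_equality D.inv_inv)
qed

lemma partial_hom_pow:
  assumes B: "group B" and D: "group D" and sub: "subgroup \<Gamma> (B \<times>\<times> D)" and "(b, d) \<in> \<Gamma>"
  shows "(b [^]\<^bsub>B\<^esub> (k::int), d [^]\<^bsub>D\<^esub> k) \<in> \<Gamma>"
proof -
  interpret B: group B by fact
  interpret D: group D by fact
  have c: "b \<in> carrier B" "d \<in> carrier D" using subgroup.subset[OF sub] assms(4) by auto
  have nat: "(b [^]\<^bsub>B\<^esub> (n::nat), d [^]\<^bsub>D\<^esub> n) \<in> \<Gamma>" for n
  proof (induction n)
    case 0
    then show ?case using subgroup.one_closed[OF sub] by simp
  next
    case (Suc n)
    from subgroup.m_closed[OF sub Suc assms(4)] show ?case by simp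
  qed
  have neg: "(inv\<^bsub>B\<^esub> (b [^]\<^bsub>B\<^esub> (n::nat)), inv\<^bsub>D\<^esub> (d [^]\<^bsub>D\<^esub> n)) \<in> \<Gamma>" for n
    using subgroup.m_inv_closed[OF sub nat[of n]] c B D by simp
  show ?thesis
  proof (cases k rule: int_cases2)
    case (nonneg n)
    then show ?thesis using nat[of n] by (simp add: int_pow_int)
  next
    case (nonpos n)
    then show ?thesis using neg[of n] c by (simp add: int_pow_int B.int_pow_neg D.int_pow_neg)
  qed
qed

text \<open>The exponents \<open>k\<close> for which the power \<open>k\<close> of \<open>b\<close>
  already has a value form a subgroup of the integers. If it is generated by some
  \<open>n > 0\<close>, divisibility provides an n-th root of the value at the n-th power of
  \<open>b\<close>, and this root is a consistent value at \<open>b\<close>; if it is trivial,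
  nothing constrains the value.\<close>

lemma partial_hom_extend_by_one:
  assumes B: "comm_group B" and D: "comm_group D" and div: "divisible_group D"
    and \<Gamma>: "partial_hom B D \<Gamma>" and b: "b \<in> carrier B"
  shows "\<exists>\<Gamma>'. \<Gamma> \<subseteq> \<Gamma>' \<and> partial_hom B D \<Gamma>' \<and> (\<exists>d. (b, d) \<in> \<Gamma>')"
proof -
  interpret B: comm_group B by fact
  interpret D: comm_group D by fact
  let ?G = "B \<times>\<times> D"
  interpret G: group ?G by (rule DirProd_group) unfold_locales
  have sub: "subgroup \<Gamma> ?G" and fn: "\<And>d. (\<one>\<^bsub>B\<^esub>, d) \<in> \<Gamma> \<Longrightarrow> d = \<one>\<^bsub>D\<^esub>"
    using \<Gamma> by (auto simp: partial_hom_def)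
  note cl = subgroup.subset[OF sub]
  note pow = partial_hom_pow[OF B.is_group D.is_group sub]
  have inv: "(inv\<^bsub>B\<^esub> c, inv\<^bsub>D\<^esub> e) \<in> \<Gamma>" if "(c, e) \<in> \<Gamma>" for c e
    using subgroup.m_inv_closed[OF sub that] cl that by (auto simp: B.is_group D.is_group)
  have mult: "(c \<otimes>\<^bsub>B\<^esub> c', e \<otimes>\<^bsub>D\<^esub> e') \<in> \<Gamma>" if "(c, e) \<in> \<Gamma>" "(c', e') \<in> \<Gamma>" for c e c' e'
    using subgroup.m_closed[OF sub that] by simp
  define P where "P n \<longleftrightarrow> 0 < n \<and> (\<exists>d. (b [^]\<^bsub>B\<^esub> n, d) \<in> \<Gamma>)" for n :: nat
  \<comment> \<open>The future value \<open>d\<close> at \<open>b\<close> must agree with all values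
    already prescribed on powers of \<open>b\<close>; this is the only obstruction to the
    extension.\<close>
  have "\<exists>d\<in>carrier D. \<forall>k::int. \<forall>e. (b [^]\<^bsub>B\<^esub> k, e) \<in> \<Gamma> \<longrightarrow> e = d [^]\<^bsub>D\<^esub> k"
  proof (cases "\<exists>n. P n")
    case True
    define n where "n = (LEAST n. P n)"
    have Pn: "P n" and least: "\<And>m. P m \<Longrightarrow> n \<le> m"
      unfolding n_def using True by (auto intro: LeastI Least_le)
    then obtain d' where n: "0 < n" and d': "(b [^]\<^bsub>B\<^esub> n, d') \<in> \<Gamma>" by (auto simp: P_def)
    have "d' \<in> carrier D" using cl d' by auto
    then obtain d where d: "d \<in> carrier D" "d [^]\<^bsub>D\<^esub> n = d'"
      using div n by (auto simp: divisible_group_def)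
    have "e = d [^]\<^bsub>D\<^esub> k" if ke: "(b [^]\<^bsub>B\<^esub> k, e) \<in> \<Gamma>" for k :: int and e
    proof -
      \<comment> \<open>Division with remainder by the least positive exponent: the power of
        \<open>b\<close> with exponent \<open>r\<close> again lies in the domain, so minimality
        forces \<open>r = 0\<close>.\<close>
      define q r where "q = k div int n" and "r = k mod int n"
      have k: "k = int n * q + r" and r: "0 \<le> r" "r < int n"
        using n by (auto simp: q_def r_def)
      have dq: "(b [^]\<^bsub>B\<^esub> (int n * q), d [^]\<^bsub>D\<^esub> (int n * q)) \<in> \<Gamma>"
        using pow[OF d', of q] B.int_pow_pow[OF b, of "int n" q] D.int_pow_pow[OF d(1), of "int n" q] d(2)
        by (simp add: int_pow_int)
      have "(b [^]\<^bsub>B\<^esub> r, e \<otimes>\<^bsub>D\<^esub> inv\<^bsub>D\<^esub> (d [^]\<^bsub>D\<^esub> (int n * q))) \<in> \<Gamma>"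
        using mult[OF ke inv[OF dq]] b by (simp add: k B.int_pow_mult B.m_ac B.m_comm[of "b [^]\<^bsub>B\<^esub> (int n * q)"])
      then have "(b [^]\<^bsub>B\<^esub> nat r, e \<otimes>\<^bsub>D\<^esub> inv\<^bsub>D\<^esub> (d [^]\<^bsub>D\<^esub> (int n * q))) \<in> \<Gamma>"
        using r by (metis int_pow_int nat_0_le)
      then have "r = 0" using least[of "nat r"] r by (force simp: P_def)
      then show ?thesis
        using partial_hom_functional[OF B.is_group D.is_group \<Gamma>, of "b [^]\<^bsub>B\<^esub> k"] ke dq k by auto
    qed
    then show ?thesis using d by blast
  next
    case False
    \<comment> \<open>Without a positive exponent in the domain only \<open>k = 0\<close> occurs,
      and the unit serves as value at \<open>b\<close>.\<close>
    have "e = \<one>\<^bsub>D\<^esub> [^]\<^bsub>D\<^esub> k" if ke: "(b [^]\<^bsub>B\<^esub> k, e) \<in> \<Gamma>" for k :: int and e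
    proof -
      have "k = 0"
      proof (rule ccontr)
        assume "k \<noteq> 0"
        have "\<exists>f. (b [^]\<^bsub>B\<^esub> nat \<bar>k\<bar>, f) \<in> \<Gamma>"
        proof (cases k rule: int_cases2)
          case (nonneg n)
          then show ?thesis using ke by (auto simp: int_pow_int)
        next
          case (nonpos n)
          then show ?thesis using inv[OF ke] b by (auto simp: int_pow_int B.int_pow_neg)
        qed
        then show False using False \<open>k \<noteq> 0\<close> unfolding P_def by (metis zero_less_abs_iff zero_less_nat_eq)
      qed
      then show ?thesis using ke fn by auto
    qed
    then show ?thesis by blast
  qed
  then obtain d where d: "d \<in> carrier D"
    and dk: "\<And>k::int. \<And>e. (b [^]\<^bsub>B\<^esub> k, e) \<in> \<Gamma> \<Longrightarrow> e = d [^]\<^bsub>D\<^esub> k" by blast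
  \<comment> \<open>The subgroup of the product generated by \<open>\<Gamma>\<close> and the new
    pair \<open>(b, d)\<close>. The trivial equation only fixes the type of the exponent.\<close>
  define \<Gamma>' where "\<Gamma>' = {(b [^]\<^bsub>B\<^esub> k \<otimes>\<^bsub>B\<^esub> c, d [^]\<^bsub>D\<^esub> k \<otimes>\<^bsub>D\<^esub> e) |k c e. (k::int) = k \<and> (c, e) \<in> \<Gamma>}"
  have I: "(b [^]\<^bsub>B\<^esub> (k::int) \<otimes>\<^bsub>B\<^esub> c, d [^]\<^bsub>D\<^esub> k \<otimes>\<^bsub>D\<^esub> e) \<in> \<Gamma>'" if "(c, e) \<in> \<Gamma>" for k c e
    using that by (auto simp: \<Gamma>'_def)
  have one: "(\<one>\<^bsub>B\<^esub>, \<one>\<^bsub>D\<^esub>) \<in> \<Gamma>" using subgroup.one_closed[OF sub] by simp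
  have "\<Gamma> \<subseteq> \<Gamma>'"
  proof clarify
    fix c e assume "(c, e) \<in> \<Gamma>"
    with I[OF this, of 0] cl show "(c, e) \<in> \<Gamma>'" by auto
  qed
  moreover have "(b, d) \<in> \<Gamma>'" using I[OF one, of 1] b d by simp
  moreover have "partial_hom B D \<Gamma>'"
    unfolding partial_hom_def
  proof (intro conjI allI impI)
    show "subgroup \<Gamma>' ?G"
    proof (rule G.subgroupI)
      show "\<Gamma>' \<subseteq> carrier ?G" using cl b d by (auto simp: \<Gamma>'_def)
      show "\<Gamma>' \<noteq> {}" using I[OF one] by blast
    next
      fix x assume "x \<in> \<Gamma>'"
      then obtain k :: int and c e where x: "x = (b [^]\<^bsub>B\<^esub> k \<otimes>\<^bsub>B\<^esub> c, d [^]\<^bsub>D\<^esub> k \<otimes>\<^bsub>D\<^esub> e)"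
        and ce: "(c, e) \<in> \<Gamma>" by (auto simp: \<Gamma>'_def)
      then have "c \<in> carrier B" "e \<in> carrier D" using cl by auto
      then have "inv\<^bsub>?G\<^esub> x = (b [^]\<^bsub>B\<^esub> (- k) \<otimes>\<^bsub>B\<^esub> inv\<^bsub>B\<^esub> c, d [^]\<^bsub>D\<^esub> (- k) \<otimes>\<^bsub>D\<^esub> inv\<^bsub>D\<^esub> e)"
        using b d by (simp add: x B.is_group D.is_group B.inv_mult D.inv_mult B.int_pow_neg D.int_pow_neg)
      then show "inv\<^bsub>?G\<^esub> x \<in> \<Gamma>'" using I[OF inv[OF ce], of "- k"] by simp
    next
      fix x y assume "x \<in> \<Gamma>'" "y \<in> \<Gamma>'"
      then obtain k l :: int and c e c' e'
        where x: "x = (b [^]\<^bsub>B\<^esub> k \<otimes>\<^bsub>B\<^esub> c, d [^]\<^bsub>D\<^esub> k \<otimes>\<^bsub>D\<^esub> e)"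
        and y: "y = (b [^]\<^bsub>B\<^esub> l \<otimes>\<^bsub>B\<^esub> c', d [^]\<^bsub>D\<^esub> l \<otimes>\<^bsub>D\<^esub> e')"
        and ce: "(c, e) \<in> \<Gamma>" "(c', e') \<in> \<Gamma>" by (auto simp: \<Gamma>'_def)
      then have "c \<in> carrier B" "e \<in> carrier D" "c' \<in> carrier B" "e' \<in> carrier D" using cl by auto
      then have "x \<otimes>\<^bsub>?G\<^esub> y = (b [^]\<^bsub>B\<^esub> (k + l) \<otimes>\<^bsub>B\<^esub> (c \<otimes>\<^bsub>B\<^esub> c'), d [^]\<^bsub>D\<^esub> (k + l) \<otimes>\<^bsub>D\<^esub> (e \<otimes>\<^bsub>D\<^esub> e'))"
        using b d by (simp add: x y B.int_pow_mult D.int_pow_mult B.m_ac D.m_ac)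
      then show "x \<otimes>\<^bsub>?G\<^esub> y \<in> \<Gamma>'" using I[OF mult[OF ce], of "k + l"] by simp
    qed
  next
    fix f assume "(\<one>\<^bsub>B\<^esub>, f) \<in> \<Gamma>'"
    then obtain k :: int and c e where k: "\<one>\<^bsub>B\<^esub> = b [^]\<^bsub>B\<^esub> k \<otimes>\<^bsub>B\<^esub> c" and f: "f = d [^]\<^bsub>D\<^esub> k \<otimes>\<^bsub>D\<^esub> e"
      and ce: "(c, e) \<in> \<Gamma>" by (auto simp: \<Gamma>'_def)
    then have c: "c \<in> carrier B" "e \<in> carrier D" using cl by auto
    \<comment> \<open>Over the unit, the power of \<open>b\<close> is the inverse of an element of
      the old domain, so its value is prescribed and the choice of \<open>d\<close> makes the two
      factors of \<open>f\<close> cancel.\<close>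
    have "b [^]\<^bsub>B\<^esub> k = inv\<^bsub>B\<^esub> c"
      using k[symmetric] b c by (simp add: B.inv_equality)
    then have "(b [^]\<^bsub>B\<^esub> k, inv\<^bsub>D\<^esub> e) \<in> \<Gamma>" using inv[OF ce] by simp
    then have "inv\<^bsub>D\<^esub> e = d [^]\<^bsub>D\<^esub> k" by (rule dk)
    then show "f = \<one>\<^bsub>D\<^esub>" using f c by (metis D.l_inv)
  qed
  ultimately show ?thesis by blast
qed

text \<open>Zorn's lemma on the graphs containing \<open>\<Gamma>0\<close>. A maximal graph has a
  value at every element of \<open>B\<close>, since otherwise it could be enlarged by that
  element.\<close>

theorem divisible_extension:
  assumes B: "comm_group B" and D: "comm_group D" and div: "divisible_group D"
    and \<Gamma>0: "partial_hom B D \<Gamma>0"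
  shows "\<exists>h\<in>hom B D. \<forall>(b, d)\<in>\<Gamma>0. h b = d"
proof -
  interpret B: comm_group B by fact
  interpret D: comm_group D by fact
  let ?G = "B \<times>\<times> D"
  interpret G: group ?G by (rule DirProd_group) unfold_locales
  define \<A> where "\<A> = {\<Gamma>. partial_hom B D \<Gamma> \<and> \<Gamma>0 \<subseteq> \<Gamma>}"
  have "\<exists>M\<in>\<A>. \<forall>X\<in>\<A>. M \<subseteq> X \<longrightarrow> X = M"
  proof (rule subset_Zorn_nonempty)
    show "\<A> \<noteq> {}" using \<Gamma>0 by (auto simp: \<A>_def)
  next
    fix \<C> assume ne: "\<C> \<noteq> {}" and ch: "subset.chain \<A> \<C>"
    have sub: "subgroup \<Gamma> ?G" if "\<Gamma> \<in> \<C>" for \<Gamma>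
      using ch that by (auto simp: subset.chain_def \<A>_def partial_hom_def)
    \<comment> \<open>Any two points of the union already lie in one member of the chain, so closure
      under products can be checked inside that member.\<close>
    have two: "\<exists>\<Gamma>\<in>\<C>. x \<in> \<Gamma> \<and> y \<in> \<Gamma>" if "x \<in> \<Union>\<C>" "y \<in> \<Union>\<C>" for x y
    proof -
      obtain A B where AB: "A \<in> \<C>" "x \<in> A" "B \<in> \<C>" "y \<in> B" using \<open>x \<in> \<Union>\<C>\<close> \<open>y \<in> \<Union>\<C>\<close> by blast
      then have "A \<subseteq> B \<or> B \<subseteq> A" using ch unfolding subset_chain_def by blast
      then show ?thesis using AB by blast
    qed
    have "subgroup (\<Union>\<C>) ?G"
    proof (rule G.subgroupI)
      show "\<Union>\<C> \<subseteq> carrier ?G" using sub subgroup.subset by blast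
      show "\<Union>\<C> \<noteq> {}" using ne sub subgroup.one_closed by blast
      show "inv\<^bsub>?G\<^esub> x \<in> \<Union>\<C>" if "x \<in> \<Union>\<C>" for x
        using that subgroup.m_inv_closed[OF sub] by (meson UnionE UnionI)
      show "x \<otimes>\<^bsub>?G\<^esub> y \<in> \<Union>\<C>" if "x \<in> \<Union>\<C>" "y \<in> \<Union>\<C>" for x y
        using two[OF that] subgroup.m_closed[OF sub] by (meson UnionI)
    qed
    moreover have "\<forall>\<Gamma>\<in>\<C>. partial_hom B D \<Gamma> \<and> \<Gamma>0 \<subseteq> \<Gamma>"
      using ch by (auto simp: subset.chain_def \<A>_def)
    ultimately show "\<Union>\<C> \<in> \<A>"
      using ne by (auto simp: \<A>_def partial_hom_def)
  qed
  then obtain M where M: "partial_hom B D M" "\<Gamma>0 \<subseteq> M"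
    and max: "\<And>X. partial_hom B D X \<Longrightarrow> M \<subseteq> X \<Longrightarrow> X = M"
    by (auto simp: \<A>_def)
  have sub: "subgroup M ?G" using M by (simp add: partial_hom_def)
  have "\<exists>d. (b, d) \<in> M" if "b \<in> carrier B" for b
    using partial_hom_extend_by_one[OF B D div M(1) that] max by blast
  then obtain h where h: "\<And>b. b \<in> carrier B \<Longrightarrow> (b, h b) \<in> M" by metis
  note fn = partial_hom_functional[OF B.is_group D.is_group M(1)]
  have "h \<in> hom B D"
  proof (rule homI)
    show "h x \<in> carrier D" if "x \<in> carrier B" for x
      using h[OF that] subgroup.subset[OF sub] by auto
    show "h (x \<otimes>\<^bsub>B\<^esub> y) = h x \<otimes>\<^bsub>D\<^esub> h y" if "x \<in> carrier B" "y \<in> carrier B" for x y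
      using fn[OF h[OF B.m_closed[OF that]]] subgroup.m_closed[OF sub h[OF that(1)] h[OF that(2)]]
      by simp
  qed
  moreover have "\<forall>(b, d)\<in>\<Gamma>0. h b = d"
  proof clarify
    fix b d assume "(b, d) \<in> \<Gamma>0"
    then have bd: "(b, d) \<in> M" using M(2) by blast
    then have "b \<in> carrier B" using subgroup.subset[OF sub] by auto
    then show "h b = d" using fn[OF h bd] by simp
  qed
  ultimately show ?thesis by blast
qed


section \<open>Embedding an abelian group into a divisible group of controlled size\<close>

subsection \<open>Divisible hulls\<close>

text \<open>The rational vector space with basis \<open>'b\<close>, packaged as a multiplicatively
  written group so that quotients and powers apply to it.\<close>

definition rat_group :: "('b \<Rightarrow>\<^sub>0 rat) monoid" where
  "rat_group = \<lparr>carrier = UNIV, monoid.mult = (+), one = 0\<rparr>"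

lemma comm_group_rat_group: "comm_group rat_group"
proof (rule comm_groupI)
  fix x :: "'b \<Rightarrow>\<^sub>0 rat"
  show "\<exists>y\<in>carrier rat_group. y \<otimes>\<^bsub>rat_group\<^esub> x = \<one>\<^bsub>rat_group\<^esub>"
    by (rule bexI[of _ "- x"]) (auto simp: rat_group_def)
qed (auto simp: rat_group_def ac_simps)

lemma rat_group_mult: "x \<otimes>\<^bsub>rat_group\<^esub> y = x + y"
  by (simp add: rat_group_def)

lemma rat_group_pow: "Poly_Mapping.lookup (x [^]\<^bsub>rat_group\<^esub> (n::nat)) b = of_nat n * Poly_Mapping.lookup x b"
  by (induction n) (auto simp: rat_group_def nat_pow_def lookup_add algebra_simps)

lemma rat_group_inv: "inv\<^bsub>rat_group\<^esub> x = - x"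
proof -
  interpret comm_group rat_group by (rule comm_group_rat_group)
  show ?thesis by (rule inv_equality) (auto simp: rat_group_def)
qed

lemma divisible_rat_group: "divisible_group rat_group"
  unfolding divisible_group_def
proof (intro ballI allI impI)
  fix x :: "'b \<Rightarrow>\<^sub>0 rat" and n :: nat
  assume n: "0 < n"
  define y where "y = Poly_Mapping.map (\<lambda>q. q / of_nat n) x"
  have "y [^]\<^bsub>rat_group\<^esub> n = x"
    by (rule poly_mapping_eqI) (use n in \<open>simp add: rat_group_pow y_def Poly_Mapping.map.rep_eq when_def\<close>)
  then show "\<exists>y\<in>carrier rat_group. y [^]\<^bsub>rat_group\<^esub> n = x" by (auto simp: rat_group_def)
qed

lemma divisible_FactGroup:
  fixes G (structure)
  assumes "comm_group G" "divisible_group G" "subgroup K G"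
  shows "divisible_group (G Mod K)"
proof -
  interpret comm_group G by fact
  interpret normal K G by (simp add: assms(3) normal_iff_subgroup)
  show ?thesis
    unfolding divisible_group_def
  proof (intro ballI allI impI)
    fix A n assume "A \<in> carrier (G Mod K)" and n: "0 < (n::nat)"
    then obtain a where a: "a \<in> carrier G" "A = K #> a" by (auto simp: carrier_FactGroup)
    then obtain c where "c \<in> carrier G" "c [^] n = a" using assms(2) n by (auto simp: divisible_group_def)
    then show "\<exists>C\<in>carrier (G Mod K). C [^]\<^bsub>G Mod K\<^esub> n = A"
      using a FactGroup_pow by (auto simp: carrier_FactGroup intro!: bexI[of _ "K #> c"])
  qed
qed

lemma comm_group_transport:
  fixes G (structure)
  assumes G: "comm_group G" and e: "inj_on (e :: 'g \<Rightarrow> 'h) (carrier G)"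
  shows "\<exists>H :: 'h monoid. comm_group H \<and> e \<in> iso G H"
proof -
  interpret comm_group G by fact
  let ?d = "inv_into (carrier G) e"
  let ?H = "\<lparr>carrier = e ` carrier G, monoid.mult = (\<lambda>a b. e (?d a \<otimes> ?d b)), one = e \<one>\<rparr>"
  have "comm_group ?H"
  proof (rule comm_groupI)
    fix x assume "x \<in> carrier ?H"
    then obtain g where "g \<in> carrier G" "x = e g" by auto
    then show "\<exists>y\<in>carrier ?H. y \<otimes>\<^bsub>?H\<^esub> x = \<one>\<^bsub>?H\<^esub>"
      using e by (auto intro!: bexI[of _ "inv g"])
  qed (use e in \<open>auto simp: m_ac\<close>)
  moreover have "e \<in> iso G ?H" using e by (auto simp: iso_def hom_def bij_betw_def)
  ultimately show ?thesis by blast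
qed

lemma divisible_iso:
  fixes G (structure)
  assumes "group G" "group H" "e \<in> iso G H" "divisible_group G"
  shows "divisible_group H"
  unfolding divisible_group_def
proof (intro ballI allI impI)
  interpret group_hom G H e
    using assms by (simp add: group_hom_def group_hom_axioms_def iso_def)
  fix d n assume d: "d \<in> carrier H" and n: "0 < (n::nat)"
  then obtain g where g: "g \<in> carrier G" "d = e g"
    using assms(3) by (auto simp: iso_def bij_betw_def)
  then obtain c where "c \<in> carrier G" "c [^] n = g" using assms(4) n by (auto simp: divisible_group_def)
  then show "\<exists>f\<in>carrier H. f [^]\<^bsub>H\<^esub> n = d" using g hom_nat_pow by (auto intro!: bexI[of _ "e c"])
qed

text \<open>The hull of \<open>M\<close> is \<open>\<rat>\<^sup>(\<^sup>M\<^sup>) / K\<close>, where \<open>K\<close> is the kernel of \<open>\<int>\<^sup>(\<^sup>M\<^sup>) \<rightarrow> M\<close>.\<close>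

lemma divisible_hull:
  assumes M: "comm_group M" and e: "inj_on (e :: 'm \<Rightarrow> 'b) (carrier M)" and i: "inj (i :: ('b \<Rightarrow>\<^sub>0 rat) \<Rightarrow> 'u)"
  shows "\<exists>(D :: 'u monoid) j. comm_group D \<and> divisible_group D \<and> j \<in> hom M D \<and> inj_on j (carrier M)"
proof -
  interpret M: comm_group M by fact
  interpret V: comm_group "rat_group :: ('b \<Rightarrow>\<^sub>0 rat) monoid" by (rule comm_group_rat_group)
  let ?V = "rat_group :: ('b \<Rightarrow>\<^sub>0 rat) monoid"
  let ?S = "e ` carrier M"
  let ?F = "free_Abelian_group ?S"
  obtain h where h: "h \<in> hom ?F M" and hf: "\<And>x. x \<in> ?S \<Longrightarrow> h (frag_of x) = inv_into (carrier M) e x"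
    using M.free_Abelian_group_universal[of "inv_into (carrier M) e" ?S] e by auto
  interpret F: comm_group ?F by (rule abelian_free_Abelian_group)
  interpret h: group_hom ?F M h
    using h by unfold_locales
  have F_mult: "c \<otimes>\<^bsub>?F\<^esub> c' = c + c'" for c c' by (simp add: free_Abelian_group_def)
  have F_add: "c + c' \<in> carrier ?F" "h (c + c') = h c \<otimes>\<^bsub>M\<^esub> h c'"
    if "c \<in> carrier ?F" "c' \<in> carrier ?F" for c c'
    using F.m_closed[OF that] h.hom_mult[OF that] unfolding F_mult by auto
  have F_neg: "- c \<in> carrier ?F" "h (- c) = inv\<^bsub>M\<^esub> (h c)" if "c \<in> carrier ?F" for c
    using F.inv_closed[OF that] h.hom_inv[OF that] that by auto
  have F_diff: "c - c' \<in> carrier ?F" "h (c - c') = h c \<otimes>\<^bsub>M\<^esub> inv\<^bsub>M\<^esub> (h c')"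
    if "c \<in> carrier ?F" "c' \<in> carrier ?F" for c c'
    using F_add[OF that(1) F_neg(1)[OF that(2)]] F_neg(2)[OF that(2)] by auto
  define \<iota> :: "('b \<Rightarrow>\<^sub>0 int) \<Rightarrow> ('b \<Rightarrow>\<^sub>0 rat)" where "\<iota> = Poly_Mapping.map of_int"
  have l: "Poly_Mapping.lookup (\<iota> c) b = of_int (Poly_Mapping.lookup c b)" for c b
    by (simp add: \<iota>_def Poly_Mapping.map.rep_eq when_def)
  have \<iota>_add: "\<iota> (c + c') = \<iota> c + \<iota> c'" and \<iota>_diff: "\<iota> (c - c') = \<iota> c - \<iota> c'"
    and \<iota>_neg: "\<iota> (- c) = - \<iota> c" and \<iota>0: "\<iota> 0 = 0" for c c'
    by (rule poly_mapping_eqI; simp add: l lookup_add lookup_minus)+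
  have \<iota>_inj: "c = c'" if "\<iota> c = \<iota> c'" for c c'
    by (rule poly_mapping_eqI) (metis l of_int_eq_iff that)
  \<comment> \<open>The integral relations of \<open>M\<close>, viewed inside the rational vector
    space. The quotient remains divisible, and an integral vector dies in it exactly when it is a
    relation; hence \<open>M\<close> embeds.\<close>
  define K where "K = \<iota> ` kernel ?F M h"
  have ker: "subgroup (kernel ?F M h) ?F" by (rule h.subgroup_kernel)
  have K: "subgroup K ?V"
  proof (rule V.subgroupI)
    show "K \<subseteq> carrier ?V" by (simp add: rat_group_def)
    show "K \<noteq> {}" using subgroup.one_closed[OF ker] by (auto simp: K_def)
    show "inv\<^bsub>?V\<^esub> x \<in> K" if x: "x \<in> K" for x
    proof -
      obtain c where c: "c \<in> kernel ?F M h" "x = \<iota> c" using x by (auto simp: K_def)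
      have "- c \<in> kernel ?F M h"
        using subgroup.m_inv_closed[OF ker c(1)] c(1) by (simp add: kernel_def)
      then show ?thesis using c by (auto simp: K_def rat_group_inv \<iota>_neg[symmetric])
    qed
    show "x \<otimes>\<^bsub>?V\<^esub> y \<in> K" if "x \<in> K" "y \<in> K" for x y
      using that subgroup.m_closed[OF ker] by (auto simp: K_def rat_group_def \<iota>_add[symmetric])
  qed
  have Kiff: "\<iota> c \<in> K \<longleftrightarrow> h c = \<one>\<^bsub>M\<^esub>" if "c \<in> carrier ?F" for c
    using that \<iota>_inj by (auto simp: K_def kernel_def)
  let ?Q = "?V Mod K"
  interpret Q: comm_group ?Q by (rule V.abelian_FactGroup[OF K])
  interpret K: normal K ?V by (simp add: K V.normal_iff_subgroup)
  define j where "j m = K #>\<^bsub>?V\<^esub> \<iota> (frag_of (e m))" for m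
  have eq_iff: "K #>\<^bsub>?V\<^esub> x = K #>\<^bsub>?V\<^esub> y \<longleftrightarrow> x - y \<in> K" for x y
  proof -
    have U: "x \<in> carrier ?V" for x by (simp add: rat_group_def)
    have "x \<in> K #>\<^bsub>?V\<^esub> y \<longleftrightarrow> x \<otimes>\<^bsub>?V\<^esub> inv\<^bsub>?V\<^esub> y \<in> K"
      using K.rcos_module[OF V.is_group U U] .
    then show ?thesis
      using V.repr_independence[of x K y] V.rcos_self[OF U K] U K
      by (auto simp: rat_group_inv) (auto simp: rat_group_def)
  qed
  have j: "j \<in> hom M ?Q"
  proof (rule homI)
    show "j x \<in> carrier ?Q" for x by (auto simp: j_def carrier_FactGroup rat_group_def)
    fix x y assume xy: "x \<in> carrier M" "y \<in> carrier M"
    \<comment> \<open>This vector is a relation because \<open>h\<close> evaluates formal sums in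
      \<open>M\<close>; its vanishing in the quotient is the additivity of \<open>j\<close>.\<close>
    let ?c = "frag_of (e (x \<otimes>\<^bsub>M\<^esub> y)) - (frag_of (e x) + frag_of (e y))"
    have fr: "frag_of (e z) \<in> carrier ?F" if "z \<in> carrier M" for z using that by simp
    have cc: "?c \<in> carrier ?F"
      using F_add[OF fr[OF xy(1)] fr[OF xy(2)]] F_diff fr[OF M.m_closed[OF xy]] by blast
    have "h ?c = h (frag_of (e (x \<otimes>\<^bsub>M\<^esub> y))) \<otimes>\<^bsub>M\<^esub> inv\<^bsub>M\<^esub> (h (frag_of (e x)) \<otimes>\<^bsub>M\<^esub> h (frag_of (e y)))"
      using F_add[OF fr[OF xy(1)] fr[OF xy(2)]] F_diff fr[OF M.m_closed[OF xy]] by metis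
    then have "h ?c = \<one>\<^bsub>M\<^esub>" using hf xy e by (simp add: M.inv_mult_group[symmetric] M.m_comm)
    then have "\<iota> ?c \<in> K" using cc Kiff by blast
    then have "j (x \<otimes>\<^bsub>M\<^esub> y) = K #>\<^bsub>?V\<^esub> (\<iota> (frag_of (e x)) \<otimes>\<^bsub>?V\<^esub> \<iota> (frag_of (e y)))"
      by (simp add: j_def eq_iff \<iota>_diff \<iota>_add rat_group_mult)
    also have "\<dots> = j x \<otimes>\<^bsub>?Q\<^esub> j y"
      unfolding j_def mult_FactGroup by (rule K.rcos_sum[symmetric]) (simp_all add: rat_group_def)
    finally show "j (x \<otimes>\<^bsub>M\<^esub> y) = j x \<otimes>\<^bsub>?Q\<^esub> j y" .
  qed
  have j_inj: "inj_on j (carrier M)"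
  proof (rule inj_onI)
    fix x y assume xy: "x \<in> carrier M" "y \<in> carrier M" and "j x = j y"
    let ?c = "frag_of (e x) - frag_of (e y)"
    have "\<iota> ?c \<in> K" using \<open>j x = j y\<close> by (simp add: j_def eq_iff \<iota>_diff)
    moreover have "?c \<in> carrier ?F"
      using F_diff xy by simp
    ultimately have "h ?c = \<one>\<^bsub>M\<^esub>" using Kiff by blast
    moreover have "h ?c = h (frag_of (e x)) \<otimes>\<^bsub>M\<^esub> inv\<^bsub>M\<^esub> h (frag_of (e y))"
      using F_diff xy by simp
    ultimately have "x \<otimes>\<^bsub>M\<^esub> inv\<^bsub>M\<^esub> y = \<one>\<^bsub>M\<^esub>" using hf xy e by simp
    then show "x = y" using xy by (metis M.inv_closed M.inv_equality M.inv_inv)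
  qed
  \<comment> \<open>The injection \<open>i\<close> encodes vectors, not cosets, so a coset is
    encoded through a chosen representative.\<close>
  define s where "s A = i (SOME x. A = K #>\<^bsub>?V\<^esub> x)" for A
  have "inj_on s (carrier ?Q)"
  proof (rule inj_onI)
    fix A B assume "A \<in> carrier ?Q" "B \<in> carrier ?Q" and "s A = s B"
    then have "\<exists>x. A = K #>\<^bsub>?V\<^esub> x" "\<exists>x. B = K #>\<^bsub>?V\<^esub> x"
      and eq: "(SOME x. A = K #>\<^bsub>?V\<^esub> x) = (SOME x. B = K #>\<^bsub>?V\<^esub> x)"
      using injD[OF i] by (auto simp: carrier_FactGroup s_def)
    then show "A = B" by (metis (mono_tags, lifting) someI_ex)
  qed
  then obtain D :: "'u monoid" where D: "comm_group D" "s \<in> iso ?Q D"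
    using comm_group_transport[OF Q.comm_group_axioms] by blast
  have "divisible_group ?Q"
    by (rule divisible_FactGroup[OF comm_group_rat_group divisible_rat_group K])
  then have "divisible_group D"
    using divisible_iso[OF Q.is_group _ D(2)] D(1) by (simp add: comm_group_def)
  moreover have "s \<circ> j \<in> hom M D"
    by (rule hom_compose[OF j]) (use D(2) in \<open>simp add: iso_def\<close>)
  moreover have "inj_on (s \<circ> j) (carrier M)"
  proof (rule comp_inj_on[OF j_inj])
    have "j ` carrier M \<subseteq> carrier ?Q" using j by (auto simp: hom_def)
    then show "inj_on s (j ` carrier M)" using \<open>inj_on s (carrier ?Q)\<close> by (rule inj_on_subset[rotated])
  qed
  ultimately show ?thesis using D(1) by blast
qed


section \<open>Cardinal arithmetic of the universe type\<close>

section \<open>Cardinalities\<close>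

text \<open>Comparison of the cardinalities of two types, phrased as a predicate on
  \<open>itself\<close> arguments so that it chains like a preorder and can be assumed in
  locales.\<close>

definition embeds :: "'a itself \<Rightarrow> 'b itself \<Rightarrow> bool" where
  "embeds _ _ \<longleftrightarrow> (\<exists>f :: 'a \<Rightarrow> 'b. inj f)"

lemma embedsI: "inj (f :: 'a \<Rightarrow> 'b) \<Longrightarrow> embeds TYPE('a) TYPE('b)"
  by (auto simp: embeds_def)

lemma embeds_trans: "embeds TYPE('a) TYPE('b) \<Longrightarrow> embeds TYPE('b) TYPE('c) \<Longrightarrow> embeds TYPE('a) TYPE('c)"
  unfolding embeds_def by (metis inj_compose)

lemma embeds_set: "embeds TYPE('a) TYPE('b) \<Longrightarrow> embeds TYPE('a set) TYPE('b set)"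
  unfolding embeds_def by (metis inj_on_image_Pow Pow_UNIV)

lemma embeds_prod:
  "embeds TYPE('a) TYPE('b) \<Longrightarrow> embeds TYPE('c) TYPE('d) \<Longrightarrow> embeds TYPE('a \<times> 'c) TYPE('b \<times> 'd)"
  unfolding embeds_def by (metis prod.inj_map)

lemma embeds_fun: "embeds TYPE('a) TYPE('b) \<Longrightarrow> embeds TYPE('c \<Rightarrow> 'a) TYPE('c \<Rightarrow> 'b)"
  unfolding embeds_def by (metis fun.inj_map)

text \<open>The universe has type \<open>'k set\<close> where \<open>'k\<close> is infinite, hence closed under products.\<close>

lemma embeds_times_self:
  assumes "infinite (UNIV :: 'k set)"
  shows "embeds TYPE('k \<times> 'k) TYPE('k)"
  using card_of_Times_same_infinite[OF assms] unfolding card_of_ordIso[symmetric] embeds_def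
  by (auto simp: bij_betw_def)

text \<open>A family of subsets of \<open>'k\<close> indexed by \<open>'a\<close> is a subset of
  \<open>'a \<times> 'k\<close>, and that product injects into \<open>'k\<close> because
  \<open>'k\<close> is infinite and at least as large as \<open>'a\<close>.\<close>

lemma embeds_fun_set:
  assumes "infinite (UNIV :: 'k set)" and "embeds TYPE('a) TYPE('k)"
  shows "embeds TYPE('a \<Rightarrow> 'k set) TYPE('k set)"
proof -
  obtain p :: "'k \<times> 'k \<Rightarrow> 'k" and f :: "'a \<Rightarrow> 'k" where p: "inj p" and f: "inj f"
    using embeds_times_self[OF assms(1)] assms(2) by (auto simp: embeds_def)
  have "inj (\<lambda>g :: 'a \<Rightarrow> 'k set. {p (f a, k) | a k. k \<in> g a})"
    (is "inj ?c")
  proof (rule injI)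
    fix g h assume "?c g = ?c h"
    moreover have "k \<in> g a \<longleftrightarrow> p (f a, k) \<in> ?c g" for g a k
      using injD[OF p] injD[OF f] by blast
    ultimately show "g = h" by blast
  qed
  then show ?thesis by (rule embedsI)
qed

lemma embeds_nat:
  assumes "infinite (UNIV :: 'k set)"
  shows "embeds TYPE(nat) TYPE('k)"
  using infinite_countable_subset[OF assms] by (auto simp: embeds_def)

lemma embeds_singleton: "embeds TYPE('k) TYPE('k set)"
  by (rule embedsI[of "\<lambda>k. {k}"]) auto

text \<open>A pair is a sequence with the first component at zero and the second one elsewhere, so
  closure under countable products gives closure under pairs.\<close>

lemma embeds_prod_set:
  assumes "infinite (UNIV :: 'k set)" "embeds TYPE('a) TYPE('k set)" "embeds TYPE('b) TYPE('k set)"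
  shows "embeds TYPE('a \<times> 'b) TYPE('k set)"
proof -
  have "embeds TYPE('k set \<times> 'k set) TYPE(nat \<Rightarrow> 'k set)"
    by (rule embedsI[of "\<lambda>(a, b) n. if n = 0 then a else b"]) (auto simp: inj_on_def fun_eq_iff split: if_splits)
  from embeds_trans[OF embeds_prod[OF assms(2,3)] embeds_trans[OF this embeds_fun_set[OF assms(1) embeds_nat[OF assms(1)]]]]
  show ?thesis .
qed

text \<open>A finitely supported function is determined by a list of its pairs of point and value.
  With \<open>divisible_hull\<close> this puts the hull of a group of universe size back into the
  universe.\<close>

lemma embeds_finite_support:
  assumes "infinite (UNIV :: 'k set)"
  shows "embeds TYPE('k set \<Rightarrow>\<^sub>0 rat) TYPE('k set)"
proof -
  have "embeds TYPE('k set \<Rightarrow>\<^sub>0 rat) TYPE(('k set \<times> rat) list)"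
  proof (rule embedsI)
    define e :: "('k set \<Rightarrow>\<^sub>0 rat) \<Rightarrow> ('k set \<times> rat) list"
      where "e c = (SOME xs. set xs = (\<lambda>k. (k, Poly_Mapping.lookup c k)) ` Poly_Mapping.keys c)" for c :: "'k set \<Rightarrow>\<^sub>0 rat"
    have e: "set (e c) = (\<lambda>k. (k, Poly_Mapping.lookup c k)) ` Poly_Mapping.keys c" for c :: "'k set \<Rightarrow>\<^sub>0 rat"
      unfolding e_def by (rule someI_ex) (simp add: finite_list)
    show "inj e"
    proof (rule injI)
      fix c c' assume "e c = e c'"
      then have eq: "(\<lambda>k. (k, Poly_Mapping.lookup c k)) ` Poly_Mapping.keys c
          = (\<lambda>k. (k, Poly_Mapping.lookup c' k)) ` Poly_Mapping.keys c'"
        unfolding e[symmetric] by simp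
      show "c = c'"
      proof (rule poly_mapping_eqI)
        fix k :: "'k set"
        have "Poly_Mapping.lookup c k = v \<and> v \<noteq> 0 \<longleftrightarrow> (k, v) \<in> (\<lambda>k. (k, Poly_Mapping.lookup c k)) ` Poly_Mapping.keys c" for v and c :: "'k set \<Rightarrow>\<^sub>0 rat"
          by (auto simp: in_keys_iff)
        then show "Poly_Mapping.lookup c k = Poly_Mapping.lookup c' k" using eq by metis
      qed
    qed
  qed
  moreover have "embeds TYPE(('k set \<times> rat) list) TYPE(nat \<Rightarrow> ('k set \<times> rat) \<times> nat)"
  proof (rule embedsI)
    \<comment> \<open>The length is stored at every position, because the default value beyond the
      end of the list may also occur as an entry.\<close>
    show "inj (\<lambda>xs n. (if n < length xs then xs ! n else undefined, length xs) :: ('k set \<times> rat) \<times> nat)"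
      by (rule injI) (auto simp: fun_eq_iff intro!: nth_equalityI split: if_splits)
  qed
  moreover have n: "embeds TYPE(nat) TYPE('k set)"
    using embeds_trans[OF embeds_nat[OF assms] embeds_singleton] .
  have q: "embeds TYPE(rat) TYPE('k set)"
    using embeds_trans[OF embedsI[OF inj_to_nat] n] .
  have "embeds TYPE('k set) TYPE('k set)" by (rule embedsI[of id]) simp
  from embeds_prod_set[OF assms embeds_prod_set[OF assms this q] n]
  have "embeds TYPE(nat \<Rightarrow> ('k set \<times> rat) \<times> nat) TYPE('k set)"
    using embeds_trans[OF embeds_fun embeds_fun_set[OF assms embeds_nat[OF assms]]] by blast
  ultimately show ?thesis by (rule embeds_trans[OF _ embeds_trans])
qed


section \<open>Sections, gluing and morphisms of sheaves\<close>

section \<open>Presheaves and sheaves\<close>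

context presheaf
begin

lemma openin_sub: "openin X U \<Longrightarrow> U \<subseteq> topspace X"
  by (rule openin_subset)

lemma cring_R: "cring R" by (rule is_cring)

lemma restr_closed:
  "\<lbrakk>openin X U; openin X V; V \<subseteq> U; s \<in> carrier (sections P U)\<rbrakk> \<Longrightarrow> restr P U V s \<in> carrier (sections P V)"
  by (rule mod_hom_closed[OF restr_hom])

lemma restr_add:
  "\<lbrakk>openin X U; openin X V; V \<subseteq> U; s \<in> carrier (sections P U); t \<in> carrier (sections P U)\<rbrakk>
    \<Longrightarrow> restr P U V (s \<oplus>\<^bsub>sections P U\<^esub> t) = restr P U V s \<oplus>\<^bsub>sections P V\<^esub> restr P U V t"
  by (rule mod_hom_add[OF restr_hom])

lemma restr_minus:
  "\<lbrakk>openin X U; openin X V; V \<subseteq> U; s \<in> carrier (sections P U); t \<in> carrier (sections P U)\<rbrakk>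
    \<Longrightarrow> restr P U V (s \<ominus>\<^bsub>sections P U\<^esub> t) = restr P U V s \<ominus>\<^bsub>sections P V\<^esub> restr P U V t"
  by (rule mod_hom_minus[OF restr_hom sections_module sections_module])

lemma restr_smult:
  "\<lbrakk>openin X U; openin X V; V \<subseteq> U; a \<in> carrier R; s \<in> carrier (sections P U)\<rbrakk>
    \<Longrightarrow> restr P U V (a \<odot>\<^bsub>sections P U\<^esub> s) = a \<odot>\<^bsub>sections P V\<^esub> restr P U V s"
  by (rule mod_hom_smult[OF restr_hom])

lemma restr_zero:
  "\<lbrakk>openin X U; openin X V; V \<subseteq> U\<rbrakk> \<Longrightarrow> restr P U V \<zero>\<^bsub>sections P U\<^esub> = \<zero>\<^bsub>sections P V\<^esub>"
  by (rule mod_hom_zero[OF restr_hom sections_module sections_module])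

lemma zero_section: "openin X U \<Longrightarrow> \<zero>\<^bsub>sections P U\<^esub> \<in> carrier (sections P U)"
  by (meson abelian_group_def abelian_monoid.zero_closed module_abelian_group sections_module)

lemma add_section:
  "\<lbrakk>openin X U; s \<in> carrier (sections P U); t \<in> carrier (sections P U)\<rbrakk>
    \<Longrightarrow> s \<oplus>\<^bsub>sections P U\<^esub> t \<in> carrier (sections P U)"
  by (meson abelian_group_def abelian_monoid.a_closed module_abelian_group sections_module)

lemma minus_section:
  "\<lbrakk>openin X U; s \<in> carrier (sections P U); t \<in> carrier (sections P U)\<rbrakk>
    \<Longrightarrow> s \<ominus>\<^bsub>sections P U\<^esub> t \<in> carrier (sections P U)"
  by (meson abelian_group.minus_closed module_abelian_group sections_module)

lemma smult_section:
  "\<lbrakk>openin X U; a \<in> carrier R; s \<in> carrier (sections P U)\<rbrakk>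
    \<Longrightarrow> a \<odot>\<^bsub>sections P U\<^esub> s \<in> carrier (sections P U)"
  by (meson Module.module.smult_closed sections_module)

lemma minus_zero_iff:
  assumes "openin X U" "s \<in> carrier (sections P U)" "t \<in> carrier (sections P U)"
  shows "s \<ominus>\<^bsub>sections P U\<^esub> t = \<zero>\<^bsub>sections P U\<^esub> \<longleftrightarrow> s = t"
proof -
  interpret M: Module.module R "sections P U" by (rule sections_module[OF assms(1)])
  show ?thesis
    using assms(2,3) by (metis a_minus_def M.a_inv_closed M.minus_equality M.minus_minus M.r_neg)
qed

end

lemma sheaf_presheaf: "sheaf R X P \<Longrightarrow> presheaf R X P"
  by (simp add: sheaf_def)

context sheaf
begin

lemma section_eqI:
  assumes U: "openin X U" and s: "s \<in> carrier (sections P U)" and t: "t \<in> carrier (sections P U)"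
    and loc: "\<And>x. x \<in> U \<Longrightarrow> \<exists>V. openin X V \<and> x \<in> V \<and> V \<subseteq> U \<and> restr P U V s = restr P U V t"
  shows "s = t"
proof (rule locality)
  let ?\<U> = "{V. openin X V \<and> V \<subseteq> U \<and> restr P U V s = restr P U V t}"
  have eq: "\<Union>?\<U> = U" using loc by blast
  show "s \<in> carrier (sections P (\<Union>?\<U>))" "t \<in> carrier (sections P (\<Union>?\<U>))" using s t by (simp_all only: eq)
  show "restr P (\<Union>?\<U>) V s = restr P (\<Union>?\<U>) V t" if "V \<in> ?\<U>" for V
    using that unfolding eq by simp
qed simp

text \<open>Gluing for a family of local sections given by a relation, which may prescribe a section on
  the same open set through different indices.\<close>

lemma glue_rel:
  assumes U: "openin X U"
    and cover: "\<And>x. x \<in> U \<Longrightarrow> \<exists>V t. openin X V \<and> x \<in> V \<and> V \<subseteq> U \<and> t \<in> carrier (sections P V) \<and> \<rho> V t"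
    and compat: "\<And>V W s t. \<lbrakk>openin X V; openin X W; V \<subseteq> U; W \<subseteq> U; s \<in> carrier (sections P V);
        t \<in> carrier (sections P W); \<rho> V s; \<rho> W t\<rbrakk> \<Longrightarrow> restr P V (V \<inter> W) s = restr P W (V \<inter> W) t"
  shows "\<exists>s\<in>carrier (sections P U). \<forall>V t. openin X V \<and> V \<subseteq> U \<and> t \<in> carrier (sections P V) \<and> \<rho> V t
      \<longrightarrow> restr P U V s = t"
proof -
  let ?\<U> = "{V. openin X V \<and> V \<subseteq> U \<and> (\<exists>t. t \<in> carrier (sections P V) \<and> \<rho> V t)}"
  define \<sigma> where "\<sigma> V = (SOME t. t \<in> carrier (sections P V) \<and> \<rho> V t)" for V
  have \<sigma>: "\<sigma> V \<in> carrier (sections P V) \<and> \<rho> V (\<sigma> V)" if "V \<in> ?\<U>" for V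
  proof -
    from that have "\<exists>t. t \<in> carrier (sections P V) \<and> \<rho> V t" by simp
    then show ?thesis unfolding \<sigma>_def by (rule someI_ex)
  qed
  have eq: "\<Union>?\<U> = U"
  proof
    show "U \<subseteq> \<Union>?\<U>"
    proof
      fix x assume "x \<in> U"
      from cover[OF this] show "x \<in> \<Union>?\<U>" by (elim exE conjE) blast
    qed
  qed blast
  have "\<exists>s\<in>carrier (sections P (\<Union>?\<U>)). \<forall>V\<in>?\<U>. restr P (\<Union>?\<U>) V s = \<sigma> V"
  proof (rule gluing)
    show "restr P V (V \<inter> W) (\<sigma> V) = restr P W (V \<inter> W) (\<sigma> W)" if "V \<in> ?\<U>" "W \<in> ?\<U>" for V W
      using that \<sigma>[OF that(1)] \<sigma>[OF that(2)] by (intro compat) simp_all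
  qed (use \<sigma> in simp_all)
  then obtain s where s: "s \<in> carrier (sections P U)" and sV: "\<forall>V\<in>?\<U>. restr P U V s = \<sigma> V"
    unfolding eq by (elim bexE)
  have "restr P U V s = t" if V: "openin X V" "V \<subseteq> U" "t \<in> carrier (sections P V)" "\<rho> V t" for V t
  proof -
    have "V \<in> ?\<U>" using V by auto
    then have *: "restr P U V s = \<sigma> V" "\<sigma> V \<in> carrier (sections P V)" "\<rho> V (\<sigma> V)"
      using sV \<sigma>[of V] by simp_all
    \<comment> \<open>The section chosen on \<open>V\<close> need not be \<open>t\<close>, but
      compatibility of \<open>V\<close> with itself identifies the two.\<close>
    have "restr P V (V \<inter> V) (\<sigma> V) = restr P V (V \<inter> V) t"
      by (rule compat) (use V * in simp_all)
    then show ?thesis using * V by (simp add: restr_id)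
  qed
  then show ?thesis by (intro bexI[OF _ s]) simp
qed

end


subsection \<open>Morphisms\<close>

lemma morI:
  assumes "\<And>U. openin X U \<Longrightarrow> \<alpha> U \<in> mod_hom R (sections P U) (sections Q U)"
    and "\<And>U V s. \<lbrakk>openin X U; openin X V; V \<subseteq> U; s \<in> carrier (sections P U)\<rbrakk>
      \<Longrightarrow> restr Q U V (\<alpha> U s) = \<alpha> V (restr P U V s)"
  shows "\<alpha> \<in> mor R X P Q"
  using assms by (auto simp: mor_def)

lemma mor_hom: "\<alpha> \<in> mor R X P Q \<Longrightarrow> openin X U \<Longrightarrow> \<alpha> U \<in> mod_hom R (sections P U) (sections Q U)"
  by (simp add: mor_def)

lemma mor_restr:
  "\<lbrakk>\<alpha> \<in> mor R X P Q; openin X U; openin X V; V \<subseteq> U; s \<in> carrier (sections P U)\<rbrakk>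
    \<Longrightarrow> restr Q U V (\<alpha> U s) = \<alpha> V (restr P U V s)"
  by (simp add: mor_def)

lemma mor_closed:
  "\<lbrakk>\<alpha> \<in> mor R X P Q; openin X U; s \<in> carrier (sections P U)\<rbrakk> \<Longrightarrow> \<alpha> U s \<in> carrier (sections Q U)"
  by (rule mod_hom_closed[OF mor_hom])

lemma mor_add:
  "\<lbrakk>\<alpha> \<in> mor R X P Q; openin X U; s \<in> carrier (sections P U); t \<in> carrier (sections P U)\<rbrakk>
    \<Longrightarrow> \<alpha> U (s \<oplus>\<^bsub>sections P U\<^esub> t) = \<alpha> U s \<oplus>\<^bsub>sections Q U\<^esub> \<alpha> U t"
  by (rule mod_hom_add[OF mor_hom])

lemma mor_smult:
  "\<lbrakk>\<alpha> \<in> mor R X P Q; openin X U; a \<in> carrier R; s \<in> carrier (sections P U)\<rbrakk>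
    \<Longrightarrow> \<alpha> U (a \<odot>\<^bsub>sections P U\<^esub> s) = a \<odot>\<^bsub>sections Q U\<^esub> \<alpha> U s"
  by (rule mod_hom_smult[OF mor_hom])

lemma mor_zero:
  "\<lbrakk>\<alpha> \<in> mor R X P Q; presheaf R X P; presheaf R X Q; openin X U\<rbrakk>
    \<Longrightarrow> \<alpha> U \<zero>\<^bsub>sections P U\<^esub> = \<zero>\<^bsub>sections Q U\<^esub>"
  by (rule mod_hom_zero[OF mor_hom presheaf.sections_module presheaf.sections_module])

lemma mor_minus:
  "\<lbrakk>\<alpha> \<in> mor R X P Q; presheaf R X P; presheaf R X Q; openin X U;
      s \<in> carrier (sections P U); t \<in> carrier (sections P U)\<rbrakk>
    \<Longrightarrow> \<alpha> U (s \<ominus>\<^bsub>sections P U\<^esub> t) = \<alpha> U s \<ominus>\<^bsub>sections Q U\<^esub> \<alpha> U t"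
  by (rule mod_hom_minus[OF mor_hom presheaf.sections_module presheaf.sections_module])

lemma mor_id_mor: "mor_id \<in> mor R X P P"
  by (rule morI) (auto simp: mor_id_def mod_hom_id)

lemma mor_comp_mor: "\<lbrakk>\<alpha> \<in> mor R X P Q; \<beta> \<in> mor R X Q S\<rbrakk> \<Longrightarrow> mor_comp \<beta> \<alpha> \<in> mor R X P S"
  by (rule morI) (auto simp: mor_comp_def mor_restr mor_closed intro: mod_hom_comp mor_hom)

definition mor_diff ::
  "('x, 'r, 'n) presheaf \<Rightarrow> ('x set \<Rightarrow> 'm \<Rightarrow> 'n) \<Rightarrow> ('x set \<Rightarrow> 'm \<Rightarrow> 'n) \<Rightarrow> 'x set \<Rightarrow> 'm \<Rightarrow> 'n" where
  "mor_diff Q \<alpha> \<beta> = (\<lambda>U s. \<alpha> U s \<ominus>\<^bsub>sections Q U\<^esub> \<beta> U s)"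

lemma mor_diff_mor:
  assumes "\<alpha> \<in> mor R X P Q" "\<beta> \<in> mor R X P Q" "presheaf R X P" "presheaf R X Q"
  shows "mor_diff Q \<alpha> \<beta> \<in> mor R X P Q"
  unfolding mor_diff_def
proof (rule morI)
  fix U assume "openin X U"
  then show "(\<lambda>s. \<alpha> U s \<ominus>\<^bsub>sections Q U\<^esub> \<beta> U s) \<in> mod_hom R (sections P U) (sections Q U)"
    by (intro mod_hom_diff mor_hom[OF assms(1)] mor_hom[OF assms(2)]
        presheaf.sections_module[OF assms(3)] presheaf.sections_module[OF assms(4)])
qed (use assms in \<open>auto simp: presheaf.restr_minus mor_closed mor_restr\<close>)

lemma mor_eqD: "\<lbrakk>mor_eq X P \<alpha> \<beta>; openin X U; s \<in> carrier (sections P U)\<rbrakk> \<Longrightarrow> \<alpha> U s = \<beta> U s"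
  by (simp add: mor_eq_def)

lemma mono_sheafI:
  assumes "\<alpha> \<in> mor R X P Q" "presheaf R X P" "presheaf R X Q"
    and "\<And>U s. \<lbrakk>openin X U; s \<in> carrier (sections P U); \<alpha> U s = \<zero>\<^bsub>sections Q U\<^esub>\<rbrakk> \<Longrightarrow> s = \<zero>\<^bsub>sections P U\<^esub>"
  shows "mono_sheaf X P \<alpha>"
  unfolding mono_sheaf_def
proof (intro allI impI inj_onI)
  fix U s t assume U: "openin X U" and st: "s \<in> carrier (sections P U)" "t \<in> carrier (sections P U)"
    and "\<alpha> U s = \<alpha> U t"
  then have "\<alpha> U (s \<ominus>\<^bsub>sections P U\<^esub> t) = \<zero>\<^bsub>sections Q U\<^esub>"
    using assms(1-3) by (simp add: mor_minus presheaf.minus_zero_iff mor_closed)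
  then have "s \<ominus>\<^bsub>sections P U\<^esub> t = \<zero>\<^bsub>sections P U\<^esub>"
    by (intro assms(4) U presheaf.minus_section[OF assms(2)] st)
  then show "s = t" using presheaf.minus_zero_iff[OF assms(2) U st] by simp
qed

text \<open>A functional, additive relation between sections of \<open>S\<close> and of a sheaf \<open>Q\<close> that is locally
  total extends to a morphism. Both the adjunction for inverse images and
  the factorisation of morphisms through images are instances.\<close>

lemma local_relation_mor:
  assumes S: "presheaf R X S" and Q: "sheaf R X Q"
    and G_carrier: "\<And>V s t. \<lbrakk>openin X V; G V s t\<rbrakk> \<Longrightarrow> s \<in> carrier (sections S V) \<and> t \<in> carrier (sections Q V)"
    and G_restr: "\<And>V W s t. \<lbrakk>openin X V; openin X W; W \<subseteq> V; G V s t\<rbrakk> \<Longrightarrow> G W (restr S V W s) (restr Q V W t)"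
    and G_add: "\<And>V s t s' t'. \<lbrakk>openin X V; G V s t; G V s' t'\<rbrakk>
      \<Longrightarrow> G V (s \<oplus>\<^bsub>sections S V\<^esub> s') (t \<oplus>\<^bsub>sections Q V\<^esub> t')"
    and G_smult: "\<And>V a s t. \<lbrakk>openin X V; a \<in> carrier R; G V s t\<rbrakk>
      \<Longrightarrow> G V (a \<odot>\<^bsub>sections S V\<^esub> s) (a \<odot>\<^bsub>sections Q V\<^esub> t)"
    and G_fun: "\<And>V s t t'. \<lbrakk>openin X V; G V s t; G V s t'\<rbrakk> \<Longrightarrow> t = t'"
    and G_local: "\<And>U s x. \<lbrakk>openin X U; s \<in> carrier (sections S U); x \<in> U\<rbrakk>
      \<Longrightarrow> \<exists>V t. openin X V \<and> x \<in> V \<and> V \<subseteq> U \<and> G V (restr S U V s) t"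
  shows "\<exists>\<gamma>\<in>mor R X S Q. \<forall>V s t. openin X V \<and> G V s t \<longrightarrow> \<gamma> V s = t"
proof -
  interpret S: presheaf R X S by fact
  interpret Q: sheaf R X Q by fact
  \<comment> \<open>The prescribed value at \<open>s\<close>: a section restricting to
    \<open>t\<close> wherever the relation pairs the restriction of \<open>s\<close> with
    \<open>t\<close>. Existence is gluing, and local totality of the relation makes it
    unique.\<close>
  define ok where "ok U s \<tau> \<longleftrightarrow> \<tau> \<in> carrier (sections Q U) \<and>
    (\<forall>V t. openin X V \<and> V \<subseteq> U \<and> G V (restr S U V s) t \<longrightarrow> restr Q U V \<tau> = t)" for U s \<tau>
  have "\<exists>\<tau>. ok U s \<tau>" if U: "openin X U" and s: "s \<in> carrier (sections S U)" for U s
  proof -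
    have "\<exists>\<tau>\<in>carrier (sections Q U). \<forall>V t. openin X V \<and> V \<subseteq> U \<and> t \<in> carrier (sections Q V) \<and>
        G V (restr S U V s) t \<longrightarrow> restr Q U V \<tau> = t"
    proof (rule Q.glue_rel[OF U])
      show "\<exists>V t. openin X V \<and> x \<in> V \<and> V \<subseteq> U \<and> t \<in> carrier (sections Q V) \<and> G V (restr S U V s) t"
        if "x \<in> U" for x
        using G_local[OF U s that] G_carrier by blast
    next
      fix V W t t'
      assume VW: "openin X V" "openin X W" "V \<subseteq> U" "W \<subseteq> U" and G: "G V (restr S U V s) t" "G W (restr S U W s) t'"
      have "G (V \<inter> W) (restr S U (V \<inter> W) s) (restr Q V (V \<inter> W) t)"
        using G_restr[OF VW(1) openin_Int[OF VW(1,2)] _ G(1)] S.restr_restr[OF U VW(1) openin_Int[OF VW(1,2)] _ VW(3) s]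
        by simp
      moreover have "G (V \<inter> W) (restr S U (V \<inter> W) s) (restr Q W (V \<inter> W) t')"
        using G_restr[OF VW(2) openin_Int[OF VW(1,2)] _ G(2)] S.restr_restr[OF U VW(2) openin_Int[OF VW(1,2)] _ VW(4) s]
        by simp
      ultimately show "restr Q V (V \<inter> W) t = restr Q W (V \<inter> W) t'"
        using G_fun[OF openin_Int[OF VW(1,2)]] by blast
    qed
    then show ?thesis using G_carrier unfolding ok_def by meson
  qed
  then obtain \<gamma> where \<gamma>: "\<And>U s. openin X U \<Longrightarrow> s \<in> carrier (sections S U) \<Longrightarrow> ok U s (\<gamma> U s)"
    by metis
  have cl: "\<gamma> U s \<in> carrier (sections Q U)" if "openin X U" "s \<in> carrier (sections S U)" for U s
    using \<gamma>[OF that] by (simp add: ok_def)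
  have loc: "restr Q U V (\<gamma> U s) = t"
    if "openin X U" "s \<in> carrier (sections S U)" "openin X V" "V \<subseteq> U" "G V (restr S U V s) t" for U s V t
    using \<gamma>[OF that(1,2)] that(3-5) by (simp add: ok_def)
  \<comment> \<open>A candidate value is recognised locally: it suffices that around each point the
    relation pairs the restrictions of \<open>s\<close> and of \<open>\<tau>\<close>. Additivity,
    linearity and naturality of \<open>\<gamma>\<close> are all proved through this
    criterion.\<close>
  have eqI: "\<gamma> U s = \<tau>"
    if U: "openin X U" and s: "s \<in> carrier (sections S U)" and \<tau>: "\<tau> \<in> carrier (sections Q U)"
      and ex: "\<And>x. x \<in> U \<Longrightarrow> \<exists>V. openin X V \<and> x \<in> V \<and> V \<subseteq> U \<and> G V (restr S U V s) (restr Q U V \<tau>)"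
    for U s \<tau>
  proof (rule Q.section_eqI[OF U cl[OF U s] \<tau>])
    fix x assume "x \<in> U"
    then obtain V where V: "openin X V" "x \<in> V" "V \<subseteq> U" "G V (restr S U V s) (restr Q U V \<tau>)"
      using ex by blast
    then show "\<exists>V. openin X V \<and> x \<in> V \<and> V \<subseteq> U \<and> restr Q U V (\<gamma> U s) = restr Q U V \<tau>"
      using loc[OF U s V(1,3,4)] by blast
  qed
  have locG: "\<exists>V. openin X V \<and> x \<in> V \<and> V \<subseteq> U \<and> G V (restr S U V s) (restr Q U V (\<gamma> U s))"
    if U: "openin X U" and s: "s \<in> carrier (sections S U)" and x: "x \<in> U" for U s x
  proof -
    obtain V t where V: "openin X V" "x \<in> V" "V \<subseteq> U" and G: "G V (restr S U V s) t"
      using G_local[OF U s x] by blast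
    with loc[OF U s V(1,3) G] show ?thesis by blast
  qed
  have "\<gamma> \<in> mor R X S Q"
  proof (rule morI)
    fix U assume U: "openin X U"
    show "\<gamma> U \<in> mod_hom R (sections S U) (sections Q U)"
    proof (rule mod_homI)
      fix s s' assume s: "s \<in> carrier (sections S U)" and s': "s' \<in> carrier (sections S U)"
      show "\<gamma> U (s \<oplus>\<^bsub>sections S U\<^esub> s') = \<gamma> U s \<oplus>\<^bsub>sections Q U\<^esub> \<gamma> U s'"
      proof (rule eqI[OF U S.add_section[OF U s s'] Q.add_section[OF U cl[OF U s] cl[OF U s']]])
        fix x assume x: "x \<in> U"
        obtain V where V: "openin X V" "x \<in> V" "V \<subseteq> U" and G: "G V (restr S U V s) (restr Q U V (\<gamma> U s))"
          using locG[OF U s x] by blast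
        obtain V' where V': "openin X V'" "x \<in> V'" "V' \<subseteq> U" and G': "G V' (restr S U V' s') (restr Q U V' (\<gamma> U s'))"
          using locG[OF U s' x] by blast
        define W where "W = V \<inter> V'"
        have W: "openin X W" "x \<in> W" "W \<subseteq> V" "W \<subseteq> V'" "W \<subseteq> U" using V V' by (auto simp: W_def)
        have "G W (restr S U W s) (restr Q U W (\<gamma> U s))"
          using G_restr[OF V(1) W(1,3) G] U V W s cl[OF U s] by (simp add: S.restr_restr Q.restr_restr)
        moreover have "G W (restr S U W s') (restr Q U W (\<gamma> U s'))"
          using G_restr[OF V'(1) W(1,4) G'] U V' W s' cl[OF U s'] by (simp add: S.restr_restr Q.restr_restr)
        ultimately have "G W (restr S U W (s \<oplus>\<^bsub>sections S U\<^esub> s')) (restr Q U W (\<gamma> U s \<oplus>\<^bsub>sections Q U\<^esub> \<gamma> U s'))"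
          using G_add[OF W(1)] U W s s' cl by (simp add: S.restr_add Q.restr_add)
        then show "\<exists>V. openin X V \<and> x \<in> V \<and> V \<subseteq> U \<and>
            G V (restr S U V (s \<oplus>\<^bsub>sections S U\<^esub> s')) (restr Q U V (\<gamma> U s \<oplus>\<^bsub>sections Q U\<^esub> \<gamma> U s'))"
          using W by blast
      qed
    next
      fix a s assume a: "a \<in> carrier R" and s: "s \<in> carrier (sections S U)"
      show "\<gamma> U (a \<odot>\<^bsub>sections S U\<^esub> s) = a \<odot>\<^bsub>sections Q U\<^esub> \<gamma> U s"
      proof (rule eqI[OF U S.smult_section[OF U a s] Q.smult_section[OF U a cl[OF U s]]])
        fix x assume x: "x \<in> U"
        obtain V where V: "openin X V" "x \<in> V" "V \<subseteq> U" and G: "G V (restr S U V s) (restr Q U V (\<gamma> U s))"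
          using locG[OF U s x] by blast
        have "G V (restr S U V (a \<odot>\<^bsub>sections S U\<^esub> s)) (restr Q U V (a \<odot>\<^bsub>sections Q U\<^esub> \<gamma> U s))"
          using G_smult[OF V(1) a G] U V s a cl by (simp add: S.restr_smult Q.restr_smult)
        then show "\<exists>V. openin X V \<and> x \<in> V \<and> V \<subseteq> U \<and>
            G V (restr S U V (a \<odot>\<^bsub>sections S U\<^esub> s)) (restr Q U V (a \<odot>\<^bsub>sections Q U\<^esub> \<gamma> U s))"
          using V by blast
      qed
    qed (rule cl[OF U])
  next
    fix U V s assume U: "openin X U" and V: "openin X V" "V \<subseteq> U" and s: "s \<in> carrier (sections S U)"
    show "restr Q U V (\<gamma> U s) = \<gamma> V (restr S U V s)"
    proof (rule eqI[symmetric, OF V(1) S.restr_closed[OF U V s] Q.restr_closed[OF U V cl[OF U s]]])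
      fix x assume "x \<in> V"
      then obtain W where W: "openin X W" "x \<in> W" "W \<subseteq> U" and G: "G W (restr S U W s) (restr Q U W (\<gamma> U s))"
        using locG[OF U s] V by blast
      have W': "openin X (W \<inter> V)" using W V by blast
      have "G (W \<inter> V) (restr S V (W \<inter> V) (restr S U V s)) (restr Q V (W \<inter> V) (restr Q U V (\<gamma> U s)))"
        using G_restr[OF W(1) W' _ G] U V W W' s cl[OF U s] by (simp add: S.restr_restr Q.restr_restr)
      then show "\<exists>W. openin X W \<and> x \<in> W \<and> W \<subseteq> V \<and>
          G W (restr S V W (restr S U V s)) (restr Q V W (restr Q U V (\<gamma> U s)))"
        using W' W \<open>x \<in> V\<close> by (intro exI[of _ "W \<inter> V"]) auto
    qed
  qed
  moreover have "\<gamma> V s = t" if V: "openin X V" and G: "G V s t" for V s t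
    using G_carrier[OF V G] loc[OF V _ V subset_refl, of s t] G cl[OF V, of s]
    by (simp add: S.restr_id[OF V] Q.restr_id[OF V])
  ultimately show ?thesis by blast
qed


section \<open>Subsheaves: kernels and images\<close>

subsection \<open>Subsheaves\<close>

text \<open>Only the carriers shrink; zero, operations and restrictions stay those of
  \<open>P\<close>. So the inclusion is \<open>mor_id\<close>, and subsheaves remain in the same
  type of sections, as injectivity and \<open>direct_image_exact\<close> require.\<close>

definition sub_presheaf :: "('x, 'r, 'm) presheaf \<Rightarrow> ('x set \<Rightarrow> 'm set) \<Rightarrow> ('x, 'r, 'm) presheaf" where
  "sub_presheaf P N = \<lparr>sections = (\<lambda>U. (sections P U)\<lparr>carrier := N U\<rparr>), restr = restr P\<rparr>"

lemma sub_presheaf_simps [simp]: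
  "sections (sub_presheaf P N) U = (sections P U)\<lparr>carrier := N U\<rparr>"
  "restr (sub_presheaf P N) = restr P"
  by (simp_all add: sub_presheaf_def)

text \<open>Sections are glued in \<open>P\<close>, and the local nature of \<open>N\<close> puts
  the result back into the subsheaf.\<close>

lemma sub_presheaf_sheaf:
  assumes P: "sheaf R X P"
    and sub: "\<And>U. openin X U \<Longrightarrow> submodule (N U) R (sections P U)"
    and N_restr: "\<And>U V s. \<lbrakk>openin X U; openin X V; V \<subseteq> U; s \<in> N U\<rbrakk> \<Longrightarrow> restr P U V s \<in> N V"
    and N_local: "\<And>U s. \<lbrakk>openin X U; s \<in> carrier (sections P U);
        \<And>x. x \<in> U \<Longrightarrow> \<exists>V. openin X V \<and> x \<in> V \<and> V \<subseteq> U \<and> restr P U V s \<in> N V\<rbrakk> \<Longrightarrow> s \<in> N U"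
  shows "sheaf R X (sub_presheaf P N)"
proof -
  interpret P: sheaf R X P by fact
  have N: "N U \<subseteq> carrier (sections P U)" if "openin X U" for U
    using subgroup.subset[OF submodule.axioms(1)[OF sub[OF that]]] by simp
  show ?thesis
  proof (intro sheaf.intro presheaf.intro presheaf_axioms.intro sheaf_axioms.intro)
    show "cring R" by (rule P.cring_R)
  next
    fix U assume U: "openin X U"
    show "Module.module R (sections (sub_presheaf P N) U)"
      by (simp add: submodule.submodule_is_module[OF sub[OF U] P.sections_module[OF U]])
  next
    fix U V assume UV: "openin X U" "openin X V" "V \<subseteq> U"
    show "restr (sub_presheaf P N) U V \<in> mod_hom R (sections (sub_presheaf P N) U) (sections (sub_presheaf P N) V)"
    proof (rule mod_homI)
      fix s t assume "s \<in> carrier (sections (sub_presheaf P N) U)" "t \<in> carrier (sections (sub_presheaf P N) U)"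
      then show "restr (sub_presheaf P N) U V (s \<oplus>\<^bsub>sections (sub_presheaf P N) U\<^esub> t) =
          restr (sub_presheaf P N) U V s \<oplus>\<^bsub>sections (sub_presheaf P N) V\<^esub> restr (sub_presheaf P N) U V t"
        using N[OF UV(1)] by (simp add: P.restr_add[OF UV] subset_iff)
    next
      fix a s assume "a \<in> carrier R" "s \<in> carrier (sections (sub_presheaf P N) U)"
      then show "restr (sub_presheaf P N) U V (a \<odot>\<^bsub>sections (sub_presheaf P N) U\<^esub> s) =
          a \<odot>\<^bsub>sections (sub_presheaf P N) V\<^esub> restr (sub_presheaf P N) U V s"
        using N[OF UV(1)] by (simp add: P.restr_smult[OF UV] subset_iff)
    qed (use N_restr[OF UV] in simp)
  next
    fix U s assume "openin X U" "s \<in> carrier (sections (sub_presheaf P N) U)"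
    then show "restr (sub_presheaf P N) U U s = s" using N[of U] by (auto intro: P.restr_id)
  next
    fix U V W s assume *: "openin X U" "openin X V" "openin X W" "W \<subseteq> V" "V \<subseteq> U"
      "s \<in> carrier (sections (sub_presheaf P N) U)"
    then show "restr (sub_presheaf P N) V W (restr (sub_presheaf P N) U V s) = restr (sub_presheaf P N) U W s"
      using N[of U] by (auto intro: P.restr_restr)
  next
    fix \<U> s t
    assume *: "\<And>V. V \<in> \<U> \<Longrightarrow> openin X V" "s \<in> carrier (sections (sub_presheaf P N) (\<Union>\<U>))"
      "t \<in> carrier (sections (sub_presheaf P N) (\<Union>\<U>))"
      "\<And>V. V \<in> \<U> \<Longrightarrow> restr (sub_presheaf P N) (\<Union>\<U>) V s = restr (sub_presheaf P N) (\<Union>\<U>) V t"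
    have "openin X (\<Union>\<U>)" using *(1) by blast
    then have "s \<in> carrier (sections P (\<Union>\<U>))" "t \<in> carrier (sections P (\<Union>\<U>))"
      using N *(2,3) by auto
    then show "s = t" by (rule P.locality[rotated]) (use *(1,4) in simp_all)
  next
    fix \<U> \<sigma>
    assume op: "\<And>V. V \<in> \<U> \<Longrightarrow> openin X V"
      and \<sigma>: "\<And>V. V \<in> \<U> \<Longrightarrow> \<sigma> V \<in> carrier (sections (sub_presheaf P N) V)"
      and comp: "\<And>V W. V \<in> \<U> \<Longrightarrow> W \<in> \<U> \<Longrightarrow> restr (sub_presheaf P N) V (V \<inter> W) (\<sigma> V) = restr (sub_presheaf P N) W (V \<inter> W) (\<sigma> W)"
    have oU: "openin X (\<Union>\<U>)" using op by blast
    have "\<exists>s\<in>carrier (sections P (\<Union>\<U>)). \<forall>V\<in>\<U>. restr P (\<Union>\<U>) V s = \<sigma> V"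
    proof (rule P.gluing[OF op])
      show "\<sigma> V \<in> carrier (sections P V)" if "V \<in> \<U>" for V
        using \<sigma>[OF that] N[OF op[OF that]] by auto
      show "restr P V (V \<inter> W) (\<sigma> V) = restr P W (V \<inter> W) (\<sigma> W)" if "V \<in> \<U>" "W \<in> \<U>" for V W
        using comp[OF that] by simp
    qed
    then obtain s where s: "s \<in> carrier (sections P (\<Union>\<U>))" "\<And>V. V \<in> \<U> \<Longrightarrow> restr P (\<Union>\<U>) V s = \<sigma> V" by blast
    have "s \<in> N (\<Union>\<U>)"
    proof (rule N_local[OF oU s(1)])
      fix x assume "x \<in> \<Union>\<U>"
      then obtain V where "V \<in> \<U>" "x \<in> V" by blast
      then show "\<exists>V. openin X V \<and> x \<in> V \<and> V \<subseteq> \<Union>\<U> \<and> restr P (\<Union>\<U>) V s \<in> N V"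
        using op \<sigma> s(2) by (intro exI[of _ V]) auto
    qed
    then show "\<exists>s\<in>carrier (sections (sub_presheaf P N) (\<Union>\<U>)). \<forall>V\<in>\<U>. restr (sub_presheaf P N) (\<Union>\<U>) V s = \<sigma> V"
      using s(2) by auto
  qed
qed

lemma sub_presheaf_incl:
  assumes "presheaf R X P" and "\<And>U. openin X U \<Longrightarrow> N U \<subseteq> carrier (sections P U)"
  shows "mor_id \<in> mor R X (sub_presheaf P N) P" "mono_sheaf X (sub_presheaf P N) mor_id"
proof -
  show "mor_id \<in> mor R X (sub_presheaf P N) P"
    by (rule morI) (use assms(2) in \<open>auto simp: mor_id_def subset_iff intro!: mod_homI\<close>)
  show "mono_sheaf X (sub_presheaf P N) mor_id"
    by (auto simp: mono_sheaf_def mor_id_def inj_on_def)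
qed

lemma kernel_sheaf:
  assumes P: "sheaf R X P" and Q: "sheaf R X Q" and \<alpha>: "\<alpha> \<in> mor R X P Q"
  shows "sheaf R X (sub_presheaf P (kernel_sections P Q \<alpha>))"
proof (rule sub_presheaf_sheaf[OF P])
  interpret P: sheaf R X P by fact
  interpret Q: sheaf R X Q by fact
  note ps = P.presheaf_axioms Q.presheaf_axioms
  fix U assume U: "openin X U"
  interpret M: Module.module R "sections P U" by (rule P.sections_module[OF U])
  interpret N: Module.module R "sections Q U" by (rule Q.sections_module[OF U])
  show "submodule (kernel_sections P Q \<alpha> U) R (sections P U)"
    by (rule M.submoduleI)
      (auto simp: kernel_sections_def mor_zero[OF \<alpha> ps U] mor_add[OF \<alpha> U] mor_smult[OF \<alpha> U]
        mod_hom_neg[OF mor_hom[OF \<alpha> U] M.module_axioms N.module_axioms])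
next
  interpret P: sheaf R X P by fact
  interpret Q: sheaf R X Q by fact
  fix U V s assume UV: "openin X U" "openin X V" "V \<subseteq> U" and s: "s \<in> kernel_sections P Q \<alpha> U"
  then show "restr P U V s \<in> kernel_sections P Q \<alpha> V"
    by (auto simp: kernel_sections_def P.restr_closed mor_restr[OF \<alpha>, symmetric] Q.restr_zero)
next
  interpret P: sheaf R X P by fact
  interpret Q: sheaf R X Q by fact
  fix U s assume U: "openin X U" and s: "s \<in> carrier (sections P U)"
    and loc: "\<And>x. x \<in> U \<Longrightarrow> \<exists>V. openin X V \<and> x \<in> V \<and> V \<subseteq> U \<and> restr P U V s \<in> kernel_sections P Q \<alpha> V"
  have "\<alpha> U s = \<zero>\<^bsub>sections Q U\<^esub>"
  proof (rule Q.section_eqI[OF U mor_closed[OF \<alpha> U s] Q.zero_section[OF U]])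
    fix x assume "x \<in> U"
    then obtain V where V: "openin X V" "x \<in> V" "V \<subseteq> U" "restr P U V s \<in> kernel_sections P Q \<alpha> V"
      using loc by blast
    then show "\<exists>V. openin X V \<and> x \<in> V \<and> V \<subseteq> U \<and> restr Q U V (\<alpha> U s) = restr Q U V \<zero>\<^bsub>sections Q U\<^esub>"
      by (intro exI[of _ V]) (auto simp: mor_restr[OF \<alpha> U _ _ s] Q.restr_zero[OF U] kernel_sections_def)
  qed
  then show "s \<in> kernel_sections P Q \<alpha> U" using s by (simp add: kernel_sections_def)
qed

text \<open>\<open>image_sections\<close> asks only for local preimages, so its locality is built
  in; what remains is to shrink neighbourhoods until the two summands of a sum have preimages on the
  same open set.\<close>

lemma image_sheaf:
  assumes P: "sheaf R X P" and Q: "sheaf R X Q" and \<alpha>: "\<alpha> \<in> mor R X P Q"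
  shows "sheaf R X (sub_presheaf Q (image_sections X P Q \<alpha>))"
proof -
  interpret P: sheaf R X P by fact
  interpret Q: sheaf R X Q by fact
  note ps = P.presheaf_axioms Q.presheaf_axioms
  have restr_im: "restr Q U V t \<in> \<alpha> V ` carrier (sections P V)"
    if "openin X U" "openin X V" "V \<subseteq> U" "t \<in> \<alpha> U ` carrier (sections P U)" for U V t
    using that by (auto simp: mor_restr[OF \<alpha>] P.restr_closed)
  have I: "s \<in> image_sections X P Q \<alpha> U"
    if "s \<in> carrier (sections Q U)" "\<And>x. x \<in> U \<Longrightarrow> \<exists>V. openin X V \<and> x \<in> V \<and> V \<subseteq> U \<and> restr Q U V s \<in> \<alpha> V ` carrier (sections P V)" for s U
    using that by (simp add: image_sections_def)
  have D: "\<exists>V. openin X V \<and> x \<in> V \<and> V \<subseteq> U \<and> restr Q U V s \<in> \<alpha> V ` carrier (sections P V)"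
    if "s \<in> image_sections X P Q \<alpha> U" "x \<in> U" for s U x
    using that by (simp add: image_sections_def)
  have C: "s \<in> carrier (sections Q U)" if "s \<in> image_sections X P Q \<alpha> U" for s U
    using that by (simp add: image_sections_def)
  show ?thesis
  proof (rule sub_presheaf_sheaf[OF Q])
    fix U assume U: "openin X U"
    interpret N: Module.module R "sections Q U" by (rule Q.sections_module[OF U])
    show "submodule (image_sections X P Q \<alpha> U) R (sections Q U)"
    proof (rule N.submoduleI)
      show "image_sections X P Q \<alpha> U \<subseteq> carrier (sections Q U)" using C by blast
      show "\<zero>\<^bsub>sections Q U\<^esub> \<in> image_sections X P Q \<alpha> U"
      proof (rule I[OF Q.zero_section[OF U]])
        fix x assume "x \<in> U"
        moreover have "restr Q U U \<zero>\<^bsub>sections Q U\<^esub> \<in> \<alpha> U ` carrier (sections P U)"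
          using mor_zero[OF \<alpha> ps U] P.zero_section[OF U] Q.restr_id[OF U Q.zero_section[OF U]]
          by (metis imageI)
        ultimately show "\<exists>V. openin X V \<and> x \<in> V \<and> V \<subseteq> U \<and>
            restr Q U V \<zero>\<^bsub>sections Q U\<^esub> \<in> \<alpha> V ` carrier (sections P V)"
          using U by blast
      qed
    next
      fix s assume s: "s \<in> image_sections X P Q \<alpha> U"
      show "\<ominus>\<^bsub>sections Q U\<^esub> s \<in> image_sections X P Q \<alpha> U"
      proof (rule I)
        fix x assume x: "x \<in> U"
        obtain V where V: "openin X V" "x \<in> V" "V \<subseteq> U" and sV: "restr Q U V s \<in> \<alpha> V ` carrier (sections P V)"
          using D[OF s x] by blast
        from sV obtain p where p: "p \<in> carrier (sections P V)" "restr Q U V s = \<alpha> V p" by blast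
        interpret MV: Module.module R "sections P V" by (rule P.sections_module[OF V(1)])
        have "restr Q U V (\<ominus>\<^bsub>sections Q U\<^esub> s) = \<alpha> V (\<ominus>\<^bsub>sections P V\<^esub> p)"
          using p V U C[OF s] mod_hom_neg[OF mor_hom[OF \<alpha> V(1)] P.sections_module Q.sections_module]
            mod_hom_neg[OF Q.restr_hom Q.sections_module Q.sections_module] by simp
        then show "\<exists>V. openin X V \<and> x \<in> V \<and> V \<subseteq> U \<and> restr Q U V (\<ominus>\<^bsub>sections Q U\<^esub> s) \<in> \<alpha> V ` carrier (sections P V)"
          using V p by blast
      qed (use C[OF s] in simp)
    next
      fix s t assume s: "s \<in> image_sections X P Q \<alpha> U" and t: "t \<in> image_sections X P Q \<alpha> U"
      show "s \<oplus>\<^bsub>sections Q U\<^esub> t \<in> image_sections X P Q \<alpha> U"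
      proof (rule I)
        fix x assume x: "x \<in> U"
        obtain V where V: "openin X V" "x \<in> V" "V \<subseteq> U" and sV: "restr Q U V s \<in> \<alpha> V ` carrier (sections P V)"
          using D[OF s x] by blast
        obtain V' where V': "openin X V'" "x \<in> V'" "V' \<subseteq> U" and tV: "restr Q U V' t \<in> \<alpha> V' ` carrier (sections P V')"
          using D[OF t x] by blast
        define W where "W = V \<inter> V'"
        have W: "openin X W" "x \<in> W" "W \<subseteq> V" "W \<subseteq> V'" "W \<subseteq> U" using V V' by (auto simp: W_def)
        have "restr Q U W s \<in> \<alpha> W ` carrier (sections P W)"
          using restr_im[OF V(1) W(1,3) sV] Q.restr_restr[OF U V(1) W(1,3) V(3) C[OF s]] by simp
        moreover have "restr Q U W t \<in> \<alpha> W ` carrier (sections P W)"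
          using restr_im[OF V'(1) W(1,4) tV] Q.restr_restr[OF U V'(1) W(1,4) V'(3) C[OF t]] by simp
        ultimately have "restr Q U W (s \<oplus>\<^bsub>sections Q U\<^esub> t) \<in> \<alpha> W ` carrier (sections P W)"
          using U W C[OF s] C[OF t]
          by (auto simp: Q.restr_add mor_add[OF \<alpha> W(1), symmetric] P.add_section)
        then show "\<exists>V. openin X V \<and> x \<in> V \<and> V \<subseteq> U \<and> restr Q U V (s \<oplus>\<^bsub>sections Q U\<^esub> t) \<in> \<alpha> V ` carrier (sections P V)"
          using W by blast
      qed (use C[OF s] C[OF t] in simp)
    next
      fix a s assume a: "a \<in> carrier R" and s: "s \<in> image_sections X P Q \<alpha> U"
      show "a \<odot>\<^bsub>sections Q U\<^esub> s \<in> image_sections X P Q \<alpha> U"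
      proof (rule I)
        fix x assume x: "x \<in> U"
        obtain V where V: "openin X V" "x \<in> V" "V \<subseteq> U" and sV: "restr Q U V s \<in> \<alpha> V ` carrier (sections P V)"
          using D[OF s x] by blast
        from sV have "restr Q U V (a \<odot>\<^bsub>sections Q U\<^esub> s) \<in> \<alpha> V ` carrier (sections P V)"
          using U V C[OF s] a
          by (auto simp: Q.restr_smult mor_smult[OF \<alpha> V(1), symmetric] P.smult_section)
        then show "\<exists>V. openin X V \<and> x \<in> V \<and> V \<subseteq> U \<and> restr Q U V (a \<odot>\<^bsub>sections Q U\<^esub> s) \<in> \<alpha> V ` carrier (sections P V)"
          using V by blast
      qed (use a C[OF s] in simp)
    qed
  next
    fix U V s assume UV: "openin X U" "openin X V" "V \<subseteq> U" and s: "s \<in> image_sections X P Q \<alpha> U"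
    show "restr Q U V s \<in> image_sections X P Q \<alpha> V"
    proof (rule I[OF Q.restr_closed[OF UV C[OF s]]])
      fix x assume x: "x \<in> V"
      then obtain W where W: "openin X W" "x \<in> W" "W \<subseteq> U" and sW: "restr Q U W s \<in> \<alpha> W ` carrier (sections P W)"
        using D[OF s, of x] UV(3) by blast
      have W': "openin X (W \<inter> V)" using W UV by blast
      have "restr Q V (W \<inter> V) (restr Q U V s) \<in> \<alpha> (W \<inter> V) ` carrier (sections P (W \<inter> V))"
        using restr_im[OF W(1) W' _ sW] Q.restr_restr[OF UV(1) W(1) W' _ W(3) C[OF s]]
          Q.restr_restr[OF UV(1,2) W' _ UV(3) C[OF s]] by simp
      then show "\<exists>W. openin X W \<and> x \<in> W \<and> W \<subseteq> V \<and> restr Q V W (restr Q U V s) \<in> \<alpha> W ` carrier (sections P W)"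
        using W W' x by (intro exI[of _ "W \<inter> V"]) auto
    qed
  next
    fix U s assume U: "openin X U" and s: "s \<in> carrier (sections Q U)"
      and loc: "\<And>x. x \<in> U \<Longrightarrow> \<exists>V. openin X V \<and> x \<in> V \<and> V \<subseteq> U \<and> restr Q U V s \<in> image_sections X P Q \<alpha> V"
    show "s \<in> image_sections X P Q \<alpha> U"
    proof (rule I[OF s])
      fix x assume "x \<in> U"
      then obtain V where V: "openin X V" "x \<in> V" "V \<subseteq> U" and sV: "restr Q U V s \<in> image_sections X P Q \<alpha> V"
        using loc by blast
      obtain W where W: "openin X W" "x \<in> W" "W \<subseteq> V" "restr Q V W (restr Q U V s) \<in> \<alpha> W ` carrier (sections P W)"
        using D[OF sV V(2)] by blast
      then show "\<exists>V. openin X V \<and> x \<in> V \<and> V \<subseteq> U \<and> restr Q U V s \<in> \<alpha> V ` carrier (sections P V)"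
        using Q.restr_restr[OF U V(1) W(1,3) V(3) s] V by (intro exI[of _ W]) auto
    qed
  qed
qed

lemma image_sectionsI:
  assumes "\<alpha> \<in> mor R X P Q" "presheaf R X Q" "openin X U" "p \<in> carrier (sections P U)"
  shows "\<alpha> U p \<in> image_sections X P Q \<alpha> U"
  using assms mor_closed[OF assms(1,3,4)] presheaf.restr_id[OF assms(2,3)]
  by (auto simp: image_sections_def intro!: exI[of _ U])


section \<open>Sheaf property and functoriality of direct images\<close>

subsection \<open>Direct images\<close>

lemma direct_image_simps [simp]:
  "sections (direct_image X f P) V = sections P (preim X f V)"
  "restr (direct_image X f P) V W = restr P (preim X f V) (preim X f W)"
  by (simp_all add: direct_image_def)

lemma openin_preim: "continuous_map X Y f \<Longrightarrow> openin Y V \<Longrightarrow> openin X (preim X f V)"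
  unfolding preim_def by (rule openin_continuous_map_preimage)

lemma preim_mono: "V \<subseteq> W \<Longrightarrow> preim X f V \<subseteq> preim X f W"
  by (auto simp: preim_def)

lemma preim_Int: "preim X f (V \<inter> W) = preim X f V \<inter> preim X f W"
  by (auto simp: preim_def)

lemma preim_Union: "preim X f (\<Union>\<U>) = \<Union>(preim X f ` \<U>)"
  by (auto simp: preim_def)

lemma preim_topspace: "continuous_map X Y f \<Longrightarrow> preim X f (topspace Y) = topspace X"
  by (auto simp: preim_def continuous_map_def)

text \<open>Different open sets of \<open>Y\<close> may have the same preimage, so a family of
  sections indexed by sets of \<open>Y\<close> need not be a function of the preimages. Gluing
  therefore goes through \<open>glue_rel\<close>, which tolerates several prescriptions on one open
  set.\<close>

lemma direct_image_sheaf: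
  assumes f: "continuous_map X Y f" and P: "sheaf R X P"
  shows "sheaf R Y (direct_image X f P)"
proof -
  interpret P: sheaf R X P by fact
  note op = openin_preim[OF f]
  show ?thesis
  proof (intro sheaf.intro presheaf.intro presheaf_axioms.intro sheaf_axioms.intro)
    show "cring R" by (rule P.cring_R)
  next
    fix \<U> s t
    assume *: "\<And>V. V \<in> \<U> \<Longrightarrow> openin Y V"
      "s \<in> carrier (sections (direct_image X f P) (\<Union>\<U>))" "t \<in> carrier (sections (direct_image X f P) (\<Union>\<U>))"
      "\<And>V. V \<in> \<U> \<Longrightarrow> restr (direct_image X f P) (\<Union>\<U>) V s = restr (direct_image X f P) (\<Union>\<U>) V t"
    have "s \<in> carrier (sections P (\<Union>(preim X f ` \<U>)))" "t \<in> carrier (sections P (\<Union>(preim X f ` \<U>)))"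
      using *(2,3) by (simp_all add: preim_Union)
    then show "s = t"
    proof (rule P.locality[rotated])
      show "openin X V" if "V \<in> preim X f ` \<U>" for V using that op *(1) by auto
      show "restr P (\<Union>(preim X f ` \<U>)) V s = restr P (\<Union>(preim X f ` \<U>)) V t" if "V \<in> preim X f ` \<U>" for V
        using that *(4) by (auto simp: preim_Union)
    qed
  next
    fix \<U> \<sigma>
    assume *: "\<And>V. V \<in> \<U> \<Longrightarrow> openin Y V"
      "\<And>V. V \<in> \<U> \<Longrightarrow> \<sigma> V \<in> carrier (sections (direct_image X f P) V)"
      "\<And>V W. \<lbrakk>V \<in> \<U>; W \<in> \<U>\<rbrakk> \<Longrightarrow> restr (direct_image X f P) V (V \<inter> W) (\<sigma> V) = restr (direct_image X f P) W (V \<inter> W) (\<sigma> W)"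
    have oU: "openin Y (\<Union>\<U>)" using *(1) by blast
    have "\<exists>s\<in>carrier (sections P (preim X f (\<Union>\<U>))). \<forall>V t. openin X V \<and> V \<subseteq> preim X f (\<Union>\<U>) \<and>
        t \<in> carrier (sections P V) \<and> (\<exists>V'\<in>\<U>. V = preim X f V' \<and> t = \<sigma> V') \<longrightarrow> restr P (preim X f (\<Union>\<U>)) V s = t"
    proof (rule P.glue_rel[OF op[OF oU]])
      fix x assume "x \<in> preim X f (\<Union>\<U>)"
      then obtain V where V: "V \<in> \<U>" "x \<in> preim X f V" by (auto simp: preim_def)
      then show "\<exists>V t. openin X V \<and> x \<in> V \<and> V \<subseteq> preim X f (\<Union>\<U>) \<and> t \<in> carrier (sections P V) \<and>
          (\<exists>V'\<in>\<U>. V = preim X f V' \<and> t = \<sigma> V')"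
        using op *(1,2) by (intro exI[of _ "preim X f V"] exI[of _ "\<sigma> V"]) (auto simp: preim_def)
    next
      fix V W s t assume "\<exists>V'\<in>\<U>. V = preim X f V' \<and> s = \<sigma> V'" "\<exists>V'\<in>\<U>. W = preim X f V' \<and> t = \<sigma> V'"
      then show "restr P V (V \<inter> W) s = restr P W (V \<inter> W) t" using *(3) by (auto simp: preim_Int)
    qed
    then obtain s where s: "s \<in> carrier (sections P (preim X f (\<Union>\<U>)))"
      and sV: "\<forall>V t. openin X V \<and> V \<subseteq> preim X f (\<Union>\<U>) \<and> t \<in> carrier (sections P V) \<and>
        (\<exists>V'\<in>\<U>. V = preim X f V' \<and> t = \<sigma> V') \<longrightarrow> restr P (preim X f (\<Union>\<U>)) V s = t"
      by (elim bexE)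
    have "restr P (preim X f (\<Union>\<U>)) (preim X f V) s = \<sigma> V" if "V \<in> \<U>" for V
    proof (rule sV[rule_format], intro conjI)
      show "openin X (preim X f V)" using op *(1)[OF that] .
      show "preim X f V \<subseteq> preim X f (\<Union>\<U>)" by (rule preim_mono) (use that in blast)
      show "\<sigma> V \<in> carrier (sections P (preim X f V))" using *(2)[OF that] by simp
      show "\<exists>V'\<in>\<U>. preim X f V = preim X f V' \<and> \<sigma> V = \<sigma> V'" using that by blast
    qed
    then show "\<exists>s\<in>carrier (sections (direct_image X f P) (\<Union>\<U>)). \<forall>V\<in>\<U>. restr (direct_image X f P) (\<Union>\<U>) V s = \<sigma> V"
      using s by auto
  qed (auto simp: op P.sections_module P.restr_hom P.restr_id P.restr_restr preim_mono)
qed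

lemma direct_image_mor_mor:
  assumes "continuous_map X Y f" "\<alpha> \<in> mor R X P Q"
  shows "direct_image_mor X f \<alpha> \<in> mor R Y (direct_image X f P) (direct_image X f Q)"
  by (rule morI) (use assms in \<open>auto simp: direct_image_mor_def mor_hom mor_restr openin_preim preim_mono\<close>)


section \<open>Colimits of sections over the neighbourhoods of a set\<close>

section \<open>Germs\<close>

text \<open>The map of colimits induced by a morphism; in the union over representatives all terms
  coincide, by \<open>germ_map_germ\<close>.\<close>

definition germ_map ::
  "'y topology \<Rightarrow> ('y, 'r, 'n) presheaf \<Rightarrow> 'y set \<Rightarrow> ('y set \<Rightarrow> 'm \<Rightarrow> 'n) \<Rightarrow> ('y set \<times> 'm) set \<Rightarrow> ('y set \<times> 'n) set" where
  "germ_map Y Q S \<alpha> A = (\<Union>(V, s)\<in>A. germ Y Q S V (\<alpha> V s))"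

text \<open>The transition map to the colimit over the neighbourhoods of a smaller set. It is the
  restriction map of the presheaf pullback.\<close>

definition germ_res ::
  "'y topology \<Rightarrow> ('y, 'r, 'm) presheaf \<Rightarrow> 'y set \<Rightarrow> ('y set \<times> 'm) set \<Rightarrow> ('y set \<times> 'm) set" where
  "germ_res Y P S A = (\<Union>(V, s)\<in>A. germ Y P S V s)"

context presheaf
begin

lemma germ_self:
  "\<lbrakk>openin X V; S \<subseteq> V; s \<in> carrier (sections P V)\<rbrakk> \<Longrightarrow> (V, s) \<in> germ X P S V s"
  by (auto simp: germ_def)

lemma germ_subset:
  assumes V: "openin X V" "S \<subseteq> V" "s \<in> carrier (sections P V)"
    and V': "openin X V'" "S \<subseteq> V'" "s' \<in> carrier (sections P V')"
    and W: "openin X W" "S \<subseteq> W" "W \<subseteq> V" "W \<subseteq> V'" and eq: "restr P V W s = restr P V' W s'"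
  shows "germ X P S V s \<subseteq> germ X P S V' s'"
proof clarify
  fix V2 s2 assume "(V2, s2) \<in> germ X P S V s"
  then obtain W2 where V2: "openin X V2" "S \<subseteq> V2" "s2 \<in> carrier (sections P V2)"
    and W2: "openin X W2" "S \<subseteq> W2" "W2 \<subseteq> V" "W2 \<subseteq> V2" and eq2: "restr P V W2 s = restr P V2 W2 s2"
    by (auto simp: germ_def)
  define N where "N = W \<inter> W2"
  have N: "openin X N" "S \<subseteq> N" "N \<subseteq> W" "N \<subseteq> W2" using W W2 by (auto simp: N_def)
  have "restr P V' N s' = restr P W N (restr P V' W s')"
    using V' W N by (simp add: restr_restr)
  also have "\<dots> = restr P W2 N (restr P V W2 s)"
    using V W W2 N by (simp add: restr_restr flip: eq)
  also have "\<dots> = restr P V2 N s2"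
    using V2 W2 N by (simp add: restr_restr eq2)
  finally show "(V2, s2) \<in> germ X P S V' s'"
    using V2 N W W2 unfolding germ_def by (auto intro!: exI[of _ N])
qed

lemma germ_eqI:
  assumes V: "openin X V" "S \<subseteq> V" "s \<in> carrier (sections P V)"
    and V': "openin X V'" "S \<subseteq> V'" "s' \<in> carrier (sections P V')"
    and W: "openin X W" "S \<subseteq> W" "W \<subseteq> V" "W \<subseteq> V'" and eq: "restr P V W s = restr P V' W s'"
  shows "germ X P S V s = germ X P S V' s'"
  using germ_subset[OF assms] germ_subset[OF V' V W(1,2,4,3) eq[symmetric]] by (rule subset_antisym)

lemma germ_eqD:
  assumes V': "openin X V'" "S \<subseteq> V'" "s' \<in> carrier (sections P V')"
    and eq: "germ X P S V s = germ X P S V' s'"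
  shows "\<exists>W. openin X W \<and> S \<subseteq> W \<and> W \<subseteq> V \<and> W \<subseteq> V' \<and> restr P V W s = restr P V' W s'"
  using germ_self[OF V'] unfolding eq[symmetric] by (auto simp: germ_def)

lemma germ_restr:
  "\<lbrakk>openin X V; openin X W; S \<subseteq> W; W \<subseteq> V; s \<in> carrier (sections P V)\<rbrakk>
    \<Longrightarrow> germ X P S W (restr P V W s) = germ X P S V s"
  by (rule germ_eqI[of _ _ _ _ _ W]) (auto simp: restr_closed restr_restr)

lemma germ_memD:
  assumes "(V', s') \<in> germ X P S V s" and V: "openin X V" "S \<subseteq> V" "s \<in> carrier (sections P V)"
  shows "openin X V'" "S \<subseteq> V'" "s' \<in> carrier (sections P V')" "germ X P S V' s' = germ X P S V s"
proof -
  show V': "openin X V'" "S \<subseteq> V'" "s' \<in> carrier (sections P V')"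
    using assms(1) by (auto simp: germ_def)
  obtain W where W: "openin X W" "S \<subseteq> W" "W \<subseteq> V'" "W \<subseteq> V" and eq: "restr P V W s = restr P V' W s'"
    using assms(1) by (auto simp: germ_def)
  show "germ X P S V' s' = germ X P S V s"
    by (rule germ_eqI[OF V' V W eq[symmetric]])
qed

text \<open>The general principle behind operations on germs written as unions: if the terms depend
  only on the germ, the union is the term of any single representative.\<close>

lemma germ_UN:
  assumes V: "openin X V" "S \<subseteq> V" "s \<in> carrier (sections P V)"
    and const: "\<And>V' s'. \<lbrakk>openin X V'; S \<subseteq> V'; s' \<in> carrier (sections P V'); germ X P S V' s' = germ X P S V s\<rbrakk>
      \<Longrightarrow> f V' s' = f V s"
  shows "(\<Union>(V', s')\<in>germ X P S V s. f V' s') = f V s"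
proof -
  have "f V' s' = f V s" if "(V', s') \<in> germ X P S V s" for V' s'
    by (rule const[OF germ_memD[OF that V]])
  then have "(\<Union>(V', s')\<in>germ X P S V s. f V' s') = (\<Union>p\<in>germ X P S V s. f V s)"
    by (intro SUP_cong) auto
  then show ?thesis using germ_self[OF V] by auto
qed

lemma carrier_germ_module:
  "A \<in> carrier (germ_module X P S) \<longleftrightarrow>
    (\<exists>V s. openin X V \<and> S \<subseteq> V \<and> s \<in> carrier (sections P V) \<and> A = germ X P S V s)"
  by (auto simp: germ_module_def)

lemma germ_in_germ_module:
  "\<lbrakk>openin X V; S \<subseteq> V; s \<in> carrier (sections P V)\<rbrakk> \<Longrightarrow> germ X P S V s \<in> carrier (germ_module X P S)"
  by (auto simp: carrier_germ_module)

text \<open>Each of the two equalities of germs holds on some neighbourhood; on the intersection of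
  these neighbourhoods the two sums restrict to the same section.\<close>

lemma germ_sum_cong:
  assumes V: "openin X V" "S \<subseteq> V" "s \<in> carrier (sections P V)"
    and W: "openin X W" "S \<subseteq> W" "t \<in> carrier (sections P W)"
    and V': "openin X V'" "S \<subseteq> V'" "s' \<in> carrier (sections P V')"
    and W': "openin X W'" "S \<subseteq> W'" "t' \<in> carrier (sections P W')"
    and eq: "germ X P S V s = germ X P S V' s'" "germ X P S W t = germ X P S W' t'"
  shows "germ X P S (V \<inter> W) (restr P V (V \<inter> W) s \<oplus>\<^bsub>sections P (V \<inter> W)\<^esub> restr P W (V \<inter> W) t) =
    germ X P S (V' \<inter> W') (restr P V' (V' \<inter> W') s' \<oplus>\<^bsub>sections P (V' \<inter> W')\<^esub> restr P W' (V' \<inter> W') t')"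
proof -
  obtain N1 where N1: "openin X N1" "S \<subseteq> N1" "N1 \<subseteq> V" "N1 \<subseteq> V'" "restr P V N1 s = restr P V' N1 s'"
    using germ_eqD[OF V' eq(1)] by blast
  obtain N2 where N2: "openin X N2" "S \<subseteq> N2" "N2 \<subseteq> W" "N2 \<subseteq> W'" "restr P W N2 t = restr P W' N2 t'"
    using germ_eqD[OF W' eq(2)] by blast
  define N where "N = N1 \<inter> N2"
  have N: "openin X N" "S \<subseteq> N" "N \<subseteq> N1" "N \<subseteq> N2" "N \<subseteq> V \<inter> W" "N \<subseteq> V' \<inter> W'"
    using N1 N2 by (auto simp: N_def)
  have op: "openin X (V \<inter> W)" "openin X (V' \<inter> W')" using V W V' W' by auto
  have "restr P V N s = restr P V' N s'"
    using N1 N V V' restr_restr[of V N1 N s] restr_restr[of V' N1 N s'] by simp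
  moreover have "restr P W N t = restr P W' N t'"
    using N2 N W W' restr_restr[of W N2 N t] restr_restr[of W' N2 N t'] by simp
  ultimately show ?thesis
    using V W V' W' N op
    by (intro germ_eqI[of _ _ _ _ _ N])
      (auto simp: add_section restr_closed restr_add restr_restr)
qed

lemma germ_add_germ:
  assumes V: "openin X V" "S \<subseteq> V" "s \<in> carrier (sections P V)"
    and W: "openin X W" "S \<subseteq> W" "t \<in> carrier (sections P W)"
  shows "germ X P S V s \<oplus>\<^bsub>germ_module X P S\<^esub> germ X P S W t =
    germ X P S (V \<inter> W) (restr P V (V \<inter> W) s \<oplus>\<^bsub>sections P (V \<inter> W)\<^esub> restr P W (V \<inter> W) t)"
proof -
  let ?g = "\<lambda>V s W t. germ X P S (V \<inter> W) (restr P V (V \<inter> W) s \<oplus>\<^bsub>sections P (V \<inter> W)\<^esub> restr P W (V \<inter> W) t)"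
  have "(\<Union>(W', t')\<in>germ X P S W t. ?g V' s' W' t') = ?g V' s' W t"
    if V': "openin X V'" "S \<subseteq> V'" "s' \<in> carrier (sections P V')" for V' s'
    by (rule germ_UN[OF W, of "?g V' s'"]) (rule germ_sum_cong[OF V' _ _ _ V' W], simp_all)
  note inner = this
  have "(\<Union>(V', s')\<in>germ X P S V s. \<Union>(W', t')\<in>germ X P S W t. ?g V' s' W' t') =
      (\<Union>(W', t')\<in>germ X P S W t. ?g V s W' t')"
  proof (rule germ_UN[OF V, of "\<lambda>V' s'. \<Union>(W', t')\<in>germ X P S W t. ?g V' s' W' t'"])
    fix V' s' assume V': "openin X V'" "S \<subseteq> V'" "s' \<in> carrier (sections P V')"
      and eq: "germ X P S V' s' = germ X P S V s"
    show "(\<Union>(W', t')\<in>germ X P S W t. ?g V' s' W' t') = (\<Union>(W', t')\<in>germ X P S W t. ?g V s W' t')"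
      unfolding inner[OF V'] inner[OF V] by (rule germ_sum_cong[OF V' W V W eq refl])
  qed
  also have "\<dots> = ?g V s W t"
    by (rule germ_UN[OF W, of "?g V s"]) (rule germ_sum_cong[OF V _ _ _ V W], simp_all)
  finally show ?thesis by (simp add: germ_module_def)
qed

lemma germ_add:
  assumes V: "openin X V" "S \<subseteq> V" "s \<in> carrier (sections P V)" "t \<in> carrier (sections P V)"
  shows "germ X P S V s \<oplus>\<^bsub>germ_module X P S\<^esub> germ X P S V t = germ X P S V (s \<oplus>\<^bsub>sections P V\<^esub> t)"
  using germ_add_germ[OF V(1-3) V(1,2,4)] V by (simp add: restr_id)

lemma germ_smult:
  assumes V: "openin X V" "S \<subseteq> V" "s \<in> carrier (sections P V)" and a: "a \<in> carrier R"
  shows "a \<odot>\<^bsub>germ_module X P S\<^esub> germ X P S V s = germ X P S V (a \<odot>\<^bsub>sections P V\<^esub> s)"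
proof -
  have "(\<Union>(V', s')\<in>germ X P S V s. germ X P S V' (a \<odot>\<^bsub>sections P V'\<^esub> s')) = germ X P S V (a \<odot>\<^bsub>sections P V\<^esub> s)"
  proof (rule germ_UN[OF V, of "\<lambda>V' s'. germ X P S V' (a \<odot>\<^bsub>sections P V'\<^esub> s')"])
    fix V' s' assume V': "openin X V'" "S \<subseteq> V'" "s' \<in> carrier (sections P V')"
      and eq: "germ X P S V' s' = germ X P S V s"
    obtain N where "openin X N" "S \<subseteq> N" "N \<subseteq> V'" "N \<subseteq> V" "restr P V' N s' = restr P V N s"
      using germ_eqD[OF V eq] by blast
    then show "germ X P S V' (a \<odot>\<^bsub>sections P V'\<^esub> s') = germ X P S V (a \<odot>\<^bsub>sections P V\<^esub> s)"
      using V V' a by (intro germ_eqI[of _ _ _ _ _ N]) (auto simp: smult_section restr_smult)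
  qed
  then show ?thesis by (simp add: germ_module_def)
qed

lemma germ_zero:
  assumes "openin X V" "S \<subseteq> V"
  shows "\<zero>\<^bsub>germ_module X P S\<^esub> = germ X P S V \<zero>\<^bsub>sections P V\<^esub>"
  using assms germ_restr[of "topspace X" V S "\<zero>\<^bsub>sections P (topspace X)\<^esub>"] openin_sub[of V]
  by (simp add: germ_module_def restr_zero zero_section)

text \<open>Neighbourhoods are closed under intersection, so the colimit is filtered and finitely
  many germs have representatives on one open set. Identities between germs then reduce to
  identities in one module of sections.\<close>

lemma germ_common:
  assumes "A \<in> carrier (germ_module X P S)" "B \<in> carrier (germ_module X P S)"
  obtains V s t where "openin X V" "S \<subseteq> V" "s \<in> carrier (sections P V)" "t \<in> carrier (sections P V)"
    "A = germ X P S V s" "B = germ X P S V t"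
proof -
  obtain V s W t where V: "openin X V" "S \<subseteq> V" "s \<in> carrier (sections P V)" "A = germ X P S V s"
    and W: "openin X W" "S \<subseteq> W" "t \<in> carrier (sections P W)" "B = germ X P S W t"
    using assms by (auto simp: carrier_germ_module)
  have "openin X (V \<inter> W)" using V W by auto
  with V W that[of "V \<inter> W" "restr P V (V \<inter> W) s" "restr P W (V \<inter> W) t"] show ?thesis
    by (simp add: restr_closed germ_restr)
qed

lemma germ_common3:
  assumes "A \<in> carrier (germ_module X P S)" "B \<in> carrier (germ_module X P S)" "C \<in> carrier (germ_module X P S)"
  obtains V s t u where "openin X V" "S \<subseteq> V" "s \<in> carrier (sections P V)" "t \<in> carrier (sections P V)"
    "u \<in> carrier (sections P V)" "A = germ X P S V s" "B = germ X P S V t" "C = germ X P S V u"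
proof -
  obtain V s t where V: "openin X V" "S \<subseteq> V" "s \<in> carrier (sections P V)" "t \<in> carrier (sections P V)"
    "A = germ X P S V s" "B = germ X P S V t"
    using germ_common[OF assms(1,2)] .
  obtain W u where W: "openin X W" "S \<subseteq> W" "u \<in> carrier (sections P W)" "C = germ X P S W u"
    using assms(3) by (auto simp: carrier_germ_module)
  have "openin X (V \<inter> W)" using V W by auto
  with V W that[of "V \<inter> W" "restr P V (V \<inter> W) s" "restr P V (V \<inter> W) t" "restr P W (V \<inter> W) u"] show ?thesis
    by (simp add: restr_closed germ_restr)
qed

text \<open>Every axiom involves at most three germs and is checked on a common open set. The
  inclusion of \<open>S\<close> in the space makes the whole space a neighbourhood, on which the
  zero germ is defined.\<close>

lemma germ_module_module:
  assumes S: "S \<subseteq> topspace X"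
  shows "Module.module R (germ_module X P S)"
proof (rule moduleI[OF cring_R])
  show "abelian_group (germ_module X P S)"
  proof (rule abelian_groupI)
    fix A B assume "A \<in> carrier (germ_module X P S)" "B \<in> carrier (germ_module X P S)"
    then obtain V s t where V: "openin X V" "S \<subseteq> V" "s \<in> carrier (sections P V)" "t \<in> carrier (sections P V)"
      and AB: "A = germ X P S V s" "B = germ X P S V t" by (rule germ_common)
    interpret M: Module.module R "sections P V" by (rule sections_module[OF V(1)])
    from V AB show "A \<oplus>\<^bsub>germ_module X P S\<^esub> B \<in> carrier (germ_module X P S)"
      and "A \<oplus>\<^bsub>germ_module X P S\<^esub> B = B \<oplus>\<^bsub>germ_module X P S\<^esub> A"
      by (auto simp: germ_add germ_in_germ_module M.a_comm)
  next
    show "\<zero>\<^bsub>germ_module X P S\<^esub> \<in> carrier (germ_module X P S)"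
      using S by (simp add: germ_zero[of "topspace X"] germ_in_germ_module zero_section)
  next
    fix A B C
    assume "A \<in> carrier (germ_module X P S)" "B \<in> carrier (germ_module X P S)" "C \<in> carrier (germ_module X P S)"
    then obtain V s t u where V: "openin X V" "S \<subseteq> V" "s \<in> carrier (sections P V)" "t \<in> carrier (sections P V)"
      "u \<in> carrier (sections P V)" and ABC: "A = germ X P S V s" "B = germ X P S V t" "C = germ X P S V u"
      by (rule germ_common3)
    interpret M: Module.module R "sections P V" by (rule sections_module[OF V(1)])
    from V ABC show "A \<oplus>\<^bsub>germ_module X P S\<^esub> B \<oplus>\<^bsub>germ_module X P S\<^esub> C =
        A \<oplus>\<^bsub>germ_module X P S\<^esub> (B \<oplus>\<^bsub>germ_module X P S\<^esub> C)"
      by (simp add: germ_add M.a_assoc)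
  next
    fix A assume "A \<in> carrier (germ_module X P S)"
    then obtain V s where V: "openin X V" "S \<subseteq> V" "s \<in> carrier (sections P V)" and A: "A = germ X P S V s"
      by (auto simp: carrier_germ_module)
    interpret M: Module.module R "sections P V" by (rule sections_module[OF V(1)])
    show "\<zero>\<^bsub>germ_module X P S\<^esub> \<oplus>\<^bsub>germ_module X P S\<^esub> A = A"
      using V by (simp add: A germ_zero[of V] germ_add)
    show "\<exists>B\<in>carrier (germ_module X P S). B \<oplus>\<^bsub>germ_module X P S\<^esub> A = \<zero>\<^bsub>germ_module X P S\<^esub>"
      using V by (intro bexI[of _ "germ X P S V (\<ominus>\<^bsub>sections P V\<^esub> s)"])
        (simp_all add: A germ_zero[of V] germ_add germ_in_germ_module M.l_neg)
  qed
next
  fix a A assume "a \<in> carrier R" "A \<in> carrier (germ_module X P S)"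
  then show "a \<odot>\<^bsub>germ_module X P S\<^esub> A \<in> carrier (germ_module X P S)"
    by (auto simp: carrier_germ_module germ_smult) (metis smult_section)
next
  fix a b A assume ab: "a \<in> carrier R" "b \<in> carrier R" and "A \<in> carrier (germ_module X P S)"
  then obtain V s where V: "openin X V" "S \<subseteq> V" "s \<in> carrier (sections P V)" and A: "A = germ X P S V s"
    by (auto simp: carrier_germ_module)
  interpret M: Module.module R "sections P V" by (rule sections_module[OF V(1)])
  show "(a \<oplus>\<^bsub>R\<^esub> b) \<odot>\<^bsub>germ_module X P S\<^esub> A = a \<odot>\<^bsub>germ_module X P S\<^esub> A \<oplus>\<^bsub>germ_module X P S\<^esub> b \<odot>\<^bsub>germ_module X P S\<^esub> A"
    using V ab by (simp add: A germ_smult germ_add M.smult_l_distr)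
  show "(a \<otimes>\<^bsub>R\<^esub> b) \<odot>\<^bsub>germ_module X P S\<^esub> A = a \<odot>\<^bsub>germ_module X P S\<^esub> (b \<odot>\<^bsub>germ_module X P S\<^esub> A)"
    using V ab by (simp add: A germ_smult M.smult_assoc1)
next
  fix a A B assume a: "a \<in> carrier R" and "A \<in> carrier (germ_module X P S)" "B \<in> carrier (germ_module X P S)"
  then obtain V s t where V: "openin X V" "S \<subseteq> V" "s \<in> carrier (sections P V)" "t \<in> carrier (sections P V)"
    and AB: "A = germ X P S V s" "B = germ X P S V t" using germ_common by metis
  interpret M: Module.module R "sections P V" by (rule sections_module[OF V(1)])
  show "a \<odot>\<^bsub>germ_module X P S\<^esub> (A \<oplus>\<^bsub>germ_module X P S\<^esub> B) =
      a \<odot>\<^bsub>germ_module X P S\<^esub> A \<oplus>\<^bsub>germ_module X P S\<^esub> a \<odot>\<^bsub>germ_module X P S\<^esub> B"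
    using V a by (simp add: AB germ_smult germ_add M.smult_r_distr)
next
  fix A assume "A \<in> carrier (germ_module X P S)"
  then obtain V s where V: "openin X V" "S \<subseteq> V" "s \<in> carrier (sections P V)" and A: "A = germ X P S V s"
    by (auto simp: carrier_germ_module)
  interpret M: Module.module R "sections P V" by (rule sections_module[OF V(1)])
  show "\<one>\<^bsub>R\<^esub> \<odot>\<^bsub>germ_module X P S\<^esub> A = A"
    using V by (simp add: A germ_smult)
qed

lemma germ_res_germ:
  assumes "openin X V" "S \<subseteq> V" "s \<in> carrier (sections P V)" and S': "S' \<subseteq> S"
  shows "germ_res X P S' (germ X P S V s) = germ X P S' V s"
  unfolding germ_res_def
proof (rule germ_UN[OF assms(1-3), of "\<lambda>V s. germ X P S' V s"])
  fix V' s' assume V': "openin X V'" "S \<subseteq> V'" "s' \<in> carrier (sections P V')" and eq: "germ X P S V' s' = germ X P S V s"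
  obtain N where "openin X N" "S \<subseteq> N" "N \<subseteq> V'" "N \<subseteq> V" "restr P V' N s' = restr P V N s"
    using germ_eqD[OF assms(1-3) eq] by blast
  then show "germ X P S' V' s' = germ X P S' V s"
    using assms V' by (intro germ_eqI[of _ _ _ _ _ N]) auto
qed

lemma germ_res_hom:
  assumes S': "S' \<subseteq> S"
  shows "germ_res X P S' \<in> mod_hom R (germ_module X P S) (germ_module X P S')"
proof (rule mod_homI)
  fix A assume "A \<in> carrier (germ_module X P S)"
  then obtain V s where V: "openin X V" "S \<subseteq> V" "s \<in> carrier (sections P V)" and A: "A = germ X P S V s"
    by (auto simp: carrier_germ_module)
  show "germ_res X P S' A \<in> carrier (germ_module X P S')"
    unfolding A germ_res_germ[OF V S'] by (rule germ_in_germ_module[OF V(1) subset_trans[OF S' V(2)] V(3)])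
next
  fix A B assume "A \<in> carrier (germ_module X P S)" "B \<in> carrier (germ_module X P S)"
  then obtain V s t where V: "openin X V" "S \<subseteq> V" "s \<in> carrier (sections P V)" "t \<in> carrier (sections P V)"
    and AB: "A = germ X P S V s" "B = germ X P S V t" by (rule germ_common)
  have "S' \<subseteq> V" using S' V by auto
  then show "germ_res X P S' (A \<oplus>\<^bsub>germ_module X P S\<^esub> B) = germ_res X P S' A \<oplus>\<^bsub>germ_module X P S'\<^esub> germ_res X P S' B"
    using V S' by (simp add: AB germ_add germ_res_germ add_section)
next
  fix a A assume "a \<in> carrier R" "A \<in> carrier (germ_module X P S)"
  then show "germ_res X P S' (a \<odot>\<^bsub>germ_module X P S\<^esub> A) = a \<odot>\<^bsub>germ_module X P S'\<^esub> germ_res X P S' A"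
    using S' by (auto simp: carrier_germ_module germ_smult germ_res_germ smult_section dest: subset_trans[OF S'])
qed

lemma germ_map_germ:
  assumes Q: "presheaf R X Q" and \<alpha>: "\<alpha> \<in> mor R X P Q"
    and V: "openin X V" "S \<subseteq> V" "s \<in> carrier (sections P V)"
  shows "germ_map X Q S \<alpha> (germ X P S V s) = germ X Q S V (\<alpha> V s)"
  unfolding germ_map_def
proof (rule germ_UN[OF V, of "\<lambda>V s. germ X Q S V (\<alpha> V s)"])
  fix V' s' assume V': "openin X V'" "S \<subseteq> V'" "s' \<in> carrier (sections P V')" and eq: "germ X P S V' s' = germ X P S V s"
  obtain N where "openin X N" "S \<subseteq> N" "N \<subseteq> V'" "N \<subseteq> V" "restr P V' N s' = restr P V N s"
    using germ_eqD[OF V eq] by blast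
  then show "germ X Q S V' (\<alpha> V' s') = germ X Q S V (\<alpha> V s)"
    using V V' by (intro presheaf.germ_eqI[OF Q, of _ _ _ _ _ N]) (auto simp: mor_closed[OF \<alpha>] mor_restr[OF \<alpha>])
qed

lemma germ_map_hom:
  assumes Q: "presheaf R X Q" and \<alpha>: "\<alpha> \<in> mor R X P Q"
  shows "germ_map X Q S \<alpha> \<in> mod_hom R (germ_module X P S) (germ_module X Q S)"
proof (rule mod_homI)
  fix A assume "A \<in> carrier (germ_module X P S)"
  then show "germ_map X Q S \<alpha> A \<in> carrier (germ_module X Q S)"
    by (auto simp: carrier_germ_module germ_map_germ[OF assms] mor_closed[OF \<alpha>] intro!: presheaf.germ_in_germ_module[OF Q])
next
  fix A B assume "A \<in> carrier (germ_module X P S)" "B \<in> carrier (germ_module X P S)"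
  then obtain V s t where V: "openin X V" "S \<subseteq> V" "s \<in> carrier (sections P V)" "t \<in> carrier (sections P V)"
    and AB: "A = germ X P S V s" "B = germ X P S V t" by (rule germ_common)
  then show "germ_map X Q S \<alpha> (A \<oplus>\<^bsub>germ_module X P S\<^esub> B) = germ_map X Q S \<alpha> A \<oplus>\<^bsub>germ_module X Q S\<^esub> germ_map X Q S \<alpha> B"
    by (simp add: germ_add germ_map_germ[OF assms] add_section presheaf.germ_add[OF Q] mor_closed[OF \<alpha>] mor_add[OF \<alpha>])
next
  fix a A assume "a \<in> carrier R" "A \<in> carrier (germ_module X P S)"
  then show "germ_map X Q S \<alpha> (a \<odot>\<^bsub>germ_module X P S\<^esub> A) = a \<odot>\<^bsub>germ_module X Q S\<^esub> germ_map X Q S \<alpha> A"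
    by (auto simp: carrier_germ_module germ_smult germ_map_germ[OF assms] smult_section
        presheaf.germ_smult[OF Q] mor_closed[OF \<alpha>] mor_smult[OF \<alpha>])
qed

end


section \<open>The sheaf of families of germs that come locally from sections\<close>

section \<open>Sheafification\<close>

definition locally_germs :: "'x topology \<Rightarrow> ('x, 'r, 'm) presheaf \<Rightarrow> 'x set \<Rightarrow> ('x \<Rightarrow> ('x set \<times> 'm) set) \<Rightarrow> bool" where
  "locally_germs X P U \<sigma> \<longleftrightarrow> (\<forall>x\<in>U. \<exists>V t. openin X V \<and> x \<in> V \<and> V \<subseteq> U \<and> t \<in> carrier (sections P V) \<and>
     (\<forall>y\<in>V. \<sigma> y = germ X P {y} V t))"

text \<open>A family that locally consists of germs of sections automatically takes values in the
  stalks, so membership in the product reduces to extensionality and the sections appear as a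
  submodule of the product of stalks.\<close>

lemma sheafify_simps:
  "sections (sheafify X P) U = (prod_module U (\<lambda>x. germ_module X P {x}))
     \<lparr>carrier := {\<sigma> \<in> extensional U. locally_germs X P U \<sigma>}\<rparr>" (is ?s)
  "restr (sheafify X P) U V \<sigma> = restrict \<sigma> V"
proof -
  have "{\<sigma> \<in> Pi\<^sub>E U (\<lambda>x. carrier (germ_module X P {x})). locally_germs X P U \<sigma>} =
      {\<sigma> \<in> extensional U. locally_germs X P U \<sigma>}"
  proof -
    have "\<sigma> x \<in> carrier (germ_module X P {x})" if \<sigma>: "locally_germs X P U \<sigma>" and x: "x \<in> U" for \<sigma> x
    proof -
      obtain V t where V: "openin X V" "x \<in> V" "t \<in> carrier (sections P V)" "\<forall>y\<in>V. \<sigma> y = germ X P {y} V t"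
        using \<sigma> x unfolding locally_germs_def by meson
      then have "\<sigma> x = germ X P {x} V t" by blast
      then show ?thesis using V by (auto simp: germ_module_def)
    qed
    then show ?thesis by (intro Collect_cong) (simp add: PiE_iff, blast)
  qed
  then show ?s
    by (simp add: sheafify_def prod_module_def locally_germs_def)
qed (simp add: sheafify_def)

context presheaf
begin

lemma locally_germsE:
  assumes "locally_germs X P U \<sigma>" "x \<in> U"
  obtains V t where "openin X V" "x \<in> V" "V \<subseteq> U" "t \<in> carrier (sections P V)" "\<And>y. y \<in> V \<Longrightarrow> \<sigma> y = germ X P {y} V t"
  using assms unfolding locally_germs_def by metis

text \<open>The neighbourhood is allowed to leave \<open>U\<close>, since the representing section
  can be restricted. This spares the intersections wherever a family is restricted or glued.\<close>

lemma locally_germsI: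
  assumes "\<And>x. x \<in> U \<Longrightarrow> \<exists>V t. openin X V \<and> x \<in> V \<and> t \<in> carrier (sections P V) \<and> (\<forall>y\<in>V \<inter> U. \<sigma> y = germ X P {y} V t)"
    and U: "openin X U"
  shows "locally_germs X P U \<sigma>"
  unfolding locally_germs_def
proof
  fix x assume x: "x \<in> U"
  obtain V t where V: "openin X V" "x \<in> V" "t \<in> carrier (sections P V)" "\<forall>y\<in>V \<inter> U. \<sigma> y = germ X P {y} V t"
    using assms(1)[OF x] by (elim exE conjE)
  have VU: "openin X (V \<inter> U)" using V U by blast
  then show "\<exists>V t. openin X V \<and> x \<in> V \<and> V \<subseteq> U \<and> t \<in> carrier (sections P V) \<and> (\<forall>y\<in>V. \<sigma> y = germ X P {y} V t)"
    using V x by (intro exI[of _ "V \<inter> U"] exI[of _ "restr P V (V \<inter> U) t"]) (auto simp: restr_closed germ_restr)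
qed

lemma locally_germs_mem:
  "locally_germs X P U \<sigma> \<Longrightarrow> x \<in> U \<Longrightarrow> \<sigma> x \<in> carrier (germ_module X P {x})"
  by (erule (1) locally_germsE) (auto intro: germ_in_germ_module)

lemma stalk_module: "openin X U \<Longrightarrow> x \<in> U \<Longrightarrow> Module.module R (germ_module X P {x})"
  using openin_sub by (intro germ_module_module) auto

lemma sheafify_submodule:
  assumes U: "openin X U"
  shows "submodule {\<sigma> \<in> extensional U. locally_germs X P U \<sigma>} R (prod_module U (\<lambda>x. germ_module X P {x}))"
proof -
  let ?M = "prod_module U (\<lambda>x. germ_module X P {x})"
  interpret M: Module.module R ?M
    by (rule prod_module_module[OF cring_R]) (rule stalk_module[OF U])
  have smult: "a \<odot>\<^bsub>?M\<^esub> \<sigma> \<in> {\<sigma> \<in> extensional U. locally_germs X P U \<sigma>}"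
    if a: "a \<in> carrier R" and \<sigma>: "\<sigma> \<in> {\<sigma> \<in> extensional U. locally_germs X P U \<sigma>}" for a \<sigma>
  proof -
    have "locally_germs X P U (a \<odot>\<^bsub>?M\<^esub> \<sigma>)"
    proof (rule locally_germsI[OF _ U])
      fix x assume "x \<in> U"
      then obtain V t where V: "openin X V" "x \<in> V" "V \<subseteq> U" "t \<in> carrier (sections P V)"
        "\<And>y. y \<in> V \<Longrightarrow> \<sigma> y = germ X P {y} V t"
        using locally_germsE[of U \<sigma> x] \<sigma> by blast
      then show "\<exists>V t. openin X V \<and> x \<in> V \<and> t \<in> carrier (sections P V) \<and> (\<forall>y\<in>V \<inter> U. (a \<odot>\<^bsub>?M\<^esub> \<sigma>) y = germ X P {y} V t)"
        using a by (intro exI[of _ V] exI[of _ "a \<odot>\<^bsub>sections P V\<^esub> t"]) (auto simp: smult_section germ_smult)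
    qed
    then show ?thesis by simp
  qed
  have sub: "{\<sigma> \<in> extensional U. locally_germs X P U \<sigma>} \<subseteq> carrier ?M"
  proof clarify
    fix \<sigma> assume ext: "\<sigma> \<in> extensional U" and lg: "locally_germs X P U \<sigma>"
    show "\<sigma> \<in> carrier ?M"
      unfolding prod_module_simps by (rule PiE_I) (rule locally_germs_mem[OF lg] extensional_arb[OF ext], assumption)+
  qed
  show ?thesis
  proof (rule M.submoduleI)
    show "\<zero>\<^bsub>?M\<^esub> \<in> {\<sigma> \<in> extensional U. locally_germs X P U \<sigma>}"
      using U by (auto intro!: locally_germsI exI[of _ U] exI[of _ "\<zero>\<^bsub>sections P U\<^esub>"] simp: zero_section germ_zero)
  next
    fix \<sigma> assume \<sigma>: "\<sigma> \<in> {\<sigma> \<in> extensional U. locally_germs X P U \<sigma>}"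
    \<comment> \<open>Closure under negatives follows from closure under scalars, as negation is
      multiplication by minus one.\<close>
    have "(\<ominus>\<^bsub>R\<^esub> \<one>\<^bsub>R\<^esub>) \<odot>\<^bsub>?M\<^esub> \<sigma> = \<ominus>\<^bsub>?M\<^esub> \<sigma>"
      using sub \<sigma> by (subst M.smult_l_minus) (auto simp del: prod_module_simps)
    then show "\<ominus>\<^bsub>?M\<^esub> \<sigma> \<in> {\<sigma> \<in> extensional U. locally_germs X P U \<sigma>}"
      using smult[OF _ \<sigma>, of "\<ominus>\<^bsub>R\<^esub> \<one>\<^bsub>R\<^esub>"] by (simp del: prod_module_simps)
  next
    fix \<sigma> \<tau> assume \<sigma>: "\<sigma> \<in> {\<sigma> \<in> extensional U. locally_germs X P U \<sigma>}"
      and \<tau>: "\<tau> \<in> {\<sigma> \<in> extensional U. locally_germs X P U \<sigma>}"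
    have "locally_germs X P U (\<sigma> \<oplus>\<^bsub>?M\<^esub> \<tau>)"
    proof (rule locally_germsI[OF _ U])
      fix x assume x: "x \<in> U"
      obtain V s where V: "openin X V" "x \<in> V" "V \<subseteq> U" "s \<in> carrier (sections P V)"
        "\<And>y. y \<in> V \<Longrightarrow> \<sigma> y = germ X P {y} V s"
        using locally_germsE[of U \<sigma> x] \<sigma> x by blast
      obtain W t where W: "openin X W" "x \<in> W" "W \<subseteq> U" "t \<in> carrier (sections P W)"
        "\<And>y. y \<in> W \<Longrightarrow> \<tau> y = germ X P {y} W t"
        using locally_germsE[of U \<tau> x] \<tau> x by blast
      have VW: "openin X (V \<inter> W)" using V W by blast
      let ?u = "restr P V (V \<inter> W) s \<oplus>\<^bsub>sections P (V \<inter> W)\<^esub> restr P W (V \<inter> W) t"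
      show "\<exists>V t. openin X V \<and> x \<in> V \<and> t \<in> carrier (sections P V) \<and> (\<forall>y\<in>V \<inter> U. (\<sigma> \<oplus>\<^bsub>?M\<^esub> \<tau>) y = germ X P {y} V t)"
        using V W VW by (intro exI[of _ "V \<inter> W"] exI[of _ ?u])
          (auto simp: add_section restr_closed germ_add_germ)
    qed
    then show "\<sigma> \<oplus>\<^bsub>?M\<^esub> \<tau> \<in> {\<sigma> \<in> extensional U. locally_germs X P U \<sigma>}" by simp
  qed (use sub smult in simp_all)
qed

lemma sheafify_sheaf: "sheaf R X (sheafify X P)"
proof (intro sheaf.intro presheaf.intro presheaf_axioms.intro sheaf_axioms.intro)
  show "cring R" by (rule cring_R)
next
  fix U assume U: "openin X U"
  show "Module.module R (sections (sheafify X P) U)"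
    unfolding sheafify_simps
    by (rule submodule.submodule_is_module[OF sheafify_submodule[OF U]])
      (rule prod_module_module[OF cring_R], rule stalk_module[OF U])
next
  fix U V assume UV: "openin X U" "openin X V" "V \<subseteq> U"
  show "restr (sheafify X P) U V \<in> mod_hom R (sections (sheafify X P) U) (sections (sheafify X P) V)"
  proof (rule mod_homI)
    fix \<sigma> assume "\<sigma> \<in> carrier (sections (sheafify X P) U)"
    then have \<sigma>: "locally_germs X P U \<sigma>" by (simp add: sheafify_simps)
    have "locally_germs X P V (restrict \<sigma> V)"
    proof (rule locally_germsI[OF _ UV(2)])
      fix x assume "x \<in> V"
      then obtain W t where "openin X W" "x \<in> W" "W \<subseteq> U" "t \<in> carrier (sections P W)"
        "\<And>y. y \<in> W \<Longrightarrow> \<sigma> y = germ X P {y} W t"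
        using locally_germsE[OF \<sigma>, of x] UV by blast
      then show "\<exists>W t. openin X W \<and> x \<in> W \<and> t \<in> carrier (sections P W) \<and> (\<forall>y\<in>W \<inter> V. restrict \<sigma> V y = germ X P {y} W t)"
        by (intro exI[of _ W] exI[of _ t]) auto
    qed
    then show "restr (sheafify X P) U V \<sigma> \<in> carrier (sections (sheafify X P) V)"
      by (simp add: sheafify_simps)
  qed (use UV in \<open>auto simp: sheafify_simps fun_eq_iff\<close>)
next
  fix U \<sigma> assume "\<sigma> \<in> carrier (sections (sheafify X P) U)"
  then show "restr (sheafify X P) U U \<sigma> = \<sigma>" by (auto simp: sheafify_simps extensional_restrict)
next
  fix U V W :: "'x set" and \<sigma> assume "W \<subseteq> V" "V \<subseteq> U"
  then show "restr (sheafify X P) V W (restr (sheafify X P) U V \<sigma>) = restr (sheafify X P) U W \<sigma>"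
    by (auto simp: sheafify_simps Int_absorb2 Int_absorb1)
next
  fix \<U> \<sigma> \<tau>
  assume *: "\<sigma> \<in> carrier (sections (sheafify X P) (\<Union>\<U>))" "\<tau> \<in> carrier (sections (sheafify X P) (\<Union>\<U>))"
    "\<And>V. V \<in> \<U> \<Longrightarrow> restr (sheafify X P) (\<Union>\<U>) V \<sigma> = restr (sheafify X P) (\<Union>\<U>) V \<tau>"
  show "\<sigma> = \<tau>"
  proof (rule extensionalityI[of _ "\<Union>\<U>"])
    fix x assume "x \<in> \<Union>\<U>"
    then obtain V where "V \<in> \<U>" "x \<in> V" by blast
    with *(3)[of V] show "\<sigma> x = \<tau> x" by (auto simp: sheafify_simps dest: fun_cong[of _ _ x])
  qed (use * in \<open>auto simp: sheafify_simps\<close>)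
next
  fix \<U> \<sigma>
  assume op: "\<And>V. V \<in> \<U> \<Longrightarrow> openin X V"
    and \<sigma>: "\<And>V. V \<in> \<U> \<Longrightarrow> \<sigma> V \<in> carrier (sections (sheafify X P) V)"
    and comp: "\<And>V W. \<lbrakk>V \<in> \<U>; W \<in> \<U>\<rbrakk> \<Longrightarrow> restr (sheafify X P) V (V \<inter> W) (\<sigma> V) = restr (sheafify X P) W (V \<inter> W) (\<sigma> W)"
  \<comment> \<open>At each point the value is read off from an arbitrary member of the cover;
    compatibility on overlaps makes it independent of that choice.\<close>
  define \<tau> where "\<tau> = (\<lambda>x\<in>\<Union>\<U>. \<sigma> (SOME V. V \<in> \<U> \<and> x \<in> V) x)"
  have \<tau>: "\<tau> x = \<sigma> V x" if V: "V \<in> \<U>" "x \<in> V" for V x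
  proof -
    define W where "W = (SOME V. V \<in> \<U> \<and> x \<in> V)"
    have W: "W \<in> \<U> \<and> x \<in> W" unfolding W_def by (rule someI[of _ V]) (use V in simp)
    then have "\<sigma> V x = \<sigma> W x"
      using comp[of V W] V by (auto simp: sheafify_simps dest: fun_cong[of _ _ x])
    moreover have "x \<in> \<Union>\<U>" using V by blast
    ultimately show ?thesis unfolding \<tau>_def by (simp flip: W_def)
  qed
  have oU: "openin X (\<Union>\<U>)" using op by blast
  have "locally_germs X P (\<Union>\<U>) \<tau>"
  proof (rule locally_germsI[OF _ oU])
    fix x assume "x \<in> \<Union>\<U>"
    then obtain V where V: "V \<in> \<U>" "x \<in> V" by blast
    have lg: "locally_germs X P V (\<sigma> V)" using \<sigma>[OF V(1)] by (simp add: sheafify_simps)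
    obtain W t where W: "openin X W" "x \<in> W" "W \<subseteq> V" "t \<in> carrier (sections P W)"
      "\<And>y. y \<in> W \<Longrightarrow> \<sigma> V y = germ X P {y} W t"
      using locally_germsE[OF lg V(2)] by blast
    then show "\<exists>W t. openin X W \<and> x \<in> W \<and> t \<in> carrier (sections P W) \<and> (\<forall>y\<in>W \<inter> \<Union>\<U>. \<tau> y = germ X P {y} W t)"
      using \<tau>[OF V(1)] by (intro exI[of _ W] exI[of _ t]) auto
  qed
  moreover have "restrict \<tau> V = \<sigma> V" if "V \<in> \<U>" for V
    using \<sigma>[OF that] \<tau>[OF that] by (intro extensionalityI[of _ V]) (auto simp: sheafify_simps)
  ultimately show "\<exists>s\<in>carrier (sections (sheafify X P) (\<Union>\<U>)). \<forall>V\<in>\<U>. restr (sheafify X P) (\<Union>\<U>) V s = \<sigma> V"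
    by (intro bexI[of _ \<tau>]) (auto simp: sheafify_simps \<tau>_def)
qed

lemma sheafify_unit_mor: "sheafify_unit X P \<in> mor R X P (sheafify X P)"
proof (rule morI)
  fix U assume U: "openin X U"
  show "sheafify_unit X P U \<in> mod_hom R (sections P U) (sections (sheafify X P) U)"
  proof (rule mod_homI)
    fix s assume s: "s \<in> carrier (sections P U)"
    have "locally_germs X P U (\<lambda>x\<in>U. germ X P {x} U s)"
      by (rule locally_germsI[OF _ U]) (use U s in \<open>auto intro!: exI[of _ U] exI[of _ s]\<close>)
    then show "sheafify_unit X P U s \<in> carrier (sections (sheafify X P) U)"
      by (simp add: sheafify_simps sheafify_unit_def)
  qed (use U in \<open>auto simp: sheafify_simps sheafify_unit_def germ_add germ_smult intro!: restrict_ext\<close>)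
next
  fix U V s assume "openin X U" "openin X V" "V \<subseteq> U" "s \<in> carrier (sections P U)"
  then show "restr (sheafify X P) U V (sheafify_unit X P U s) = sheafify_unit X P V (restr P U V s)"
    by (auto simp: sheafify_simps sheafify_unit_def germ_restr fun_eq_iff)
qed

lemma sheafify_mor_eq: "sheafify_mor X Q \<alpha> U \<sigma> = (\<lambda>x\<in>U. germ_map X Q {x} \<alpha> (\<sigma> x))"
  by (simp add: sheafify_mor_def germ_map_def)

lemma sheafify_mor_mor:
  assumes Q: "presheaf R X Q" and \<alpha>: "\<alpha> \<in> mor R X P Q"
  shows "sheafify_mor X Q \<alpha> \<in> mor R X (sheafify X P) (sheafify X Q)"
proof -
  note eq = sheafify_mor_eq
  show ?thesis
  proof (rule morI)
    fix U assume U: "openin X U"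
    show "sheafify_mor X Q \<alpha> U \<in> mod_hom R (sections (sheafify X P) U) (sections (sheafify X Q) U)"
    proof (rule mod_homI)
      fix \<sigma> assume "\<sigma> \<in> carrier (sections (sheafify X P) U)"
      then have \<sigma>: "locally_germs X P U \<sigma>" by (simp add: sheafify_simps)
      have "locally_germs X Q U (sheafify_mor X Q \<alpha> U \<sigma>)"
      proof (rule presheaf.locally_germsI[OF Q _ U])
        fix x assume "x \<in> U"
        then obtain W t where W: "openin X W" "x \<in> W" "W \<subseteq> U" "t \<in> carrier (sections P W)"
          "\<And>y. y \<in> W \<Longrightarrow> \<sigma> y = germ X P {y} W t"
          using locally_germsE[OF \<sigma>] by blast
        then show "\<exists>W t. openin X W \<and> x \<in> W \<and> t \<in> carrier (sections Q W) \<and>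
            (\<forall>y\<in>W \<inter> U. sheafify_mor X Q \<alpha> U \<sigma> y = germ X Q {y} W t)"
          by (intro exI[of _ W] exI[of _ "\<alpha> W t"]) (auto simp: eq germ_map_germ[OF Q \<alpha>] mor_closed[OF \<alpha>])
      qed
      then show "sheafify_mor X Q \<alpha> U \<sigma> \<in> carrier (sections (sheafify X Q) U)"
        by (simp add: sheafify_simps eq)
    qed (use mod_hom_add[OF germ_map_hom[OF Q \<alpha>]] mod_hom_smult[OF germ_map_hom[OF Q \<alpha>]] locally_germs_mem
         in \<open>auto simp: sheafify_simps eq intro!: restrict_ext\<close>)
  next
    fix U V :: "'x set" and \<sigma> assume "V \<subseteq> U"
    then show "restr (sheafify X Q) U V (sheafify_mor X Q \<alpha> U \<sigma>) = sheafify_mor X Q \<alpha> V (restr (sheafify X P) U V \<sigma>)"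
      by (auto simp: sheafify_simps eq fun_eq_iff)
  qed
qed

lemma sheafify_mor_unit:
  assumes Q: "presheaf R X Q" and \<alpha>: "\<alpha> \<in> mor R X P Q" and U: "openin X U" and s: "s \<in> carrier (sections P U)"
  shows "sheafify_mor X Q \<alpha> U (sheafify_unit X P U s) = sheafify_unit X Q U (\<alpha> U s)"
  using U s by (auto simp: sheafify_mor_eq sheafify_unit_def germ_map_germ[OF Q \<alpha>] intro!: restrict_ext)

end


section \<open>Sheafified pullbacks inside a prescribed type\<close>

section \<open>Inverse images\<close>

subsection \<open>The presheaf pullback\<close>

lemma pre_inverse_image_simps:
  "sections (pre_inverse_image Y f P) U = germ_module Y P (f ` U)"
  "restr (pre_inverse_image Y f P) U V = germ_res Y P (f ` V)"
  by (simp_all add: pre_inverse_image_def germ_res_def fun_eq_iff)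

lemma pre_inverse_image_mor_eq: "pre_inverse_image_mor Y f Q \<alpha> U = germ_map Y Q (f ` U) \<alpha>"
  by (simp add: pre_inverse_image_mor_def germ_map_def fun_eq_iff)

lemma continuous_map_image_subset: "continuous_map X Y f \<Longrightarrow> openin X U \<Longrightarrow> f ` U \<subseteq> topspace Y"
  using openin_subset[of X U] by (auto simp: continuous_map_def)

lemma pre_inverse_image_presheaf:
  assumes f: "continuous_map X Y f" and P: "presheaf R Y P"
  shows "presheaf R X (pre_inverse_image Y f P)"
proof -
  interpret P: presheaf R Y P by fact
  have *: "\<exists>W s. openin Y W \<and> f ` U \<subseteq> W \<and> s \<in> carrier (sections P W) \<and> A = germ Y P (f ` U) W s"
    if "A \<in> carrier (sections (pre_inverse_image Y f P) U)" for A U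
    using that by (simp add: pre_inverse_image_simps P.carrier_germ_module)
  show ?thesis
  proof (intro presheaf.intro presheaf_axioms.intro)
    show "cring R" by (rule P.cring_R)
    show "Module.module R (sections (pre_inverse_image Y f P) U)" if "openin X U" for U
      unfolding pre_inverse_image_simps by (rule P.germ_module_module[OF continuous_map_image_subset[OF f that]])
    show "restr (pre_inverse_image Y f P) U V \<in> mod_hom R (sections (pre_inverse_image Y f P) U) (sections (pre_inverse_image Y f P) V)"
      if "V \<subseteq> U" for U V
      unfolding pre_inverse_image_simps by (rule P.germ_res_hom) (use that in blast)
  next
    fix U A assume "A \<in> carrier (sections (pre_inverse_image Y f P) U)"
    from *[OF this] show "restr (pre_inverse_image Y f P) U U A = A"
      by (auto simp: pre_inverse_image_simps P.germ_res_germ)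
  next
    fix U V W A assume VW: "W \<subseteq> V" "V \<subseteq> U" and A: "A \<in> carrier (sections (pre_inverse_image Y f P) U)"
    obtain Z s where Z: "openin Y Z" "f ` U \<subseteq> Z" "s \<in> carrier (sections P Z)" and A: "A = germ Y P (f ` U) Z s"
      using *[OF A] by blast
    have sub: "f ` W \<subseteq> f ` V" "f ` V \<subseteq> f ` U" "f ` W \<subseteq> f ` U" "f ` V \<subseteq> Z" using VW Z(2) by auto
    show "restr (pre_inverse_image Y f P) V W (restr (pre_inverse_image Y f P) U V A) = restr (pre_inverse_image Y f P) U W A"
      using Z sub by (simp add: A pre_inverse_image_simps P.germ_res_germ)
  qed
qed

lemma pre_inverse_image_mor_mor:
  assumes P: "presheaf R Y P" and Q: "presheaf R Y Q" and \<alpha>: "\<alpha> \<in> mor R Y P Q"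
  shows "pre_inverse_image_mor Y f Q \<alpha> \<in> mor R X (pre_inverse_image Y f P) (pre_inverse_image Y f Q)"
proof -
  interpret P: presheaf R Y P by fact
  show ?thesis
  proof (rule morI)
    show "pre_inverse_image_mor Y f Q \<alpha> U \<in> mod_hom R (sections (pre_inverse_image Y f P) U) (sections (pre_inverse_image Y f Q) U)" for U
      unfolding pre_inverse_image_simps pre_inverse_image_mor_eq by (rule P.germ_map_hom[OF Q \<alpha>])
  next
    fix U V A assume VU: "V \<subseteq> U" and A: "A \<in> carrier (sections (pre_inverse_image Y f P) U)"
    obtain Z s where Z: "openin Y Z" "f ` U \<subseteq> Z" "s \<in> carrier (sections P Z)" and A: "A = germ Y P (f ` U) Z s"
      using A by (auto simp add: pre_inverse_image_simps P.carrier_germ_module)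
    have sub: "f ` V \<subseteq> f ` U" "f ` V \<subseteq> Z" using VU Z(2) by auto
    show "restr (pre_inverse_image Y f Q) U V (pre_inverse_image_mor Y f Q \<alpha> U A) =
        pre_inverse_image_mor Y f Q \<alpha> V (restr (pre_inverse_image Y f P) U V A)"
      using Z sub by (simp add: A pre_inverse_image_simps pre_inverse_image_mor_eq P.germ_res_germ
          P.germ_map_germ[OF Q \<alpha>] presheaf.germ_res_germ[OF Q] mor_closed[OF \<alpha>])
  qed
qed


subsection \<open>Copies\<close>

text \<open>Transport of structure along injections of the modules of sections. The assumption
  \<open>ex\<close> is what makes the \<open>SOME\<close> in \<open>copy_code\<close> pick actual
  injections; code and decode are then mutually inverse morphisms, through which locality and gluing
  pass to the copy.\<close>

lemma copy_sheaf:
  fixes P :: "('x, 'r, 'm) presheaf"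
  assumes P: "sheaf R X P" and ex: "\<exists>e :: 'x set \<Rightarrow> 'm \<Rightarrow> 'u. \<forall>U. openin X U \<longrightarrow> inj_on (e U) (carrier (sections P U))"
  shows "sheaf R X (copy X P :: ('x, 'r, 'u) presheaf)"
    and "(copy_code X P :: 'x set \<Rightarrow> 'm \<Rightarrow> 'u) \<in> mor R X P (copy X P)"
    and "(copy_decode X P :: 'x set \<Rightarrow> 'u \<Rightarrow> 'm) \<in> mor R X (copy X P) P"
    and "\<lbrakk>openin X U; s \<in> carrier (sections P U)\<rbrakk> \<Longrightarrow> copy_decode X P U (copy_code X P U s :: 'u) = s"
    and "\<lbrakk>openin X U; a \<in> carrier (sections (copy X P) U)\<rbrakk> \<Longrightarrow> copy_code X P U (copy_decode X P U (a :: 'u)) = a"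
proof -
  interpret P: sheaf R X P by fact
  let ?e = "copy_code X P :: 'x set \<Rightarrow> 'm \<Rightarrow> 'u"
  let ?d = "copy_decode X P :: 'x set \<Rightarrow> 'u \<Rightarrow> 'm"
  let ?C = "copy X P :: ('x, 'r, 'u) presheaf"
  have inj: "inj_on (?e U) (carrier (sections P U))" if "openin X U" for U
    using someI_ex[OF ex] that unfolding copy_code_def by blast
  have sec: "sections ?C U = image_module (?e U) (sections P U)" for U by (simp add: copy_def)
  have res: "restr ?C U V a = ?e V (restr P U V (?d U a))" for U V a by (simp add: copy_def)
  show de: "?d U (?e U s) = s" if "openin X U" "s \<in> carrier (sections P U)" for U s
    using that by (simp add: copy_decode_def inj)
  have mem: "\<exists>s\<in>carrier (sections P U). a = ?e U s" if "a \<in> carrier (sections ?C U)" for U a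
    using that by (auto simp: sec image_module_simps)
  show ed: "?e U (?d U a) = a" if "openin X U" "a \<in> carrier (sections ?C U)" for U a
    using mem[OF that(2)] that(1) by (auto simp: de)
  have ecl: "?e U s \<in> carrier (sections ?C U)" if "s \<in> carrier (sections P U)" for U s
    using that by (simp add: sec image_module_simps)
  have ehom: "?e U \<in> mod_hom R (sections P U) (sections ?C U)" if "openin X U" for U
    unfolding sec by (rule image_module_hom[OF inj[OF that]])
  have dhom: "?d U \<in> mod_hom R (sections ?C U) (sections P U)" if "openin X U" for U
    unfolding sec copy_decode_def by (rule image_module_inv_hom[OF P.sections_module[OF that] inj[OF that]])
  have dcl: "?d U a \<in> carrier (sections P U)" if "openin X U" "a \<in> carrier (sections ?C U)" for U a
    using mod_hom_closed[OF dhom that(2)] that(1) by simp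
  have er: "restr ?C U V (?e U s) = ?e V (restr P U V s)" if "openin X U" "s \<in> carrier (sections P U)" for U V s
    using that by (simp add: res de)
  show "?e \<in> mor R X P ?C" by (rule morI) (simp_all add: ehom er)
  show "?d \<in> mor R X ?C P"
    by (rule morI) (simp_all add: dhom res de P.restr_closed dcl)
  show "sheaf R X ?C"
  proof (intro sheaf.intro presheaf.intro presheaf_axioms.intro sheaf_axioms.intro)
    show "cring R" by (rule P.cring_R)
    show "Module.module R (sections ?C U)" if "openin X U" for U
      unfolding sec by (rule image_module_module[OF P.sections_module[OF that] inj[OF that]])
    show "restr ?C U V \<in> mod_hom R (sections ?C U) (sections ?C V)"
      if "openin X U" "openin X V" "V \<subseteq> U" for U V
      using mod_hom_comp(1)[OF mod_hom_comp(1)[OF dhom[OF that(1)] P.restr_hom[OF that]] ehom[OF that(2)]]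
      by (simp add: copy_def)
    show "restr ?C U U a = a" if "openin X U" "a \<in> carrier (sections ?C U)" for U a
      using that by (simp add: res P.restr_id dcl ed)
    show "restr ?C V W (restr ?C U V a) = restr ?C U W a"
      if "openin X U" "openin X V" "openin X W" "W \<subseteq> V" "V \<subseteq> U" "a \<in> carrier (sections ?C U)" for U V W a
      using that by (simp add: res de P.restr_closed dcl P.restr_restr)
  next
    fix \<U> s t
    assume op: "\<And>V. V \<in> \<U> \<Longrightarrow> openin X V" and s: "s \<in> carrier (sections ?C (\<Union>\<U>))" and t: "t \<in> carrier (sections ?C (\<Union>\<U>))"
      and eq: "\<And>V. V \<in> \<U> \<Longrightarrow> restr ?C (\<Union>\<U>) V s = restr ?C (\<Union>\<U>) V t"
    have oU: "openin X (\<Union>\<U>)" using op by blast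
    have "?d (\<Union>\<U>) s = ?d (\<Union>\<U>) t"
    proof (rule P.locality[OF op dcl[OF oU s] dcl[OF oU t]])
      fix V assume V: "V \<in> \<U>"
      then have "?e V (restr P (\<Union>\<U>) V (?d (\<Union>\<U>) s)) = ?e V (restr P (\<Union>\<U>) V (?d (\<Union>\<U>) t))"
        using eq[OF V] by (simp add: res)
      then show "restr P (\<Union>\<U>) V (?d (\<Union>\<U>) s) = restr P (\<Union>\<U>) V (?d (\<Union>\<U>) t)"
        by (rule inj_onD[OF inj[OF op[OF V]]])
          (use op[OF V] V oU s t in \<open>auto intro!: P.restr_closed dcl\<close>)
    qed simp
    then show "s = t" using ed[OF oU s] ed[OF oU t] by metis
  next
    fix \<U> \<sigma>
    assume op: "\<And>V. V \<in> \<U> \<Longrightarrow> openin X V" and \<sigma>: "\<And>V. V \<in> \<U> \<Longrightarrow> \<sigma> V \<in> carrier (sections ?C V)"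
      and comp: "\<And>V W. \<lbrakk>V \<in> \<U>; W \<in> \<U>\<rbrakk> \<Longrightarrow> restr ?C V (V \<inter> W) (\<sigma> V) = restr ?C W (V \<inter> W) (\<sigma> W)"
    have oU: "openin X (\<Union>\<U>)" using op by blast
    have "\<exists>s\<in>carrier (sections P (\<Union>\<U>)). \<forall>V\<in>\<U>. restr P (\<Union>\<U>) V s = ?d V (\<sigma> V)"
    proof (rule P.gluing[OF op])
      show "?d V (\<sigma> V) \<in> carrier (sections P V)" if "V \<in> \<U>" for V using that by (simp add: dcl op \<sigma>)
      fix V W assume VW: "V \<in> \<U>" "W \<in> \<U>"
      have oVW: "openin X (V \<inter> W)" using VW op by blast
      have "?e (V \<inter> W) (restr P V (V \<inter> W) (?d V (\<sigma> V))) = ?e (V \<inter> W) (restr P W (V \<inter> W) (?d W (\<sigma> W)))"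
        using comp[OF VW] by (simp add: res)
      then show "restr P V (V \<inter> W) (?d V (\<sigma> V)) = restr P W (V \<inter> W) (?d W (\<sigma> W))"
        by (rule inj_onD[OF inj[OF oVW]])
          (use op VW oVW \<sigma> in \<open>auto intro!: P.restr_closed dcl\<close>)
    qed simp
    then obtain s where s: "s \<in> carrier (sections P (\<Union>\<U>))" "\<forall>V\<in>\<U>. restr P (\<Union>\<U>) V s = ?d V (\<sigma> V)" by blast
    then have "\<forall>V\<in>\<U>. restr ?C (\<Union>\<U>) V (?e (\<Union>\<U>) s) = \<sigma> V"
      using op \<sigma> oU by (simp add: er ed)
    then show "\<exists>s\<in>carrier (sections ?C (\<Union>\<U>)). \<forall>V\<in>\<U>. restr ?C (\<Union>\<U>) V s = \<sigma> V"
      using ecl[OF s(1)] by blast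
  qed
qed

text \<open>Only an injection into the target type is needed; a choice of representatives encodes each
  germ of the pullback as a tuple \<open>(V, W, s)\<close>.\<close>

lemma inverse_image_code_exists:
  fixes P :: "('y, 'r, 'm) presheaf" and X :: "'x topology"
  assumes f: "continuous_map X Y f" and P: "presheaf R Y P"
    and emb: "embeds TYPE('x \<Rightarrow> 'x set \<times> 'y set \<times> 'm) TYPE('u)"
  shows "\<exists>e :: 'x set \<Rightarrow> ('x \<Rightarrow> ('x set \<times> ('y set \<times> 'm) set) set) \<Rightarrow> 'u.
    \<forall>U. openin X U \<longrightarrow> inj_on (e U) (carrier (sections (big_inverse_image X Y f P) U))"
proof -
  interpret P: presheaf R Y P by fact
  let ?P = "pre_inverse_image Y f P"
  interpret PP: presheaf R X ?P by (rule pre_inverse_image_presheaf[OF f P])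
  obtain i :: "('x \<Rightarrow> 'x set \<times> 'y set \<times> 'm) \<Rightarrow> 'u" where i: "inj i" using emb by (auto simp: embeds_def)
  \<comment> \<open>A representative of a germ of germs: an open set \<open>V\<close> upstairs, an
    open set \<open>W\<close> around the image of \<open>V\<close>, and a section over
    \<open>W\<close>. Recording representatives avoids the nested power sets in the type of
    germs.\<close>
  define r :: "'x \<Rightarrow> ('x set \<times> ('y set \<times> 'm) set) set \<Rightarrow> 'x set \<times> 'y set \<times> 'm" where
    "r x A = (SOME (V, W, s). A = germ X ?P {x} V (germ Y P (f ` V) W s))" for x A
  have r: "\<exists>p. A = (case p of (V, W, s) \<Rightarrow> germ X ?P {x} V (germ Y P (f ` V) W s))"
    if A: "A \<in> carrier (germ_module X ?P {x})" for x A
  proof -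
    obtain V t where V: "t \<in> carrier (sections ?P V)" "A = germ X ?P {x} V t"
      using A unfolding PP.carrier_germ_module by blast
    then obtain W s where "t = germ Y P (f ` V) W s"
      by (auto simp: pre_inverse_image_simps P.carrier_germ_module)
    then show ?thesis using V by (intro exI[of _ "(V, W, s)"]) simp
  qed
  have r_eq: "A = (case r x A of (V, W, s) \<Rightarrow> germ X ?P {x} V (germ Y P (f ` V) W s))"
    if "A \<in> carrier (germ_module X ?P {x})" for x A
    using someI_ex[OF r[OF that]] unfolding r_def by (simp add: case_prod_unfold)
  have "inj_on (\<lambda>\<sigma>. i (\<lambda>x. r x (\<sigma> x))) (carrier (sections (sheafify X ?P) U))" for U
  proof (rule inj_onI)
    fix \<sigma> \<tau> assume \<sigma>: "\<sigma> \<in> carrier (sections (sheafify X ?P) U)" and \<tau>: "\<tau> \<in> carrier (sections (sheafify X ?P) U)"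
      and "i (\<lambda>x. r x (\<sigma> x)) = i (\<lambda>x. r x (\<tau> x))"
    then have eq: "r x (\<sigma> x) = r x (\<tau> x)" for x by (metis injD[OF i])
    show "\<sigma> = \<tau>"
    proof (rule extensionalityI[of _ U])
      fix x assume "x \<in> U"
      then have "\<sigma> x \<in> carrier (germ_module X ?P {x})" "\<tau> x \<in> carrier (germ_module X ?P {x})"
        using \<sigma> \<tau> by (auto simp: sheafify_simps intro: PP.locally_germs_mem)
      then show "\<sigma> x = \<tau> x" using r_eq[of "\<sigma> x" x] r_eq[of "\<tau> x" x] eq[of x] by simp
    qed (use \<sigma> \<tau> in \<open>auto simp: sheafify_simps\<close>)
  qed
  then show ?thesis by (intro exI[of _ "\<lambda>U \<sigma>. i (\<lambda>x. r x (\<sigma> x))"]) simp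
qed


section \<open>The adjunction between inverse and direct image\<close>

subsection \<open>The adjunction\<close>

text \<open>The arguments \<open>u\<close> and \<open>m\<close> fix the types of sections of the
  pullback and of the sheaf on \<open>Y\<close>; \<open>emb\<close> is the size condition under
  which the copy of the big pullback exists.\<close>

locale inverse_image_setup =
  fixes R :: "'r ring" and X :: "'x topology" and Y :: "'y topology" and f :: "'x \<Rightarrow> 'y"
    and u :: "'u itself" and m :: "'m itself"
  assumes f: "continuous_map X Y f"
    and emb: "embeds TYPE('x \<Rightarrow> 'x set \<times> 'y set \<times> 'm) TYPE('u)"
begin

abbreviation big :: "('y, 'r, 'm) presheaf \<Rightarrow> ('x, 'r, 'x \<Rightarrow> ('x set \<times> ('y set \<times> 'm) set) set) presheaf" where
  "big P \<equiv> big_inverse_image X Y f P"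

abbreviation pull :: "('y, 'r, 'm) presheaf \<Rightarrow> ('x, 'r, 'u) presheaf" where
  "pull P \<equiv> inverse_image X Y f P"

abbreviation eta :: "('y, 'r, 'm) presheaf \<Rightarrow> 'y set \<Rightarrow> 'm \<Rightarrow> 'u" where
  "eta P \<equiv> inverse_image_unit X Y f P"

definition big_unit :: "('y, 'r, 'm) presheaf \<Rightarrow> 'y set \<Rightarrow> 'm \<Rightarrow> 'x \<Rightarrow> ('x set \<times> ('y set \<times> 'm) set) set" where
  "big_unit P V s = sheafify_unit X (pre_inverse_image Y f P) (preim X f V) (germ Y P (f ` preim X f V) V s)"

lemma big_sheaf: "presheaf R Y P \<Longrightarrow> sheaf R X (big P)"
  by (rule presheaf.sheafify_sheaf[OF pre_inverse_image_presheaf[OF f]])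

text \<open>Both the sheaf property and the existence of an encoding ask for the presheaf on
  \<open>Y\<close>, whence the doubled premise in later instances.\<close>

lemmas copy_big = copy_sheaf[OF big_sheaf inverse_image_code_exists[OF f _ emb], folded inverse_image_def]

lemma pull_sheaf: "presheaf R Y P \<Longrightarrow> sheaf R X (pull P)"
  using copy_big(1) by simp

lemma unit_eq: "eta P V s = copy_code X (big P) (preim X f V) (big_unit P V s)"
  by (simp add: inverse_image_unit_def big_unit_def)

lemma image_preim: "f ` preim X f V \<subseteq> V"
  by (auto simp: preim_def)

lemma big_unit_mor:
  assumes P: "presheaf R Y P"
  shows "big_unit P \<in> mor R Y P (direct_image X f (big P))"
proof -
  let ?P = "pre_inverse_image Y f P"
  interpret P: presheaf R Y P by fact
  interpret PP: presheaf R X ?P by (rule pre_inverse_image_presheaf[OF f P])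
  have germ_mor: "(\<lambda>V. germ Y P (f ` preim X f V) V) \<in> mor R Y P (direct_image X f ?P)"
  proof (rule morI)
    fix V assume V: "openin Y V"
    show "germ Y P (f ` preim X f V) V \<in> mod_hom R (sections P V) (sections (direct_image X f ?P) V)"
      by (rule mod_homI) (simp_all add: pre_inverse_image_simps P.germ_in_germ_module[OF V image_preim]
          P.germ_add[OF V image_preim] P.germ_smult[OF V image_preim])
  next
    fix V W s assume V: "openin Y V" "openin Y W" "W \<subseteq> V" and s: "s \<in> carrier (sections P V)"
    have "f ` preim X f W \<subseteq> f ` preim X f V" 
      by (intro image_mono preim_mono V(3))
    then show "restr (direct_image X f ?P) V W (germ Y P (f ` preim X f V) V s) =
        germ Y P (f ` preim X f W) W (restr P V W s)"
      by (simp add: pre_inverse_image_simps P.germ_res_germ[OF V(1) image_preim s]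
          P.germ_restr[OF V(1,2) image_preim V(3) s])
  qed
  have "big_unit P = mor_comp (direct_image_mor X f (sheafify_unit X ?P)) (\<lambda>V. germ Y P (f ` preim X f V) V)"
    by (simp add: big_unit_def mor_comp_def direct_image_mor_def fun_eq_iff)
  then show ?thesis
    using mor_comp_mor[OF germ_mor direct_image_mor_mor[OF f PP.sheafify_unit_mor]] by simp
qed

lemma unit_mor:
  assumes P: "presheaf R Y P"
  shows "eta P \<in> mor R Y P (direct_image X f (pull P))"
proof -
  have "eta P = mor_comp (direct_image_mor X f (copy_code X (big P))) (big_unit P)"
    by (simp add: unit_eq mor_comp_def direct_image_mor_def fun_eq_iff)
  then show ?thesis
    using mor_comp_mor[OF big_unit_mor[OF P] direct_image_mor_mor[OF f copy_big(2)[OF P P]]] by simp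
qed

text \<open>Sections of the pullback are locally germs of germs, and a germ along the image of
  \<open>V\<close> is represented by a section over some open \<open>W\<close>. So they are locally
  restrictions of unit sections; together with \<open>big_unit_eqD\<close> this describes the
  pullback by generators and relations.\<close>

lemma big_unit_local:
  assumes P: "presheaf R Y P" and U: "openin X U" and \<sigma>: "\<sigma> \<in> carrier (sections (big P) U)" and x: "x \<in> U"
  shows "\<exists>V W w. openin X V \<and> x \<in> V \<and> V \<subseteq> U \<and> openin Y W \<and> V \<subseteq> preim X f W \<and>
    w \<in> carrier (sections P W) \<and> restr (big P) U V \<sigma> = restr (big P) (preim X f W) V (big_unit P W w)"
proof -
  let ?P = "pre_inverse_image Y f P"
  interpret P: presheaf R Y P by fact
  interpret PP: presheaf R X ?P by (rule pre_inverse_image_presheaf[OF f P])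
  have "locally_germs X ?P U \<sigma>" using \<sigma> by (simp add: sheafify_simps)
  then obtain V t where V: "openin X V" "x \<in> V" "V \<subseteq> U" "t \<in> carrier (sections ?P V)"
    and \<sigma>t: "\<And>y. y \<in> V \<Longrightarrow> \<sigma> y = germ X ?P {y} V t" using x PP.locally_germsE by metis
  obtain W w where W: "openin Y W" "f ` V \<subseteq> W" "w \<in> carrier (sections P W)" and t: "t = germ Y P (f ` V) W w"
    using V(4) by (auto simp: pre_inverse_image_simps P.carrier_germ_module)
  have VW: "V \<subseteq> preim X f W" using W(2) openin_subset[OF V(1)] by (auto simp: preim_def)
  have "germ X ?P {y} (preim X f W) (germ Y P (f ` preim X f W) W w) = germ X ?P {y} V t" if y: "y \<in> V" for y
  proof -
    have g: "germ Y P (f ` preim X f W) W w \<in> carrier (sections ?P (preim X f W))"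
      using W image_preim[of W] by (simp add: pre_inverse_image_simps P.germ_in_germ_module)
    have "restr ?P (preim X f W) V (germ Y P (f ` preim X f W) W w) = t"
      using W image_preim[of W] VW by (simp add: pre_inverse_image_simps t P.germ_res_germ image_mono)
    then show ?thesis
      using PP.germ_restr[OF openin_preim[OF f W(1)] V(1) _ VW g, of "{y}"] y by simp
  qed
  then have "restr (big P) U V \<sigma> = restr (big P) (preim X f W) V (big_unit P W w)"
    using VW \<sigma>t by (auto simp: sheafify_simps big_unit_def sheafify_unit_def fun_eq_iff)
  then show ?thesis using V W VW by blast
qed

text \<open>Equality of two unit sections on \<open>V\<close> is equality of germs at each point,
  hence along the image of a small neighbourhood of \<open>x\<close>. The neighbourhood
  \<open>N\<close> downstairs depends on \<open>x\<close>; in general none of them serves all of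
  \<open>V\<close>.\<close>

lemma big_unit_eqD:
  assumes P: "presheaf R Y P" and W: "openin Y W" "w \<in> carrier (sections P W)"
    and W': "openin Y W'" "w' \<in> carrier (sections P W')"
    and V: "openin X V" "V \<subseteq> preim X f W" "V \<subseteq> preim X f W'"
    and eq: "restr (big P) (preim X f W) V (big_unit P W w) = restr (big P) (preim X f W') V (big_unit P W' w')"
    and x: "x \<in> V"
  shows "\<exists>N. openin Y N \<and> f x \<in> N \<and> N \<subseteq> W \<and> N \<subseteq> W' \<and> restr P W N w = restr P W' N w'"
proof -
  let ?P = "pre_inverse_image Y f P"
  interpret P: presheaf R Y P by fact
  interpret PP: presheaf R X ?P by (rule pre_inverse_image_presheaf[OF f P])
  let ?g = "germ Y P (f ` preim X f W) W w" and ?g' = "germ Y P (f ` preim X f W') W' w'"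
  have "germ X ?P {x} (preim X f W) ?g = germ X ?P {x} (preim X f W') ?g'"
    using fun_cong[OF eq, of x] x V by (simp add: sheafify_simps big_unit_def sheafify_unit_def subset_iff)
  moreover have "?g' \<in> carrier (sections ?P (preim X f W'))"
    using W' image_preim[of W'] by (simp add: pre_inverse_image_simps P.germ_in_germ_module)
  ultimately obtain Z where Z: "openin X Z" "x \<in> Z" "Z \<subseteq> preim X f W" "Z \<subseteq> preim X f W'"
    and "restr ?P (preim X f W) Z ?g = restr ?P (preim X f W') Z ?g'"
    using PP.germ_eqD[OF openin_preim[OF f W'(1)], of "{x}" ?g' "preim X f W" ?g] x V by blast
  then have eqZ: "germ Y P (f ` Z) W w = germ Y P (f ` Z) W' w'"
    by (simp add: pre_inverse_image_simps P.germ_res_germ[OF W(1) image_preim W(2) image_mono]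
        P.germ_res_germ[OF W'(1) image_preim W'(2) image_mono])
  have "f ` Z \<subseteq> W'" using Z(4) by (auto simp: preim_def)
  then obtain N where "openin Y N" "f ` Z \<subseteq> N" "N \<subseteq> W" "N \<subseteq> W'" "restr P W N w = restr P W' N w'"
    using P.germ_eqD[OF W'(1) _ W'(2) eqZ] by blast
  then show ?thesis using Z(2) by blast
qed

lemma restr_unit:
  assumes P: "presheaf R Y P" and W: "openin Y W" "w \<in> carrier (sections P W)"
    and V: "openin X V" "V \<subseteq> preim X f W"
  shows "restr (pull P) (preim X f W) V (eta P W w)
    = copy_code X (big P) V (restr (big P) (preim X f W) V (big_unit P W w))"
  unfolding unit_eq
  by (rule mor_restr[OF copy_big(2)[OF P P] openin_preim[OF f W(1)] V])
    (use mor_closed[OF big_unit_mor[OF P] W] in simp)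

lemma unit_local:
  assumes P: "presheaf R Y P" and U: "openin X U" and \<sigma>: "\<sigma> \<in> carrier (sections (pull P) U)" and x: "x \<in> U"
  shows "\<exists>V W w. openin X V \<and> x \<in> V \<and> V \<subseteq> U \<and> openin Y W \<and> V \<subseteq> preim X f W \<and>
    w \<in> carrier (sections P W) \<and> restr (pull P) U V \<sigma> = restr (pull P) (preim X f W) V (eta P W w)"
proof -
  note C = copy_big[OF P P]
  let ?\<sigma> = "copy_decode X (big P) U \<sigma>"
  have d: "?\<sigma> \<in> carrier (sections (big P) U)" by (rule mor_closed[OF C(3) U \<sigma>])
  from big_unit_local[OF P U d x] obtain V W w where V: "openin X V" "x \<in> V" "V \<subseteq> U"
    and W: "openin Y W" "w \<in> carrier (sections P W)" "V \<subseteq> preim X f W"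
    and eq: "restr (big P) U V ?\<sigma> = restr (big P) (preim X f W) V (big_unit P W w)" by blast
  have "restr (pull P) U V \<sigma> = copy_code X (big P) V (restr (big P) U V ?\<sigma>)"
    using mor_restr[OF C(2) U V(1,3) d] C(5)[OF U \<sigma>] by simp
  then have "restr (pull P) U V \<sigma> = restr (pull P) (preim X f W) V (eta P W w)"
    unfolding restr_unit[OF P W(1,2) V(1) W(3)] eq .
  then show ?thesis using V W by blast
qed

lemma unit_eqD:
  assumes P: "presheaf R Y P" and W: "openin Y W" "w \<in> carrier (sections P W)"
    and W': "openin Y W'" "w' \<in> carrier (sections P W')"
    and V: "openin X V" "V \<subseteq> preim X f W" "V \<subseteq> preim X f W'"
    and eq: "restr (pull P) (preim X f W) V (eta P W w) = restr (pull P) (preim X f W') V (eta P W' w')"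
    and x: "x \<in> V"
  shows "\<exists>N. openin Y N \<and> f x \<in> N \<and> N \<subseteq> W \<and> N \<subseteq> W' \<and> restr P W N w = restr P W' N w'"
proof (rule big_unit_eqD[OF P W W' V _ x])
  note C = copy_big[OF P P]
  interpret B: sheaf R X "big P" by (rule big_sheaf[OF P])
  have cl: "restr (big P) (preim X f Z) V (big_unit P Z z) \<in> carrier (sections (big P) V)"
    if "openin Y Z" "z \<in> carrier (sections P Z)" "V \<subseteq> preim X f Z" for Z z
    using mor_closed[OF big_unit_mor[OF P] that(1,2)] that
    by (intro B.restr_closed openin_preim[OF f] V) auto
  show "restr (big P) (preim X f W) V (big_unit P W w) = restr (big P) (preim X f W') V (big_unit P W' w')"
    using eq C(4)[OF V(1) cl[OF W V(2)]] C(4)[OF V(1) cl[OF W' V(3)]]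
    unfolding restr_unit[OF P W V(1,2)] restr_unit[OF P W' V(1,3)] by metis
qed

text \<open>The transpose is forced on restrictions of unit sections, which gives a relation between
  local sections of the pullback and of \<open>Q\<close>. It is locally total by
  \<open>unit_local\<close> and single-valued by \<open>unit_eqD\<close>, so
  \<open>local_relation_mor\<close> turns it into a morphism.\<close>

lemma adjunct_exists:
  assumes P: "presheaf R Y P" and Q: "sheaf R X Q" and \<alpha>: "\<alpha> \<in> mor R Y P (direct_image X f Q)"
  shows "\<exists>\<beta>\<in>mor R X (pull P) Q. \<forall>W. openin Y W \<longrightarrow> (\<forall>w\<in>carrier (sections P W). \<beta> (preim X f W) (eta P W w) = \<alpha> W w)"
proof -
  interpret P: presheaf R Y P by fact
  interpret Q: sheaf R X Q by fact
  interpret I: sheaf R X "pull P" by (rule pull_sheaf[OF P])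
  note op = openin_preim[OF f]
  note \<eta> = unit_mor[OF P]
  have ucl: "eta P W w \<in> carrier (sections (pull P) (preim X f W))" if "openin Y W" "w \<in> carrier (sections P W)" for W w
    using mor_closed[OF \<eta> that] by simp
  have acl: "\<alpha> W w \<in> carrier (sections Q (preim X f W))" if "openin Y W" "w \<in> carrier (sections P W)" for W w
    using mor_closed[OF \<alpha> that] by simp
  have ures: "eta P N (restr P W N w) = restr (pull P) (preim X f W) (preim X f N) (eta P W w)"
    if "openin Y W" "openin Y N" "N \<subseteq> W" "w \<in> carrier (sections P W)" for W N w
    using mor_restr[OF \<eta> that] by simp
  have ares: "\<alpha> N (restr P W N w) = restr Q (preim X f W) (preim X f N) (\<alpha> W w)"
    if "openin Y W" "openin Y N" "N \<subseteq> W" "w \<in> carrier (sections P W)" for W N w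
    using mor_restr[OF \<alpha> that] by simp
  define G where "G V s t \<longleftrightarrow> (\<exists>W w. openin Y W \<and> V \<subseteq> preim X f W \<and> w \<in> carrier (sections P W) \<and>
    s = restr (pull P) (preim X f W) V (eta P W w) \<and> t = restr Q (preim X f W) V (\<alpha> W w))" for V s t
  have GE: "\<exists>W w. openin Y W \<and> V \<subseteq> preim X f W \<and> w \<in> carrier (sections P W) \<and>
    s = restr (pull P) (preim X f W) V (eta P W w) \<and> t = restr Q (preim X f W) V (\<alpha> W w)" if "G V s t" for V s t
    using that by (simp add: G_def)
  have GI: "G V (restr (pull P) (preim X f W) V (eta P W w)) (restr Q (preim X f W) V (\<alpha> W w))"
    if "openin Y W" "V \<subseteq> preim X f W" "w \<in> carrier (sections P W)" for V W w
    using that unfolding G_def by blast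
  have "\<exists>\<beta>\<in>mor R X (pull P) Q. \<forall>V s t. openin X V \<and> G V s t \<longrightarrow> \<beta> V s = t"
  proof (rule local_relation_mor[OF I.presheaf_axioms Q])
    fix V s t assume V: "openin X V" and "G V s t"
    then show "s \<in> carrier (sections (pull P) V) \<and> t \<in> carrier (sections Q V)"
      using GE[of V s t] by (auto intro!: I.restr_closed Q.restr_closed op ucl acl)
  next
    fix V Z s t assume V: "openin X V" "openin X Z" "Z \<subseteq> V" and G: "G V s t"
    obtain W w where W: "openin Y W" "V \<subseteq> preim X f W" "w \<in> carrier (sections P W)"
      and s: "s = restr (pull P) (preim X f W) V (eta P W w)" and t: "t = restr Q (preim X f W) V (\<alpha> W w)"
      using GE[OF G] by blast
    have "restr (pull P) V Z s = restr (pull P) (preim X f W) Z (eta P W w)"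
      unfolding s by (rule I.restr_restr[OF op[OF W(1)] V(1,2,3) W(2) ucl[OF W(1,3)]])
    moreover have "restr Q V Z t = restr Q (preim X f W) Z (\<alpha> W w)"
      unfolding t by (rule Q.restr_restr[OF op[OF W(1)] V(1,2,3) W(2) acl[OF W(1,3)]])
    ultimately show "G Z (restr (pull P) V Z s) (restr Q V Z t)"
      using GI[OF W(1) subset_trans[OF V(3) W(2)] W(3)] by simp
  next
    fix V s t s' t' assume V: "openin X V" and G: "G V s t" and G': "G V s' t'"
    obtain W w where W: "openin Y W" "V \<subseteq> preim X f W" "w \<in> carrier (sections P W)"
      and s: "s = restr (pull P) (preim X f W) V (eta P W w)" and t: "t = restr Q (preim X f W) V (\<alpha> W w)"
      using GE[OF G] by blast
    obtain W' w' where W': "openin Y W'" "V \<subseteq> preim X f W'" "w' \<in> carrier (sections P W')"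
      and s': "s' = restr (pull P) (preim X f W') V (eta P W' w')" and t': "t' = restr Q (preim X f W') V (\<alpha> W' w')"
      using GE[OF G'] by blast
    \<comment> \<open>Two unit sections can be added once their sections downstairs are restricted
      to a common open set, whose preimage still contains \<open>V\<close>.\<close>
    define N where "N = W \<inter> W'"
    have N: "openin Y N" "N \<subseteq> W" "N \<subseteq> W'" "V \<subseteq> preim X f N" using W W' by (auto simp: N_def preim_def)
    define z where "z = restr P W N w"
    define z' where "z' = restr P W' N w'"
    have z: "z \<in> carrier (sections P N)" "z' \<in> carrier (sections P N)"
      using W W' N by (auto simp: z_def z'_def P.restr_closed)
    have "s = restr (pull P) (preim X f N) V (eta P N z)" "t = restr Q (preim X f N) V (\<alpha> N z)"
      unfolding s t z_def using W N V
      by (simp_all add: ures ares I.restr_restr Q.restr_restr op ucl acl preim_mono)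
    moreover have "s' = restr (pull P) (preim X f N) V (eta P N z')" "t' = restr Q (preim X f N) V (\<alpha> N z')"
      unfolding s' t' z'_def using W' N V
      by (simp_all add: ures ares I.restr_restr Q.restr_restr op ucl acl preim_mono)
    ultimately have "s \<oplus>\<^bsub>sections (pull P) V\<^esub> s' = restr (pull P) (preim X f N) V (eta P N (z \<oplus>\<^bsub>sections P N\<^esub> z'))"
      "t \<oplus>\<^bsub>sections Q V\<^esub> t' = restr Q (preim X f N) V (\<alpha> N (z \<oplus>\<^bsub>sections P N\<^esub> z'))"
      using N z V mor_add[OF \<eta> N(1) z] mor_add[OF \<alpha> N(1) z]
      by (simp_all add: I.restr_add Q.restr_add op ucl acl)
    then show "G V (s \<oplus>\<^bsub>sections (pull P) V\<^esub> s') (t \<oplus>\<^bsub>sections Q V\<^esub> t')"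
      using GI[OF N(1,4) P.add_section[OF N(1) z]] by simp
  next
    fix V a s t assume V: "openin X V" and a: "a \<in> carrier R" and G: "G V s t"
    obtain W w where W: "openin Y W" "V \<subseteq> preim X f W" "w \<in> carrier (sections P W)"
      and s: "s = restr (pull P) (preim X f W) V (eta P W w)" and t: "t = restr Q (preim X f W) V (\<alpha> W w)"
      using GE[OF G] by blast
    have "a \<odot>\<^bsub>sections (pull P) V\<^esub> s = restr (pull P) (preim X f W) V (eta P W (a \<odot>\<^bsub>sections P W\<^esub> w))"
      "a \<odot>\<^bsub>sections Q V\<^esub> t = restr Q (preim X f W) V (\<alpha> W (a \<odot>\<^bsub>sections P W\<^esub> w))"
      unfolding s t using W V a mor_smult[OF \<eta> W(1) a W(3)] mor_smult[OF \<alpha> W(1) a W(3)]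
      by (simp_all add: I.restr_smult Q.restr_smult op ucl acl)
    then show "G V (a \<odot>\<^bsub>sections (pull P) V\<^esub> s) (a \<odot>\<^bsub>sections Q V\<^esub> t)"
      using GI[OF W(1,2) P.smult_section[OF W(1) a W(3)]] by simp
  next
    fix V s t t' assume V: "openin X V" and G: "G V s t" and G': "G V s t'"
    obtain W w where W: "openin Y W" "V \<subseteq> preim X f W" "w \<in> carrier (sections P W)"
      and s: "s = restr (pull P) (preim X f W) V (eta P W w)" and t: "t = restr Q (preim X f W) V (\<alpha> W w)"
      using GE[OF G] by blast
    obtain W' w' where W': "openin Y W'" "V \<subseteq> preim X f W'" "w' \<in> carrier (sections P W')"
      and s': "s = restr (pull P) (preim X f W') V (eta P W' w')" and t': "t' = restr Q (preim X f W') V (\<alpha> W' w')"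
      using GE[OF G'] by blast
    have tc: "t \<in> carrier (sections Q V)" "t' \<in> carrier (sections Q V)"
      unfolding t t' using V W W' by (simp_all add: Q.restr_closed op acl)
    \<comment> \<open>The sections \<open>w\<close> and \<open>w'\<close> agree only near each
      \<open>f x\<close>, so equality of the prescribed values is verified locally in
      \<open>V\<close> and concluded by locality of \<open>Q\<close>.\<close>
    show "t = t'"
    proof (rule Q.section_eqI[OF V tc])
      fix x assume x: "x \<in> V"
      obtain N where N: "openin Y N" "f x \<in> N" "N \<subseteq> W" "N \<subseteq> W'" "restr P W N w = restr P W' N w'"
        using unit_eqD[OF P W(1,3) W'(1,3) V W(2) W'(2) _ x] s s' by metis
      define Z where "Z = V \<inter> preim X f N"
      have Z: "openin X Z" "x \<in> Z" "Z \<subseteq> V" "Z \<subseteq> preim X f N"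
        using V op[OF N(1)] N(2) x W(2) by (auto simp: Z_def preim_def)
      have ZW: "Z \<subseteq> preim X f W" "Z \<subseteq> preim X f W'" using Z W W' by auto
      have "restr Q V Z t = restr Q (preim X f N) Z (\<alpha> N (restr P W N w))"
        unfolding t using W N(1-4) V Z ZW by (simp add: ares Q.restr_restr op acl preim_mono)
      also have "\<dots> = restr Q V Z t'"
        unfolding t' N(5) using W' N(1-4) V Z ZW by (simp add: ares Q.restr_restr op acl preim_mono)
      finally show "\<exists>Z. openin X Z \<and> x \<in> Z \<and> Z \<subseteq> V \<and> restr Q V Z t = restr Q V Z t'" using Z by blast
    qed
  next
    fix U s x assume U: "openin X U" and s: "s \<in> carrier (sections (pull P) U)" and x: "x \<in> U"
    from unit_local[OF P U s x] obtain V W w where V: "openin X V" "x \<in> V" "V \<subseteq> U"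
      and W: "openin Y W" "V \<subseteq> preim X f W" "w \<in> carrier (sections P W)"
      and eq: "restr (pull P) U V s = restr (pull P) (preim X f W) V (eta P W w)" by blast
    have "G V (restr (pull P) U V s) (restr Q (preim X f W) V (\<alpha> W w))"
      unfolding eq by (rule GI[OF W])
    then show "\<exists>V t. openin X V \<and> x \<in> V \<and> V \<subseteq> U \<and> G V (restr (pull P) U V s) t"
      using V by (intro exI conjI)
  qed
  then obtain \<beta> where \<beta>: "\<beta> \<in> mor R X (pull P) Q" and \<beta>G: "\<forall>V s t. openin X V \<and> G V s t \<longrightarrow> \<beta> V s = t"
    by (elim bexE)
  have "\<beta> (preim X f W) (eta P W w) = \<alpha> W w" if W: "openin Y W" "w \<in> carrier (sections P W)" for W w
    using \<beta>G op[OF W(1)] GI[OF W(1) subset_refl W(2)]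
    by (simp add: I.restr_id[OF op[OF W(1)] ucl[OF W]] Q.restr_id[OF op[OF W(1)] acl[OF W]])
  then show ?thesis using \<beta> by blast
qed

text \<open>Sections of the pullback are locally restrictions of unit sections, and morphisms
  commute with restriction, so agreement on unit sections is agreement everywhere.\<close>

lemma adjunct_unique:
  assumes P: "presheaf R Y P" and Q: "sheaf R X Q" and \<beta>: "\<beta> \<in> mor R X (pull P) Q" and \<gamma>: "\<gamma> \<in> mor R X (pull P) Q"
    and eq: "\<And>W w. \<lbrakk>openin Y W; w \<in> carrier (sections P W)\<rbrakk>
      \<Longrightarrow> \<beta> (preim X f W) (eta P W w) = \<gamma> (preim X f W) (eta P W w)"
  shows "mor_eq X (pull P) \<beta> \<gamma>"
  unfolding mor_eq_def
proof (intro allI impI ballI)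
  interpret Q: sheaf R X Q by fact
  fix U s assume U: "openin X U" and s: "s \<in> carrier (sections (pull P) U)"
  show "\<beta> U s = \<gamma> U s"
  proof (rule Q.section_eqI[OF U mor_closed[OF \<beta> U s] mor_closed[OF \<gamma> U s]])
    fix x assume x: "x \<in> U"
    from unit_local[OF P U s x] obtain V W w where V: "openin X V" "x \<in> V" "V \<subseteq> U"
      and W: "openin Y W" "V \<subseteq> preim X f W" "w \<in> carrier (sections P W)"
      and r: "restr (pull P) U V s = restr (pull P) (preim X f W) V (eta P W w)" by blast
    have u: "eta P W w \<in> carrier (sections (pull P) (preim X f W))"
      using mor_closed[OF unit_mor[OF P] W(1,3)] by simp
    have "restr Q U V (\<beta> U s) = restr Q U V (\<gamma> U s)"
      using mor_restr[OF \<beta> U V(1,3) s] mor_restr[OF \<gamma> U V(1,3) s] eq[OF W(1,3)]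
        mor_restr[OF \<beta> openin_preim[OF f W(1)] V(1) W(2) u] mor_restr[OF \<gamma> openin_preim[OF f W(1)] V(1) W(2) u]
      by (simp add: r)
    then show "\<exists>V. openin X V \<and> x \<in> V \<and> V \<subseteq> U \<and> restr Q U V (\<beta> U s) = restr Q U V (\<gamma> U s)"
      using V by blast
  qed
qed

lemma inverse_image_mor_mor:
  assumes P: "presheaf R Y P" and Q: "presheaf R Y Q" and \<alpha>: "\<alpha> \<in> mor R Y P Q"
  shows "inverse_image_mor X Y f P Q \<alpha> \<in> mor R X (pull P) (pull Q)"
proof -
  let ?s = "sheafify_mor X (pre_inverse_image Y f Q) (pre_inverse_image_mor Y f Q \<alpha>)"
  have s: "?s \<in> mor R X (big P) (big Q)"
    by (rule presheaf.sheafify_mor_mor[OF pre_inverse_image_presheaf[OF f P] pre_inverse_image_presheaf[OF f Q]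
      pre_inverse_image_mor_mor[OF P Q \<alpha>]])
  have "mor_comp (copy_code X (big Q)) (mor_comp ?s (copy_decode X (big P))) \<in> mor R X (pull P) (pull Q)"
    by (rule mor_comp_mor[OF mor_comp_mor[OF copy_big(3)[OF P P] s] copy_big(2)[OF Q Q]])
  then show ?thesis by (simp add: inverse_image_mor_def mor_comp_def comp_def)
qed

text \<open>Naturality of the unit. Combined with \<open>adjunct_unique\<close> it allows identities
  between pulled back morphisms to be checked downstairs, without opening sheafification or
  encodings again.\<close>

lemma inverse_image_mor_unit:
  assumes P: "presheaf R Y P" and Q: "presheaf R Y Q" and \<alpha>: "\<alpha> \<in> mor R Y P Q"
    and W: "openin Y W" "w \<in> carrier (sections P W)"
  shows "inverse_image_mor X Y f P Q \<alpha> (preim X f W) (eta P W w) = (eta Q W (\<alpha> W w) :: 'u)"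
proof -
  interpret P: presheaf R Y P by fact
  have op: "openin X (preim X f W)" by (rule openin_preim[OF f W(1)])
  have b: "big_unit P W w \<in> carrier (sections (big P) (preim X f W))"
    using mor_closed[OF big_unit_mor[OF P] W] by simp
  have g: "germ Y P (f ` preim X f W) W w \<in> carrier (sections (pre_inverse_image Y f P) (preim X f W))"
    using W image_preim[of W] by (simp add: pre_inverse_image_simps P.germ_in_germ_module)
  have "sheafify_mor X (pre_inverse_image Y f Q) (pre_inverse_image_mor Y f Q \<alpha>) (preim X f W) (big_unit P W w)
      = big_unit Q W (\<alpha> W w)"
    unfolding big_unit_def
    using presheaf.sheafify_mor_unit[OF pre_inverse_image_presheaf[OF f P] pre_inverse_image_presheaf[OF f Q]
        pre_inverse_image_mor_mor[OF P Q \<alpha>] op g] W image_preim[of W]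
    by (simp add: pre_inverse_image_mor_eq P.germ_map_germ[OF Q \<alpha>])
  then show ?thesis
    using copy_big(4)[OF P P op b] by (simp add: inverse_image_mor_def unit_eq)
qed

end


section \<open>Godement sheaves of coinduced modules and their extension property\<close>

section \<open>Injective sheaves\<close>

lemma zero_mor:
  assumes P: "presheaf R X P" and Q: "presheaf R X Q"
  shows "(\<lambda>U s. \<zero>\<^bsub>sections Q U\<^esub>) \<in> mor R X P Q"
proof (rule morI)
  fix U assume U: "openin X U"
  interpret M: Module.module R "sections Q U" by (rule presheaf.sections_module[OF Q U])
  show "(\<lambda>s. \<zero>\<^bsub>sections Q U\<^esub>) \<in> mod_hom R (sections P U) (sections Q U)"
    by (rule mod_homI) simp_all
qed (simp add: presheaf.restr_zero[OF Q])

text \<open>With it, the cokernel of a zero morphism becomes an embedding of its target; both the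
  embedding into a Godement sheaf and the start of a resolution are obtained this way.\<close>

lemma image_sections_zero:
  assumes P: "presheaf R X P" and Q: "sheaf R X Q" and U: "openin X U"
    and s: "s \<in> image_sections X P Q (\<lambda>U s. \<zero>\<^bsub>sections Q U\<^esub>) U"
  shows "s = \<zero>\<^bsub>sections Q U\<^esub>"
proof -
  interpret Q: sheaf R X Q by fact
  have sc: "s \<in> carrier (sections Q U)" using s by (simp add: image_sections_def)
  show ?thesis
  proof (rule Q.section_eqI[OF U sc Q.zero_section[OF U]])
    fix x assume "x \<in> U"
    then obtain V where "openin X V" "x \<in> V" "V \<subseteq> U" "restr Q U V s = \<zero>\<^bsub>sections Q V\<^esub>"
      using s by (auto simp: image_sections_def)
    then show "\<exists>V. openin X V \<and> x \<in> V \<and> V \<subseteq> U \<and> restr Q U V s = restr Q U V \<zero>\<^bsub>sections Q U\<^esub>"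
      using Q.restr_zero[OF U] by auto
  qed
qed

lemma image_sections_submodule:
  assumes P: "sheaf R X P" and Q: "sheaf R X Q" and \<alpha>: "\<alpha> \<in> mor R X P Q" and U: "openin X U"
  shows "submodule (image_sections X P Q \<alpha> U) R (sections Q U)"
proof -
  interpret Q: sheaf R X Q by fact
  interpret M: Module.module R "sections Q U" by (rule Q.sections_module[OF U])
  have "Module.module R (sections (sub_presheaf Q (image_sections X P Q \<alpha>)) U)"
    by (rule presheaf.sections_module[OF sheaf_presheaf[OF image_sheaf[OF P Q \<alpha>]] U])
  then show ?thesis
    by (intro M.module_incl_imp_submodule) (auto simp: image_sections_def)
qed

text \<open>The sheaf \<open>V \<mapsto> \<Prod>\<^sub>i Hom(R, D i)\<close>, the product ranging over the indices \<open>i\<close> with \<open>p i \<in> V\<close>.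
  For \<open>p\<close> the identity these are Godement sheaves; the general form makes the family closed
  under direct images.\<close>

definition godement :: "'r ring \<Rightarrow> 'i set \<Rightarrow> ('i \<Rightarrow> 'y) \<Rightarrow> ('i \<Rightarrow> 'd monoid) \<Rightarrow> ('y, 'r, 'i \<Rightarrow> 'r \<Rightarrow> 'd) presheaf" where
  "godement R I p D = \<lparr>sections = (\<lambda>V. prod_module {i \<in> I. p i \<in> V} (\<lambda>i. coind_module R (D i))),
     restr = (\<lambda>U V s. restrict s {i \<in> I. p i \<in> V})\<rparr>"

lemma godement_simps:
  "sections (godement R I p D) V = prod_module {i \<in> I. p i \<in> V} (\<lambda>i. coind_module R (D i))"
  "restr (godement R I p D) U V s = restrict s {i \<in> I. p i \<in> V}"
  by (simp_all add: godement_def)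

lemma direct_image_godement:
  "direct_image X f (godement R (topspace X) (\<lambda>x. x) D) = godement R (topspace X) f D"
proof -
  have "{i \<in> topspace X. i \<in> preim X f V} = {i \<in> topspace X. f i \<in> V}" for V
    by (auto simp: preim_def)
  then show ?thesis by (simp add: direct_image_def godement_def)
qed

lemma godement_sheaf:
  fixes p :: "'i \<Rightarrow> 'y"
  assumes R: "cring R" and D: "\<And>i. i \<in> I \<Longrightarrow> comm_group (D i)"
  shows "sheaf R Y (godement R I p D)"
proof (intro sheaf.intro presheaf.intro presheaf_axioms.intro sheaf_axioms.intro)
  let ?G = "godement R I p D" and ?C = "\<lambda>i. coind_module R (D i)"
  show "cring R" by fact
  show "Module.module R (sections ?G U)" for U
    unfolding godement_simps by (rule prod_module_module[OF R], rule coind_module_module[OF R D]) simp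
  show "restr ?G U V \<in> mod_hom R (sections ?G U) (sections ?G V)" if "V \<subseteq> U" for U V
    by (rule mod_homI) (use that in \<open>auto simp: godement_simps PiE_iff fun_eq_iff
          simp del: coind_module_simps\<close>)
  show "restr ?G U U s = s" if "s \<in> carrier (sections ?G U)" for U s
    using that by (simp add: godement_simps PiE_iff extensional_restrict)
  show "restr ?G V W (restr ?G U V s) = restr ?G U W s" if "W \<subseteq> V" for U V W s
    using that by (auto simp: godement_simps fun_eq_iff)
next
  let ?G = "godement R I p D"
  fix \<U> s t
  assume s: "s \<in> carrier (sections ?G (\<Union>\<U>))" and t: "t \<in> carrier (sections ?G (\<Union>\<U>))"
    and eq: "\<And>V. V \<in> \<U> \<Longrightarrow> restr ?G (\<Union>\<U>) V s = restr ?G (\<Union>\<U>) V t"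
  show "s = t"
  proof (rule extensionalityI[of _ "{i \<in> I. p i \<in> \<Union>\<U>}"])
    fix i assume "i \<in> {i \<in> I. p i \<in> \<Union>\<U>}"
    then obtain V where "V \<in> \<U>" "p i \<in> V" "i \<in> I" by blast
    then show "s i = t i" using fun_cong[OF eq, of V i] by (simp add: godement_simps)
  qed (use s t in \<open>simp_all add: godement_simps PiE_iff\<close>)
next
  let ?G = "godement R I p D"
  fix \<U> :: "'y set set" and \<sigma>
  assume \<sigma>: "\<And>V. V \<in> \<U> \<Longrightarrow> \<sigma> V \<in> carrier (sections ?G V)"
    and comp: "\<And>V W. \<lbrakk>V \<in> \<U>; W \<in> \<U>\<rbrakk> \<Longrightarrow> restr ?G V (V \<inter> W) (\<sigma> V) = restr ?G W (V \<inter> W) (\<sigma> W)"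
  define c where "c i = (SOME V. V \<in> \<U> \<and> p i \<in> V)" for i
  define s where "s = (\<lambda>i\<in>{i \<in> I. p i \<in> \<Union>\<U>}. \<sigma> (c i) i)"
  have c: "c i \<in> \<U> \<and> p i \<in> c i" if "V \<in> \<U>" "p i \<in> V" for i V
    unfolding c_def by (rule someI[of _ V]) (use that in simp)
  have s: "s i = \<sigma> V i" if "V \<in> \<U>" "p i \<in> V" "i \<in> I" for V i
    using fun_cong[OF comp[OF that(1), of "c i"], of i] c[OF that(1,2)] that
    by (auto simp: s_def godement_simps)
  have car: "\<sigma> V i \<in> carrier (coind_module R (D i))" if "V \<in> \<U>" "p i \<in> V" "i \<in> I" for V i
    using \<sigma>[OF that(1)] that(2,3) by (simp add: godement_simps PiE_iff del: coind_module_simps)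
  have "s \<in> carrier (sections ?G (\<Union>\<U>))"
    unfolding godement_simps prod_module_simps
  proof (rule PiE_I)
    fix i assume "i \<in> {i \<in> I. p i \<in> \<Union>\<U>}"
    then obtain V where V: "V \<in> \<U>" "p i \<in> V" "i \<in> I" by blast
    then show "s i \<in> carrier (coind_module R (D i))" using s[OF V] car[OF V] by simp
  qed (auto simp: s_def)
  moreover have "restr ?G (\<Union>\<U>) V s = \<sigma> V" if "V \<in> \<U>" for V
    unfolding godement_simps
    by (rule extensionalityI[of _ "{i \<in> I. p i \<in> V}"])
      (use that \<sigma>[OF that] s in \<open>auto simp: godement_simps PiE_iff simp del: coind_module_simps\<close>)
  ultimately show "\<exists>s\<in>carrier (sections ?G (\<Union>\<U>)). \<forall>V\<in>\<U>. restr ?G (\<Union>\<U>) V s = \<sigma> V" by blast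
qed

text \<open>The morphism that corresponds to additive maps \<open>h i\<close> from the stalks at
  \<open>p i\<close> to \<open>D i\<close> under the adjunction for coinduced modules: a section
  \<open>t\<close> goes to the map sending \<open>r\<close> to the value of \<open>h i\<close> at
  the germ of \<open>r t\<close>.\<close>

definition coinduced_mor ::
  "'r ring \<Rightarrow> 'y topology \<Rightarrow> ('y, 'r, 'm) presheaf \<Rightarrow> 'i set \<Rightarrow> ('i \<Rightarrow> 'y) \<Rightarrow> ('i \<Rightarrow> ('y set \<times> 'm) set \<Rightarrow> 'd)
    \<Rightarrow> 'y set \<Rightarrow> 'm \<Rightarrow> 'i \<Rightarrow> 'r \<Rightarrow> 'd" where
  "coinduced_mor R Y B I p h = (\<lambda>V t. \<lambda>i\<in>{i \<in> I. p i \<in> V}. \<lambda>r\<in>carrier R. h i (germ Y B {p i} V (r \<odot>\<^bsub>sections B V\<^esub> t)))"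

lemma coinduced_mor_mor:
  assumes B: "presheaf R Y B"
    and h: "\<And>i. i \<in> I \<Longrightarrow> p i \<in> topspace Y \<Longrightarrow> h i \<in> hom (add_monoid (germ_module Y B {p i})) (D i)"
  shows "coinduced_mor R Y B I p h \<in> mor R Y B (godement R I p D)"
proof -
  interpret B: presheaf R Y B by fact
  have hm: "h i (germ Y B {p i} V s) \<in> carrier (D i)"
    if "openin Y V" "i \<in> I" "p i \<in> V" "s \<in> carrier (sections B V)" for V i s
    using h[of i] that B.openin_sub[OF that(1)] B.germ_in_germ_module[OF that(1) _ that(4), of "{p i}"]
    by (auto simp: hom_def Pi_iff)
  have ha: "h i (germ Y B {p i} V (s \<oplus>\<^bsub>sections B V\<^esub> t)) = h i (germ Y B {p i} V s) \<otimes>\<^bsub>D i\<^esub> h i (germ Y B {p i} V t)"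
    if "openin Y V" "i \<in> I" "p i \<in> V" "s \<in> carrier (sections B V)" "t \<in> carrier (sections B V)" for V i s t
  proof -
    have pV: "{p i} \<subseteq> V" "p i \<in> topspace Y" using that(3) B.openin_sub[OF that(1)] by auto
    show ?thesis
      using hom_mult[OF h[OF that(2) pV(2)], of "germ Y B {p i} V s" "germ Y B {p i} V t"]
        B.germ_in_germ_module[OF that(1) pV(1)] B.germ_add[OF that(1) pV(1) that(4,5)] that(4,5) by simp
  qed
  show ?thesis
  proof (rule morI)
    fix V assume V: "openin Y V"
    interpret M: Module.module R "sections B V" by (rule B.sections_module[OF V])
    show "coinduced_mor R Y B I p h V \<in> mod_hom R (sections B V) (sections (godement R I p D) V)"
    proof (rule mod_homI)
      fix t assume t: "t \<in> carrier (sections B V)"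
      show "coinduced_mor R Y B I p h V t \<in> carrier (sections (godement R I p D) V)"
        unfolding godement_simps prod_module_simps coinduced_mor_def
        using V t by (auto simp: hom_def hm ha M.smult_l_distr)
    next
      fix s t assume s: "s \<in> carrier (sections B V)" and t: "t \<in> carrier (sections B V)"
      show "coinduced_mor R Y B I p h V (s \<oplus>\<^bsub>sections B V\<^esub> t) =
          coinduced_mor R Y B I p h V s \<oplus>\<^bsub>sections (godement R I p D) V\<^esub> coinduced_mor R Y B I p h V t"
        unfolding godement_simps prod_module_simps coinduced_mor_def
        using V s t by (auto simp: fun_eq_iff ha M.smult_r_distr)
    next
      fix a t assume a: "a \<in> carrier R" and t: "t \<in> carrier (sections B V)"
      show "coinduced_mor R Y B I p h V (a \<odot>\<^bsub>sections B V\<^esub> t) =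
          a \<odot>\<^bsub>sections (godement R I p D) V\<^esub> coinduced_mor R Y B I p h V t"
        unfolding godement_simps prod_module_simps coinduced_mor_def
        using a t by (auto simp: fun_eq_iff M.smult_assoc1)
    qed
  next
    fix U V s assume UV: "openin Y U" "openin Y V" "V \<subseteq> U" and s: "s \<in> carrier (sections B U)"
    have "germ Y B {p i} V (r \<odot>\<^bsub>sections B V\<^esub> restr B U V s) = germ Y B {p i} U (r \<odot>\<^bsub>sections B U\<^esub> s)"
      if "p i \<in> V" "r \<in> carrier R" for i r
      using B.germ_restr[OF UV(1,2) _ UV(3) B.smult_section[OF UV(1) that(2) s], of "{p i}"] that
      by (simp add: B.restr_smult[OF UV that(2) s])
    then show "restr (godement R I p D) U V (coinduced_mor R Y B I p h U s) =
        coinduced_mor R Y B I p h V (restr B U V s)"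
      using UV(3) by (auto simp: godement_simps coinduced_mor_def fun_eq_iff)
  qed
qed

text \<open>By the adjunction for coinduced modules, \<open>g\<close> amounts to one additive map
  per index, from the stalk of \<open>A\<close> to \<open>D i\<close>. Since \<open>\<iota>\<close>
  is injective on germs, this is a partial homomorphism on the stalk of \<open>B\<close>, and
  divisibility extends it.\<close>

lemma godement_extension:
  assumes R: "cring R" and D: "\<And>i. i \<in> I \<Longrightarrow> comm_group (D i) \<and> divisible_group (D i)"
    and A: "presheaf R Y A" and B: "presheaf R Y B" and \<iota>: "\<iota> \<in> mor R Y A B" and mono: "mono_sheaf Y A \<iota>"
    and g: "g \<in> mor R Y A (godement R I p D)"
  shows "\<exists>h\<in>mor R Y B (godement R I p D). mor_eq Y A (mor_comp h \<iota>) g"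
proof -
  let ?G = "godement R I p D"
  interpret A: presheaf R Y A by fact
  interpret B: presheaf R Y B by fact
  interpret R: cring R by fact
  have "\<exists>h\<in>hom (add_monoid (germ_module Y B {p i})) (D i).
      \<forall>V s. openin Y V \<and> p i \<in> V \<and> s \<in> carrier (sections A V) \<longrightarrow> h (germ Y B {p i} V (\<iota> V s)) = g V s i \<one>\<^bsub>R\<^esub>"
    if i: "i \<in> I" and pi: "p i \<in> topspace Y" for i
  proof -
    let ?S = "germ_module Y B {p i}"
    interpret S: Module.module R ?S by (rule B.germ_module_module) (use pi in simp)
    interpret Dg: comm_group "D i" using D[OF i] by simp
    \<comment> \<open>The graph, inside the stalk of \<open>B\<close> times \<open>D i\<close>, of
      the map that sends the germ of \<open>\<iota> s\<close> to \<open>g s\<close> at index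
      \<open>i\<close> evaluated at one.\<close>
    define \<Gamma> where "\<Gamma> = {(germ Y B {p i} V (\<iota> V s), g V s i \<one>\<^bsub>R\<^esub>) | V s.
      openin Y V \<and> p i \<in> V \<and> s \<in> carrier (sections A V)}"
    have I: "(germ Y B {p i} V (\<iota> V s), g V s i \<one>\<^bsub>R\<^esub>) \<in> \<Gamma>" if "openin Y V" "p i \<in> V" "s \<in> carrier (sections A V)" for V s
      using that by (auto simp: \<Gamma>_def)
    have gcl: "g V s i \<in> carrier (coind_module R (D i))" if "openin Y V" "p i \<in> V" "s \<in> carrier (sections A V)" for V s
      using mor_closed[OF g that(1,3)] that i by (simp add: godement_simps PiE_iff del: coind_module_simps)
    have g1: "g V s i \<one>\<^bsub>R\<^esub> \<in> carrier (D i)" if "openin Y V" "p i \<in> V" "s \<in> carrier (sections A V)" for V s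
      using gcl[OF that] by (auto simp: hom_def)
    have gadd: "g V (s \<oplus>\<^bsub>sections A V\<^esub> t) i \<one>\<^bsub>R\<^esub> = g V s i \<one>\<^bsub>R\<^esub> \<otimes>\<^bsub>D i\<^esub> g V t i \<one>\<^bsub>R\<^esub>"
      if "openin Y V" "p i \<in> V" "s \<in> carrier (sections A V)" "t \<in> carrier (sections A V)" for V s t
      using mor_add[OF g that(1,3,4)] that i by (simp add: godement_simps)
    have gres: "g W (restr A V W s) i \<one>\<^bsub>R\<^esub> = g V s i \<one>\<^bsub>R\<^esub>"
      if "openin Y V" "openin Y W" "W \<subseteq> V" "p i \<in> W" "s \<in> carrier (sections A V)" for V W s
      using mor_restr[OF g that(1,2,3,5), symmetric] that i by (simp add: godement_simps)
    have gzero: "g V \<zero>\<^bsub>sections A V\<^esub> i \<one>\<^bsub>R\<^esub> = \<one>\<^bsub>D i\<^esub>" if "openin Y V" "p i \<in> V" for V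
    proof -
      interpret M: Module.module R "sections A V" by (rule A.sections_module[OF that(1)])
      show ?thesis using gadd[OF that M.zero_closed M.zero_closed] g1[OF that M.zero_closed] by simp
    qed
    have icl: "\<iota> V s \<in> carrier (sections B V)" if "openin Y V" "s \<in> carrier (sections A V)" for V s
      by (rule mor_closed[OF \<iota> that])
    have gicl: "germ Y B {p i} V (\<iota> V s) \<in> carrier ?S" if "openin Y V" "p i \<in> V" "s \<in> carrier (sections A V)" for V s
      using that by (intro B.germ_in_germ_module icl) auto
    have ires: "germ Y B {p i} W (\<iota> W (restr A V W s)) = germ Y B {p i} V (\<iota> V s)"
      if "openin Y V" "openin Y W" "W \<subseteq> V" "p i \<in> W" "s \<in> carrier (sections A V)" for V W s
      using B.germ_restr[OF that(1,2) _ that(3) icl[OF that(1,5)], of "{p i}"] mor_restr[OF \<iota> that(1,2,3,5)] that(4)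
      by simp
    interpret Sg: comm_group "add_monoid ?S" by (rule S.a_comm_group)
    let ?P = "add_monoid ?S \<times>\<times> D i"
    interpret P: group ?P by (rule DirProd_group) unfold_locales
    have "subgroup \<Gamma> ?P"
    proof (rule P.subgroupI)
      show "\<Gamma> \<subseteq> carrier ?P" using gicl g1 by (auto simp: \<Gamma>_def)
      show "\<Gamma> \<noteq> {}" using I[OF openin_topspace pi A.zero_section[OF openin_topspace]] by blast
    next
      fix x assume "x \<in> \<Gamma>"
      then obtain V s where V: "openin Y V" "p i \<in> V" "s \<in> carrier (sections A V)"
        and x: "x = (germ Y B {p i} V (\<iota> V s), g V s i \<one>\<^bsub>R\<^esub>)" by (auto simp: \<Gamma>_def)
      interpret M: Module.module R "sections A V" by (rule A.sections_module[OF V(1)])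
      let ?y = "(germ Y B {p i} V (\<iota> V (\<ominus>\<^bsub>sections A V\<^esub> s)), g V (\<ominus>\<^bsub>sections A V\<^esub> s) i \<one>\<^bsub>R\<^esub>)"
      have "?y \<otimes>\<^bsub>?P\<^esub> x = (germ Y B {p i} V (\<iota> V \<zero>\<^bsub>sections A V\<^esub>), g V \<zero>\<^bsub>sections A V\<^esub> i \<one>\<^bsub>R\<^esub>)"
        using V B.germ_add[OF V(1) _ icl icl, of "{p i}"]
        by (simp add: x gadd[symmetric] mor_add[OF \<iota> V(1), symmetric] M.l_neg)
      also have "\<dots> = \<one>\<^bsub>?P\<^esub>"
        using V gzero[OF V(1,2)] mor_zero[OF \<iota> A B V(1)] B.germ_zero[OF V(1), of "{p i}"] by simp
      finally have "inv\<^bsub>?P\<^esub> x = ?y"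
        using V gicl g1 by (intro P.inv_equality) (auto simp: x)
      then show "inv\<^bsub>?P\<^esub> x \<in> \<Gamma>" using I[OF V(1,2), of "\<ominus>\<^bsub>sections A V\<^esub> s"] V by simp
    next
      fix x y assume "x \<in> \<Gamma>" "y \<in> \<Gamma>"
      then obtain V s W t where V: "openin Y V" "p i \<in> V" "s \<in> carrier (sections A V)"
        and W: "openin Y W" "p i \<in> W" "t \<in> carrier (sections A W)"
        and xy: "x = (germ Y B {p i} V (\<iota> V s), g V s i \<one>\<^bsub>R\<^esub>)" "y = (germ Y B {p i} W (\<iota> W t), g W t i \<one>\<^bsub>R\<^esub>)"
        by (auto simp: \<Gamma>_def)
      define N where "N = V \<inter> W"
      have N: "openin Y N" "p i \<in> N" "N \<subseteq> V" "N \<subseteq> W" using V W by (auto simp: N_def)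
      define s' where "s' = restr A V N s"
      define t' where "t' = restr A W N t"
      have st: "s' \<in> carrier (sections A N)" "t' \<in> carrier (sections A N)"
        using V W N by (auto simp: s'_def t'_def A.restr_closed)
      have x: "x = (germ Y B {p i} N (\<iota> N s'), g N s' i \<one>\<^bsub>R\<^esub>)"
        using V N by (simp add: xy s'_def ires gres)
      have y: "y = (germ Y B {p i} N (\<iota> N t'), g N t' i \<one>\<^bsub>R\<^esub>)"
        using W N by (simp add: xy t'_def ires gres)
      have "x \<otimes>\<^bsub>?P\<^esub> y = (germ Y B {p i} N (\<iota> N (s' \<oplus>\<^bsub>sections A N\<^esub> t')), g N (s' \<oplus>\<^bsub>sections A N\<^esub> t') i \<one>\<^bsub>R\<^esub>)"
        using st N B.germ_add[OF N(1) _ icl[OF N(1) st(1)] icl[OF N(1) st(2)], of "{p i}"]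
        by (simp add: x y gadd mor_add[OF \<iota>])
      then show "x \<otimes>\<^bsub>?P\<^esub> y \<in> \<Gamma>" using I[OF N(1,2) A.add_section[OF N(1) st]] by simp
    qed
    \<comment> \<open>Single-valuedness: if the germ of \<open>\<iota> s\<close> is zero, then
      \<open>\<iota> s\<close> vanishes on a smaller \<open>W\<close>, so \<open>s\<close> vanishes
      there by injectivity, and \<open>g\<close> at index \<open>i\<close> sees only the restriction
      to \<open>W\<close>.\<close>
    moreover have "d = \<one>\<^bsub>D i\<^esub>" if d\<Gamma>: "(\<one>\<^bsub>add_monoid ?S\<^esub>, d) \<in> \<Gamma>" for d
    proof -
      obtain V s where V: "openin Y V" "p i \<in> V" "s \<in> carrier (sections A V)"
        and eq: "\<zero>\<^bsub>?S\<^esub> = germ Y B {p i} V (\<iota> V s)" and d: "d = g V s i \<one>\<^bsub>R\<^esub>" using d\<Gamma> by (auto simp: \<Gamma>_def)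
      have "germ Y B {p i} V \<zero>\<^bsub>sections B V\<^esub> = germ Y B {p i} V (\<iota> V s)"
        using eq B.germ_zero[OF V(1), of "{p i}"] V by simp
      then obtain W where W: "openin Y W" "p i \<in> W" "W \<subseteq> V"
        and "restr B V W \<zero>\<^bsub>sections B V\<^esub> = restr B V W (\<iota> V s)"
        using B.germ_eqD[OF V(1) _ icl[OF V(1,3)], of "{p i}" V "\<zero>\<^bsub>sections B V\<^esub>"] V by auto
      then have "\<iota> W (restr A V W s) = \<iota> W \<zero>\<^bsub>sections A W\<^esub>"
        using V by (simp add: B.restr_zero mor_restr[OF \<iota>] mor_zero[OF \<iota> A B])
      then have "restr A V W s = \<zero>\<^bsub>sections A W\<^esub>"
        using mono V W A.restr_closed[OF V(1) W(1,3) V(3)] A.zero_section[OF W(1)]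
        unfolding mono_sheaf_def by (metis inj_onD)
      then show ?thesis using gres[OF V(1) W(1,3,2) V(3)] gzero[OF W(1,2)] d by simp
    qed
    ultimately have "partial_hom (add_monoid ?S) (D i) \<Gamma>" by (simp add: partial_hom_def)
    from divisible_extension[OF S.a_comm_group Dg.comm_group_axioms _ this] D[OF i]
    obtain h where "h \<in> hom (add_monoid ?S) (D i)" "\<forall>(b, d)\<in>\<Gamma>. h b = d" by blast
    then have "h (germ Y B {p i} V (\<iota> V s)) = g V s i \<one>\<^bsub>R\<^esub>"
      if "openin Y V" "p i \<in> V" "s \<in> carrier (sections A V)" for V s
      using I[OF that] by auto
    then show ?thesis using \<open>h \<in> hom (add_monoid ?S) (D i)\<close> by blast
  qed
  \<comment> \<open>Stated as an implication, so that it holds for every \<open>i\<close> and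
    \<open>choice\<close> yields one function.\<close>
  then have ex: "\<forall>i. \<exists>h. i \<in> I \<and> p i \<in> topspace Y \<longrightarrow> h \<in> hom (add_monoid (germ_module Y B {p i})) (D i) \<and>
      (\<forall>V s. openin Y V \<and> p i \<in> V \<and> s \<in> carrier (sections A V) \<longrightarrow> h (germ Y B {p i} V (\<iota> V s)) = g V s i \<one>\<^bsub>R\<^esub>)"
    by blast
  obtain h where h: "\<And>i. i \<in> I \<Longrightarrow> p i \<in> topspace Y \<Longrightarrow> h i \<in> hom (add_monoid (germ_module Y B {p i})) (D i)"
    and hg: "\<And>i V s. \<lbrakk>i \<in> I; openin Y V; p i \<in> V; s \<in> carrier (sections A V)\<rbrakk>
      \<Longrightarrow> h i (germ Y B {p i} V (\<iota> V s)) = g V s i \<one>\<^bsub>R\<^esub>"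
  proof -
    from ex[THEN choice] obtain h where *: "\<forall>i. i \<in> I \<and> p i \<in> topspace Y \<longrightarrow>
        h i \<in> hom (add_monoid (germ_module Y B {p i})) (D i) \<and>
        (\<forall>V s. openin Y V \<and> p i \<in> V \<and> s \<in> carrier (sections A V) \<longrightarrow> h i (germ Y B {p i} V (\<iota> V s)) = g V s i \<one>\<^bsub>R\<^esub>)" ..
    show thesis
    proof (rule that)
      fix i V s assume "i \<in> I" "openin Y V" "p i \<in> V" "s \<in> carrier (sections A V)"
      then show "h i (germ Y B {p i} V (\<iota> V s)) = g V s i \<one>\<^bsub>R\<^esub>"
        using * openin_subset[of Y V] by (auto simp: subset_iff)
    qed (use * in simp)
  qed
  have "mor_eq Y A (mor_comp (coinduced_mor R Y B I p h) \<iota>) g"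
    unfolding mor_eq_def
  proof (intro allI impI ballI)
    fix V s assume V: "openin Y V" and s: "s \<in> carrier (sections A V)"
    have gs: "g V s \<in> (\<Pi>\<^sub>E i\<in>{i \<in> I. p i \<in> V}. carrier (coind_module R (D i)))"
      using mor_closed[OF g V s] by (simp add: godement_simps del: coind_module_simps)
    show "mor_comp (coinduced_mor R Y B I p h) \<iota> V s = g V s"
    proof (rule extensionalityI[of _ "{i \<in> I. p i \<in> V}"])
      show "mor_comp (coinduced_mor R Y B I p h) \<iota> V s \<in> extensional {i \<in> I. p i \<in> V}"
        by (simp add: mor_comp_def coinduced_mor_def)
      show "g V s \<in> extensional {i \<in> I. p i \<in> V}" using gs by (simp add: PiE_iff)
      fix i assume i: "i \<in> {i \<in> I. p i \<in> V}"
      then have gi: "g V s i \<in> carrier (coind_module R (D i))" using gs by (auto simp del: coind_module_simps)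
      show "mor_comp (coinduced_mor R Y B I p h) \<iota> V s i = g V s i"
      proof (rule extensionalityI[of _ "carrier R"])
        show "mor_comp (coinduced_mor R Y B I p h) \<iota> V s i \<in> extensional (carrier R)"
          using i by (simp add: mor_comp_def coinduced_mor_def)
        show "g V s i \<in> extensional (carrier R)" using gi by simp
        fix r assume r: "r \<in> carrier R"
        \<comment> \<open>The value at \<open>r\<close> is recovered from evaluations at one, by
          linearity of \<open>g\<close> and the action of scalars on the coinduced module.\<close>
        have "g V (r \<odot>\<^bsub>sections A V\<^esub> s) i \<one>\<^bsub>R\<^esub> = g V s i (\<one>\<^bsub>R\<^esub> \<otimes>\<^bsub>R\<^esub> r)"
          using mor_smult[OF g V r s] i by (simp add: godement_simps)
        then show "mor_comp (coinduced_mor R Y B I p h) \<iota> V s i r = g V s i r"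
          using hg[of i V "r \<odot>\<^bsub>sections A V\<^esub> s"] i V r s
          by (simp add: mor_comp_def coinduced_mor_def mor_smult[OF \<iota>] A.smult_section flip: mor_smult[OF \<iota>])
      qed
    qed
  qed
  moreover have "coinduced_mor R Y B I p h \<in> mor R Y B ?G"
    by (rule coinduced_mor_mor[OF B h])
  ultimately show ?thesis ..
qed


section \<open>Enough injectives, and direct images of injectives\<close>

subsection \<open>Enough injectives\<close>

text \<open>The extension property of \<open>G\<close> passes to a retract. It is assumed explicitly
  rather than as \<open>injective_sheaf\<close>, because Godement sheaves have their sections in a
  different type.\<close>

lemma injective_sheaf_retract:
  fixes I :: "('y, 'r, 'u) presheaf"
  assumes I: "sheaf R Y I"
    and ext: "\<And>(A :: ('y, 'r, 'u) presheaf) (B :: ('y, 'r, 'u) presheaf) \<iota> g.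
      \<lbrakk>sheaf R Y A; sheaf R Y B; \<iota> \<in> mor R Y A B; mono_sheaf Y A \<iota>; g \<in> mor R Y A G\<rbrakk>
        \<Longrightarrow> \<exists>h\<in>mor R Y B G. mor_eq Y A (mor_comp h \<iota>) g"
    and a: "a \<in> mor R Y I G" and b: "b \<in> mor R Y G I" and ba: "mor_eq Y I (mor_comp b a) mor_id"
  shows "injective_sheaf R Y I"
  unfolding injective_sheaf_def
proof (intro conjI allI impI I)
  fix A B :: "('y, 'r, 'u) presheaf" and \<iota> g
  assume *: "sheaf R Y A \<and> sheaf R Y B \<and> \<iota> \<in> mor R Y A B \<and> mono_sheaf Y A \<iota> \<and> g \<in> mor R Y A I"
  then have g: "g \<in> mor R Y A I" by simp
  from * mor_comp_mor[OF g a] obtain h where h: "h \<in> mor R Y B G" "mor_eq Y A (mor_comp h \<iota>) (mor_comp a g)"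
    using ext[of A B \<iota> "mor_comp a g"] by blast
  have "mor_eq Y A (mor_comp (mor_comp b h) \<iota>) g"
    using h(2) ba mor_closed[OF g] by (simp add: mor_eq_def mor_comp_def mor_id_def)
  then show "\<exists>h\<in>mor R Y B I. mor_eq Y A (mor_comp h \<iota>) g"
    using mor_comp_mor[OF h(1) b] by blast
qed

text \<open>Sections live in \<open>'k set\<close>. The size properties of \<open>'k\<close> assumed
  here are what make that type absorb products over points, coinduced modules and divisible
  hulls.\<close>

locale universe =
  fixes points :: "'x itself" and scalars :: "'r itself" and codes :: "'k itself"
  assumes infinite_universe: "infinite (UNIV :: 'k set)"
    and embeds_points: "embeds TYPE('x) TYPE('k)" and embeds_scalars: "embeds TYPE('r) TYPE('k)"
begin

lemma embeds_point_sets: "embeds TYPE('x set) TYPE('k set)"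
  by (rule embeds_set[OF embeds_points])

lemma embeds_self: "embeds TYPE('k set) TYPE('k set)"
  by (rule embedsI[of id]) simp

lemma embeds_coinduced: "embeds TYPE('x \<Rightarrow> 'r \<Rightarrow> 'k set) TYPE('k set)"
  using embeds_trans[OF embeds_fun[OF embeds_fun_set[OF infinite_universe embeds_scalars]]
      embeds_fun_set[OF infinite_universe embeds_points]] .

text \<open>The type on the left is the one encoding sections of a pullback: at each point, a triple
  representing a germ of germs.\<close>

lemma embeds_pullback:
  assumes "embeds TYPE('m) TYPE('k set)"
  shows "embeds TYPE('x \<Rightarrow> 'x set \<times> 'x set \<times> 'm) TYPE('k set)"
  using embeds_trans[OF embeds_fun[OF embeds_prod_set[OF infinite_universe embeds_point_sets
        embeds_prod_set[OF infinite_universe embeds_point_sets assms]]]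
      embeds_fun_set[OF infinite_universe embeds_points]] .

text \<open>A local preimage near \<open>x\<close> is the same as a preimage of the germ at
  \<open>x\<close>, after shrinking. So membership in the image sheaf can be tested stalk by stalk,
  which is where the cokernel is formed.\<close>

lemma germ_in_stalk_image_iff:
  assumes A: "presheaf R X A" and B: "presheaf R X B" and \<alpha>: "\<alpha> \<in> mor R X A B"
    and U: "openin X U" and s: "s \<in> carrier (sections B U)"
  shows "s \<in> image_sections X A B \<alpha> U \<longleftrightarrow>
    (\<forall>x\<in>U. germ X B {x} U s \<in> germ_map X B {x} \<alpha> ` carrier (germ_module X A {x}))"
proof -
  interpret A: presheaf R X A by fact
  interpret B: presheaf R X B by fact
  have "(\<exists>V. openin X V \<and> x \<in> V \<and> V \<subseteq> U \<and> restr B U V s \<in> \<alpha> V ` carrier (sections A V)) \<longleftrightarrow>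
      germ X B {x} U s \<in> germ_map X B {x} \<alpha> ` carrier (germ_module X A {x})" (is "?L \<longleftrightarrow> ?R") if x: "x \<in> U" for x
  proof
    assume ?L
    then obtain V a where V: "openin X V" "x \<in> V" "V \<subseteq> U" and a: "a \<in> carrier (sections A V)" "restr B U V s = \<alpha> V a"
      by blast
    have "germ X B {x} U s = germ_map X B {x} \<alpha> (germ X A {x} V a)"
      using V a x s U B.germ_restr[OF U V(1) _ V(3) s, of "{x}"] A.germ_map_germ[OF B \<alpha> V(1) _ a(1), of "{x}"] by simp
    moreover have "germ X A {x} V a \<in> carrier (germ_module X A {x})"
      using V a by (intro A.germ_in_germ_module) auto
    ultimately show ?R by blast
  next
    assume ?R
    then obtain G where G: "G \<in> carrier (germ_module X A {x})" and sG: "germ X B {x} U s = germ_map X B {x} \<alpha> G" by blast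
    obtain V a where V: "openin X V" "{x} \<subseteq> V" "a \<in> carrier (sections A V)" and Ga: "G = germ X A {x} V a"
      using G unfolding A.carrier_germ_module by blast
    have eq: "germ X B {x} U s = germ X B {x} V (\<alpha> V a)"
      using sG A.germ_map_germ[OF B \<alpha> V] by (simp add: Ga)
    obtain W where W: "openin X W" "{x} \<subseteq> W" "W \<subseteq> U" "W \<subseteq> V" "restr B U W s = restr B V W (\<alpha> V a)"
      using B.germ_eqD[OF V(1,2) mor_closed[OF \<alpha> V(1,3)] eq] by blast
    then have "restr B U W s = \<alpha> W (restr A V W a)" using mor_restr[OF \<alpha> V(1) W(1,4) V(3)] by simp
    then show ?L using W A.restr_closed[OF V(1) W(1,4) V(3)] by blast
  qed
  then show ?thesis using s by (simp add: image_sections_def)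
qed

text \<open>Dividing each stalk by the stalk of the image before embedding it into a divisible group
  realises the cokernel of \<open>\<alpha>\<close> inside a Godement sheaf, without forming a quotient sheaf.\<close>

lemma godement_cokernel:
  fixes R :: "'r ring" and B :: "('x, 'r, 'k set) presheaf"
  assumes A: "sheaf R X A" and B: "sheaf R X B" and \<alpha>: "\<alpha> \<in> mor R X A B"
  shows "\<exists>(D :: 'x \<Rightarrow> 'k set monoid) c. (\<forall>x\<in>topspace X. comm_group (D x) \<and> divisible_group (D x)) \<and>
    c \<in> mor R X B (godement R (topspace X) (\<lambda>x. x) D) \<and>
    (\<forall>U s. openin X U \<and> s \<in> carrier (sections B U) \<longrightarrow>
      (c U s = \<zero>\<^bsub>sections (godement R (topspace X) (\<lambda>x. x) D) U\<^esub> \<longleftrightarrow> s \<in> image_sections X A B \<alpha> U))"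
proof -
  interpret A: sheaf R X A by fact
  interpret B: sheaf R X B by fact
  interpret R: cring R by (rule B.cring_R)
  define S where "S x = germ_map X B {x} \<alpha> ` carrier (germ_module X A {x})" for x
  obtain i :: "'x set \<times> 'k set \<Rightarrow> 'k set" where i: "inj i"
    using embeds_prod_set[OF infinite_universe embeds_point_sets embeds_self] by (auto simp: embeds_def)
  obtain q :: "('k set \<Rightarrow>\<^sub>0 rat) \<Rightarrow> 'k set" where q: "inj q"
    using embeds_finite_support[OF infinite_universe] by (auto simp: embeds_def)
  have "\<exists>(D :: 'k set monoid) j. comm_group D \<and> divisible_group D \<and>
      j \<in> hom (add_monoid (germ_module X B {x})) D \<and> (\<forall>G\<in>carrier (germ_module X B {x}). j G = \<one>\<^bsub>D\<^esub> \<longleftrightarrow> G \<in> S x)"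
    if x: "x \<in> topspace X" for x
  proof -
    let ?M = "add_monoid (germ_module X B {x})"
    interpret MA: Module.module R "germ_module X A {x}" by (rule A.stalk_module[OF openin_topspace x])
    interpret MB: Module.module R "germ_module X B {x}" by (rule B.stalk_module[OF openin_topspace x])
    interpret h: group_hom "add_monoid (germ_module X A {x})" ?M "germ_map X B {x} \<alpha>"
      using A.germ_map_hom[OF B.presheaf_axioms \<alpha>, of "{x}"] MA.a_group MB.a_group
      by (simp add: group_hom_def group_hom_axioms_def mod_hom_def)
    have S: "subgroup (S x) ?M" using h.img_is_subgroup by (simp add: S_def)
    interpret N: normal "S x" ?M using S by (simp add: comm_group.normal_iff_subgroup[OF MB.a_comm_group])
    interpret Q: comm_group "?M Mod S x" by (rule comm_group.abelian_FactGroup[OF MB.a_comm_group S])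
    \<comment> \<open>A coset in the stalk is encoded by an open set and a section whose germ
      represents it; such pairs fit into the universe, whereas sets of germs have no evident place
      there.\<close>
    define code where "code C = i (SOME p. C = S x #>\<^bsub>?M\<^esub> germ X B {x} (fst p) (snd p))" for C
    have "inj_on code (carrier (?M Mod S x))"
    proof (rule inj_onI)
      fix C C' assume C: "C \<in> carrier (?M Mod S x)" and C': "C' \<in> carrier (?M Mod S x)" and eq: "code C = code C'"
      have ex: "\<exists>p. C = S x #>\<^bsub>?M\<^esub> germ X B {x} (fst p) (snd p)" if C: "C \<in> carrier (?M Mod S x)" for C
      proof -
        obtain G where "G \<in> carrier (germ_module X B {x})" "C = S x #>\<^bsub>?M\<^esub> G"
          using C by (auto simp: carrier_FactGroup)
        moreover from this obtain V s where "G = germ X B {x} V s" by (auto simp: B.carrier_germ_module)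
        ultimately show ?thesis by (intro exI[of _ "(V, s)"]) simp
      qed
      have eq: "(SOME p. C = S x #>\<^bsub>?M\<^esub> germ X B {x} (fst p) (snd p)) = (SOME p. C' = S x #>\<^bsub>?M\<^esub> germ X B {x} (fst p) (snd p))"
        using eq unfolding code_def by (rule injD[OF i])
      show "C = C'" using someI_ex[OF ex[OF C]] someI_ex[OF ex[OF C']] unfolding eq by simp
    qed
    from divisible_hull[OF Q.comm_group_axioms this q] obtain D :: "'k set monoid" and j where
      D: "comm_group D" "divisible_group D" and j: "j \<in> hom (?M Mod S x) D" and inj: "inj_on j (carrier (?M Mod S x))" by blast
    interpret D: comm_group D by fact
    interpret j: group_hom "?M Mod S x" D j using j by unfold_locales
    have "(\<lambda>G. j (S x #>\<^bsub>?M\<^esub> G)) \<in> hom ?M D"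
      using hom_compose[OF N.r_coset_hom_Mod j] by (simp add: comp_def)
    \<comment> \<open>Injectivity of the hull makes the kernel of the composite exactly the image
      stalk.\<close>
    moreover have "j (S x #>\<^bsub>?M\<^esub> G) = \<one>\<^bsub>D\<^esub> \<longleftrightarrow> G \<in> S x" if G: "G \<in> carrier (germ_module X B {x})" for G
    proof -
      have GM: "G \<in> carrier ?M" using G by simp
      have c: "S x #>\<^bsub>?M\<^esub> G \<in> carrier (?M Mod S x)" using GM by (auto simp: carrier_FactGroup)
      have "j (S x #>\<^bsub>?M\<^esub> G) = j \<one>\<^bsub>?M Mod S x\<^esub> \<longleftrightarrow> S x #>\<^bsub>?M\<^esub> G = \<one>\<^bsub>?M Mod S x\<^esub>"
        using inj_on_eq_iff[OF inj c Q.one_closed] .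
      also have "\<dots> \<longleftrightarrow> G \<in> S x"
        using group.coset_join1[OF MB.a_group _ GM S] group.coset_join2[OF MB.a_group GM S] subgroup.subset[OF S] by auto
      finally show ?thesis unfolding j.hom_one .
    qed
    ultimately show ?thesis using D by blast
  qed
  then have "\<forall>x. \<exists>(D :: 'k set monoid) j. x \<in> topspace X \<longrightarrow> comm_group D \<and> divisible_group D \<and>
      j \<in> hom (add_monoid (germ_module X B {x})) D \<and> (\<forall>G\<in>carrier (germ_module X B {x}). j G = \<one>\<^bsub>D\<^esub> \<longleftrightarrow> G \<in> S x)" by blast
  then obtain D :: "'x \<Rightarrow> 'k set monoid" and j where
    D: "\<And>x. x \<in> topspace X \<Longrightarrow> comm_group (D x) \<and> divisible_group (D x)"
    and j: "\<And>x. x \<in> topspace X \<Longrightarrow> j x \<in> hom (add_monoid (germ_module X B {x})) (D x)"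
    and ker: "\<And>x G. x \<in> topspace X \<Longrightarrow> G \<in> carrier (germ_module X B {x}) \<Longrightarrow> j x G = \<one>\<^bsub>D x\<^esub> \<longleftrightarrow> G \<in> S x"
    by metis
  let ?G = "godement R (topspace X) (\<lambda>x. x) D"
  let ?c = "coinduced_mor R X B (topspace X) (\<lambda>x. x) j"
  have "?c U s = \<zero>\<^bsub>sections ?G U\<^esub> \<longleftrightarrow> s \<in> image_sections X A B \<alpha> U"
    if U: "openin X U" and s: "s \<in> carrier (sections B U)" for U s
  proof -
    interpret M: Module.module R "sections B U" by (rule B.sections_module[OF U])
    have gj: "j x (germ X B {x} U t) = \<one>\<^bsub>D x\<^esub> \<longleftrightarrow> germ X B {x} U t \<in> S x"
      if "x \<in> U" "t \<in> carrier (sections B U)" for x t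
      using that B.openin_sub[OF U] U by (intro ker B.germ_in_germ_module) auto
    show ?thesis
    proof
      assume eq: "?c U s = \<zero>\<^bsub>sections ?G U\<^esub>"
      have "germ X B {x} U s \<in> S x" if x: "x \<in> U" for x
      proof -
        \<comment> \<open>Evaluation at one recovers the value of \<open>j x\<close> on the germ of
          \<open>s\<close> itself.\<close>
        have "?c U s x \<one>\<^bsub>R\<^esub> = \<zero>\<^bsub>sections ?G U\<^esub> x \<one>\<^bsub>R\<^esub>" by (simp only: eq)
        then have "j x (germ X B {x} U s) = \<one>\<^bsub>D x\<^esub>"
          using x s B.openin_sub[OF U] by (auto simp: coinduced_mor_def godement_simps)
        then show ?thesis using gj[OF x s] by simp
      qed
      then show "s \<in> image_sections X A B \<alpha> U"
        using germ_in_stalk_image_iff[OF A.presheaf_axioms B.presheaf_axioms \<alpha> U s] by (simp add: S_def)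
    next
      assume im: "s \<in> image_sections X A B \<alpha> U"
      \<comment> \<open>The coinduced morphism evaluates \<open>j x\<close> on all multiples
        \<open>r s\<close>, so the image must contain these along with \<open>s\<close>.\<close>
      have "submodule (image_sections X A B \<alpha> U) R (sections B U)"
        by (rule image_sections_submodule[OF A B \<alpha> U])
      then have "r \<odot>\<^bsub>sections B U\<^esub> s \<in> image_sections X A B \<alpha> U" if "r \<in> carrier R" for r
        using that im by (rule submodule.smult_closed)
      then have "j x (germ X B {x} U (r \<odot>\<^bsub>sections B U\<^esub> s)) = \<one>\<^bsub>D x\<^esub>" if "x \<in> U" "r \<in> carrier R" for x r
        using that s gj[OF that(1), of "r \<odot>\<^bsub>sections B U\<^esub> s"]
          germ_in_stalk_image_iff[OF A.presheaf_axioms B.presheaf_axioms \<alpha> U, of "r \<odot>\<^bsub>sections B U\<^esub> s"]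
        by (simp add: S_def)
      then show "?c U s = \<zero>\<^bsub>sections ?G U\<^esub>"
        by (auto simp: coinduced_mor_def godement_simps intro!: restrict_ext)
    qed
  qed
  moreover have "?c \<in> mor R X B ?G"
    by (rule coinduced_mor_mor[OF B.presheaf_axioms j])
  ultimately show ?thesis using D by (intro exI[of _ D] exI[of _ ?c]) simp
qed

text \<open>The cokernel construction applied to the zero endomorphism, whose image is zero, so that
  the kernel of \<open>c\<close> vanishes.\<close>

lemma godement_embedding:
  fixes R :: "'r ring" and A :: "('x, 'r, 'k set) presheaf"
  assumes A: "sheaf R X A"
  shows "\<exists>(D :: 'x \<Rightarrow> 'k set monoid) c. (\<forall>x\<in>topspace X. comm_group (D x) \<and> divisible_group (D x)) \<and>
    c \<in> mor R X A (godement R (topspace X) (\<lambda>x. x) D) \<and> mono_sheaf X A c"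
proof -
  interpret A: sheaf R X A by fact
  obtain D :: "'x \<Rightarrow> 'k set monoid" and c where D: "\<forall>x\<in>topspace X. comm_group (D x) \<and> divisible_group (D x)"
    and c: "c \<in> mor R X A (godement R (topspace X) (\<lambda>x. x) D)"
    and ker: "\<forall>U s. openin X U \<and> s \<in> carrier (sections A U) \<longrightarrow>
      (c U s = \<zero>\<^bsub>sections (godement R (topspace X) (\<lambda>x. x) D) U\<^esub> \<longleftrightarrow> s \<in> image_sections X A A (\<lambda>U s. \<zero>\<^bsub>sections A U\<^esub>) U)"
    using godement_cokernel[OF A A zero_mor[OF A.presheaf_axioms A.presheaf_axioms]] by blast
  have G: "sheaf R X (godement R (topspace X) (\<lambda>x. x) D)" using D by (intro godement_sheaf[OF A.cring_R]) simp
  have "mono_sheaf X A c"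
    by (rule mono_sheafI[OF c A.presheaf_axioms sheaf_presheaf[OF G]])
      (use ker image_sections_zero[OF A.presheaf_axioms A] in blast)
  then show ?thesis using D c by blast
qed

text \<open>The Godement sheaf has sections in a function type. Its copy in the universe is an
  injective object in the sense of \<open>injective_sheaf\<close>, and \<open>a\<close>,
  \<open>b\<close> make the original a retract of it.\<close>

lemma godement_copy_injective:
  fixes R :: "'r ring" and D :: "'x \<Rightarrow> 'k set monoid"
  assumes R: "cring R" and D: "\<And>x. x \<in> topspace X \<Longrightarrow> comm_group (D x) \<and> divisible_group (D x)"
  shows "\<exists>(E :: ('x, 'r, 'k set) presheaf) a b. injective_sheaf R X E \<and>
    a \<in> mor R X (godement R (topspace X) (\<lambda>x. x) D) E \<and> b \<in> mor R X E (godement R (topspace X) (\<lambda>x. x) D) \<and>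
    mor_eq X (godement R (topspace X) (\<lambda>x. x) D) (mor_comp b a) mor_id"
proof -
  let ?G = "godement R (topspace X) (\<lambda>x. x) D"
  have G: "sheaf R X ?G" using D by (intro godement_sheaf[OF R]) simp
  obtain e :: "('x \<Rightarrow> 'r \<Rightarrow> 'k set) \<Rightarrow> 'k set" where e: "inj e" using embeds_coinduced by (auto simp: embeds_def)
  have ex: "\<exists>e :: 'x set \<Rightarrow> ('x \<Rightarrow> 'r \<Rightarrow> 'k set) \<Rightarrow> 'k set. \<forall>U. openin X U \<longrightarrow> inj_on (e U) (carrier (sections ?G U))"
    using e by (intro exI[of _ "\<lambda>U. e"]) (auto intro: inj_on_subset)
  note C = copy_sheaf[OF G ex]
  have "injective_sheaf R X (copy X ?G :: ('x, 'r, 'k set) presheaf)"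
  proof (rule injective_sheaf_retract[OF C(1) _ C(3) C(2)])
    show "mor_eq X (copy X ?G :: ('x, 'r, 'k set) presheaf) (mor_comp (copy_code X ?G) (copy_decode X ?G)) mor_id"
      by (simp add: mor_eq_def mor_comp_def mor_id_def C(5))
    fix A B :: "('x, 'r, 'k set) presheaf" and \<iota> g
    assume "sheaf R X A" "sheaf R X B" "\<iota> \<in> mor R X A B" "mono_sheaf X A \<iota>" "g \<in> mor R X A ?G"
    then show "\<exists>h\<in>mor R X B ?G. mor_eq X A (mor_comp h \<iota>) g"
      using D by (intro godement_extension[OF R]) (auto dest: sheaf_presheaf)
  qed
  moreover have "mor_eq X ?G (mor_comp (copy_decode X ?G) (copy_code X ?G :: 'x set \<Rightarrow> _ \<Rightarrow> 'k set)) mor_id"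
    by (simp add: mor_eq_def mor_comp_def mor_id_def C(4))
  ultimately show ?thesis using C(2,3) by blast
qed

text \<open>The inductive step for resolutions: \<open>c\<close> followed by its target
  \<open>E\<close> continues \<open>\<alpha>\<close> exactly at \<open>B\<close>. The map into the
  copy has a left inverse, so composing with it leaves the kernel unchanged.\<close>

theorem injective_cokernel:
  fixes R :: "'r ring" and B :: "('x, 'r, 'k set) presheaf"
  assumes A: "sheaf R X A" and B: "sheaf R X B" and \<alpha>: "\<alpha> \<in> mor R X A B"
  shows "\<exists>(E :: ('x, 'r, 'k set) presheaf) c. injective_sheaf R X E \<and> c \<in> mor R X B E \<and>
    (\<forall>U. openin X U \<longrightarrow> kernel_sections B E c U = image_sections X A B \<alpha> U)"
proof -
  interpret B: sheaf R X B by fact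
  obtain D :: "'x \<Rightarrow> 'k set monoid" and c where D: "\<forall>x\<in>topspace X. comm_group (D x) \<and> divisible_group (D x)"
    and c: "c \<in> mor R X B (godement R (topspace X) (\<lambda>x. x) D)"
    and ker: "\<forall>U s. openin X U \<and> s \<in> carrier (sections B U) \<longrightarrow>
      (c U s = \<zero>\<^bsub>sections (godement R (topspace X) (\<lambda>x. x) D) U\<^esub> \<longleftrightarrow> s \<in> image_sections X A B \<alpha> U)"
    using godement_cokernel[OF A B \<alpha>] by blast
  let ?G = "godement R (topspace X) (\<lambda>x. x) D"
  have G: "presheaf R X ?G" using D by (intro sheaf_presheaf godement_sheaf[OF B.cring_R]) simp
  obtain E :: "('x, 'r, 'k set) presheaf" and a b where E: "injective_sheaf R X E"
    and a: "a \<in> mor R X ?G E" and b: "b \<in> mor R X E ?G"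
    and ba: "mor_eq X ?G (mor_comp b a) mor_id"
    using godement_copy_injective[OF B.cring_R, of X D] D by blast
  have Es: "presheaf R X E" using E by (simp add: injective_sheaf_def sheaf_presheaf)
  have az: "a U t = \<zero>\<^bsub>sections E U\<^esub> \<longleftrightarrow> t = \<zero>\<^bsub>sections ?G U\<^esub>" if U: "openin X U" and t: "t \<in> carrier (sections ?G U)" for U t
  proof -
    have "b U (a U t) = t" using ba U t by (simp add: mor_eq_def mor_comp_def mor_id_def)
    then show ?thesis using mor_zero[OF a G Es U] mor_zero[OF b Es G U] by metis
  qed
  have "kernel_sections B E (mor_comp a c) U = image_sections X A B \<alpha> U" if U: "openin X U" for U
  proof -
    have car: "s \<in> carrier (sections B U)" if "s \<in> image_sections X A B \<alpha> U" for s
      using that by (simp add: image_sections_def)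
    have iff: "a U (c U s) = \<zero>\<^bsub>sections E U\<^esub> \<longleftrightarrow> s \<in> image_sections X A B \<alpha> U"
      if "s \<in> carrier (sections B U)" for s
      using ker U az[OF U mor_closed[OF c U that]] that by simp
    show ?thesis
      unfolding kernel_sections_def mor_comp_def comp_def using iff car by blast
  qed
  then show ?thesis using E mor_comp_mor[OF c a] by blast
qed

text \<open>Direct image preserves retracts and turns a Godement sheaf on \<open>X\<close> into one
  on \<open>Y\<close> indexed through \<open>f\<close>, to which \<open>godement_extension\<close>
  applies directly.\<close>

theorem direct_image_injective:
  fixes R :: "'r ring" and J :: "('x, 'r, 'k set) presheaf" and Y :: "'y topology"
  assumes f: "continuous_map X Y f" and J: "injective_sheaf R X J"
  shows "injective_sheaf R Y (direct_image X f J)"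
proof -
  have Js: "sheaf R X J" using J by (simp add: injective_sheaf_def)
  interpret J: sheaf R X J by fact
  obtain D :: "'x \<Rightarrow> 'k set monoid" and c where D: "\<forall>x\<in>topspace X. comm_group (D x) \<and> divisible_group (D x)"
    and c: "c \<in> mor R X J (godement R (topspace X) (\<lambda>x. x) D)" "mono_sheaf X J c"
    using godement_embedding[OF Js] by blast
  let ?G = "godement R (topspace X) (\<lambda>x. x) D"
  obtain E :: "('x, 'r, 'k set) presheaf" and a b where E: "injective_sheaf R X E"
    and a: "a \<in> mor R X ?G E" and b: "b \<in> mor R X E ?G"
    and ba: "mor_eq X ?G (mor_comp b a) mor_id"
    using godement_copy_injective[OF J.cring_R, of X D] D by blast
  have ac: "mor_comp a c \<in> mor R X J E" by (rule mor_comp_mor[OF c(1) a])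
  have "mono_sheaf X J (mor_comp a c)"
    unfolding mono_sheaf_def
  proof (intro allI impI inj_onI)
    fix U s t assume U: "openin X U" and s: "s \<in> carrier (sections J U)" and t: "t \<in> carrier (sections J U)"
      and "mor_comp a c U s = mor_comp a c U t"
    then have "b U (a U (c U s)) = b U (a U (c U t))" by (simp add: mor_comp_def)
    then have "c U s = c U t"
      using ba U mor_closed[OF c(1) U s] mor_closed[OF c(1) U t] by (simp add: mor_eq_def mor_comp_def mor_id_def)
    then show "s = t" using c(2) U s t by (auto simp: mono_sheaf_def dest: inj_onD)
  qed
  \<comment> \<open>The detour through \<open>E\<close> is needed because injectivity of
    \<open>J\<close> may be invoked only for sheaves in the universe; \<open>\<rho>\<close> composed
    with \<open>a\<close> then exhibits \<open>J\<close> as a retract of the Godement sheaf.\<close>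
  then obtain \<rho> where \<rho>: "\<rho> \<in> mor R X E J" "mor_eq X J (mor_comp \<rho> (mor_comp a c)) mor_id"
    using J E Js ac mor_id_mor unfolding injective_sheaf_def by metis
  have fG: "direct_image X f ?G = godement R (topspace X) f D" by (rule direct_image_godement)
  show ?thesis
  proof (rule injective_sheaf_retract[OF direct_image_sheaf[OF f Js]])
    show "direct_image_mor X f c \<in> mor R Y (direct_image X f J) (godement R (topspace X) f D)"
      using direct_image_mor_mor[OF f c(1)] by (simp add: fG)
    show "direct_image_mor X f (mor_comp \<rho> a) \<in> mor R Y (godement R (topspace X) f D) (direct_image X f J)"
      using direct_image_mor_mor[OF f mor_comp_mor[OF a \<rho>(1)]] by (simp add: fG)
    show "mor_eq Y (direct_image X f J) (mor_comp (direct_image_mor X f (mor_comp \<rho> a)) (direct_image_mor X f c)) mor_id"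
      using \<rho>(2) openin_preim[OF f] by (simp add: mor_eq_def mor_comp_def mor_id_def direct_image_mor_def)
    fix A B :: "('y, 'r, 'k set) presheaf" and \<iota> g
    assume "sheaf R Y A" "sheaf R Y B" "\<iota> \<in> mor R Y A B" "mono_sheaf Y A \<iota>" "g \<in> mor R Y A (godement R (topspace X) f D)"
    then show "\<exists>h\<in>mor R Y B (godement R (topspace X) f D). mor_eq Y A (mor_comp h \<iota>) g"
      using D by (intro godement_extension[OF J.cring_R]) (auto dest: sheaf_presheaf)
  qed
qed

end


section \<open>Existence of injective resolutions and the comparison theorem\<close>

section \<open>Injective resolutions\<close>

lemma injective_sheaf_sheaf: "injective_sheaf R X I \<Longrightarrow> sheaf R X I"
  by (simp add: injective_sheaf_def)

text \<open>Here \<open>\<alpha>\<close> may have a kernel. As \<open>\<beta>\<close> kills it,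
  \<open>\<beta>\<close> factors through the image sheaf of \<open>\<alpha>\<close>, and injectivity
  extends the factorisation from that subsheaf to \<open>B\<close>. All lifts and homotopies are
  built with this.\<close>

lemma injective_extend_along:
  fixes A B I :: "('x, 'r, 'u) presheaf"
  assumes I: "injective_sheaf R X I" and A: "sheaf R X A" and B: "sheaf R X B"
    and \<alpha>: "\<alpha> \<in> mor R X A B" and \<beta>: "\<beta> \<in> mor R X A I"
    and ker: "\<And>U s. \<lbrakk>openin X U; s \<in> carrier (sections A U); \<alpha> U s = \<zero>\<^bsub>sections B U\<^esub>\<rbrakk> \<Longrightarrow> \<beta> U s = \<zero>\<^bsub>sections I U\<^esub>"
  shows "\<exists>h\<in>mor R X B I. \<forall>U s. openin X U \<and> s \<in> carrier (sections A U) \<longrightarrow> h U (\<alpha> U s) = \<beta> U s"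
proof -
  interpret A: sheaf R X A by fact
  interpret B: sheaf R X B by fact
  have Is: "sheaf R X I" using I by (rule injective_sheaf_sheaf)
  interpret I: sheaf R X I by fact
  let ?S = "sub_presheaf B (image_sections X A B \<alpha>)"
  have S: "sheaf R X ?S" by (rule image_sheaf[OF A B \<alpha>])
  have im: "\<alpha> V a \<in> image_sections X A B \<alpha> V" if "openin X V" "a \<in> carrier (sections A V)" for V a
    by (rule image_sectionsI[OF \<alpha> B.presheaf_axioms that])
  \<comment> \<open>The factorisation is given by the relation between \<open>\<alpha> a\<close> and
    \<open>\<beta> a\<close>; it is total only locally, since sections of the image sheaf have only
    local preimages.\<close>
  have "\<exists>\<gamma>\<in>mor R X ?S I. \<forall>V s t. openin X V \<and> (\<exists>a\<in>carrier (sections A V). s = \<alpha> V a \<and> t = \<beta> V a) \<longrightarrow> \<gamma> V s = t"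
  proof (rule local_relation_mor[OF sheaf_presheaf[OF S] Is])
    fix V s t assume V: "openin X V" and "\<exists>a\<in>carrier (sections A V). s = \<alpha> V a \<and> t = \<beta> V a"
    then show "s \<in> carrier (sections ?S V) \<and> t \<in> carrier (sections I V)"
      using im mor_closed[OF \<beta>] by auto
  next
    fix V W s t assume V: "openin X V" "openin X W" "W \<subseteq> V" and "\<exists>a\<in>carrier (sections A V). s = \<alpha> V a \<and> t = \<beta> V a"
    then obtain a where a: "a \<in> carrier (sections A V)" "s = \<alpha> V a" "t = \<beta> V a" by blast
    show "\<exists>a\<in>carrier (sections A W). restr ?S V W s = \<alpha> W a \<and> restr I V W t = \<beta> W a"
      using V a by (intro bexI[of _ "restr A V W a"]) (simp_all add: mor_restr[OF \<alpha>] mor_restr[OF \<beta>] A.restr_closed)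
  next
    fix V s t s' t' assume V: "openin X V" and "\<exists>a\<in>carrier (sections A V). s = \<alpha> V a \<and> t = \<beta> V a"
      "\<exists>a\<in>carrier (sections A V). s' = \<alpha> V a \<and> t' = \<beta> V a"
    then obtain a a' where a: "a \<in> carrier (sections A V)" "s = \<alpha> V a" "t = \<beta> V a"
      and a': "a' \<in> carrier (sections A V)" "s' = \<alpha> V a'" "t' = \<beta> V a'" by blast
    show "\<exists>a\<in>carrier (sections A V). s \<oplus>\<^bsub>sections ?S V\<^esub> s' = \<alpha> V a \<and> t \<oplus>\<^bsub>sections I V\<^esub> t' = \<beta> V a"
      using V a a' by (intro bexI[of _ "a \<oplus>\<^bsub>sections A V\<^esub> a'"]) (simp_all add: mor_add[OF \<alpha>] mor_add[OF \<beta>] A.add_section)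
  next
    fix V c s t assume V: "openin X V" and c: "c \<in> carrier R" and "\<exists>a\<in>carrier (sections A V). s = \<alpha> V a \<and> t = \<beta> V a"
    then obtain a where a: "a \<in> carrier (sections A V)" "s = \<alpha> V a" "t = \<beta> V a" by blast
    show "\<exists>a\<in>carrier (sections A V). c \<odot>\<^bsub>sections ?S V\<^esub> s = \<alpha> V a \<and> c \<odot>\<^bsub>sections I V\<^esub> t = \<beta> V a"
      using V a c by (intro bexI[of _ "c \<odot>\<^bsub>sections A V\<^esub> a"]) (simp_all add: mor_smult[OF \<alpha>] mor_smult[OF \<beta>] A.smult_section)
  next
    fix V s t t' assume V: "openin X V" and "\<exists>a\<in>carrier (sections A V). s = \<alpha> V a \<and> t = \<beta> V a"
      "\<exists>a\<in>carrier (sections A V). s = \<alpha> V a \<and> t' = \<beta> V a"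
    then obtain a a' where a: "a \<in> carrier (sections A V)" "s = \<alpha> V a" "t = \<beta> V a"
      and a': "a' \<in> carrier (sections A V)" "s = \<alpha> V a'" "t' = \<beta> V a'" by blast
    have "\<alpha> V (a \<ominus>\<^bsub>sections A V\<^esub> a') = \<zero>\<^bsub>sections B V\<^esub>"
      using V a a' mor_minus[OF \<alpha> A.presheaf_axioms B.presheaf_axioms V a(1) a'(1)]
        B.minus_zero_iff[OF V mor_closed[OF \<alpha> V a(1)] mor_closed[OF \<alpha> V a'(1)]] by simp
    from ker[OF V A.minus_section[OF V a(1) a'(1)] this] show "t = t'"
      using mor_minus[OF \<beta> A.presheaf_axioms I.presheaf_axioms V a(1) a'(1)]
        I.minus_zero_iff[OF V mor_closed[OF \<beta> V a(1)] mor_closed[OF \<beta> V a'(1)]] a(3) a'(3) by simp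
  next
    fix U s x assume U: "openin X U" and s: "s \<in> carrier (sections ?S U)" and x: "x \<in> U"
    from s have "s \<in> image_sections X A B \<alpha> U" by simp
    then obtain V a where "openin X V" "x \<in> V" "V \<subseteq> U" "a \<in> carrier (sections A V)" "restr B U V s = \<alpha> V a"
      using x unfolding image_sections_def by blast
    then show "\<exists>V t. openin X V \<and> x \<in> V \<and> V \<subseteq> U \<and> (\<exists>a\<in>carrier (sections A V). restr ?S U V s = \<alpha> V a \<and> t = \<beta> V a)"
      by (intro exI[of _ V] exI[of _ "\<beta> V a"]) auto
  qed
  then obtain \<gamma> where \<gamma>: "\<gamma> \<in> mor R X ?S I"
    and \<gamma>\<alpha>: "\<forall>V s t. openin X V \<and> (\<exists>a\<in>carrier (sections A V). s = \<alpha> V a \<and> t = \<beta> V a) \<longrightarrow> \<gamma> V s = t" by (elim bexE)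
  have sub: "\<And>U. openin X U \<Longrightarrow> image_sections X A B \<alpha> U \<subseteq> carrier (sections B U)" by (auto simp: image_sections_def)
  note incl = sub_presheaf_incl[OF B.presheaf_axioms sub]
  have "\<exists>h\<in>mor R X B I. mor_eq X ?S (mor_comp h mor_id) \<gamma>"
    using I S B incl \<gamma> unfolding injective_sheaf_def by blast
  then obtain h where h: "h \<in> mor R X B I" and hS: "mor_eq X ?S (mor_comp h mor_id) \<gamma>" by blast
  have "h U (\<alpha> U s) = \<beta> U s" if "openin X U" "s \<in> carrier (sections A U)" for U s
  proof -
    have "h U (\<alpha> U s) = \<gamma> U (\<alpha> U s)"
      using mor_eqD[OF hS that(1), of "\<alpha> U s"] im[OF that] by (simp add: mor_comp_def mor_id_def)
    also have "\<dots> = \<beta> U s" using \<gamma>\<alpha> that by blast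
    finally show ?thesis .
  qed
  then show ?thesis using h by blast
qed

lemma exact_zero:
  assumes "exact_sheaf X P Q S \<alpha> \<beta>" "\<alpha> \<in> mor R X P Q" "presheaf R X Q" "openin X U" "s \<in> carrier (sections P U)"
  shows "\<beta> U (\<alpha> U s) = \<zero>\<^bsub>sections S U\<^esub>"
  using image_sectionsI[OF assms(2-5)] assms(1,4) by (auto simp: exact_sheaf_def kernel_sections_def)

text \<open>Sections in the kernel of \<open>\<beta>\<close> are locally values of
  \<open>\<alpha>\<close>, so \<open>\<eta>\<close> vanishes on them locally, hence globally. This
  supplies the kernel condition of \<open>injective_extend_along\<close>.\<close>

lemma exact_kills:
  assumes ex: "exact_sheaf X P Q S \<alpha> \<beta>" and T: "sheaf R X T" and \<eta>: "\<eta> \<in> mor R X Q T"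
    and z: "\<And>U s. \<lbrakk>openin X U; s \<in> carrier (sections P U)\<rbrakk> \<Longrightarrow> \<eta> U (\<alpha> U s) = \<zero>\<^bsub>sections T U\<^esub>"
    and U: "openin X U" and s: "s \<in> carrier (sections Q U)" and \<beta>s: "\<beta> U s = \<zero>\<^bsub>sections S U\<^esub>"
  shows "\<eta> U s = \<zero>\<^bsub>sections T U\<^esub>"
proof -
  interpret T: sheaf R X T by fact
  have "s \<in> image_sections X P Q \<alpha> U"
    using ex U s \<beta>s by (simp add: exact_sheaf_def kernel_sections_def)
  show ?thesis
  proof (rule T.section_eqI[OF U mor_closed[OF \<eta> U s] T.zero_section[OF U]])
    fix x assume "x \<in> U"
    then obtain V a where V: "openin X V" "x \<in> V" "V \<subseteq> U" "a \<in> carrier (sections P V)" "restr Q U V s = \<alpha> V a"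
      using \<open>s \<in> image_sections X P Q \<alpha> U\<close> unfolding image_sections_def by blast
    then have "restr T U V (\<eta> U s) = \<zero>\<^bsub>sections T V\<^esub>"
      using z by (simp add: mor_restr[OF \<eta> U _ _ s])
    then show "\<exists>V. openin X V \<and> x \<in> V \<and> V \<subseteq> U \<and> restr T U V (\<eta> U s) = restr T U V \<zero>\<^bsub>sections T U\<^esub>"
      using V T.restr_zero[OF U] by (intro exI[of _ V]) auto
  qed
qed

context universe
begin

text \<open>Recursion on the last morphism constructed: its cokernel is embedded into an injective
  sheaf.\<close>

lemma injective_resolution_exists:
  fixes R :: "'r ring" and F :: "('x, 'r, 'k set) presheaf"
  assumes F: "sheaf R X F"
  shows "\<exists>I. injective_resolution R X F I"
proof -
  interpret F: sheaf R X F by fact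
  \<comment> \<open>The state is a morphism with its source and target. It starts with the zero
    endomorphism of \<open>F\<close>, so the first step produces a monomorphism from
    \<open>F\<close>, which is the augmentation.\<close>
  let ?P = "\<lambda>(n :: nat) (A :: ('x, 'r, 'k set) presheaf, B :: ('x, 'r, 'k set) presheaf, \<alpha>).
    sheaf R X A \<and> sheaf R X B \<and> \<alpha> \<in> mor R X A B \<and> (n = 0 \<longrightarrow> A = F \<and> B = F \<and> \<alpha> = (\<lambda>U s. \<zero>\<^bsub>sections F U\<^esub>))"
  let ?Q = "\<lambda>n :: nat. \<lambda>(A :: ('x, 'r, 'k set) presheaf, B :: ('x, 'r, 'k set) presheaf, \<alpha>) (A', B', \<alpha>').
    A' = B \<and> injective_sheaf R X B' \<and> (\<forall>U. openin X U \<longrightarrow> kernel_sections B B' \<alpha>' U = image_sections X A B \<alpha> U)"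
  have "\<exists>S. \<forall>n. ?P n (S n) \<and> ?Q n (S n) (S (Suc n))"
  proof (rule dependent_nat_choice)
    show "\<exists>x. ?P 0 x"
      using F zero_mor[OF F.presheaf_axioms F.presheaf_axioms]
      by (intro exI[of _ "(F, F, \<lambda>U s. \<zero>\<^bsub>sections F U\<^esub>)"]) simp
    fix x n assume P: "?P n x"
    obtain A B \<alpha> where x: "x = (A, B, \<alpha>)" by (cases x)
    then have ab: "sheaf R X A" "sheaf R X B" "\<alpha> \<in> mor R X A B" using P by auto
    obtain E :: "('x, 'r, 'k set) presheaf" and c where "injective_sheaf R X E" "c \<in> mor R X B E" "\<forall>U. openin X U \<longrightarrow> kernel_sections B E c U = image_sections X A B \<alpha> U"
      using injective_cokernel[OF ab] by blast
    then show "\<exists>y. ?P (Suc n) y \<and> ?Q n x y"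
      using ab by (intro exI[of _ "(B, E, c)"]) (simp add: x injective_sheaf_sheaf)
  qed
  then obtain S where S': "\<forall>n. ?P n (S n) \<and> ?Q n (S n) (S (Suc n))" ..
  have S: "?P n (S n)" "?Q n (S n) (S (Suc n))" for n using S' by simp_all
  define A where "A n = fst (S n)" for n
  define B where "B n = fst (snd (S n))" for n
  define c where "c n = snd (snd (S n))" for n
  have Sn: "S n = (A n, B n, c n)" for n by (simp add: A_def B_def c_def)
  have sh: "sheaf R X (A n)" "sheaf R X (B n)" "c n \<in> mor R X (A n) (B n)" for n
    using S(1)[of n] by (simp_all add: Sn)
  have A0: "A 0 = F" "B 0 = F" "c 0 = (\<lambda>U s. \<zero>\<^bsub>sections F U\<^esub>)"
    using S(1)[of 0] by (simp_all add: Sn)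
  have AS: "A (Suc n) = B n" and inj: "injective_sheaf R X (B (Suc n))"
    and ker: "openin X U \<Longrightarrow> kernel_sections (B n) (B (Suc n)) (c (Suc n)) U = image_sections X (A n) (B n) (c n) U" for n U
    using S(2)[of n] by (simp_all add: Sn)
  have cm: "c (Suc n) \<in> mor R X (B n) (B (Suc n))" for n using sh(3)[of "Suc n"] by (simp add: AS)
  have ex: "exact_sheaf X (B n) (B (Suc n)) (B (Suc (Suc n))) (c (Suc n)) (c (Suc (Suc n)))" for n
    using ker[of _ "Suc n"] by (simp add: exact_sheaf_def AS)
  \<comment> \<open>The sheaf \<open>F\<close> occupies index zero of \<open>B\<close>, so the
    resolution begins at \<open>B 1\<close>, and its first differential is the morphism with index
    two.\<close>
  let ?I = "\<lparr>obj = (\<lambda>n. B (Suc n)), diff = (\<lambda>n. c (Suc (Suc n))), aug = c (Suc 0)\<rparr>"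
  have "mono_sheaf X F (c (Suc 0))"
  proof (rule mono_sheafI[OF cm[of 0, unfolded A0] F.presheaf_axioms sheaf_presheaf[OF sh(2)]])
    fix U s assume U: "openin X U" and s: "s \<in> carrier (sections F U)" and "c (Suc 0) U s = \<zero>\<^bsub>sections (B (Suc 0)) U\<^esub>"
    then have "s \<in> kernel_sections F (B (Suc 0)) (c (Suc 0)) U" by (simp add: kernel_sections_def)
    then have "s \<in> image_sections X F F (\<lambda>U s. \<zero>\<^bsub>sections F U\<^esub>) U"
      using ker[OF U, of 0] by (simp add: A0)
    then show "s = \<zero>\<^bsub>sections F U\<^esub>" by (rule image_sections_zero[OF F.presheaf_axioms F U])
  qed
  then have "injective_resolution R X F ?I"
    using inj cm[of 0] cm ex[of 0] ex by (simp add: injective_resolution_def A0)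
  then show ?thesis ..
qed

lemma inj_res_resolution:
  fixes R :: "'r ring" and F :: "('x, 'r, 'k set) presheaf"
  assumes "sheaf R X F"
  shows "injective_resolution R X F (inj_res R X F)"
  unfolding inj_res_def by (rule someI_ex[OF injective_resolution_exists[OF assms]])

end

locale inj_resolution =
  fixes R :: "'r ring" and X :: "'x topology" and F :: "('x, 'r, 'u) presheaf" and I :: "('x, 'r, 'u) resolution"
  assumes res: "injective_resolution R X F I" and F: "sheaf R X F"
begin

lemma obj_injective: "injective_sheaf R X (obj I n)"
  and diff_mor: "diff I n \<in> mor R X (obj I n) (obj I (Suc n))"
  and aug_mor: "aug I \<in> mor R X F (obj I 0)"
  and aug_mono: "mono_sheaf X F (aug I)"
  and exact_aug: "exact_sheaf X F (obj I 0) (obj I (Suc 0)) (aug I) (diff I 0)"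
  and exact_diff: "exact_sheaf X (obj I n) (obj I (Suc n)) (obj I (Suc (Suc n))) (diff I n) (diff I (Suc n))"
  using res by (auto simp: injective_resolution_def)

lemma obj_sheaf: "sheaf R X (obj I n)"
  by (rule injective_sheaf_sheaf[OF obj_injective])

lemma obj_presheaf: "presheaf R X (obj I n)"
  by (rule sheaf_presheaf[OF obj_sheaf])

lemma F_presheaf: "presheaf R X F"
  by (rule sheaf_presheaf[OF F])

lemma diff_aug:
  "\<lbrakk>openin X U; s \<in> carrier (sections F U)\<rbrakk> \<Longrightarrow> diff I 0 U (aug I U s) = \<zero>\<^bsub>sections (obj I (Suc 0)) U\<^esub>"
  by (rule exact_zero[OF exact_aug aug_mor obj_presheaf])

lemma diff_diff:
  "\<lbrakk>openin X U; s \<in> carrier (sections (obj I n) U)\<rbrakk>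
    \<Longrightarrow> diff I (Suc n) U (diff I n U s) = \<zero>\<^bsub>sections (obj I (Suc (Suc n))) U\<^esub>"
  by (rule exact_zero[OF exact_diff diff_mor obj_presheaf])

lemma aug_zero:
  assumes "openin X U" "s \<in> carrier (sections F U)" "aug I U s = \<zero>\<^bsub>sections (obj I 0) U\<^esub>"
  shows "s = \<zero>\<^bsub>sections F U\<^esub>"
  using aug_mono assms mor_zero[OF aug_mor F_presheaf obj_presheaf assms(1)]
    presheaf.zero_section[OF F_presheaf assms(1)]
  unfolding mono_sheaf_def by (metis inj_onD)

lemma global_complex: "cochain_complex R (global_obj X I) (global_diff X I)"
  unfolding global_obj_def global_diff_def
  by (rule cochain_complex.intro)
    (simp_all add: presheaf.sections_module[OF obj_presheaf] mor_hom[OF diff_mor] diff_diff)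

end

text \<open>The comparison theorem: each component extends the previous one along the differential
  of \<open>I\<close>.\<close>

lemma lift_exists:
  fixes F G :: "('x, 'r, 'u) presheaf"
  assumes "injective_resolution R X F I" "sheaf R X F" "injective_resolution R X G J" "sheaf R X G"
    and \<phi>: "\<phi> \<in> mor R X F G"
  shows "\<exists>g. g \<in> lifts R X F I J \<phi>"
proof -
  interpret I: inj_resolution R X F I by (rule inj_resolution.intro) fact+
  interpret J: inj_resolution R X G J by (rule inj_resolution.intro) fact+
  \<comment> \<open>Besides being a morphism, a component must send cocycles to cocycles. Carried
    along as an invariant, this is the kernel condition for constructing the next component;
    \<open>exact_kills\<close> restores it.\<close>
  let ?P = "\<lambda>n g. g \<in> mor R X (obj I n) (obj J n) \<and>
    (\<forall>U s. openin X U \<and> s \<in> carrier (sections (obj I n) U) \<and> diff I n U s = \<zero>\<^bsub>sections (obj I (Suc n)) U\<^esub>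
      \<longrightarrow> diff J n U (g U s) = \<zero>\<^bsub>sections (obj J (Suc n)) U\<^esub>) \<and>
    (n = 0 \<longrightarrow> (\<forall>U s. openin X U \<and> s \<in> carrier (sections F U) \<longrightarrow> g U (aug I U s) = aug J U (\<phi> U s)))"
  let ?Q = "\<lambda>n g g'. \<forall>U s. openin X U \<and> s \<in> carrier (sections (obj I n) U) \<longrightarrow> g' U (diff I n U s) = diff J n U (g U s)"
  have "\<exists>g. \<forall>n. ?P n (g n) \<and> ?Q n (g n) (g (Suc n))"
  proof (rule dependent_nat_choice)
    have "\<exists>h\<in>mor R X (obj I 0) (obj J 0). \<forall>U s. openin X U \<and> s \<in> carrier (sections F U) \<longrightarrow>
        h U (aug I U s) = mor_comp (aug J) \<phi> U s"
    proof (rule injective_extend_along[OF J.obj_injective I.F I.obj_sheaf I.aug_mor mor_comp_mor[OF \<phi> J.aug_mor]])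
      fix U s assume U: "openin X U" and "s \<in> carrier (sections F U)" "aug I U s = \<zero>\<^bsub>sections (obj I 0) U\<^esub>"
      then have "s = \<zero>\<^bsub>sections F U\<^esub>" by (rule I.aug_zero)
      then show "mor_comp (aug J) \<phi> U s = \<zero>\<^bsub>sections (obj J 0) U\<^esub>"
        using mor_zero[OF mor_comp_mor[OF \<phi> J.aug_mor] I.F_presheaf J.obj_presheaf U] by simp
    qed
    then obtain h where h: "h \<in> mor R X (obj I 0) (obj J 0)"
      and ha: "\<forall>U s. openin X U \<and> s \<in> carrier (sections F U) \<longrightarrow> h U (aug I U s) = mor_comp (aug J) \<phi> U s" by blast
    have "diff J 0 U (h U s) = \<zero>\<^bsub>sections (obj J (Suc 0)) U\<^esub>"
      if U: "openin X U" and s: "s \<in> carrier (sections (obj I 0) U)" and z: "diff I 0 U s = \<zero>\<^bsub>sections (obj I (Suc 0)) U\<^esub>" for U s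
    proof -
      have "mor_comp (diff J 0) h U s = \<zero>\<^bsub>sections (obj J (Suc 0)) U\<^esub>"
      proof (rule exact_kills[OF I.exact_aug J.obj_sheaf mor_comp_mor[OF h J.diff_mor] _ U s z])
        fix U s assume "openin X U" "s \<in> carrier (sections F U)"
        then show "mor_comp (diff J 0) h U (aug I U s) = \<zero>\<^bsub>sections (obj J (Suc 0)) U\<^esub>"
          using ha J.diff_aug mor_closed[OF \<phi>] by (simp add: mor_comp_def)
      qed
      then show ?thesis by (simp add: mor_comp_def)
    qed
    then show "\<exists>g. ?P 0 g" using h ha by (intro exI[of _ h]) (simp add: mor_comp_def)
  next
    fix g n assume P: "?P n g"
    then have g: "g \<in> mor R X (obj I n) (obj J n)" by blast
    have "\<exists>h\<in>mor R X (obj I (Suc n)) (obj J (Suc n)). \<forall>U s. openin X U \<and> s \<in> carrier (sections (obj I n) U) \<longrightarrow>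
        h U (diff I n U s) = mor_comp (diff J n) g U s"
      by (rule injective_extend_along[OF J.obj_injective I.obj_sheaf I.obj_sheaf I.diff_mor mor_comp_mor[OF g J.diff_mor]])
        (use P in \<open>simp add: mor_comp_def\<close>)
    then obtain h where h: "h \<in> mor R X (obj I (Suc n)) (obj J (Suc n))"
      and hd: "\<forall>U s. openin X U \<and> s \<in> carrier (sections (obj I n) U) \<longrightarrow> h U (diff I n U s) = mor_comp (diff J n) g U s" by blast
    have "diff J (Suc n) U (h U s) = \<zero>\<^bsub>sections (obj J (Suc (Suc n))) U\<^esub>"
      if U: "openin X U" and s: "s \<in> carrier (sections (obj I (Suc n)) U)"
        and z: "diff I (Suc n) U s = \<zero>\<^bsub>sections (obj I (Suc (Suc n))) U\<^esub>" for U s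
    proof -
      have "mor_comp (diff J (Suc n)) h U s = \<zero>\<^bsub>sections (obj J (Suc (Suc n))) U\<^esub>"
      proof (rule exact_kills[OF I.exact_diff J.obj_sheaf mor_comp_mor[OF h J.diff_mor] _ U s z])
        fix U s assume "openin X U" "s \<in> carrier (sections (obj I n) U)"
        then show "mor_comp (diff J (Suc n)) h U (diff I n U s) = \<zero>\<^bsub>sections (obj J (Suc (Suc n))) U\<^esub>"
          using hd J.diff_diff mor_closed[OF g] by (simp add: mor_comp_def)
      qed
      then show ?thesis by (simp add: mor_comp_def)
    qed
    then show "\<exists>g'. ?P (Suc n) g' \<and> ?Q n g g'" using h hd by (intro exI[of _ h]) (simp add: mor_comp_def)
  qed
  then obtain g where g: "\<forall>n. ?P n (g n) \<and> ?Q n (g n) (g (Suc n))" ..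
  have "?P n (g n)" "?Q n (g n) (g (Suc n))" for n using g by simp_all
  then have "g \<in> lifts R X F I J \<phi>"
    unfolding lifts_def mor_eq_def mor_comp_def by simp
  then show ?thesis by (rule exI[of _ g])
qed

lemma liftsD:
  assumes "g \<in> lifts R X F I J \<phi>"
  shows "g n \<in> mor R X (obj I n) (obj J n)"
    and "\<lbrakk>openin X U; s \<in> carrier (sections (obj I n) U)\<rbrakk> \<Longrightarrow> diff J n U (g n U s) = g (Suc n) U (diff I n U s)"
    and "\<lbrakk>openin X U; t \<in> carrier (sections F U)\<rbrakk> \<Longrightarrow> g 0 U (aug I U t) = aug J U (\<phi> U t)"
  using assms by (auto simp: lifts_def mor_eq_def mor_comp_def)

lemma liftsI:
  assumes "\<And>n. g n \<in> mor R X (obj I n) (obj J n)"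
    and "\<And>n U s. \<lbrakk>openin X U; s \<in> carrier (sections (obj I n) U)\<rbrakk> \<Longrightarrow> diff J n U (g n U s) = g (Suc n) U (diff I n U s)"
    and "\<And>U t. \<lbrakk>openin X U; t \<in> carrier (sections F U)\<rbrakk> \<Longrightarrow> g 0 U (aug I U t) = aug J U (\<phi> U t)"
  shows "g \<in> lifts R X F I J \<phi>"
  using assms by (auto simp: lifts_def mor_eq_def mor_comp_def)

lemma lifts_id: "(\<lambda>n. mor_id) \<in> lifts R X F I I mor_id"
  by (rule liftsI) (simp_all add: mor_id_mor, simp_all add: mor_id_def)

lemma lifts_comp:
  assumes g: "g \<in> lifts R X F I J \<phi>" and h: "h \<in> lifts R X G J K \<psi>" and \<phi>: "\<phi> \<in> mor R X F G"
  shows "(\<lambda>n. mor_comp (h n) (g n)) \<in> lifts R X F I K (mor_comp \<psi> \<phi>)"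
proof (rule liftsI)
  show "mor_comp (h n) (g n) \<in> mor R X (obj I n) (obj K n)" for n
    by (rule mor_comp_mor[OF liftsD(1)[OF g] liftsD(1)[OF h]])
  show "diff K n U (mor_comp (h n) (g n) U s) = mor_comp (h (Suc n)) (g (Suc n)) U (diff I n U s)"
    if "openin X U" "s \<in> carrier (sections (obj I n) U)" for n U s
    using liftsD(2)[OF h that(1) mor_closed[OF liftsD(1)[OF g] that]] liftsD(2)[OF g that] by (simp add: mor_comp_def)
  show "mor_comp (h 0) (g 0) U (aug I U t) = aug K U (mor_comp \<psi> \<phi> U t)"
    if "openin X U" "t \<in> carrier (sections F U)" for U t
    using liftsD(3)[OF h that(1) mor_closed[OF \<phi> that]] liftsD(3)[OF g that] by (simp add: mor_comp_def)
qed

lemma lifts_cong: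
  assumes "g \<in> lifts R X F I J \<phi>" "mor_eq X F \<phi> \<psi>"
  shows "g \<in> lifts R X F I J \<psi>"
  by (rule liftsI) (use assms(2) in \<open>auto simp: liftsD[OF assms(1)] mor_eq_def\<close>)

text \<open>The difference \<open>\<delta>\<close> of two lifts annihilates the augmentation; a
  contracting homotopy is built degree by degree and evaluated on a global cocycle.\<close>

lemma lifts_homotopic:
  fixes F G :: "('x, 'r, 'u) presheaf"
  assumes "injective_resolution R X F I" "sheaf R X F" "injective_resolution R X G J" "sheaf R X G"
    and g: "g \<in> lifts R X F I J \<phi>" and g': "g' \<in> lifts R X F I J \<phi>" and z: "z \<in> cocycles (global_obj X I) (global_diff X I) k"
  shows "g k (topspace X) z \<ominus>\<^bsub>global_obj X J k\<^esub> g' k (topspace X) z \<in> coboundaries (global_obj X J) (global_diff X J) k"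
proof -
  interpret I: inj_resolution R X F I by (rule inj_resolution.intro) fact+
  interpret J: inj_resolution R X G J by (rule inj_resolution.intro) fact+
  define \<delta> where "\<delta> n = mor_diff (obj J n) (g n) (g' n)" for n
  note gm = liftsD(1)[OF g] liftsD(1)[OF g']
  have \<delta>: "\<delta> n \<in> mor R X (obj I n) (obj J n)" for n
    unfolding \<delta>_def by (rule mor_diff_mor[OF gm I.obj_presheaf J.obj_presheaf])
  have d\<delta>: "diff J n U (\<delta> n U s) = \<delta> (Suc n) U (diff I n U s)"
    if U: "openin X U" and s: "s \<in> carrier (sections (obj I n) U)" for n U s
    using mor_minus[OF J.diff_mor J.obj_presheaf J.obj_presheaf U mor_closed[OF gm(1) U s] mor_closed[OF gm(2) U s]]
      liftsD(2)[OF g U s] liftsD(2)[OF g' U s] by (simp add: \<delta>_def mor_diff_def)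
  have \<delta>aug: "\<delta> 0 U (aug I U t) = \<zero>\<^bsub>sections (obj J 0) U\<^esub>" if U: "openin X U" and t: "t \<in> carrier (sections F U)" for U t
    using liftsD(3)[OF g U t] liftsD(3)[OF g' U t]
      presheaf.minus_zero_iff[OF J.obj_presheaf U mor_closed[OF gm(1) U mor_closed[OF I.aug_mor U t]]
        mor_closed[OF gm(2) U mor_closed[OF I.aug_mor U t]]]
    by (simp add: \<delta>_def mor_diff_def)
  \<comment> \<open>The homotopy \<open>h\<close> in stage \<open>n\<close> lowers degree from
    \<open>n+1\<close> to \<open>n\<close>. The invariant states that \<open>\<delta>\<close> minus
    \<open>d h\<close> vanishes on values of the differential, hence on its kernel in the next
    degree, so that the next homotopy can be extended along the differential.\<close>
  let ?P = "\<lambda>n h. h \<in> mor R X (obj I (Suc n)) (obj J n) \<and>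
    (\<forall>U s. openin X U \<and> s \<in> carrier (sections (obj I n) U) \<longrightarrow>
      \<delta> (Suc n) U (diff I n U s) = diff J n U (h U (diff I n U s))) \<and>
    (n = 0 \<longrightarrow> (\<forall>U s. openin X U \<and> s \<in> carrier (sections (obj I 0) U) \<longrightarrow> h U (diff I 0 U s) = \<delta> 0 U s))"
  let ?Q = "\<lambda>n h h'. \<forall>U s. openin X U \<and> s \<in> carrier (sections (obj I (Suc n)) U) \<longrightarrow>
      h' U (diff I (Suc n) U s) = \<delta> (Suc n) U s \<ominus>\<^bsub>sections (obj J (Suc n)) U\<^esub> diff J n U (h U s)"
  have "\<exists>h. \<forall>n. ?P n (h n) \<and> ?Q n (h n) (h (Suc n))"
  proof (rule dependent_nat_choice)
    have "\<exists>h\<in>mor R X (obj I (Suc 0)) (obj J 0). \<forall>U s. openin X U \<and> s \<in> carrier (sections (obj I 0) U) \<longrightarrow>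
        h U (diff I 0 U s) = \<delta> 0 U s"
    proof (rule injective_extend_along[OF J.obj_injective I.obj_sheaf I.obj_sheaf I.diff_mor \<delta>])
      fix U s assume *: "openin X U" "s \<in> carrier (sections (obj I 0) U)" "diff I 0 U s = \<zero>\<^bsub>sections (obj I (Suc 0)) U\<^esub>"
      show "\<delta> 0 U s = \<zero>\<^bsub>sections (obj J 0) U\<^esub>"
        by (rule exact_kills[OF I.exact_aug J.obj_sheaf \<delta> _ *]) (rule \<delta>aug)
    qed
    then obtain h where h: "h \<in> mor R X (obj I (Suc 0)) (obj J 0)"
      and hd: "\<forall>U s. openin X U \<and> s \<in> carrier (sections (obj I 0) U) \<longrightarrow> h U (diff I 0 U s) = \<delta> 0 U s" by blast
    then show "\<exists>h. ?P 0 h" using d\<delta> by (intro exI[of _ h]) simp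
  next
    fix h n assume P: "?P n h"
    then have h: "h \<in> mor R X (obj I (Suc n)) (obj J n)" by blast
    let ?e = "mor_diff (obj J (Suc n)) (\<delta> (Suc n)) (mor_comp (diff J n) h)"
    have dh: "mor_comp (diff J n) h \<in> mor R X (obj I (Suc n)) (obj J (Suc n))"
      by (rule mor_comp_mor[OF h J.diff_mor])
    have e: "?e \<in> mor R X (obj I (Suc n)) (obj J (Suc n))"
      by (rule mor_diff_mor[OF \<delta> dh I.obj_presheaf J.obj_presheaf])
    have "\<exists>h'\<in>mor R X (obj I (Suc (Suc n))) (obj J (Suc n)). \<forall>U s. openin X U \<and> s \<in> carrier (sections (obj I (Suc n)) U) \<longrightarrow>
        h' U (diff I (Suc n) U s) = ?e U s"
    proof (rule injective_extend_along[OF J.obj_injective I.obj_sheaf I.obj_sheaf I.diff_mor e])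
      fix U s assume U: "openin X U" and s: "s \<in> carrier (sections (obj I (Suc n)) U)"
        and zz: "diff I (Suc n) U s = \<zero>\<^bsub>sections (obj I (Suc (Suc n))) U\<^esub>"
      show "?e U s = \<zero>\<^bsub>sections (obj J (Suc n)) U\<^esub>"
      proof (rule exact_kills[OF I.exact_diff J.obj_sheaf e _ U s zz])
        fix U s assume U: "openin X U" and s: "s \<in> carrier (sections (obj I n) U)"
        note ds = mor_closed[OF I.diff_mor U s]
        show "?e U (diff I n U s) = \<zero>\<^bsub>sections (obj J (Suc n)) U\<^esub>"
          using P U s presheaf.minus_zero_iff[OF J.obj_presheaf U mor_closed[OF \<delta> U ds] mor_closed[OF dh U ds]]
          by (simp add: mor_diff_def mor_comp_def)
      qed
    qed
    then obtain h' where h': "h' \<in> mor R X (obj I (Suc (Suc n))) (obj J (Suc n))"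
      and hd: "\<forall>U s. openin X U \<and> s \<in> carrier (sections (obj I (Suc n)) U) \<longrightarrow> h' U (diff I (Suc n) U s) = ?e U s" by blast
    have "diff J (Suc n) U (h' U (diff I (Suc n) U s)) = \<delta> (Suc (Suc n)) U (diff I (Suc n) U s)"
      if U: "openin X U" and s: "s \<in> carrier (sections (obj I (Suc n)) U)" for U s
    proof -
      interpret M: Module.module R "sections (obj J (Suc (Suc n))) U" by (rule presheaf.sections_module[OF J.obj_presheaf U])
      have hs: "h U s \<in> carrier (sections (obj J n) U)" by (rule mor_closed[OF h U s])
      have \<delta>s: "\<delta> (Suc n) U s \<in> carrier (sections (obj J (Suc n)) U)" by (rule mor_closed[OF \<delta> U s])
      have "diff J (Suc n) U (h' U (diff I (Suc n) U s)) =
          diff J (Suc n) U (\<delta> (Suc n) U s) \<ominus>\<^bsub>sections (obj J (Suc (Suc n))) U\<^esub> diff J (Suc n) U (diff J n U (h U s))"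
        using hd U s mor_minus[OF J.diff_mor J.obj_presheaf J.obj_presheaf U \<delta>s mor_closed[OF J.diff_mor U hs]]
        by (simp add: mor_diff_def mor_comp_def)
      also have "\<dots> = diff J (Suc n) U (\<delta> (Suc n) U s)"
        using J.diff_diff[OF U hs] mor_closed[OF J.diff_mor U \<delta>s] by (simp add: a_minus_def)
      finally show ?thesis by (simp add: d\<delta>[OF U s])
    qed
    then show "\<exists>h'. ?P (Suc n) h' \<and> ?Q n h h'"
      using h' hd by (intro exI[of _ h']) (simp add: mor_diff_def mor_comp_def)
  qed
  then obtain h where h: "\<forall>n. ?P n (h n) \<and> ?Q n (h n) (h (Suc n))" ..
  have hP: "?P n (h n)" and hQ: "?Q n (h n) (h (Suc n))" for n using h by simp_all
  let ?T = "topspace X"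
  have T: "openin X ?T" by simp
  have zc: "z \<in> carrier (sections (obj I k) ?T)" and dz: "diff I k ?T z = \<zero>\<^bsub>sections (obj I (Suc k)) ?T\<^esub>"
    using z by (auto simp: cocycles_def global_obj_def global_diff_def)
  \<comment> \<open>On a cocycle the formula \<open>\<delta> = h d + d h\<close> loses its first
    summand. In degree zero there is no second one, in accordance with the degree zero coboundaries
    being just zero.\<close>
  have "\<delta> k ?T z \<in> coboundaries (global_obj X J) (global_diff X J) k"
  proof (cases k)
    case 0
    have h0: "h 0 \<in> mor R X (obj I (Suc 0)) (obj J 0)" using hP by blast
    have "\<delta> 0 ?T z = h 0 ?T \<zero>\<^bsub>sections (obj I (Suc 0)) ?T\<^esub>" using hP[of 0] zc dz 0 T by metis
    then show ?thesis
      using mor_zero[OF h0 I.obj_presheaf J.obj_presheaf T] by (simp add: coboundaries_def 0 global_obj_def)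
  next
    case (Suc n)
    have hn: "h n \<in> mor R X (obj I (Suc n)) (obj J n)" and hn': "h (Suc n) \<in> mor R X (obj I (Suc (Suc n))) (obj J (Suc n))"
      using hP by blast+
    have zc: "z \<in> carrier (sections (obj I (Suc n)) ?T)" and dz: "diff I (Suc n) ?T z = \<zero>\<^bsub>sections (obj I (Suc (Suc n))) ?T\<^esub>"
      using zc dz Suc by auto
    have hz: "h n ?T z \<in> carrier (sections (obj J n) ?T)" by (rule mor_closed[OF hn T zc])
    have "\<delta> (Suc n) ?T z \<ominus>\<^bsub>sections (obj J (Suc n)) ?T\<^esub> diff J n ?T (h n ?T z) = \<zero>\<^bsub>sections (obj J (Suc n)) ?T\<^esub>"
      using hQ[of n] zc T dz mor_zero[OF hn' I.obj_presheaf J.obj_presheaf T] by metis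
    then have "\<delta> (Suc n) ?T z = diff J n ?T (h n ?T z)"
      using presheaf.minus_zero_iff[OF J.obj_presheaf T mor_closed[OF \<delta> T zc] mor_closed[OF J.diff_mor T hz]] by simp
    then show ?thesis using hz by (simp add: Suc coboundaries_def global_obj_def global_diff_def)
  qed
  then show ?thesis by (simp add: \<delta>_def mor_diff_def global_obj_def)
qed


section \<open>Functoriality of sheaf cohomology through lifts\<close>

section \<open>Sheaf cohomology as a functor\<close>

abbreviation res_class :: "'x topology \<Rightarrow> ('x, 'r, 'u) resolution \<Rightarrow> nat \<Rightarrow> 'u \<Rightarrow> 'u set" where
  "res_class X I \<equiv> cohom_class (global_obj X I) (global_diff X I)"

abbreviation res_cocycles :: "'x topology \<Rightarrow> ('x, 'r, 'u) resolution \<Rightarrow> nat \<Rightarrow> 'u set" where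
  "res_cocycles X I \<equiv> cocycles (global_obj X I) (global_diff X I)"

abbreviation res_cohom :: "'x topology \<Rightarrow> ('x, 'r, 'u) resolution \<Rightarrow> nat \<Rightarrow> ('r, 'u set) module" where
  "res_cohom X I \<equiv> cohom_module (global_obj X I) (global_diff X I)"

abbreviation res_map :: "'x topology \<Rightarrow> ('x, 'r, 'u) resolution \<Rightarrow> nat \<Rightarrow> (nat \<Rightarrow> 'x set \<Rightarrow> 'u \<Rightarrow> 'u) \<Rightarrow> 'u set \<Rightarrow> 'u set" where
  "res_map X J k g \<equiv> cohom_map (global_obj X J) (global_diff X J) k (g k (topspace X))"

context
  fixes R :: "'r ring" and X :: "'x topology" and F G :: "('x, 'r, 'u) presheaf" and I J
  assumes I: "inj_resolution R X F I" and J: "inj_resolution R X G J"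
begin

interpretation I: inj_resolution R X F I by (rule I)
interpretation J: inj_resolution R X G J by (rule J)

lemma lifts_cochain_at:
  assumes g: "g \<in> lifts R X F I J \<phi>"
  shows "cochain_at R (global_obj X I) (global_diff X I) (global_obj X J) (global_diff X J) k (g k (topspace X))"
proof (rule cochain_atI[OF I.global_complex J.global_complex, where h = "\<lambda>n. g n (topspace X)"])
  show "g n (topspace X) \<in> mod_hom R (global_obj X I n) (global_obj X J n)" for n
    unfolding global_obj_def by (rule mor_hom[OF liftsD(1)[OF g] openin_topspace])
  show "global_diff X J n (g n (topspace X) x) = g (Suc n) (topspace X) (global_diff X I n x)"
    if "x \<in> carrier (global_obj X I n)" for n x
    using liftsD(2)[OF g openin_topspace, of x n] that by (simp add: global_obj_def global_diff_def)
qed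

lemma res_map_class:
  assumes g: "g \<in> lifts R X F I J \<phi>" and z: "z \<in> res_cocycles X I k"
  shows "res_map X J k g (res_class X I k z) = res_class X J k (g k (topspace X) z)"
  by (rule cohom_map_class[OF I.global_complex J.global_complex lifts_cochain_at[OF g] z])

lemma lift_cocycle:
  assumes g: "g \<in> lifts R X F I J \<phi>" and z: "z \<in> res_cocycles X I k"
  shows "g k (topspace X) z \<in> res_cocycles X J k"
  using lifts_cochain_at[OF g] z by (auto simp: cochain_at_def)

lemma res_map_hom:
  assumes g: "g \<in> lifts R X F I J \<phi>"
  shows "res_map X J k g \<in> mod_hom R (res_cohom X I k) (res_cohom X J k)"
  by (rule cohom_map_hom[OF I.global_complex J.global_complex lifts_cochain_at[OF g]])

lemma lift_class_unique:
  assumes g: "g \<in> lifts R X F I J \<phi>" and g': "g' \<in> lifts R X F I J \<phi>" and z: "z \<in> res_cocycles X I k"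
  shows "res_class X J k (g k (topspace X) z) = res_class X J k (g' k (topspace X) z)"
proof -
  interpret C: cochain_complex R "global_obj X J" "global_diff X J" by (rule J.global_complex)
  show ?thesis
    using C.cohom_class_eq_iff[OF C.cocycles_carrier[OF lift_cocycle[OF g z]] C.cocycles_carrier[OF lift_cocycle[OF g' z]]]
      lifts_homotopic[OF I.res I.F J.res J.F g g' z] by simp
qed

end

lemma res_cohomE:
  assumes "inj_resolution R X F I" "x \<in> carrier (res_cohom X I k)"
  obtains z where "z \<in> res_cocycles X I k" "x = res_class X I k z"
  using assms(2) cochain_complex.carrier_cohom_module[OF inj_resolution.global_complex[OF assms(1)]] by auto

text \<open>A composite of lifts lifts the composite morphism, and lifts of the same morphism agree
  on classes; so \<open>l\<close> may be any lift of \<open>\<chi>\<close>. This is the source of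
  functoriality and of the final naturality.\<close>

lemma res_map_comp:
  assumes I: "inj_resolution R X F I" and J: "inj_resolution R X G J" and K: "inj_resolution R X H K"
    and g: "g \<in> lifts R X F I J \<phi>" and h: "h \<in> lifts R X G J K \<psi>" and l: "l \<in> lifts R X F I K \<chi>"
    and \<phi>: "\<phi> \<in> mor R X F G" and eq: "mor_eq X F \<chi> (mor_comp \<psi> \<phi>)" and x: "x \<in> carrier (res_cohom X I k)"
  shows "res_map X K k h (res_map X J k g x) = res_map X K k l x"
proof -
  obtain z where z: "z \<in> res_cocycles X I k" and xz: "x = res_class X I k z" using res_cohomE[OF I x] .
  have "res_map X K k h (res_map X J k g x) = res_class X K k (mor_comp (h k) (g k) (topspace X) z)"
    using res_map_class[OF I J g z] res_map_class[OF J K h lift_cocycle[OF I J g z]] by (simp add: xz mor_comp_def)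
  also have "\<dots> = res_class X K k (l k (topspace X) z)"
    by (rule lift_class_unique[OF I K lifts_comp[OF g h \<phi>] lifts_cong[OF l eq] z])
  also have "\<dots> = res_map X K k l x" using res_map_class[OF I K l z] by (simp add: xz)
  finally show ?thesis .
qed

lemma res_map_id:
  assumes I: "inj_resolution R X F I" and g: "g \<in> lifts R X F I I \<phi>" and eq: "mor_eq X F \<phi> mor_id"
    and x: "x \<in> carrier (res_cohom X I k)"
  shows "res_map X I k g x = x"
proof -
  obtain z where z: "z \<in> res_cocycles X I k" and xz: "x = res_class X I k z" using res_cohomE[OF I x] .
  have "res_map X I k g x = res_class X I k (g k (topspace X) z)" using res_map_class[OF I I g z] by (simp add: xz)
  also have "\<dots> = res_class X I k (mor_id (topspace X) z)"
    using lift_class_unique[OF I I lifts_cong[OF g eq] lifts_id z] by simp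
  finally show ?thesis by (simp add: xz mor_id_def)
qed

context universe
begin

lemma inj_res_inj_resolution:
  fixes R :: "'r ring" and F :: "('x, 'r, 'k set) presheaf"
  assumes "sheaf R X F"
  shows "inj_resolution R X F (inj_res R X F)"
  by (rule inj_resolution.intro[OF inj_res_resolution[OF assms] assms])

lemma sheaf_cohom_eq: "sheaf_cohom R X k F = res_cohom X (inj_res R X F) k"
  by (simp add: sheaf_cohom_def Let_def)

lemma sheaf_cohom_module:
  fixes R :: "'r ring" and F :: "('x, 'r, 'k set) presheaf"
  assumes "sheaf R X F"
  shows "Module.module R (sheaf_cohom R X k F)"
  unfolding sheaf_cohom_eq
  by (rule cochain_complex.cohom_module_module[OF inj_resolution.global_complex[OF inj_res_inj_resolution[OF assms]]])

text \<open>Replaces the \<open>SOME\<close> by some lift, the same one for all degrees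
  \<open>k\<close>; afterwards only the property of being a lift is used.\<close>

lemma sheaf_cohom_mor_lift:
  fixes R :: "'r ring" and F G :: "('x, 'r, 'k set) presheaf"
  assumes F: "sheaf R X F" and G: "sheaf R X G" and \<phi>: "\<phi> \<in> mor R X F G"
  obtains g where "g \<in> lifts R X F (inj_res R X F) (inj_res R X G) \<phi>"
    and "\<And>k. sheaf_cohom_mor R X k F G \<phi> = res_map X (inj_res R X G) k g"
proof
  show "(SOME g. g \<in> lifts R X F (inj_res R X F) (inj_res R X G) \<phi>) \<in> lifts R X F (inj_res R X F) (inj_res R X G) \<phi>"
    by (rule someI_ex[OF lift_exists[OF inj_res_resolution[OF F] F inj_res_resolution[OF G] G \<phi>]])
qed (simp add: sheaf_cohom_mor_def Let_def)

lemma sheaf_cohom_mor_hom: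
  fixes R :: "'r ring" and F G :: "('x, 'r, 'k set) presheaf"
  assumes F: "sheaf R X F" and G: "sheaf R X G" and \<phi>: "\<phi> \<in> mor R X F G"
  shows "sheaf_cohom_mor R X k F G \<phi> \<in> mod_hom R (sheaf_cohom R X k F) (sheaf_cohom R X k G)"
  using sheaf_cohom_mor_lift[OF assms] res_map_hom[OF inj_res_inj_resolution[OF F] inj_res_inj_resolution[OF G]]
  unfolding sheaf_cohom_eq by metis

lemma sheaf_cohom_mor_id:
  fixes R :: "'r ring" and F :: "('x, 'r, 'k set) presheaf"
  assumes F: "sheaf R X F" and x: "x \<in> carrier (sheaf_cohom R X k F)"
  shows "sheaf_cohom_mor R X k F F mor_id x = x"
proof -
  obtain g where g: "g \<in> lifts R X F (inj_res R X F) (inj_res R X F) mor_id"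
    and eq: "\<And>k. sheaf_cohom_mor R X k F F mor_id = res_map X (inj_res R X F) k g"
    using sheaf_cohom_mor_lift[OF F F mor_id_mor] by blast
  show ?thesis
    unfolding eq by (rule res_map_id[OF inj_res_inj_resolution[OF F] g _ x[unfolded sheaf_cohom_eq]])
      (simp add: mor_eq_def)
qed

lemma sheaf_cohom_mor_comp:
  fixes R :: "'r ring" and F G H :: "('x, 'r, 'k set) presheaf"
  assumes F: "sheaf R X F" and G: "sheaf R X G" and H: "sheaf R X H"
    and \<phi>: "\<phi> \<in> mor R X F G" and \<psi>: "\<psi> \<in> mor R X G H" and x: "x \<in> carrier (sheaf_cohom R X k F)"
  shows "sheaf_cohom_mor R X k G H \<psi> (sheaf_cohom_mor R X k F G \<phi> x) = sheaf_cohom_mor R X k F H (mor_comp \<psi> \<phi>) x"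
proof -
  obtain g where g: "g \<in> lifts R X F (inj_res R X F) (inj_res R X G) \<phi>"
    and eg: "\<And>k. sheaf_cohom_mor R X k F G \<phi> = res_map X (inj_res R X G) k g"
    using sheaf_cohom_mor_lift[OF F G \<phi>] by blast
  obtain h where h: "h \<in> lifts R X G (inj_res R X G) (inj_res R X H) \<psi>"
    and eh: "\<And>k. sheaf_cohom_mor R X k G H \<psi> = res_map X (inj_res R X H) k h"
    using sheaf_cohom_mor_lift[OF G H \<psi>] by blast
  obtain l where l: "l \<in> lifts R X F (inj_res R X F) (inj_res R X H) (mor_comp \<psi> \<phi>)"
    and el: "\<And>k. sheaf_cohom_mor R X k F H (mor_comp \<psi> \<phi>) = res_map X (inj_res R X H) k l"
    using sheaf_cohom_mor_lift[OF F H mor_comp_mor[OF \<phi> \<psi>]] by blast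
  show ?thesis
    unfolding eg eh el
    by (rule res_map_comp[OF inj_res_inj_resolution[OF F] inj_res_inj_resolution[OF G] inj_res_inj_resolution[OF H]
        g h l \<phi> _ x[unfolded sheaf_cohom_eq]]) (simp add: mor_eq_def)
qed

end


section \<open>Direct images of injective resolutions and the map induced by a continuous
  map\<close>

section \<open>Exact direct images\<close>

text \<open>\<open>direct_image_exact\<close> speaks only of short exact sequences, so it is applied
  to the kernel of \<open>\<alpha>\<close>, the sheaf \<open>A\<close> and the kernel of
  \<open>\<beta>\<close>. What it contributes is the local surjectivity of the pushed
  \<open>\<alpha>\<close> onto the pushed kernel of \<open>\<beta>\<close>; kernels themselves are
  computed on sections and commute with direct image.\<close>

lemma direct_image_exact_sequence:
  fixes A B C :: "('x, 'r, 'u) presheaf"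
  assumes f: "continuous_map X Y f" and dex: "direct_image_exact TYPE('u) R X Y f"
    and A: "sheaf R X A" and B: "sheaf R X B" and C: "sheaf R X C"
    and \<alpha>: "\<alpha> \<in> mor R X A B" and \<beta>: "\<beta> \<in> mor R X B C" and ex: "exact_sheaf X A B C \<alpha> \<beta>"
  shows "exact_sheaf Y (direct_image X f A) (direct_image X f B) (direct_image X f C)
    (direct_image_mor X f \<alpha>) (direct_image_mor X f \<beta>)"
proof -
  interpret A: sheaf R X A by fact
  interpret B: sheaf R X B by fact
  interpret C: sheaf R X C by fact
  let ?K = "sub_presheaf A (kernel_sections A B \<alpha>)" and ?L = "sub_presheaf B (kernel_sections B C \<beta>)"
  have K: "sheaf R X ?K" by (rule kernel_sheaf[OF A B \<alpha>])
  have L: "sheaf R X ?L" by (rule kernel_sheaf[OF B C \<beta>])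
  have \<beta>\<alpha>: "\<beta> U (\<alpha> U a) = \<zero>\<^bsub>sections C U\<^esub>" if "openin X U" "a \<in> carrier (sections A U)" for U a
    by (rule exact_zero[OF ex \<alpha> B.presheaf_axioms that])
  have \<alpha>L: "\<alpha> \<in> mor R X A ?L"
  proof (rule morI)
    fix U assume U: "openin X U"
    show "\<alpha> U \<in> mod_hom R (sections A U) (sections ?L U)"
      by (rule mod_homI) (simp_all add: kernel_sections_def mor_closed[OF \<alpha> U] \<beta>\<alpha>[OF U] mor_add[OF \<alpha> U] mor_smult[OF \<alpha> U])
  qed (simp add: mor_restr[OF \<alpha>])
  have sub: "\<And>U. openin X U \<Longrightarrow> kernel_sections A B \<alpha> U \<subseteq> carrier (sections A U)" by (auto simp: kernel_sections_def)
  have "exact_sheaf X ?K A ?L mor_id \<alpha>"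
    unfolding exact_sheaf_def
  proof (intro allI impI)
    fix U assume U: "openin X U"
    have "s \<in> image_sections X ?K A mor_id U" if s: "s \<in> kernel_sections A B \<alpha> U" for s
    proof -
      have "restr A U U s = s" using s sub[OF U] by (intro A.restr_id[OF U]) blast
      then show ?thesis
        using s sub[OF U] U unfolding image_sections_def by (auto simp: mor_id_def intro!: exI[of _ U])
    qed
    moreover have "s \<in> kernel_sections A B \<alpha> U" if s: "s \<in> image_sections X ?K A mor_id U" for s
    proof -
      have sc: "s \<in> carrier (sections A U)" using s by (simp add: image_sections_def)
      have "\<alpha> U s = \<zero>\<^bsub>sections B U\<^esub>"
      proof (rule B.section_eqI[OF U mor_closed[OF \<alpha> U sc] B.zero_section[OF U]])
        fix x assume "x \<in> U"
        then obtain V where V: "openin X V" "x \<in> V" "V \<subseteq> U" and "restr A U V s \<in> kernel_sections A B \<alpha> V"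
          using s by (auto simp: image_sections_def mor_id_def)
        then have "restr B U V (\<alpha> U s) = \<zero>\<^bsub>sections B V\<^esub>"
          using mor_restr[OF \<alpha> U V(1,3) sc] by (simp add: kernel_sections_def)
        then show "\<exists>V. openin X V \<and> x \<in> V \<and> V \<subseteq> U \<and> restr B U V (\<alpha> U s) = restr B U V \<zero>\<^bsub>sections B U\<^esub>"
          using V B.restr_zero[OF U V(1,3)] by auto
      qed
      then show ?thesis using sc by (simp add: kernel_sections_def)
    qed
    ultimately have "image_sections X ?K A mor_id U = kernel_sections A B \<alpha> U" by blast
    then show "image_sections X ?K A mor_id U = kernel_sections A ?L \<alpha> U" by (simp add: kernel_sections_def)
  qed
  moreover have "epi_sheaf X A ?L \<alpha>"
    unfolding epi_sheaf_def
  proof (intro allI impI)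
    fix U assume U: "openin X U"
    \<comment> \<open>Exactness puts the image of \<open>\<alpha>\<close> inside the kernel of
      \<open>\<beta>\<close>, so passing to the subsheaf as target does not change it.\<close>
    have "image_sections X A ?L \<alpha> U = kernel_sections B C \<beta> U \<inter> image_sections X A B \<alpha> U"
      by (auto simp: image_sections_def kernel_sections_def)
    also have "\<dots> = kernel_sections B C \<beta> U" using ex U by (simp add: exact_sheaf_def)
    finally show "image_sections X A ?L \<alpha> U = carrier (sections ?L U)" by simp
  qed
  ultimately have "short_exact R X ?K A ?L mor_id \<alpha>"
    using K A L \<alpha>L sub_presheaf_incl[OF A.presheaf_axioms sub] by (simp add: short_exact_def)
  then have "epi_sheaf Y (direct_image X f A) (direct_image X f ?L) (direct_image_mor X f \<alpha>)"
    using dex unfolding direct_image_exact_def short_exact_def by blast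
  then have epi: "image_sections Y (direct_image X f A) (direct_image X f ?L) (direct_image_mor X f \<alpha>) V
      = kernel_sections B C \<beta> (preim X f V)" if "openin Y V" for V
    using that by (simp add: epi_sheaf_def)
  interpret fC: sheaf R Y "direct_image X f C" by (rule direct_image_sheaf[OF f C])
  show ?thesis
    unfolding exact_sheaf_def
  proof (intro allI impI subset_antisym subsetI)
    fix V s assume V: "openin Y V" and s: "s \<in> image_sections Y (direct_image X f A) (direct_image X f B) (direct_image_mor X f \<alpha>) V"
    note f\<beta> = direct_image_mor_mor[OF f \<beta>]
    have sc: "s \<in> carrier (sections (direct_image X f B) V)" using s by (simp add: image_sections_def)
    have "direct_image_mor X f \<beta> V s = \<zero>\<^bsub>sections (direct_image X f C) V\<^esub>"
    proof (rule fC.section_eqI[OF V mor_closed[OF f\<beta> V sc] fC.zero_section[OF V]])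
      fix y assume "y \<in> V"
      then obtain W a where W: "openin Y W" "y \<in> W" "W \<subseteq> V" and a: "a \<in> carrier (sections A (preim X f W))"
        "restr (direct_image X f B) V W s = \<alpha> (preim X f W) a"
        using s by (auto simp: image_sections_def direct_image_mor_def)
      have "restr (direct_image X f C) V W (direct_image_mor X f \<beta> V s) = \<beta> (preim X f W) (\<alpha> (preim X f W) a)"
        using mor_restr[OF f\<beta> V W(1,3) sc] unfolding a(2) by (simp add: direct_image_mor_def)
      also have "\<dots> = restr (direct_image X f C) V W \<zero>\<^bsub>sections (direct_image X f C) V\<^esub>"
        using \<beta>\<alpha>[OF openin_preim[OF f W(1)] a(1)] fC.restr_zero[OF V W(1,3)] by simp
      finally show "\<exists>W. openin Y W \<and> y \<in> W \<and> W \<subseteq> V \<and> restr (direct_image X f C) V W (direct_image_mor X f \<beta> V s) =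
          restr (direct_image X f C) V W \<zero>\<^bsub>sections (direct_image X f C) V\<^esub>"
        using W by blast
    qed
    then show "s \<in> kernel_sections (direct_image X f B) (direct_image X f C) (direct_image_mor X f \<beta>) V"
      using sc by (simp add: kernel_sections_def)
  next
    fix V s assume V: "openin Y V" and s: "s \<in> kernel_sections (direct_image X f B) (direct_image X f C) (direct_image_mor X f \<beta>) V"
    from s have "s \<in> kernel_sections B C \<beta> (preim X f V)" by (simp add: kernel_sections_def direct_image_mor_def)
    then have "s \<in> image_sections Y (direct_image X f A) (direct_image X f ?L) (direct_image_mor X f \<alpha>) V"
      using epi[OF V] by simp
    then show "s \<in> image_sections Y (direct_image X f A) (direct_image X f B) (direct_image_mor X f \<alpha>) V"
      by (simp add: image_sections_def kernel_sections_def)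
  qed
qed

definition direct_image_resolution ::
  "'x topology \<Rightarrow> ('x \<Rightarrow> 'y) \<Rightarrow> ('x, 'r, 'u) resolution \<Rightarrow> ('y, 'r, 'u) resolution" where
  "direct_image_resolution X f I = \<lparr>obj = (\<lambda>n. direct_image X f (obj I n)),
     diff = (\<lambda>n. direct_image_mor X f (diff I n)), aug = direct_image_mor X f (aug I)\<rparr>"

lemma direct_image_resolution_simps [simp]:
  "obj (direct_image_resolution X f I) n = direct_image X f (obj I n)"
  "diff (direct_image_resolution X f I) n = direct_image_mor X f (diff I n)"
  "aug (direct_image_resolution X f I) = direct_image_mor X f (aug I)"
  by (simp_all add: direct_image_resolution_def)

text \<open>The preimage of the whole space is the whole space, so the complexes of global sections
  are equal, not merely isomorphic, and cohomology classes may be moved between the two spaces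
  without any map.\<close>

lemma global_direct_image_resolution:
  assumes "continuous_map X Y f"
  shows "global_obj Y (direct_image_resolution X f I) = global_obj X I"
    and "global_diff Y (direct_image_resolution X f I) = global_diff X I"
  using preim_topspace[OF assms]
  by (simp_all add: global_obj_def global_diff_def direct_image_mor_def fun_eq_iff)

lemma direct_image_lifts:
  assumes f: "continuous_map X Y f" and g: "g \<in> lifts R X F I J \<phi>"
  shows "(\<lambda>n. direct_image_mor X f (g n)) \<in> lifts R Y (direct_image X f F)
    (direct_image_resolution X f I) (direct_image_resolution X f J) (direct_image_mor X f \<phi>)"
proof (rule liftsI)
  show "direct_image_mor X f (g n) \<in> mor R Y (obj (direct_image_resolution X f I) n) (obj (direct_image_resolution X f J) n)" for n
    using direct_image_mor_mor[OF f liftsD(1)[OF g]] by simp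
qed (simp_all add: direct_image_mor_def liftsD(2,3)[OF g openin_preim[OF f]])

context universe
begin

lemma direct_image_inj_resolution:
  fixes R :: "'r ring" and F :: "('x, 'r, 'k set) presheaf"
  assumes f: "continuous_map X Y f" and dex: "direct_image_exact TYPE('k set) R X Y f"
    and I: "inj_resolution R X F I"
  shows "inj_resolution R Y (direct_image X f F) (direct_image_resolution X f I)"
proof (rule inj_resolution.intro)
  interpret I: inj_resolution R X F I by fact
  show "sheaf R Y (direct_image X f F)" by (rule direct_image_sheaf[OF f I.F])
  note ex = direct_image_exact_sequence[OF f dex]
  have "mono_sheaf Y (direct_image X f F) (direct_image_mor X f (aug I))"
    using I.aug_mono openin_preim[OF f] by (simp add: mono_sheaf_def direct_image_mor_def)
  then show "injective_resolution R Y (direct_image X f F) (direct_image_resolution X f I)"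
    unfolding injective_resolution_def
    using direct_image_injective[OF f I.obj_injective] direct_image_mor_mor[OF f I.diff_mor]
      direct_image_mor_mor[OF f I.aug_mor]
      ex[OF I.F I.obj_sheaf I.obj_sheaf I.aug_mor I.diff_mor I.exact_aug]
      ex[OF I.obj_sheaf I.obj_sheaf I.obj_sheaf I.diff_mor I.diff_mor I.exact_diff]
    by simp
qed

text \<open>By adjunction, cochain maps \<open>f\<^sup>* I \<rightarrow> J\<close> are cochain maps \<open>I \<rightarrow> f\<^sub>* J\<close>, and \<open>f\<^sub>* J\<close> is an injective
  resolution. Hence the induced map on cohomology is computed by an arbitrary lift of the unit;
  exactness of \<open>f\<^sup>*\<close> is never needed.\<close>

lemma induced_cohom_map_lift:
  fixes R :: "'r ring" and H :: "('x, 'r, 'k set) presheaf" and f :: "'x \<Rightarrow> 'x"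
  assumes f: "continuous_map X Y f" and dex: "direct_image_exact TYPE('k set) R X Y f"
    and H: "sheaf R Y H"
  defines "fH \<equiv> inverse_image X Y f H :: ('x, 'r, 'k set) presheaf"
  obtains l where "l \<in> lifts R Y H (inj_res R Y H) (direct_image_resolution X f (inj_res R X fH)) (inverse_image_unit X Y f H)"
    and "\<And>k. induced_cohom_map R X Y f k H = res_map Y (direct_image_resolution X f (inj_res R X fH)) k l"
proof -
  interpret inverse_image_setup R X Y f "TYPE('k set)" "TYPE('k set)"
    by (rule inverse_image_setup.intro[OF f embeds_pullback[OF embeds_self]])
  define I where "I = inj_res R Y H"
  define J where "J = inj_res R X fH"
  define fI where "fI = (inverse_image_resolution X Y f H I :: ('x, 'r, 'k set) resolution)"
  have fHs: "sheaf R X fH" unfolding fH_def by (rule pull_sheaf[OF sheaf_presheaf[OF H]])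
  interpret I: inj_resolution R Y H I unfolding I_def by (rule inj_res_inj_resolution[OF H])
  interpret J: inj_resolution R X fH J unfolding J_def by (rule inj_res_inj_resolution[OF fHs])
  let ?fJ = "direct_image_resolution X f J"
  interpret fJ: inj_resolution R Y "direct_image X f fH" ?fJ
    by (rule direct_image_inj_resolution[OF f dex J.inj_resolution_axioms])
  have \<eta>: "eta H \<in> mor R Y H (direct_image X f fH)" unfolding fH_def by (rule unit_mor[OF I.F_presheaf])
  have fI: "obj fI n = pull (obj I n)" "diff fI n = inverse_image_mor X Y f (obj I n) (obj I (Suc n)) (diff I n)"
    "aug fI = inverse_image_mor X Y f H (obj I 0) (aug I)" for n
    by (simp_all add: fI_def inverse_image_resolution_def)
  note dm = inverse_image_mor_mor[OF I.obj_presheaf I.obj_presheaf I.diff_mor]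
  note am = inverse_image_mor_mor[OF I.F_presheaf I.obj_presheaf I.aug_mor]
  note du = inverse_image_mor_unit[OF I.obj_presheaf I.obj_presheaf I.diff_mor]
  note au = inverse_image_mor_unit[OF I.F_presheaf I.obj_presheaf I.aug_mor]
  have ucl: "eta P W w \<in> carrier (sections (pull P) (preim X f W))"
    if "presheaf R Y P" "openin Y W" "w \<in> carrier (sections P W)" for P W w
    using mor_closed[OF unit_mor[OF that(1)] that(2,3)] by simp
  \<comment> \<open>The \<open>SOME\<close> in \<open>induced_cohom_map\<close> has to be justified.
    Since \<open>fI\<close> is not known to be a resolution, a lift of the unit into the pushed
    resolution is built first and then transposed componentwise; \<open>adjunct_unique\<close>
    reduces the required identities to unit sections.\<close>
  have "\<exists>g. g \<in> lifts R X fH fI J mor_id"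
  proof -
    obtain l where l: "l \<in> lifts R Y H I ?fJ (eta H)"
      using lift_exists[OF I.res I.F fJ.res fJ.F \<eta>] by blast
    have "\<forall>n. \<exists>\<beta>. \<beta> \<in> mor R X (pull (obj I n)) (obj J n) \<and>
        (\<forall>W. openin Y W \<longrightarrow> (\<forall>w\<in>carrier (sections (obj I n) W). \<beta> (preim X f W) (eta (obj I n) W w) = l n W w))"
      using adjunct_exists[OF I.obj_presheaf J.obj_sheaf liftsD(1)[OF l, simplified]] by blast
    then obtain g where g: "\<And>n. g n \<in> mor R X (pull (obj I n)) (obj J n)"
      and gl: "\<And>n W w. openin Y W \<Longrightarrow> w \<in> carrier (sections (obj I n) W) \<Longrightarrow> g n (preim X f W) (eta (obj I n) W w) = l n W w"
      by metis
    have "g \<in> lifts R X fH fI J mor_id"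
    proof (rule liftsI)
      show "g n \<in> mor R X (obj fI n) (obj J n)" for n using g by (simp add: fI)
    next
      fix n
      have "mor_eq X (pull (obj I n)) (mor_comp (diff J n) (g n)) (mor_comp (g (Suc n)) (diff fI n))"
        unfolding fI
      proof (rule adjunct_unique[OF I.obj_presheaf J.obj_sheaf mor_comp_mor[OF g J.diff_mor] mor_comp_mor[OF dm g]])
        fix W w assume W: "openin Y W" and w: "w \<in> carrier (sections (obj I n) W)"
        show "mor_comp (diff J n) (g n) (preim X f W) (eta (obj I n) W w) =
            mor_comp (g (Suc n)) (inverse_image_mor X Y f (obj I n) (obj I (Suc n)) (diff I n)) (preim X f W) (eta (obj I n) W w)"
          using liftsD(2)[OF l W w] du[OF W w] gl[OF W w] gl[OF W mor_closed[OF I.diff_mor W w]]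
          by (simp add: mor_comp_def direct_image_mor_def)
      qed
      then show "diff J n U (g n U s) = g (Suc n) U (diff fI n U s)"
        if "openin X U" "s \<in> carrier (sections (obj fI n) U)" for U s
        using mor_eqD[of X "pull (obj I n)" "mor_comp (diff J n) (g n)" "mor_comp (g (Suc n)) (diff fI n)"] that
        by (simp add: mor_comp_def fI(1))
    next
      have "mor_eq X fH (mor_comp (g 0) (aug fI)) (mor_comp (aug J) mor_id)"
        unfolding fI fH_def
      proof (rule adjunct_unique[OF I.F_presheaf J.obj_sheaf mor_comp_mor[OF am g]])
        show "mor_comp (aug J) mor_id \<in> mor R X (pull H) (obj J 0)"
          using mor_comp_mor[OF mor_id_mor J.aug_mor] by (simp add: fH_def)
        fix W w assume W: "openin Y W" and w: "w \<in> carrier (sections H W)"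
        show "mor_comp (g 0) (inverse_image_mor X Y f H (obj I 0) (aug I)) (preim X f W) (eta H W w) =
            mor_comp (aug J) mor_id (preim X f W) (eta H W w)"
          using liftsD(3)[OF l W w] au[OF W w] gl[OF W mor_closed[OF I.aug_mor W w]]
          by (simp add: mor_comp_def direct_image_mor_def mor_id_def)
      qed
      then show "g 0 U (aug fI U t) = aug J U (mor_id U t)" if "openin X U" "t \<in> carrier (sections fH U)" for U t
        using mor_eqD[of X fH "mor_comp (g 0) (aug fI)" "mor_comp (aug J) mor_id"] that by (simp add: mor_comp_def)
    qed
    then show ?thesis by (rule exI[of _ g])
  qed
  then have g: "(SOME g. g \<in> lifts R X fH fI J mor_id) \<in> lifts R X fH fI J mor_id" by (rule someI_ex)
  define g where "g = (SOME g. g \<in> lifts R X fH fI J mor_id)"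
  note g = g[folded g_def]
  \<comment> \<open>The transpose back of the chosen \<open>g\<close>. On global sections it is
    exactly the map in the definition of the induced map.\<close>
  define l where "l n = mor_comp (direct_image_mor X f (g n)) (eta (obj I n))" for n
  have "l \<in> lifts R Y H I ?fJ (eta H)"
  proof (rule liftsI)
    show "l n \<in> mor R Y (obj I n) (obj ?fJ n)" for n
      unfolding l_def using mor_comp_mor[OF unit_mor[OF I.obj_presheaf] direct_image_mor_mor[OF f liftsD(1)[OF g, unfolded fI]]]
      by simp
    show "diff ?fJ n U (l n U s) = l (Suc n) U (diff I n U s)" if U: "openin Y U" and s: "s \<in> carrier (sections (obj I n) U)" for n U s
      using liftsD(2)[OF g openin_preim[OF f U], of "eta (obj I n) U s" n, unfolded fI] ucl[OF I.obj_presheaf U s] du[OF U s]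
      by (simp add: l_def mor_comp_def direct_image_mor_def)
    show "l 0 U (aug I U t) = aug ?fJ U (eta H U t)" if U: "openin Y U" and t: "t \<in> carrier (sections H U)" for U t
      using liftsD(3)[OF g openin_preim[OF f U], of "eta H U t", unfolded fI] ucl[OF I.F_presheaf U t] au[OF U t]
      by (simp add: l_def mor_comp_def direct_image_mor_def fH_def mor_id_def)
  qed
  moreover have "induced_cohom_map R X Y f k H = res_map Y ?fJ k l" for k
    unfolding induced_cohom_map_def Let_def
    by (simp add: global_direct_image_resolution[OF f] l_def mor_comp_def direct_image_mor_def preim_topspace[OF f] comp_def
        flip: fH_def I_def J_def fI_def g_def)
  ultimately show thesis using that unfolding I_def J_def by blast
qed

end


section \<open>The natural isomorphism between the two copersistence modules\<close>

section \<open>Comparison of the copersistence modules\<close>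

lemma descend_self: "descend s i i = id"
  by (cases i) auto

lemma descend_trans:
  assumes "l \<le> j" "j \<le> i"
  shows "descend s j l (descend s i j z) = descend s i l z"
  using assms
proof (induction i arbitrary: z)
  case (Suc i)
  then show ?case
  proof (cases "j \<le> i")
    case False
    then have "j = Suc i" using Suc.prems by simp
    then show ?thesis by (simp add: descend_self del: descend.simps)
  qed simp
qed simp

text \<open>Agreement on preimages is all that is needed, so \<open>h\<close> need equal the
  composite only on points of the space. The conclusions are equalities, and no coherence
  isomorphisms for direct images appear.\<close>

lemma direct_image_comp:
  assumes "\<And>W. preim X h W = preim X f (preim Y g W)"
  shows "direct_image X h P = direct_image Y g (direct_image X f P)"
    and "direct_image_mor X h \<alpha> = direct_image_mor Y g (direct_image_mor X f \<alpha>)"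
    and "direct_image_resolution X h I = direct_image_resolution Y g (direct_image_resolution X f I)"
  using assms by (simp_all add: direct_image_def direct_image_mor_def direct_image_resolution_def)

locale exact_diagram =
  fixes R :: "'r ring" and X :: "enat \<Rightarrow> 'x topology" and \<phi> :: "enat \<Rightarrow> enat \<Rightarrow> 'x \<Rightarrow> 'x"
    and F :: "('x, 'r, 'm) presheaf" and k :: nat
  assumes diagram: "top_functor X \<phi>"
    and exact: "\<And>i j. i \<le> j \<Longrightarrow> direct_image_exact TYPE(('x, 'r, 'm) univ) R (X i) (X j) (\<phi> i j)"
    and F: "sheaf R (X \<infinity>) F"
begin

sublocale universe "TYPE('x)" "TYPE('r)" "TYPE(('x + 'r + 'm) list)"
proof
  show "infinite (UNIV :: ('x + 'r + 'm) list set)" by (rule infinite_UNIV_listI)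
  show "embeds TYPE('x) TYPE(('x + 'r + 'm) list)"
    by (rule embedsI[of "\<lambda>x. [Inl x]"]) (auto simp: inj_def)
  show "embeds TYPE('r) TYPE(('x + 'r + 'm) list)"
    by (rule embedsI[of "\<lambda>r. [Inr (Inl r)]"]) (auto simp: inj_def)
qed

lemma embeds_section: "embeds TYPE('m) TYPE(('x, 'r, 'm) univ)"
  by (rule embedsI[of "\<lambda>m. {[Inr (Inr m)]}"]) (auto simp: inj_def)

lemma continuous: "i \<le> j \<Longrightarrow> continuous_map (X i) (X j) (\<phi> i j)"
  using diagram by (simp add: top_functor_def)

lemma preim_functor:
  assumes "i \<le> j" "j \<le> l"
  shows "preim (X i) (\<phi> i l) W = preim (X i) (\<phi> i j) (preim (X j) (\<phi> j l) W)"
  using diagram assms continuous_map_image_subset_topspace[OF continuous[OF assms(1)]]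
  by (auto simp: preim_def top_functor_def)

abbreviation (input) pull_at :: "nat \<Rightarrow> ('x, 'r, ('x, 'r, 'm) univ) presheaf" where
  "pull_at \<equiv> pulled X \<phi> F"

abbreviation (input) G :: "nat \<Rightarrow> ('x, 'r, ('x, 'r, 'm) univ) presheaf" where
  "G \<equiv> G_obj X \<phi> F"

abbreviation (input) t :: "nat \<Rightarrow> 'x \<Rightarrow> 'x" where
  "t i \<equiv> \<phi> (enat i) (enat (Suc i))"

lemma continuous_t: "continuous_map (X (enat i)) (X (enat (Suc i))) (t i)"
  by (rule continuous) simp

lemma continuous_infinity: "continuous_map (X (enat i)) (X \<infinity>) (\<phi> (enat i) \<infinity>)"
  by (rule continuous) simp

lemma exact_infinity: "direct_image_exact TYPE(('x, 'r, 'm) univ) R (X (enat i)) (X \<infinity>) (\<phi> (enat i) \<infinity>)"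
  by (rule exact) simp

lemma exact_t: "direct_image_exact TYPE(('x, 'r, 'm) univ) R (X (enat i)) (X (enat (Suc i))) (t i)"
  by (rule exact) simp

lemma preim_step:
  "preim (X (enat i)) (\<phi> (enat i) \<infinity>) W = preim (X (enat i)) (t i) (preim (X (enat (Suc i))) (\<phi> (enat (Suc i)) \<infinity>) W)"
  by (rule preim_functor) simp_all

lemmas image_step = direct_image_comp[OF preim_step]

lemma base_setup: "inverse_image_setup TYPE('m) TYPE(('x, 'r, 'm) univ) (X (enat i)) (X \<infinity>) (\<phi> (enat i) \<infinity>)"
  by (rule inverse_image_setup.intro[OF continuous_infinity embeds_pullback[OF embeds_section]])

lemma step_setup:
  "inverse_image_setup TYPE(('x, 'r, 'm) univ) TYPE(('x, 'r, 'm) univ) (X (enat i)) (X (enat (Suc i))) (t i)"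
  by (rule inverse_image_setup.intro[OF continuous_t embeds_pullback[OF embeds_self]])

lemma F_presheaf: "presheaf R (X \<infinity>) F"
  by (rule sheaf_presheaf[OF F])

lemma pull_at_sheaf: "sheaf R (X (enat i)) (pull_at i)"
  unfolding pulled_def by (rule inverse_image_setup.pull_sheaf[OF base_setup F_presheaf])

lemma G_sheaf: "sheaf R (X \<infinity>) (G i)"
  unfolding G_obj_def by (rule direct_image_sheaf[OF continuous_infinity pull_at_sheaf])

abbreviation (input) pull_step :: "nat \<Rightarrow> ('x, 'r, ('x, 'r, 'm) univ) presheaf" where
  "pull_step i \<equiv> inverse_image (X (enat i)) (X (enat (Suc i))) (t i) (pull_at (Suc i))"

abbreviation (input) step_unit :: "nat \<Rightarrow> 'x set \<Rightarrow> ('x, 'r, 'm) univ \<Rightarrow> ('x, 'r, 'm) univ" where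
  "step_unit i \<equiv> inverse_image_unit (X (enat i)) (X (enat (Suc i))) (t i) (pull_at (Suc i))"

abbreviation (input) step_iso :: "nat \<Rightarrow> 'x set \<Rightarrow> ('x, 'r, 'm) univ \<Rightarrow> ('x, 'r, 'm) univ" where
  "step_iso i \<equiv> pulled_iso R X \<phi> F i"

lemma pull_step_sheaf: "sheaf R (X (enat i)) (pull_step i)"
  by (rule inverse_image_setup.pull_sheaf[OF step_setup sheaf_presheaf[OF pull_at_sheaf]])

lemma step_unit_mor:
  "step_unit i \<in> mor R (X (enat (Suc i))) (pull_at (Suc i)) (direct_image (X (enat i)) (t i) (pull_step i))"
  by (rule inverse_image_setup.unit_mor[OF step_setup sheaf_presheaf[OF pull_at_sheaf]])

text \<open>\<open>pulled_iso\<close> is picked by \<open>SOME\<close>, so a morphism compatible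
  with the units must be produced: the unit of the long map is transposed first along
  \<open>X (i+1) \<rightarrow> X \<infinity>\<close>, then along
  \<open>X i \<rightarrow> X (i+1)\<close>.\<close>

lemma step_iso_mor: "step_iso i \<in> mor R (X (enat i)) (pull_step i) (pull_at i)"
proof -
  let ?Xi = "X (enat i)" and ?Xj = "X (enat (Suc i))" and ?g = "\<phi> (enat (Suc i)) \<infinity>"
  let ?ui = "inverse_image_unit ?Xi (X \<infinity>) (\<phi> (enat i) \<infinity>) F"
  let ?uj = "inverse_image_unit ?Xj (X \<infinity>) ?g F"
  have ui: "?ui \<in> mor R (X \<infinity>) F (direct_image ?Xj ?g (direct_image ?Xi (t i) (pull_at i)))"
    using inverse_image_setup.unit_mor[OF base_setup F_presheaf, of i] by (simp add: pulled_def image_step[where i = i])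
  obtain \<beta> where \<beta>: "\<beta> \<in> mor R ?Xj (pull_at (Suc i)) (direct_image ?Xi (t i) (pull_at i))"
    and \<beta>u: "\<forall>W. openin (X \<infinity>) W \<longrightarrow> (\<forall>w\<in>carrier (sections F W). \<beta> (preim ?Xj ?g W) (?uj W w) = ?ui W w)"
    using inverse_image_setup.adjunct_exists[OF base_setup F_presheaf direct_image_sheaf[OF continuous_t pull_at_sheaf] ui]
    unfolding pulled_def by blast
  obtain c where c: "c \<in> mor R ?Xi (pull_step i) (pull_at i)"
    and cu: "\<forall>V. openin ?Xj V \<longrightarrow> (\<forall>w\<in>carrier (sections (pull_at (Suc i)) V).
      c (preim ?Xi (t i) V) (step_unit i V w) = \<beta> V w)"
    using inverse_image_setup.adjunct_exists[OF step_setup sheaf_presheaf[OF pull_at_sheaf] pull_at_sheaf \<beta>] by blast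
  have cW: "c (preim ?Xi (\<phi> (enat i) \<infinity>) W) (step_unit i (preim ?Xj ?g W) (?uj W s)) = ?ui W s"
    if W: "openin (X \<infinity>) W" and s: "s \<in> carrier (sections F W)" for W s
  proof -
    have "?uj W s \<in> carrier (sections (pull_at (Suc i)) (preim ?Xj ?g W))"
      using mor_closed[OF inverse_image_setup.unit_mor[OF base_setup F_presheaf] W s, of "Suc i"] by (simp add: pulled_def)
    then show ?thesis
      using cu \<beta>u W s openin_preim[OF continuous_infinity W, of "Suc i"] by (simp add: preim_step[of i])
  qed
  have "\<exists>c. c \<in> mor R ?Xi (pull_step i) (pull_at i) \<and>
     (\<forall>W. openin (X \<infinity>) W \<longrightarrow> (\<forall>s\<in>carrier (sections F W).
        c (preim ?Xi (\<phi> (enat i) \<infinity>) W) (step_unit i (preim ?Xj ?g W) (?uj W s)) = ?ui W s))"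
    by (intro exI[of _ c] conjI allI impI ballI c cW)
  from someI_ex[OF this] show ?thesis
    unfolding pulled_iso_def inverse_image_comp_def by (simp add: pulled_def)
qed

abbreviation (input) J :: "nat \<Rightarrow> ('x, 'r, ('x, 'r, 'm) univ) resolution" where
  "J i \<equiv> inj_res R (X (enat i)) (pull_at i)"

abbreviation (input) fJ :: "nat \<Rightarrow> ('x, 'r, ('x, 'r, 'm) univ) resolution" where
  "fJ i \<equiv> direct_image_resolution (X (enat i)) (\<phi> (enat i) \<infinity>) (J i)"

lemma J_res: "inj_resolution R (X (enat i)) (pull_at i) (J i)"
  by (rule inj_res_inj_resolution[OF pull_at_sheaf])

lemma fJ_res: "inj_resolution R (X \<infinity>) (G i) (fJ i)"
  unfolding G_obj_def by (rule direct_image_inj_resolution[OF continuous_infinity exact_infinity J_res])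

lemma G_res: "inj_resolution R (X \<infinity>) (G i) (inj_res R (X \<infinity>) (G i))"
  by (rule inj_res_inj_resolution[OF G_sheaf])

lemma D_obj_eq: "D_obj R X \<phi> F k i = res_cohom (X \<infinity>) (fJ i) k"
  by (simp add: D_obj_def sheaf_cohom_eq global_direct_image_resolution[OF continuous_infinity])

text \<open>The two direct images in the definition are taken along different maps to
  \<open>X \<infinity>\<close>; factoring the longer one through \<open>X (i+1)\<close> exhibits the
  step as the direct image of a single morphism on \<open>X (i+1)\<close>.\<close>

lemma G_step_eq:
  "G_step R X \<phi> F i = direct_image_mor (X (enat (Suc i))) (\<phi> (enat (Suc i)) \<infinity>)
    (mor_comp (direct_image_mor (X (enat i)) (t i) (step_iso i)) (step_unit i))"
  by (simp add: G_step_def preim_step[of i] mor_comp_def direct_image_mor_def fun_eq_iff)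

lemma step_mor:
  "mor_comp (direct_image_mor (X (enat i)) (t i) (step_iso i)) (step_unit i)
    \<in> mor R (X (enat (Suc i))) (pull_at (Suc i)) (direct_image (X (enat i)) (t i) (pull_at i))"
  by (rule mor_comp_mor[OF step_unit_mor direct_image_mor_mor[OF continuous_t step_iso_mor]])

lemma G_step_mor: "G_step R X \<phi> F i \<in> mor R (X \<infinity>) (G (Suc i)) (G i)"
  using direct_image_mor_mor[OF continuous_infinity step_mor] by (simp add: G_step_eq G_obj_def image_step[where i = i])

lemma G_map_self: "G_map R X \<phi> F i i = mor_id"
  by (simp add: G_map_def descend_self mor_id_def fun_eq_iff)

lemma G_map_Suc: "j \<le> i \<Longrightarrow> G_map R X \<phi> F (Suc i) j = mor_comp (G_map R X \<phi> F i j) (G_step R X \<phi> F i)"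
  by (simp add: G_map_def mor_comp_def fun_eq_iff)

lemma G_map_mor: "j \<le> i \<Longrightarrow> G_map R X \<phi> F i j \<in> mor R (X \<infinity>) (G i) (G j)"
proof (induction i)
  case 0
  then show ?case using mor_id_mor by (simp add: G_map_self)
next
  case (Suc i)
  show ?case
  proof (cases "j \<le> i")
    case True
    then show ?thesis using mor_comp_mor[OF G_step_mor Suc.IH] by (simp add: G_map_Suc)
  next
    case False
    then have "j = Suc i" using Suc.prems by simp
    then show ?thesis using mor_id_mor by (simp add: G_map_self)
  qed
qed

lemma G_map_trans:
  assumes "l \<le> j" "j \<le> i"
  shows "mor_comp (G_map R X \<phi> F j l) (G_map R X \<phi> F i j) = G_map R X \<phi> F i l"
  by (simp add: mor_comp_def G_map_def fun_eq_iff descend_trans[OF assms])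

text \<open>The structure map of cohomology is moved to \<open>X \<infinity>\<close>: a lift of the
  unit followed by a lift of the identification is a lift of their composite on
  \<open>X (i+1)\<close>, and its direct image lifts the step of \<open>G\<close>.\<close>

lemma D_step_lift:
  "\<exists>l\<in>lifts R (X \<infinity>) (G (Suc i)) (fJ (Suc i)) (fJ i) (G_step R X \<phi> F i).
    \<forall>x\<in>carrier (D_obj R X \<phi> F k (Suc i)). D_step R X \<phi> F k i x = res_map (X \<infinity>) (fJ i) k l x"
proof -
  let ?Xi = "X (enat i)" and ?Xj = "X (enat (Suc i))" and ?g = "\<phi> (enat (Suc i)) \<infinity>"
  let ?J' = "inj_res R ?Xi (pull_step i)"
  obtain u where u: "u \<in> lifts R ?Xj (pull_at (Suc i)) (J (Suc i)) (direct_image_resolution ?Xi (t i) ?J') (step_unit i)"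
    and eu: "\<And>k. induced_cohom_map R ?Xi ?Xj (t i) k (pull_at (Suc i)) = res_map ?Xj (direct_image_resolution ?Xi (t i) ?J') k u"
    using induced_cohom_map_lift[OF continuous_t exact_t pull_at_sheaf] by blast
  obtain c where c: "c \<in> lifts R ?Xi (pull_step i) ?J' (J i) (step_iso i)"
    and ec: "\<And>k. sheaf_cohom_mor R ?Xi k (pull_step i) (pull_at i) (step_iso i) = res_map ?Xi (J i) k c"
    using sheaf_cohom_mor_lift[OF pull_step_sheaf pull_at_sheaf step_iso_mor] by blast
  have J': "inj_resolution R ?Xi (pull_step i) ?J'" by (rule inj_res_inj_resolution[OF pull_step_sheaf])
  note tJ' = direct_image_inj_resolution[OF continuous_t exact_t J']
  define v where "v n = mor_comp (direct_image_mor ?Xi (t i) (c n)) (u n)" for n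
  have v: "v \<in> lifts R ?Xj (pull_at (Suc i)) (J (Suc i)) (direct_image_resolution ?Xi (t i) (J i))
      (mor_comp (direct_image_mor ?Xi (t i) (step_iso i)) (step_unit i))"
    unfolding v_def by (rule lifts_comp[OF u direct_image_lifts[OF continuous_t c] step_unit_mor])
  define l where "l n = direct_image_mor ?Xj ?g (v n)" for n
  have l: "l \<in> lifts R (X \<infinity>) (G (Suc i)) (fJ (Suc i)) (fJ i) (G_step R X \<phi> F i)"
    using direct_image_lifts[OF continuous_infinity v] by (simp add: l_def[abs_def] G_step_eq G_obj_def image_step[where i = i])
  have "D_step R X \<phi> F k i x = res_map (X \<infinity>) (fJ i) k l x" if x: "x \<in> carrier (D_obj R X \<phi> F k (Suc i))" for x
  proof -
    note gt = global_direct_image_resolution[OF continuous_t] and gi = global_direct_image_resolution[OF continuous_infinity]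
    have x': "x \<in> carrier (res_cohom ?Xj (J (Suc i)) k)" using x by (simp add: D_obj_def sheaf_cohom_eq)
    obtain z where z: "z \<in> res_cocycles ?Xj (J (Suc i)) k" and xz: "x = res_class ?Xj (J (Suc i)) k z"
      by (rule res_cohomE[OF J_res x'])
    have uz: "u k (topspace ?Xj) z \<in> res_cocycles ?Xi ?J' k"
      using lift_cocycle[OF J_res tJ' u z] by (simp add: gt)
    have "D_step R X \<phi> F k i x = res_class ?Xi (J i) k (c k (topspace ?Xi) (u k (topspace ?Xj) z))"
      unfolding D_step_def comp_def eu ec xz res_map_class[OF J_res tJ' u z]
      using res_map_class[OF J' J_res c uz] by (simp add: gt)
    \<comment> \<open>Preimages of the total spaces are total, so all direct images are invisible on
      global sections.\<close>
    also have "c k (topspace ?Xi) (u k (topspace ?Xj) z) = l k (topspace (X \<infinity>)) z"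
      by (simp add: l_def v_def mor_comp_def direct_image_mor_def preim_topspace[OF continuous_t] preim_topspace[OF continuous_infinity])
    also have "res_class ?Xi (J i) k (l k (topspace (X \<infinity>)) z) = res_map (X \<infinity>) (fJ i) k l x"
      using res_map_class[OF fJ_res fJ_res l, of z k] z by (simp add: xz gi)
    finally show ?thesis .
  qed
  then show ?thesis using l by blast
qed

lemma D_step_hom: "D_step R X \<phi> F k i \<in> mod_hom R (D_obj R X \<phi> F k (Suc i)) (D_obj R X \<phi> F k i)"
proof -
  obtain l where l: "l \<in> lifts R (X \<infinity>) (G (Suc i)) (fJ (Suc i)) (fJ i) (G_step R X \<phi> F i)"
    and eq: "\<And>x. x \<in> carrier (D_obj R X \<phi> F k (Suc i)) \<Longrightarrow> D_step R X \<phi> F k i x = res_map (X \<infinity>) (fJ i) k l x"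
    using D_step_lift[of i] by blast
  show ?thesis
  proof (rule mod_hom_cong[OF _ _ eq])
    show "res_map (X \<infinity>) (fJ i) k l \<in> mod_hom R (D_obj R X \<phi> F k (Suc i)) (D_obj R X \<phi> F k i)"
      unfolding D_obj_eq by (rule res_map_hom[OF fJ_res fJ_res l])
    show "Module.module R (D_obj R X \<phi> F k (Suc i))"
      unfolding D_obj_def by (rule sheaf_cohom_module[OF pull_at_sheaf])
  qed
qed

lemma D_map_hom: "j \<le> i \<Longrightarrow> D_map R X \<phi> F k i j \<in> mod_hom R (D_obj R X \<phi> F k i) (D_obj R X \<phi> F k j)"
proof (induction i)
  case 0
  then show ?case by (simp add: D_map_def mod_hom_id)
next
  case (Suc i)
  show ?case
  proof (cases "j \<le> i")
    case True
    then show ?thesis using mod_hom_comp(1)[OF D_step_hom Suc.IH] by (simp add: D_map_def comp_def)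
  next
    case False
    then have "j = Suc i" using Suc.prems by simp
    then show ?thesis by (simp add: D_map_def mod_hom_id)
  qed
qed

definition comparison_lift :: "nat \<Rightarrow> nat \<Rightarrow> 'x set \<Rightarrow> ('x, 'r, 'm) univ \<Rightarrow> ('x, 'r, 'm) univ" where
  "comparison_lift i = (SOME a. a \<in> lifts R (X \<infinity>) (G i) (inj_res R (X \<infinity>) (G i)) (fJ i) mor_id)"

definition comparison :: "nat \<Rightarrow> ('x, 'r, 'm) univ set \<Rightarrow> ('x, 'r, 'm) univ set" where
  "comparison i = res_map (X \<infinity>) (fJ i) k (comparison_lift i)"

lemma comparison_lift: "comparison_lift i \<in> lifts R (X \<infinity>) (G i) (inj_res R (X \<infinity>) (G i)) (fJ i) mor_id"
  unfolding comparison_lift_def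
  by (rule someI_ex[OF lift_exists[OF inj_resolution.res[OF G_res] G_sheaf inj_resolution.res[OF fJ_res] G_sheaf mor_id_mor]])

lemma comparison_hom: "comparison i \<in> mod_hom R (sheaf_cohom R (X \<infinity>) k (G i)) (D_obj R X \<phi> F k i)"
  unfolding comparison_def D_obj_eq sheaf_cohom_eq by (rule res_map_hom[OF G_res fJ_res comparison_lift])

text \<open>Both resolutions resolve the same sheaf, so a lift of the identity in the opposite
  direction exists and is inverse on cohomology by uniqueness of lifts.\<close>

lemma comparison_bij: "bij_betw (comparison i) (carrier (sheaf_cohom R (X \<infinity>) k (G i))) (carrier (D_obj R X \<phi> F k i))"
proof -
  obtain b where b: "b \<in> lifts R (X \<infinity>) (G i) (fJ i) (inj_res R (X \<infinity>) (G i)) mor_id"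
    using lift_exists[OF inj_resolution.res[OF fJ_res] G_sheaf inj_resolution.res[OF G_res] G_sheaf mor_id_mor] by blast
  let ?I = "inj_res R (X \<infinity>) (G i)"
  let ?b = "res_map (X \<infinity>) ?I k b"
  have id: "mor_eq (X \<infinity>) (G i) mor_id (mor_comp mor_id mor_id)" "mor_eq (X \<infinity>) (G i) mor_id mor_id"
    by (simp_all add: mor_eq_def mor_comp_def mor_id_def)
  have bhom: "?b \<in> mod_hom R (D_obj R X \<phi> F k i) (sheaf_cohom R (X \<infinity>) k (G i))"
    unfolding D_obj_eq sheaf_cohom_eq by (rule res_map_hom[OF fJ_res G_res b])
  have ba: "?b (comparison i x) = x" if "x \<in> carrier (sheaf_cohom R (X \<infinity>) k (G i))" for x
    using res_map_comp[OF G_res fJ_res G_res comparison_lift b lifts_id mor_id_mor id(1) that[unfolded sheaf_cohom_eq]]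
      res_map_id[OF G_res lifts_id id(2) that[unfolded sheaf_cohom_eq]]
    unfolding comparison_def by simp
  have ab: "comparison i (?b y) = y" if "y \<in> carrier (D_obj R X \<phi> F k i)" for y
    using res_map_comp[OF fJ_res G_res fJ_res b comparison_lift lifts_id mor_id_mor id(1) that[unfolded D_obj_eq]]
      res_map_id[OF fJ_res lifts_id id(2) that[unfolded D_obj_eq]]
    unfolding comparison_def by simp
  show ?thesis
    by (rule bij_betw_byWitness[of _ ?b])
      (use ba ab mod_hom_closed[OF bhom] mod_hom_closed[OF comparison_hom] in auto)
qed

text \<open>Both composites are induced by lifts of the same morphism \<open>G_step\<close> between
  the same two resolutions, so each equals the map of one auxiliary lift \<open>d\<close>.\<close>

lemma comparison_step:
  assumes x: "x \<in> carrier (sheaf_cohom R (X \<infinity>) k (G (Suc i)))"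
  shows "comparison i (sheaf_cohom_mor R (X \<infinity>) k (G (Suc i)) (G i) (G_step R X \<phi> F i) x)
    = D_step R X \<phi> F k i (comparison (Suc i) x)"
proof -
  obtain l where l: "l \<in> lifts R (X \<infinity>) (G (Suc i)) (fJ (Suc i)) (fJ i) (G_step R X \<phi> F i)"
    and eq: "\<And>x. x \<in> carrier (D_obj R X \<phi> F k (Suc i)) \<Longrightarrow> D_step R X \<phi> F k i x = res_map (X \<infinity>) (fJ i) k l x"
    using D_step_lift[of i] by blast
  obtain s where s: "s \<in> lifts R (X \<infinity>) (G (Suc i)) (inj_res R (X \<infinity>) (G (Suc i))) (inj_res R (X \<infinity>) (G i)) (G_step R X \<phi> F i)"
    and es: "\<And>k. sheaf_cohom_mor R (X \<infinity>) k (G (Suc i)) (G i) (G_step R X \<phi> F i) = res_map (X \<infinity>) (inj_res R (X \<infinity>) (G i)) k s"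
    using sheaf_cohom_mor_lift[OF G_sheaf G_sheaf G_step_mor] by blast
  obtain d where d: "d \<in> lifts R (X \<infinity>) (G (Suc i)) (inj_res R (X \<infinity>) (G (Suc i))) (fJ i) (G_step R X \<phi> F i)"
    using lift_exists[OF inj_resolution.res[OF G_res] G_sheaf inj_resolution.res[OF fJ_res] G_sheaf G_step_mor] by blast
  have id: "mor_eq (X \<infinity>) (G (Suc i)) (G_step R X \<phi> F i) (mor_comp mor_id (G_step R X \<phi> F i))"
    "mor_eq (X \<infinity>) (G (Suc i)) (G_step R X \<phi> F i) (mor_comp (G_step R X \<phi> F i) mor_id)"
    by (simp_all add: mor_eq_def mor_comp_def mor_id_def)
  note x' = x[unfolded sheaf_cohom_eq]
  have "comparison i (sheaf_cohom_mor R (X \<infinity>) k (G (Suc i)) (G i) (G_step R X \<phi> F i) x) = res_map (X \<infinity>) (fJ i) k d x"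
    unfolding comparison_def es by (rule res_map_comp[OF G_res G_res fJ_res s comparison_lift d G_step_mor id(1) x'])
  also have "\<dots> = res_map (X \<infinity>) (fJ i) k l (comparison (Suc i) x)"
    unfolding comparison_def by (rule res_map_comp[OF G_res fJ_res fJ_res comparison_lift l d mor_id_mor id(2) x', symmetric])
  also have "\<dots> = D_step R X \<phi> F k i (comparison (Suc i) x)"
    by (rule eq[symmetric, OF mod_hom_closed[OF comparison_hom x]])
  finally show ?thesis .
qed

text \<open>Both families of structure maps are composites of single steps, so naturality follows
  from \<open>comparison_step\<close> by induction, using functoriality of cohomology on the side of
  \<open>G\<close>.\<close>

lemma comparison_natural:
  assumes "j \<le> i" and "x \<in> carrier (sheaf_cohom R (X \<infinity>) k (G i))"
  shows "comparison j (sheaf_cohom_mor R (X \<infinity>) k (G i) (G j) (G_map R X \<phi> F i j) x) = D_map R X \<phi> F k i j (comparison i x)"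
  using assms
proof (induction i arbitrary: x)
  case 0
  then show ?case by (simp add: G_map_self sheaf_cohom_mor_id[OF G_sheaf] D_map_def)
next
  case (Suc i)
  show ?case
  proof (cases "j \<le> i")
    case True
    let ?y = "sheaf_cohom_mor R (X \<infinity>) k (G (Suc i)) (G i) (G_step R X \<phi> F i) x"
    have y: "?y \<in> carrier (sheaf_cohom R (X \<infinity>) k (G i))"
      by (rule mod_hom_closed[OF sheaf_cohom_mor_hom[OF G_sheaf G_sheaf G_step_mor] Suc.prems(2)])
    have "sheaf_cohom_mor R (X \<infinity>) k (G (Suc i)) (G j) (G_map R X \<phi> F (Suc i) j) x
        = sheaf_cohom_mor R (X \<infinity>) k (G i) (G j) (G_map R X \<phi> F i j) ?y"
      using sheaf_cohom_mor_comp[OF G_sheaf G_sheaf G_sheaf G_step_mor G_map_mor[OF True] Suc.prems(2)]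
      by (simp add: G_map_Suc[OF True])
    then show ?thesis
      using Suc.IH[OF True y] comparison_step[OF Suc.prems(2)] True by (simp add: D_map_def)
  next
    case False
    then have "j = Suc i" using Suc.prems by simp
    then show ?thesis
      using sheaf_cohom_mor_id[OF G_sheaf Suc.prems(2)] by (simp add: G_map_self D_map_def descend_self del: descend.simps)
  qed
qed

lemma isomorphic:
  "copersistence_isomorphic R
      (\<lambda>i. sheaf_cohom R (X \<infinity>) k (G i))
      (\<lambda>i j. sheaf_cohom_mor R (X \<infinity>) k (G i) (G j) (G_map R X \<phi> F i j))
      (D_obj R X \<phi> F k) (D_map R X \<phi> F k)"
proof -
  have "copersistence_module R (\<lambda>i. sheaf_cohom R (X \<infinity>) k (G i))
      (\<lambda>i j. sheaf_cohom_mor R (X \<infinity>) k (G i) (G j) (G_map R X \<phi> F i j))"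
    unfolding copersistence_module_def
    by (auto simp: sheaf_cohom_module[OF G_sheaf] sheaf_cohom_mor_hom[OF G_sheaf G_sheaf G_map_mor] G_map_self
        sheaf_cohom_mor_id[OF G_sheaf] sheaf_cohom_mor_comp[OF G_sheaf G_sheaf G_sheaf G_map_mor G_map_mor] G_map_trans)
  moreover have "copersistence_module R (D_obj R X \<phi> F k) (D_map R X \<phi> F k)"
    unfolding copersistence_module_def
    using D_map_hom by (auto simp: D_obj_def sheaf_cohom_module[OF pull_at_sheaf] D_map_def descend_self descend_trans)
  ultimately show ?thesis
    unfolding copersistence_isomorphic_def
    using comparison_hom comparison_bij comparison_natural by blast
qed

end

theorem theorem4p2:
  fixes R :: "'r ring"
    and X :: "enat \<Rightarrow> 'x topology" and \<phi> :: "enat \<Rightarrow> enat \<Rightarrow> 'x \<Rightarrow> 'x"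
    and F :: "('x, 'r, 'm) presheaf" and k :: nat
  assumes "cring R"
    and "top_functor X \<phi>"
    and "\<And>i j. i \<le> j \<Longrightarrow> direct_image_exact TYPE(('x, 'r, 'm) univ) R (X i) (X j) (\<phi> i j)"
    and "sheaf R (X \<infinity>) F"
  shows "copersistence_isomorphic R
      (\<lambda>i. sheaf_cohom R (X \<infinity>) k (G_obj X \<phi> F i))
      (\<lambda>i j. sheaf_cohom_mor R (X \<infinity>) k (G_obj X \<phi> F i) (G_obj X \<phi> F j) (G_map R X \<phi> F i j))
      (D_obj R X \<phi> F k) (D_map R X \<phi> F k)"
  by (rule exact_diagram.isomorphic[OF exact_diagram.intro[OF assms(2,3,4)]])

end
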